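(* The truncated time-domain PML problem $$ \begin{cases} \partial_t u+(\sigma+\hat\sigma)u+\hat\sigma u^*+\nabla\cdot p=f & \text{in }\Omega_\rho^+\times(0,T),\\ \partial_t p^*=-\nabla u,\quad \partial_t u^*=\sigma u & \text{in }\Omega_\rho^+\times(0,T),\\ \partial_t p+\Lambda_1p=\partial_tp^*+\Lambda_2p^* & \text{in }\Omega_\rho^+\times(0,T),\\ u=0 & \text{on }(\partial D\cup\Gamma_0)\times(0,T),\\ u=0 & \text{on }\Gamma_\rho^+\times(0,T),\\ u|_{t=0}=p|_{t=0}=u^*|_{t=0}=p^*|_{t=0}=0 & \text{in }\Omega_\rho^+ \end{cases} $$ has a unique solution $(u,p,u^*,p^* )$ such that $$u\in L^2(0,T;H_0^1(\Omega_\rho^+))\cap H^1(0,T;L^2(\Omega_\rho^+)),\qquad u^*\in H^1(0,T;L^2(\Omega_\rho^+)),$$ $$p\in L^2(0,T;H(\mathrm{div},\Omega_\rho^+))\cap H^1(0,T;L^2(\Omega_\rho^+)),\qquad p^*\in H^1(0,T;L^2(\Omega_\rho^+)).$$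
   Context: Geometry: $0<R<\rho$ and $T>0$ are fixed. $\Gamma_0\subset\mathbb{R}^2$ is a non-selfintersecting $C^2$-smooth curve, a local perturbation of the line $\{x_2=0\}$ coinciding with it for $|x_1|>R$. $\Omega\subset\mathbb{R}^2$ is the unbounded domain above $\Gamma_0$. $B_a^+=\{x\in\Omega:|x|<a\}$ for $a=R,\rho$. $D\subset B_R^+$ is a bounded domain with Lipschitz boundary and connected exterior. $\Omega_\rho^+=B_\rho^+\setminus\overline D$, $\Gamma_\rho^+=\{x\in\Omega:|x|=\rho\}$. On the boundary of $\Omega_\rho^+$, $\Gamma_0$ means $\Gamma_0\cap\{|x|\le\rho\}$. $(r,\theta)$ are polar coordinates. PML coefficients: $\sigma=\sigma(r)$ with $\sigma=0$ for $r\le R$, $\sigma>0$ for $r>R$, monotonically increasing on $[R,\rho]$ with $\sigma_R\le\sigma\le\sigma_\rho$ there. $\hat\sigma(r)=r^{-1}\int_0^r\sigma(\tau)\,d\tau$. $\Lambda_1=M^{T}\mathrm{diag}\{\sigma,\hat\sigma\}M$, $\Lambda_2=M^{T}\mathrm{diag}\{\hat\sigma,\sigma\}M$, $M=\begin{pmatrix}\cos\theta&\sin\theta\\-\sin\theta&\cos\theta\end{pmatrix}$. The unknowns $u,u^*$ are scalar and $p,p^*$ are $2$-vector valued. $H(\mathrm{div},\Omega_\rho^+)=\{p\in L^2(\Omega_\rho^+):\nabla\cdot p\in L^2(\Omega_\rho^+)\}$. Source: $f$ is compactly supported in space in $B_R^+\setminus\overline D$; for every bounded domain $\Omega_0$,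 $f\in H^2(0,T;L^2(\Omega_0))$, $f|_{t=0}=0$, and $f=\tilde f|_{(0,T)}$ with $\tilde f\in H^2(0,\infty;L^2(\Omega_0))$, $\|\tilde f\|_{H^2(0,\infty;L^2(\Omega_0))}\le\|f\|_{H^2(0,T;L^2(\Omega_0))}$. *)

theory Defs
  imports "HOL-Analysis.Analysis"
begin

section \<open>Test functions and Sobolev spaces on an open set\<close>

type_synonym plane = "real^2"

primrec Ck :: "nat \<Rightarrow> ('a::euclidean_space \<Rightarrow> real) \<Rightarrow> bool" where
  "Ck 0 f \<longleftrightarrow> continuous_on UNIV f"
| "Ck (Suc k) f \<longleftrightarrow> (\<forall>x. f differentiable (at x)) \<and>
     (\<forall>b\<in>Basis. Ck k (\<lambda>x. frechet_derivative f (at x) b))"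

definition smooth :: "('a::euclidean_space \<Rightarrow> real) \<Rightarrow> bool" where
  "smooth f \<longleftrightarrow> (\<forall>k. Ck k f)"

definition supp :: "('a::euclidean_space \<Rightarrow> real) \<Rightarrow> 'a set" where
  "supp f = closure {x. f x \<noteq> 0}"

definition test_fun :: "'a::euclidean_space set \<Rightarrow> ('a \<Rightarrow> real) \<Rightarrow> bool" where
  "test_fun S f \<longleftrightarrow> smooth f \<and> compact (supp f) \<and> supp f \<subseteq> S"

definition grad :: "(plane \<Rightarrow> real) \<Rightarrow> plane \<Rightarrow> plane" where
  "grad f x = (\<chi> i. frechet_derivative f (at x) (axis i 1))"

text \<open>
  A function space is a pair consisting of a set of representatives and a seminorm; its elements
  in the mathematical sense are the classes modulo functions of seminorm zero (for all spaces below: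
  modulo equality almost everywhere).
\<close>

type_synonym ('a, 'v) fspace = "('a \<Rightarrow> 'v) set \<times> (('a \<Rightarrow> 'v) \<Rightarrow> real)"

abbreviation carr :: "('a, 'v) fspace \<Rightarrow> ('a \<Rightarrow> 'v) set" where
  "carr \<equiv> fst"

abbreviation nrm :: "('a, 'v) fspace \<Rightarrow> ('a \<Rightarrow> 'v) \<Rightarrow> real" where
  "nrm \<equiv> snd"

definition L2_space :: "plane set \<Rightarrow> (plane, 'v::euclidean_space) fspace" where
  "L2_space Om =
     ({g. g \<in> borel_measurable (lebesgue_on Om) \<and>
          integrable (lebesgue_on Om) (\<lambda>x. (norm (g x))\<^sup>2)},
      \<lambda>g. sqrt (\<integral>x. (norm (g x))\<^sup>2 \<partial>lebesgue_on Om))"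

definition is_weak_grad :: "plane set \<Rightarrow> (plane \<Rightarrow> real) \<Rightarrow> (plane \<Rightarrow> plane) \<Rightarrow> bool" where
  "is_weak_grad Om w G \<longleftrightarrow> G \<in> carr (L2_space Om) \<and>
     (\<forall>\<phi>. test_fun Om \<phi> \<longrightarrow>
        (\<integral>x. w x *\<^sub>R grad \<phi> x \<partial>lebesgue_on Om) = - (\<integral>x. \<phi> x *\<^sub>R G x \<partial>lebesgue_on Om))"

definition is_weak_div :: "plane set \<Rightarrow> (plane \<Rightarrow> plane) \<Rightarrow> (plane \<Rightarrow> real) \<Rightarrow> bool" where
  "is_weak_div Om p d \<longleftrightarrow> d \<in> carr (L2_space Om) \<and>
     (\<forall>\<phi>. test_fun Om \<phi> \<longrightarrow>
        (\<integral>x. p x \<bullet> grad \<phi> x \<partial>lebesgue_on Om) = - (\<integral>x. d x * \<phi> x \<partial>lebesgue_on Om))"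

text \<open>
  The weak derivatives (here and for the time derivative below) are unique up to null sets; the
  choice operator picks a representative. It is only meaningful where one exists, which is
  guaranteed by membership in the corresponding Sobolev space.
\<close>

definition weak_grad :: "plane set \<Rightarrow> (plane \<Rightarrow> real) \<Rightarrow> plane \<Rightarrow> plane" where
  "weak_grad Om w = (SOME G. is_weak_grad Om w G)"

definition weak_div :: "plane set \<Rightarrow> (plane \<Rightarrow> plane) \<Rightarrow> plane \<Rightarrow> real" where
  "weak_div Om p = (SOME d. is_weak_div Om p d)"

definition H1_space :: "plane set \<Rightarrow> (plane, real) fspace" where
  "H1_space Om =
     ({w \<in> carr (L2_space Om). \<exists>G. is_weak_grad Om w G},
      \<lambda>w. sqrt ((nrm (L2_space Om) w)\<^sup>2 + (nrm (L2_space Om) (weak_grad Om w))\<^sup>2))"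

text \<open>The closure of the test functions in \<open>H1\<close>.\<close>

definition H10_space :: "plane set \<Rightarrow> (plane, real) fspace" where
  "H10_space Om =
     ({w \<in> carr (H1_space Om). \<exists>\<phi>. (\<forall>n::nat. test_fun Om (\<phi> n)) \<and>
          (\<lambda>n. nrm (H1_space Om) (\<lambda>x. w x - \<phi> n x)) \<longlonglongrightarrow> 0},
      nrm (H1_space Om))"

definition Hdiv_space :: "plane set \<Rightarrow> (plane, plane) fspace" where
  "Hdiv_space Om =
     ({p \<in> carr (L2_space Om). \<exists>d. is_weak_div Om p d},
      \<lambda>p. sqrt ((nrm (L2_space Om) p)\<^sup>2 + (nrm (L2_space Om) (weak_div Om p))\<^sup>2))"

text \<open>
  \<open>w = 0\<close> on the part \<open>S\<close> of the boundary of \<open>Om\<close>, in the sense of traces: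
  \<open>w\<close> is an \<open>H1\<close>-limit of smooth functions vanishing near \<open>S\<close>.
\<close>

definition vanishes_on :: "plane set \<Rightarrow> plane set \<Rightarrow> (plane \<Rightarrow> real) \<Rightarrow> bool" where
  "vanishes_on Om S w \<longleftrightarrow> w \<in> carr (H1_space Om) \<and>
     (\<exists>\<phi>. (\<forall>n::nat. smooth (\<phi> n) \<and> supp (\<phi> n) \<inter> S = {} \<and> \<phi> n \<in> carr (H1_space Om)) \<and>
        (\<lambda>n. nrm (H1_space Om) (\<lambda>x. w x - \<phi> n x)) \<longlonglongrightarrow> 0)"

section \<open>Bochner spaces on a time interval\<close>

text \<open>
  The Bochner integral of a map from the interval \<open>I\<close> into a function space \<open>X\<close>, following the
  construction of the library; the library's own notion needs values in a normed type, whereas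
  \<open>X\<close> is only a seminormed set of functions on a variable domain.
\<close>

definition simple_map ::
    "real set \<Rightarrow> ('a, 'v::euclidean_space) fspace \<Rightarrow> (real \<Rightarrow> 'a \<Rightarrow> 'v) \<Rightarrow> bool" where
  "simple_map I X s \<longleftrightarrow> finite (s ` I) \<and> s ` I \<subseteq> carr X \<and>
     (\<forall>g. {t\<in>I. s t = g} \<in> sets lebesgue)"

definition simple_int ::
    "real set \<Rightarrow> (real \<Rightarrow> 'a \<Rightarrow> 'v::euclidean_space) \<Rightarrow> 'a \<Rightarrow> 'v" where
  "simple_int I s = (\<lambda>x. \<Sum>g\<in>s ` I. measure lebesgue {t\<in>I. s t = g} *\<^sub>R g x)"

definition strongly_measurable ::
    "real set \<Rightarrow> ('a, 'v::euclidean_space) fspace \<Rightarrow> (real \<Rightarrow> 'a \<Rightarrow> 'v) \<Rightarrow> bool" where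
  "strongly_measurable I X F \<longleftrightarrow> (AE t in lebesgue_on I. F t \<in> carr X) \<and>
     (\<exists>s. (\<forall>n::nat. simple_map I X (s n)) \<and>
        (AE t in lebesgue_on I. (\<lambda>n. nrm X (\<lambda>x. F t x - s n t x)) \<longlonglongrightarrow> 0))"

definition has_bochner_int ::
    "real set \<Rightarrow> ('a, 'v::euclidean_space) fspace \<Rightarrow> (real \<Rightarrow> 'a \<Rightarrow> 'v) \<Rightarrow> ('a \<Rightarrow> 'v) \<Rightarrow> bool" where
  "has_bochner_int I X F w \<longleftrightarrow> strongly_measurable I X F \<and> w \<in> carr X \<and>
     (\<exists>s. (\<forall>n::nat. simple_map I X (s n) \<and> emeasure lebesgue {t\<in>I. s n t \<noteq> (\<lambda>_. 0)} < \<infinity>) \<and>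
        (\<lambda>n. \<integral>\<^sup>+t. ennreal (nrm X (\<lambda>x. F t x - s n t x)) \<partial>lebesgue_on I) \<longlonglongrightarrow> 0 \<and>
        (\<lambda>n. nrm X (\<lambda>x. simple_int I (s n) x - w x)) \<longlonglongrightarrow> 0)"

definition L2_time ::
    "real set \<Rightarrow> ('a, 'v::euclidean_space) fspace \<Rightarrow> (real \<Rightarrow> 'a \<Rightarrow> 'v) set" where
  "L2_time I X = {u. strongly_measurable I X u \<and>
     (\<integral>\<^sup>+t. ennreal ((nrm X (u t))\<^sup>2) \<partial>lebesgue_on I) < \<infinity>}"

definition is_time_deriv ::
    "real set \<Rightarrow> ('a, 'v::euclidean_space) fspace \<Rightarrow> (real \<Rightarrow> 'a \<Rightarrow> 'v) \<Rightarrow> (real \<Rightarrow> 'a \<Rightarrow> 'v) \<Rightarrow> bool" where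
  "is_time_deriv I X u v \<longleftrightarrow> v \<in> L2_time I X \<and>
     (\<forall>\<phi>. test_fun I \<phi> \<longrightarrow>
        (\<exists>w. has_bochner_int I X (\<lambda>t x. deriv \<phi> t *\<^sub>R u t x) w \<and>
             has_bochner_int I X (\<lambda>t x. \<phi> t *\<^sub>R v t x) (\<lambda>x. - w x)))"

definition time_deriv ::
    "real set \<Rightarrow> ('a, 'v::euclidean_space) fspace \<Rightarrow> (real \<Rightarrow> 'a \<Rightarrow> 'v) \<Rightarrow> real \<Rightarrow> 'a \<Rightarrow> 'v" where
  "time_deriv I X u = (SOME v. is_time_deriv I X u v)"

definition H1_time ::
    "real set \<Rightarrow> ('a, 'v::euclidean_space) fspace \<Rightarrow> (real \<Rightarrow> 'a \<Rightarrow> 'v) set" where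
  "H1_time I X = {u \<in> L2_time I X. \<exists>v. is_time_deriv I X u v}"

definition H2_time ::
    "real set \<Rightarrow> ('a, 'v::euclidean_space) fspace \<Rightarrow> (real \<Rightarrow> 'a \<Rightarrow> 'v) set" where
  "H2_time I X = {u \<in> H1_time I X. time_deriv I X u \<in> H1_time I X}"

definition L2_time_norm ::
    "real set \<Rightarrow> ('a, 'v::euclidean_space) fspace \<Rightarrow> (real \<Rightarrow> 'a \<Rightarrow> 'v) \<Rightarrow> real" where
  "L2_time_norm I X u = sqrt (\<integral>t. (nrm X (u t))\<^sup>2 \<partial>lebesgue_on I)"

definition H2_time_norm ::
    "real set \<Rightarrow> ('a, 'v::euclidean_space) fspace \<Rightarrow> (real \<Rightarrow> 'a \<Rightarrow> 'v) \<Rightarrow> real" where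
  "H2_time_norm I X u =
     sqrt ((L2_time_norm I X u)\<^sup>2 + (L2_time_norm I X (time_deriv I X u))\<^sup>2
         + (L2_time_norm I X (time_deriv I X (time_deriv I X u)))\<^sup>2)"

text \<open>
  The value at \<open>t = 0\<close> is that of the representative that is continuous on \<open>[0,T]\<close>.
\<close>

definition has_initial_value ::
    "real \<Rightarrow> ('a, 'v::euclidean_space) fspace \<Rightarrow> (real \<Rightarrow> 'a \<Rightarrow> 'v) \<Rightarrow> ('a \<Rightarrow> 'v) \<Rightarrow> bool" where
  "has_initial_value T X u g \<longleftrightarrow>
     (\<exists>c. (\<forall>t\<in>{0..T}. c t \<in> carr X) \<and>
        (\<forall>t0\<in>{0..T}. ((\<lambda>t. nrm X (\<lambda>x. c t x - c t0 x)) \<longlongrightarrow> 0) (at t0 within {0..T})) \<and>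
        (AE t in lebesgue_on {0<..<T}. nrm X (\<lambda>x. u t x - c t x) = 0) \<and>
        nrm X (\<lambda>x. c 0 x - g x) = 0)"

section \<open>Geometry\<close>

text \<open>
  A non-selfintersecting regular \<open>C2\<close> curve that coincides with the line \<open>{x\<^sub>2 = 0}\<close> for
  \<open>\<bar>x\<^sub>1\<bar> > R\<close>. The part in \<open>\<bar>x\<^sub>1\<bar> \<le> R\<close> is then automatically compact.
\<close>

definition perturbed_line :: "real \<Rightarrow> plane set \<Rightarrow> bool" where
  "perturbed_line R \<Gamma> \<longleftrightarrow>
     (\<exists>\<gamma> \<gamma>' \<gamma>''. \<Gamma> = range \<gamma> \<and> inj \<gamma> \<and>
        (\<forall>s. (\<gamma> has_vector_derivative \<gamma>' s) (at s)) \<and>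
        (\<forall>s. (\<gamma>' has_vector_derivative \<gamma>'' s) (at s)) \<and>
        continuous_on UNIV \<gamma>'' \<and> (\<forall>s. \<gamma>' s \<noteq> 0)) \<and>
     (\<forall>x. \<bar>x$1\<bar> > R \<longrightarrow> (x \<in> \<Gamma> \<longleftrightarrow> x$2 = 0))"

text \<open>
  The domain above \<open>\<Gamma>\<close>: the component of the complement that contains all
  sufficiently high points of the vertical axis.
\<close>

definition upper_domain :: "plane set \<Rightarrow> plane set" where
  "upper_domain \<Gamma> = {x. \<forall>\<^sub>F h in at_top. connected_component (- \<Gamma>) (vector [0, h]) x}"

text \<open>
  Locally, after a rigid motion sending \<open>z\<close> to the origin, the set is the strict epigraph
  of a Lipschitz function.
\<close>

definition lipschitz_boundary :: "plane set \<Rightarrow> bool" where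
  "lipschitz_boundary D \<longleftrightarrow>
     (\<forall>z\<in>frontier D. \<exists>Q g L r h. orthogonal_transformation Q \<and> 0 < r \<and> 0 < h \<and>
        L-lipschitz_on (UNIV::real set) g \<and> (\<forall>s. \<bar>s\<bar> < r \<longrightarrow> \<bar>g s\<bar> < h) \<and>
        (\<forall>y::plane. \<bar>y$1\<bar> < r \<and> \<bar>y$2\<bar> < h \<longrightarrow> (z + Q y \<in> D \<longleftrightarrow> g (y$1) < y$2)))"

definition half_disc :: "plane set \<Rightarrow> real \<Rightarrow> plane set" where
  "half_disc \<Gamma> a = {x \<in> upper_domain \<Gamma>. norm x < a}"

definition is_obstacle :: "plane set \<Rightarrow> real \<Rightarrow> plane set \<Rightarrow> bool" where
  "is_obstacle \<Gamma> R D \<longleftrightarrow> open D \<and> connected D \<and> D \<noteq> {} \<and> D \<subseteq> half_disc \<Gamma> R \<and>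
     lipschitz_boundary D \<and> connected (- closure D)"

definition truncated_domain :: "plane set \<Rightarrow> plane set \<Rightarrow> real \<Rightarrow> plane set" where
  "truncated_domain \<Gamma> D \<rho> = half_disc \<Gamma> \<rho> - closure D"

definition outer_arc :: "plane set \<Rightarrow> real \<Rightarrow> plane set" where
  "outer_arc \<Gamma> \<rho> = {x \<in> upper_domain \<Gamma>. norm x = \<rho>}"

section \<open>PML coefficients\<close>

definition pml_coefficient ::
    "real \<Rightarrow> real \<Rightarrow> real \<Rightarrow> real \<Rightarrow> (real \<Rightarrow> real) \<Rightarrow> bool" where
  "pml_coefficient R \<rho> \<sigma>\<^sub>R \<sigma>\<^sub>\<rho> \<sigma> \<longleftrightarrow>
     (\<forall>r\<le>R. \<sigma> r = 0) \<and> (\<forall>r>R. \<sigma> r > 0) \<and> mono_on {R..\<rho>} \<sigma> \<and>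
     (\<forall>r\<in>{R..\<rho>}. \<sigma>\<^sub>R \<le> \<sigma> r \<and> \<sigma> r \<le> \<sigma>\<^sub>\<rho>)"

definition sigma_hat :: "(real \<Rightarrow> real) \<Rightarrow> real \<Rightarrow> real" where
  "sigma_hat \<sigma> r = (1 / r) * integral {0..r} \<sigma>"

definition polar_angle :: "plane \<Rightarrow> real" where
  "polar_angle x = Arg (Complex (x$1) (x$2))"

definition rot_mat :: "real \<Rightarrow> real^2^2" where
  "rot_mat \<theta> = vector [vector [cos \<theta>, sin \<theta>], vector [- sin \<theta>, cos \<theta>]]"

definition diag2 :: "real \<Rightarrow> real \<Rightarrow> real^2^2" where
  "diag2 a b = vector [vector [a, 0], vector [0, b]]"

definition Lambda1 :: "(real \<Rightarrow> real) \<Rightarrow> plane \<Rightarrow> real^2^2" where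
  "Lambda1 \<sigma> x = transpose (rot_mat (polar_angle x)) **
     diag2 (\<sigma> (norm x)) (sigma_hat \<sigma> (norm x)) ** rot_mat (polar_angle x)"

definition Lambda2 :: "(real \<Rightarrow> real) \<Rightarrow> plane \<Rightarrow> real^2^2" where
  "Lambda2 \<sigma> x = transpose (rot_mat (polar_angle x)) **
     diag2 (sigma_hat \<sigma> (norm x)) (\<sigma> (norm x)) ** rot_mat (polar_angle x)"

section \<open>Source and PML problem\<close>

text \<open>
  The source lives on the physical domain \<open>upper_domain \<Gamma> - closure D\<close>; its values elsewhere are
  irrelevant, so the bounded domains \<open>\<Omega>0\<close> are those contained in it.
\<close>

definition admissible_source ::
    "plane set \<Rightarrow> plane set \<Rightarrow> real \<Rightarrow> real \<Rightarrow> (real \<Rightarrow> plane \<Rightarrow> real) \<Rightarrow> bool" where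
  "admissible_source \<Gamma> D R T f \<longleftrightarrow>
     (\<exists>K. compact K \<and> K \<subseteq> half_disc \<Gamma> R - closure D \<and>
        (AE t in lebesgue_on {0<..<T}.
           AE x in lebesgue_on (upper_domain \<Gamma> - closure D). x \<notin> K \<longrightarrow> f t x = 0)) \<and>
     (\<forall>\<Omega>0. open \<Omega>0 \<and> connected \<Omega>0 \<and> \<Omega>0 \<noteq> {} \<and> bounded \<Omega>0 \<and>
            \<Omega>0 \<subseteq> upper_domain \<Gamma> - closure D \<longrightarrow>
        f \<in> H2_time {0<..<T} (L2_space \<Omega>0) \<and>
        has_initial_value T (L2_space \<Omega>0) f (\<lambda>_. 0) \<and>
        (\<exists>f'. f' \<in> H2_time {0<..} (L2_space \<Omega>0) \<and>
           (AE t in lebesgue_on {0<..<T}. AE x in lebesgue_on \<Omega>0. f' t x = f t x) \<and>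
           H2_time_norm {0<..} (L2_space \<Omega>0) f' \<le> H2_time_norm {0<..<T} (L2_space \<Omega>0) f))"

definition solution_class ::
    "plane set \<Rightarrow> real \<Rightarrow> (real \<Rightarrow> plane \<Rightarrow> real) \<Rightarrow> (real \<Rightarrow> plane \<Rightarrow> plane) \<Rightarrow>
     (real \<Rightarrow> plane \<Rightarrow> real) \<Rightarrow> (real \<Rightarrow> plane \<Rightarrow> plane) \<Rightarrow> bool" where
  "solution_class Om T u p us ps \<longleftrightarrow>
     u \<in> L2_time {0<..<T} (H10_space Om) \<inter> H1_time {0<..<T} (L2_space Om) \<and>
     us \<in> H1_time {0<..<T} (L2_space Om) \<and>
     p \<in> L2_time {0<..<T} (Hdiv_space Om) \<inter> H1_time {0<..<T} (L2_space Om) \<and>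
     ps \<in> H1_time {0<..<T} (L2_space Om)"

definition pml_equations ::
    "plane set \<Rightarrow> real \<Rightarrow> (real \<Rightarrow> real) \<Rightarrow> (real \<Rightarrow> plane \<Rightarrow> real) \<Rightarrow>
     (real \<Rightarrow> plane \<Rightarrow> real) \<Rightarrow> (real \<Rightarrow> plane \<Rightarrow> plane) \<Rightarrow>
     (real \<Rightarrow> plane \<Rightarrow> real) \<Rightarrow> (real \<Rightarrow> plane \<Rightarrow> plane) \<Rightarrow> bool" where
  "pml_equations Om T \<sigma> f u p us ps \<longleftrightarrow>
     (AE t in lebesgue_on {0<..<T}. AE x in lebesgue_on Om.
        time_deriv {0<..<T} (L2_space Om) u t x
          + (\<sigma> (norm x) + sigma_hat \<sigma> (norm x)) * u t x
          + sigma_hat \<sigma> (norm x) * us t x + weak_div Om (p t) x = f t x \<and>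
        time_deriv {0<..<T} (L2_space Om) ps t x = - weak_grad Om (u t) x \<and>
        time_deriv {0<..<T} (L2_space Om) us t x = \<sigma> (norm x) * u t x \<and>
        time_deriv {0<..<T} (L2_space Om) p t x + Lambda1 \<sigma> x *v p t x
          = time_deriv {0<..<T} (L2_space Om) ps t x + Lambda2 \<sigma> x *v ps t x)"

definition pml_solution ::
    "plane set \<Rightarrow> plane set \<Rightarrow> real \<Rightarrow> real \<Rightarrow> (real \<Rightarrow> real) \<Rightarrow> (real \<Rightarrow> plane \<Rightarrow> real) \<Rightarrow>
     (real \<Rightarrow> plane \<Rightarrow> real) \<Rightarrow> (real \<Rightarrow> plane \<Rightarrow> plane) \<Rightarrow>
     (real \<Rightarrow> plane \<Rightarrow> real) \<Rightarrow> (real \<Rightarrow> plane \<Rightarrow> plane) \<Rightarrow> bool" where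
  "pml_solution \<Gamma> D \<rho> T \<sigma> f u p us ps \<longleftrightarrow>
     (let Om = truncated_domain \<Gamma> D \<rho> in
        pml_equations Om T \<sigma> f u p us ps \<and>
        (AE t in lebesgue_on {0<..<T}. vanishes_on Om (frontier D \<union> (\<Gamma> \<inter> cball 0 \<rho>)) (u t)) \<and>
        (AE t in lebesgue_on {0<..<T}. vanishes_on Om (outer_arc \<Gamma> \<rho>) (u t)) \<and>
        has_initial_value T (L2_space Om) u (\<lambda>_. 0) \<and>
        has_initial_value T (L2_space Om) p (\<lambda>_. 0) \<and>
        has_initial_value T (L2_space Om) us (\<lambda>_. 0) \<and>
        has_initial_value T (L2_space Om) ps (\<lambda>_. 0))"

end

theory Submission imports Defs begin

text \<open>
  The PML problem is a bounded perturbation of a wave equation in first-order form. Putting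
  \<open>q = p - p\<^sup>*\<close>, the equations for \<open>U = (u, p, u\<^sup>*, q)\<close> read \<open>U' = A U + B U + F\<close>, where
  \<open>A (u, p, u\<^sup>*, q) = (- div p, - grad u, 0, 0)\<close> carries all the derivatives, \<open>B\<close> is multiplication
  by the bounded PML coefficients, and \<open>F = (f, 0, 0, 0)\<close>. Let \<open>gr\<close> be the closure in \<open>L2 \<times> L2\<close> of
  the pairs \<open>(\<phi>, grad \<phi>)\<close> over all test functions. It is the graph of the gradient on \<open>H10\<close>, and its
  adjoint is minus the weak divergence on \<open>H(div)\<close>. Hence \<open>A\<close> is skew-adjoint, and its resolvent
  exists because \<open>gr\<close> is a closed subspace: the resolvent equation \<open>x - l A x = h\<close> is solved by an orthogonal
  projection onto a rescaled copy of \<open>gr\<close> (\<open>skew_relation_maximal_dissipative\<close>). The boundary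
  condition is built into the domain of \<open>A\<close>, and the geometry enters through the fact that the
  truncated domain is open and hence disjoint from its boundary. Openness rests on the closedness of the
  perturbed line (\<open>closed_perturbed_line\<close>), since only components of an open set need be open.

  Existence (\<open>evolution_exists\<close>) replaces \<open>A\<close> by its bounded dissipative Yosida approximations, for
  which the equation is a linear ordinary differential equation. Energy estimates that do not depend
  on the regularisation show that the approximate solutions converge uniformly. If \<open>F\<close> is
  \<open>C1\<close> and \<open>F 0 = 0\<close>, then the time derivatives solve the same approximate problems with \<open>F'\<close> as
  right-hand side, so they converge uniformly as well, and closedness of \<open>A\<close> passes the equation to
  the limit. The solution is \<open>C1\<close> in time with values in \<open>L2\<close>, and \<open>grad u\<close> and \<open>div p\<close> are
  continuous in time because the equations express them by continuous quantities. The right-hand side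
  has the required regularity: a map in \<open>H2(0,T; L2)\<close> has a \<open>C1\<close> representative (\<open>H2_time_C1\<close>),
  first on balls and then, by a partition of the compact support, on the whole domain
  (\<open>compactly_supported_source_C1\<close>).

  Uniqueness (\<open>weak_solution_unique\<close>, \<open>evolution_unique\<close>): the difference \<open>C\<close> of two solutions is only
  weakly differentiable in time, so its primitive \<open>Y(t)\<close>, the integral of \<open>C\<close> over \<open>[0,t]\<close>, is used
  instead. It is \<open>C1\<close>, and integrating the equation gives \<open>Y' = A Y + B Y\<close> with \<open>Y(0) = 0\<close>; the
  energy estimate forces \<open>Y = 0\<close> and hence \<open>C = 0\<close>.

  Between this operator theory and the function classes of the statement stands a dictionary. The
  space \<open>L2\<close> is a seminormed set of functions on a variable domain; \<open>cls\<close> maps it into a fixed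
  Hilbert space of classes of square-integrable functions on the whole plane. The Bochner integral
  and the weak time derivative are tested against vectors of this Hilbert space, which reduces them
  to scalar integrals and to the classical fact that a weak derivative on an interval
  determines a function up to a constant (\<open>weak_derivative_primitive\<close>). In the converse direction,
  continuous curves are uniformly approximated by step functions on a grid
  (\<open>has_bochner_int_continuous\<close>).
\<close>

section \<open>Orthogonal projection in a Hilbert space\<close>

text \<open>
  A minimising sequence for the distance to \<open>M\<close> is Cauchy by the parallelogram identity, and at a
  point of least distance the first variation vanishes.
\<close>

lemma closed_subspace_projection:
  fixes M :: "'a::{real_inner, banach} set"
  assumes "subspace M" "closed M"
  obtains m where "m \<in> M" "\<And>y. y \<in> M \<Longrightarrow> inner (x - m) y = 0"
proof -
  let ?S = "(\<lambda>y. (norm (x - y))\<^sup>2) ` M"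
  define d where "d = Inf ?S"
  have "0 \<in> M" using assms(1) by (rule subspace_0)
  then have ne: "?S \<noteq> {}" by blast
  have bb: "bdd_below ?S" by (rule bdd_belowI[of _ 0]) auto
  have dle: "d \<le> (norm (x - y))\<^sup>2" if "y \<in> M" for y
    unfolding d_def using that bb by (intro cInf_lower) auto
  have "\<exists>y\<in>M. (norm (x - y))\<^sup>2 < d + 1 / (real n + 1)" for n
  proof -
    have "Inf ?S < d + 1 / (real n + 1)" by (simp add: d_def)
    then show ?thesis using cInf_lessD[OF ne] by blast
  qed
  then obtain y where yM: "\<And>n. y n \<in> M" and yd: "\<And>n. (norm (x - y n))\<^sup>2 < d + 1 / (real n + 1)"
    by metis
  have par: "(norm (y n - y k))\<^sup>2 \<le> 2 / (real n + 1) + 2 / (real k + 1)" for n k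
  proof -
    have mid: "(1/2) *\<^sub>R (y n + y k) \<in> M"
      using assms(1) yM by (simp add: subspace_add subspace_scale)
    have "(norm (y n - y k))\<^sup>2 = 2 * (norm (x - y n))\<^sup>2 + 2 * (norm (x - y k))\<^sup>2
        - 4 * (norm (x - (1/2) *\<^sub>R (y n + y k)))\<^sup>2"
      by (simp add: power2_norm_eq_inner inner_diff_left inner_diff_right inner_add_left
          inner_add_right inner_commute algebra_simps)
    also have "\<dots> \<le> 2 * (d + 1 / (real n + 1)) + 2 * (d + 1 / (real k + 1)) - 4 * d"
      using yd[of n] yd[of k] dle[OF mid] by (intro diff_mono add_mono mult_left_mono) auto
    finally show ?thesis by simp
  qed
  have "Cauchy y"
  proof (rule CauchyI)
    fix e :: real assume "0 < e"
    then obtain N where N: "4 / (e\<^sup>2) < real N" using reals_Archimedean2 by blast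
    show "\<exists>N. \<forall>m\<ge>N. \<forall>n\<ge>N. norm (y m - y n) < e"
    proof (intro exI[of _ N] allI impI)
      fix m n assume mn: "N \<le> m" "N \<le> n"
      have "4 < real N * e\<^sup>2" using N \<open>0 < e\<close> by (simp add: divide_simps)
      also have "real N * e\<^sup>2 \<le> (real N + 1) * e\<^sup>2" by (intro mult_right_mono) auto
      finally have "4 / (real N + 1) < e\<^sup>2" by (simp add: divide_simps mult.commute)
      moreover have "2 / (real m + 1) \<le> 2 / (real N + 1)" "2 / (real n + 1) \<le> 2 / (real N + 1)"
        using mn by (auto intro!: divide_left_mono)
      moreover have "2 / (real N + 1) + 2 / (real N + 1) = 4 / (real N + 1)" by simp
      ultimately have "(norm (y m - y n))\<^sup>2 < e\<^sup>2" using par[of m n] by linarith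
      then show "norm (y m - y n) < e" using \<open>0 < e\<close> power_less_imp_less_base by force
    qed
  qed
  then obtain m where lim: "y \<longlonglongrightarrow> m" using Cauchy_convergent convergentD by blast
  have mM: "m \<in> M" using assms(2) yM lim closed_sequentially by blast
  have "(norm (x - m))\<^sup>2 \<le> d"
  proof (rule LIMSEQ_le)
    show "(\<lambda>n. (norm (x - y n))\<^sup>2) \<longlonglongrightarrow> (norm (x - m))\<^sup>2"
      by (intro tendsto_intros lim)
    show "(\<lambda>n. d + 1 / (real n + 1)) \<longlonglongrightarrow> d"
      using LIMSEQ_inverse_real_of_nat_add[of d] by (simp add: divide_inverse add.commute)
    show "\<exists>N. \<forall>n\<ge>N. (norm (x - y n))\<^sup>2 \<le> d + 1 / (real n + 1)"
      using yd less_imp_le by blast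
  qed
  with dle have opt: "(norm (x - m))\<^sup>2 \<le> (norm (x - z))\<^sup>2" if "z \<in> M" for z
    using that order_trans by blast
  have "inner (x - m) z = 0" if z: "z \<in> M" for z
  proof (cases "z = 0")
    case False
    define t where "t = inner (x - m) z / inner z z"
    have zz: "inner z z > 0" using False by simp
    have "m + t *\<^sub>R z \<in> M" using mM z assms(1) by (simp add: subspace_add subspace_scale)
    from opt[OF this] have "(norm (x - m))\<^sup>2 \<le> (norm (x - m - t *\<^sub>R z))\<^sup>2"
      by (simp add: algebra_simps)
    also have "\<dots> = (norm (x - m))\<^sup>2 - 2 * t * inner (x - m) z + t\<^sup>2 * inner z z"
      unfolding power2_norm_eq_inner
      by (simp add: inner_diff_left inner_diff_right inner_commute power2_eq_square algebra_simps)
    also have "t\<^sup>2 * inner z z = t * inner (x - m) z" using zz by (simp add: t_def power2_eq_square)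
    finally have "t * inner (x - m) z \<le> 0" by simp
    moreover have "t * inner (x - m) z = (inner (x - m) z)\<^sup>2 / inner z z" by (simp add: t_def power2_eq_square)
    ultimately have "(inner (x - m) z)\<^sup>2 \<le> 0" using zz by (simp add: divide_le_0_iff)
    then show ?thesis by simp
  qed simp
  with mM show ?thesis using that by blast
qed

text \<open>
  A closed subspace is its own biorthogonal complement: test with the component of \<open>x\<close>
  orthogonal to \<open>M\<close>.
\<close>

lemma mem_closed_subspace_if_orthogonal:
  fixes M :: "'a::{real_inner, banach} set"
  assumes "subspace M" "closed M"
    and orth: "\<And>h. (\<And>y. y \<in> M \<Longrightarrow> inner y h = 0) \<Longrightarrow> inner x h = 0"
  shows "x \<in> M"
proof -
  obtain m where m: "m \<in> M" "\<And>y. y \<in> M \<Longrightarrow> inner (x - m) y = 0"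
    using closed_subspace_projection[OF assms(1,2)] by metis
  have "inner x (x - m) = 0" by (rule orth) (metis inner_commute m(2))
  moreover have "inner m (x - m) = 0" using m by (simp add: inner_commute)
  ultimately have "inner (x - m) (x - m) = 0" by (simp add: inner_diff_left)
  then show ?thesis using m(1) by simp
qed

lemma riesz_representation:
  fixes L :: "'a::{real_inner, banach} \<Rightarrow> real"
  assumes "bounded_linear L"
  obtains r where "\<And>h. L h = inner r h"
proof -
  interpret bounded_linear L by fact
  let ?M = "{x. L x = 0}"
  show ?thesis
  proof (cases "\<exists>x. L x \<noteq> 0")
    case False
    then show ?thesis using that[of 0] by simp
  next
    case True
    then obtain x where x: "L x \<noteq> 0" by blast
    have sub: "subspace ?M" by (auto simp: subspace_def zero add scaleR)
    have "continuous_on UNIV L" using assms linear_continuous_on by blast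
    then have "closed ?M" using continuous_closed_preimage_constant[of UNIV L 0] by simp
    then obtain m where m: "L m = 0" and orth: "\<And>y. L y = 0 \<Longrightarrow> inner (x - m) y = 0"
      using closed_subspace_projection[OF sub] by (metis (mono_tags) mem_Collect_eq)
    define e where "e = x - m"
    have Le: "L e = L x" by (simp add: e_def diff m)
    have "e \<noteq> 0" using Le x zero by force
    have "L h = inner ((L e / inner e e) *\<^sub>R e) h" for h
    proof -
      have "L (h - (L h / L e) *\<^sub>R e) = 0" using x Le by (simp add: diff scaleR)
      then have "inner e (h - (L h / L e) *\<^sub>R e) = 0" using orth e_def by blast
      then have "inner e h = (L h / L e) * inner e e" by (simp add: inner_diff_right)
      then show ?thesis using \<open>e \<noteq> 0\<close> x Le by (simp add: field_simps)
    qed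
    then show ?thesis using that by blast
  qed
qed

section \<open>Energy estimates and linear differential equations\<close>

text \<open>
  The function \<open>exp (- k t) * \<phi> t - c * t\<close> is nonincreasing.
\<close>

lemma gronwall_affine:
  fixes \<phi> :: "real \<Rightarrow> real"
  assumes deriv: "\<And>t. t \<in> {0..T} \<Longrightarrow> (\<phi> has_vector_derivative \<phi>' t) (at t within {0..T})"
    and le: "\<And>t. t \<in> {0..T} \<Longrightarrow> \<phi>' t \<le> k * \<phi> t + c"
    and "0 \<le> k" "0 \<le> c" and t: "t \<in> {0..T}"
  shows "\<phi> t \<le> exp (k * t) * (\<phi> 0 + c * t)"
proof -
  define \<psi> where "\<psi> s = exp (- k * s) * \<phi> s - c * s" for s
  have "\<psi> t \<le> \<psi> 0"
  proof (rule DERIV_nonpos_imp_decreasing_open[of 0 t \<psi>])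
    show "0 \<le> t" using t by simp
    have "continuous_on {0..T} \<phi>"
      using deriv by (meson continuous_on_eq_continuous_within has_vector_derivative_continuous)
    then have "continuous_on {0..t} \<phi>" using t by (auto intro: continuous_on_subset)
    then show "continuous_on {0..t} \<psi>" unfolding \<psi>_def by (intro continuous_intros)
    fix x assume x: "0 < x" "x < t"
    have "(\<phi> has_vector_derivative \<phi>' x) (at x within {0<..<t})"
      by (rule has_vector_derivative_within_subset[OF deriv]) (use x t in auto)
    then have d: "(\<phi> has_real_derivative \<phi>' x) (at x)"
      using x at_within_open[of x "{0<..<t}"] by (simp add: has_real_derivative_iff_has_vector_derivative)
    have "(\<psi> has_real_derivative exp (- k * x) * (\<phi>' x - k * \<phi> x) - c) (at x)"
      unfolding \<psi>_def
      by (rule derivative_eq_intros d refl)+ (simp add: algebra_simps)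
    moreover have "exp (- k * x) * (\<phi>' x - k * \<phi> x) \<le> exp (- k * x) * c"
      using le[of x] x t by (intro mult_left_mono) auto
    moreover have "exp (- k * x) * c \<le> 1 * c"
      using \<open>0 \<le> k\<close> \<open>0 \<le> c\<close> x by (intro mult_right_mono) auto
    ultimately show "\<exists>y. (\<psi> has_real_derivative y) (at x) \<and> y \<le> 0"
      by (intro exI[of _ "exp (- k * x) * (\<phi>' x - k * \<phi> x) - c"]) linarith
  qed
  then have "exp (- k * t) * \<phi> t \<le> \<phi> 0 + c * t" by (simp add: \<psi>_def)
  then have "exp (k * t) * (exp (- k * t) * \<phi> t) \<le> exp (k * t) * (\<phi> 0 + c * t)"
    by (intro mult_left_mono) auto
  then show ?thesis by (simp add: mult.assoc[symmetric] exp_add[symmetric])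
qed

lemma has_vector_derivative_norm_sq:
  fixes U :: "real \<Rightarrow> 'a::real_inner"
  assumes "(U has_vector_derivative V) (at t within S)"
  shows "((\<lambda>t. (norm (U t))\<^sup>2) has_vector_derivative 2 * inner V (U t)) (at t within S)"
  unfolding power2_norm_eq_inner
  using bounded_bilinear.has_vector_derivative[OF bounded_bilinear_inner assms assms]
  by (simp add: inner_commute)

text \<open>
  Gronwall's inequality for \<open>(norm (U t))\<^sup>2\<close>; the linear term is absorbed by
  \<open>2 c \<parallel>U\<parallel> \<le> c\<^sup>2 + \<parallel>U\<parallel>\<^sup>2\<close>, which accounts for the summand \<open>1\<close> in the exponent.
\<close>

lemma energy_estimate:
  fixes U :: "real \<Rightarrow> 'a::real_inner"
  assumes deriv: "\<And>t. t \<in> {0..T} \<Longrightarrow> (U has_vector_derivative V t) (at t within {0..T})"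
    and le: "\<And>t. t \<in> {0..T} \<Longrightarrow> inner (V t) (U t) \<le> b * (norm (U t))\<^sup>2 + c * norm (U t)"
    and "0 \<le> b" "0 \<le> c" and t: "t \<in> {0..T}"
  shows "(norm (U t))\<^sup>2 \<le> exp ((2 * b + 1) * T) * ((norm (U 0))\<^sup>2 + c\<^sup>2 * T)"
proof -
  have "(norm (U t))\<^sup>2 \<le> exp ((2 * b + 1) * t) * ((norm (U 0))\<^sup>2 + c\<^sup>2 * t)"
  proof (rule gronwall_affine[OF has_vector_derivative_norm_sq[OF deriv] _ _ _ t])
    fix s assume s: "s \<in> {0..T}"
    have "2 * (c * norm (U s)) \<le> c\<^sup>2 + (norm (U s))\<^sup>2"
      using sum_squares_bound[of c "norm (U s)"] by simp
    then show "2 * inner (V s) (U s) \<le> (2 * b + 1) * (norm (U s))\<^sup>2 + c\<^sup>2"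
      using le[OF s] by (simp add: algebra_simps)
  qed (use assms in auto)
  also have "\<dots> \<le> exp ((2 * b + 1) * T) * ((norm (U 0))\<^sup>2 + c\<^sup>2 * T)"
    using t assms by (intro mult_mono) (auto intro!: mult_left_mono)
  finally show ?thesis .
qed

lemma integral_initial_deriv:
  fixes F :: "real \<Rightarrow> 'a::banach"
  assumes "continuous_on {0..T} F" "t \<in> {0..T}"
  shows "((\<lambda>t. integral {0..t} F) has_vector_derivative F t) (at t within {0..T})"
  using integral_has_vector_derivative assms by blast

lemma continuous_initial_integral:
  fixes F :: "real \<Rightarrow> 'a::banach"
  assumes "continuous_on {0..T} F"
  shows "continuous_on {0..T} (\<lambda>t. integral {0..t} F)"
  using integral_initial_deriv[OF assms]
  by (meson continuous_on_eq_continuous_within has_vector_derivative_continuous)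

text \<open>
  Duhamel's formula written as the series of its Picard corrections: the \<open>k\<close>-th correction is
  obtained by applying \<open>L\<close> and integrating \<open>k\<close> times, so a factorial makes the series converge
  uniformly.
\<close>

lemma linear_ode_exists:
  fixes L :: "'a::banach \<Rightarrow> 'a"
  assumes L: "bounded_linear L" and F: "continuous_on {0..T} F"
  obtains U where "U 0 = 0"
    "\<And>t. t \<in> {0..T} \<Longrightarrow> (U has_vector_derivative L (U t) + F t) (at t within {0..T})"
proof -
  interpret L: bounded_linear L by fact
  obtain K where K: "0 < K" "\<And>x. norm (L x) \<le> norm x * K" using L.pos_bounded by blast
  have "bounded (F ` {0..T})" using F by (intro compact_imp_bounded compact_continuous_image) auto
  then obtain M where M: "\<And>t. t \<in> {0..T} \<Longrightarrow> norm (F t) \<le> M" unfolding bounded_iff by blast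
  define W where "W = rec_nat (\<lambda>t. integral {0..t} F) (\<lambda>_ w t. integral {0..t} (\<lambda>s. L (w s)))"
  have W0: "W 0 = (\<lambda>t. integral {0..t} F)"
    and WS: "\<And>k. W (Suc k) = (\<lambda>t. integral {0..t} (\<lambda>s. L (W k s)))" by (auto simp: W_def)
  have contL: "continuous_on {0..T} (\<lambda>s. L (w s))" if "continuous_on {0..T} w" for w
    using that L.continuous_on by blast
  have Wc: "continuous_on {0..T} (W k)" for k
    by (induction k) (auto simp: W0 WS intro!: continuous_initial_integral F contL)
  have bound: "norm (W k t) \<le> M * K ^ k * t ^ Suc k / fact (Suc k)" if "t \<in> {0..T}" for k t
    using that
  proof (induction k arbitrary: t)
    case 0
    have "norm (integral {0..t} F) \<le> M * (t - 0)"
      by (rule integral_bound) (use 0 F M in \<open>auto intro: continuous_on_subset\<close>)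
    then show ?case using 0 by (simp add: W0)
  next
    case (Suc k)
    have sub: "{0..t} \<subseteq> {0..T}" using Suc.prems by auto
    have "((\<lambda>s. M * K ^ Suc k * s ^ Suc k / fact (Suc k)) has_integral
        (M * K ^ Suc k * t ^ Suc (Suc k) / fact (Suc (Suc k))
          - M * K ^ Suc k * 0 ^ Suc (Suc k) / fact (Suc (Suc k)))) {0..t}"
    proof (rule fundamental_theorem_of_calculus)
      fix x assume "x \<in> {0..t}"
      have "((\<lambda>s. M * K ^ Suc k / fact (Suc (Suc k)) * s ^ Suc (Suc k)) has_real_derivative
          M * K ^ Suc k / fact (Suc (Suc k)) * (real (Suc (Suc k)) * x ^ Suc k)) (at x within {0..t})"
        by (rule derivative_eq_intros refl | simp)+
      moreover have "M * K ^ Suc k / fact (Suc (Suc k)) * (real (Suc (Suc k)) * x ^ Suc k)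
          = M * K ^ Suc k * x ^ Suc k / fact (Suc k)"
        unfolding fact_Suc[of "Suc k"] of_nat_mult by (simp add: divide_simps del: fact_Suc of_nat_Suc)
      ultimately show "((\<lambda>s. M * K ^ Suc k * s ^ Suc (Suc k) / fact (Suc (Suc k))) has_vector_derivative
          M * K ^ Suc k * x ^ Suc k / fact (Suc k)) (at x within {0..t})"
        unfolding has_real_derivative_iff_has_vector_derivative[symmetric] by (simp del: fact_Suc)
    qed (use Suc.prems in auto)
    then have hi: "((\<lambda>s. M * K ^ Suc k * s ^ Suc k / fact (Suc k)) has_integral
        M * K ^ Suc k * t ^ Suc (Suc k) / fact (Suc (Suc k))) {0..t}" by simp
    have "norm (integral {0..t} (\<lambda>s. L (W k s))) \<le> integral {0..t} (\<lambda>s. M * K ^ Suc k * s ^ Suc k / fact (Suc k))"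
    proof (rule integral_norm_bound_integral)
      show "(\<lambda>s. L (W k s)) integrable_on {0..t}"
        using contL[OF Wc[of k]] sub by (intro integrable_continuous_real) (auto intro: continuous_on_subset)
      show "(\<lambda>s. M * K ^ Suc k * s ^ Suc k / fact (Suc k)) integrable_on {0..t}" using hi by blast
      fix s assume "s \<in> {0..t}"
      then have "norm (W k s) \<le> M * K ^ k * s ^ Suc k / fact (Suc k)" using Suc.IH sub by blast
      then have "norm (W k s) * K \<le> M * K ^ k * s ^ Suc k / fact (Suc k) * K"
        using K(1) by (intro mult_right_mono) auto
      then show "norm (L (W k s)) \<le> M * K ^ Suc k * s ^ Suc k / fact (Suc k)"
        using K(2)[of "W k s"] by (simp add: algebra_simps)
    qed
    then show ?case unfolding WS integral_unique[OF hi] .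
  qed
  define S where "S n t = (\<Sum>k<n. W k t)" for n t
  define U where "U t = (\<Sum>k. W k t)" for t
  have unif: "uniform_limit {0..T} S U sequentially"
    unfolding S_def U_def
  proof (rule Weierstrass_m_test)
    fix n t assume t: "t \<in> {0..T}"
    have M0: "0 \<le> M" using M[OF t] norm_ge_zero order_trans by blast
    have "norm (W n t) \<le> M * K ^ n * t ^ Suc n / fact (Suc n)" using bound t by blast
    also have "\<dots> \<le> M * K ^ n * T ^ Suc n / fact n"
      using t K M0 by (intro frac_le mult_left_mono power_mono) (auto intro!: fact_mono)
    also have "\<dots> = M * T * ((K * T) ^ n / fact n)" by (simp add: power_mult_distrib)
    finally show "norm (W n t) \<le> M * T * ((K * T) ^ n / fact n)" .
  next
    show "summable (\<lambda>n. M * T * ((K * T) ^ n / fact n))"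
      using summable_exp[of "K * T"] by (intro summable_mult) (simp add: divide_inverse mult.commute)
  qed
  have Sc: "continuous_on {0..T} (S n)" for n unfolding S_def by (intro continuous_intros Wc)
  have Uc: "continuous_on {0..T} U"
    using uniform_limit_theorem[OF _ unif] Sc by simp
  have SS: "S (Suc n) t = integral {0..t} F + integral {0..t} (\<lambda>s. L (S n s))" if t: "t \<in> {0..T}" for n t
  proof -
    have "integral {0..t} (\<lambda>s. L (S n s)) = (\<Sum>k<n. integral {0..t} (\<lambda>s. L (W k s)))"
      unfolding S_def L.sum
      using t by (intro integral_sum integrable_continuous_real ballI finite_lessThan
          continuous_on_subset[OF contL[OF Wc]]) auto
    then show ?thesis unfolding S_def sum.lessThan_Suc_shift by (simp add: W0 WS)
  qed
  have eq: "U t = integral {0..t} (\<lambda>s. L (U s) + F s)" if t: "t \<in> {0..T}" for t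
  proof -
    have sub: "{0..t} \<subseteq> {0..T}" using t by auto
    have u: "uniform_limit {0..t} (\<lambda>n s. L (S n s)) (\<lambda>s. L (U s)) sequentially"
      by (rule bounded_linear.uniform_limit[OF L]) (use uniform_limit_on_subset[OF unif] sub in auto)
    obtain I J where I: "\<And>n. ((\<lambda>s. L (S n s)) has_integral I n) {0..t}"
      and J: "((\<lambda>s. L (U s)) has_integral J) {0..t}" and IJ: "(I \<longlongrightarrow> J) sequentially"
      by (rule uniform_limit_integral[OF u]) (use continuous_on_subset[OF contL[OF Sc] sub] in auto)
    have "(\<lambda>n. S (Suc n) t) \<longlonglongrightarrow> integral {0..t} F + J"
      unfolding SS[OF t] integral_unique[OF I] by (intro tendsto_intros IJ)
    moreover have "(\<lambda>n. S (Suc n) t) \<longlonglongrightarrow> U t"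
      using tendsto_uniform_limitI[OF unif t] by (rule LIMSEQ_Suc)
    ultimately have "U t = integral {0..t} F + J" using LIMSEQ_unique by blast
    moreover have "F integrable_on {0..t}"
      using F sub by (intro integrable_continuous_real) (auto intro: continuous_on_subset)
    moreover have "(\<lambda>s. L (U s)) integrable_on {0..t}" using J by auto
    ultimately show ?thesis using J by (simp add: integral_add integral_unique)
  qed
  have hc: "continuous_on {0..T} (\<lambda>s. L (U s) + F s)" by (intro continuous_intros contL Uc F)
  show ?thesis
  proof (rule that[of "\<lambda>t. integral {0..t} (\<lambda>s. L (U s) + F s)"])
    fix t assume t: "t \<in> {0..T}"
    show "((\<lambda>t. integral {0..t} (\<lambda>s. L (U s) + F s)) has_vector_derivative
        L (integral {0..t} (\<lambda>s. L (U s) + F s)) + F t) (at t within {0..T})"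
      using integral_initial_deriv[OF hc t] eq[OF t] by simp
  qed simp
qed

text \<open>
  The Steklov averages \<open>1/h \<integral> F\<close> over \<open>[t, t + h]\<close> are differentiable and converge uniformly;
  \<open>F\<close> is extended by its end values to give the averages a meaning near \<open>T\<close>.
\<close>

lemma C1_uniformly_dense:
  fixes F :: "real \<Rightarrow> 'a::banach"
  assumes F: "continuous_on {0..T} F" and "0 < \<delta>"
  obtains G G' where "continuous_on {0..T} G'"
    "\<And>t. t \<in> {0..T} \<Longrightarrow> (G has_vector_derivative G' t) (at t within {0..T})"
    "\<And>t. t \<in> {0..T} \<Longrightarrow> norm (G t - F t) \<le> \<delta>"
proof (cases "0 \<le> T")
  case True
  define E where "E s = F (max 0 (min T s))" for s
  have Ec: "continuous_on X E" for X
    unfolding E_def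
    by (rule continuous_on_compose2[OF F]) (use True in \<open>auto intro!: continuous_intros\<close>)
  have EF: "E t = F t" if "t \<in> {0..T}" for t using that by (auto simp: E_def)
  have "uniformly_continuous_on {0..T+1} E" using Ec compact_uniformly_continuous by blast
  then obtain d where d: "0 < d"
    and ud: "\<And>s t. s \<in> {0..T+1} \<Longrightarrow> t \<in> {0..T+1} \<Longrightarrow> dist s t < d \<Longrightarrow> dist (E s) (E t) < \<delta>"
    using \<open>0 < \<delta>\<close> unfolding uniformly_continuous_on_def by metis
  define h where "h = min 1 (d / 2)"
  have h: "0 < h" "h \<le> 1" "h < d" using d by (auto simp: h_def)
  define P where "P t = integral {0..t} E" for t
  have Pd: "(P has_vector_derivative E t) (at t within {0..T+1})" if "t \<in> {0..T+1}" for t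
    unfolding P_def using integral_initial_deriv[OF Ec that] .
  show ?thesis
  proof (rule that[of "\<lambda>t. (1/h) *\<^sub>R (E (t + h) - E t)" "\<lambda>t. (1/h) *\<^sub>R (P (t + h) - P t)"])
    show "continuous_on {0..T} (\<lambda>t. (1/h) *\<^sub>R (E (t + h) - E t))"
      by (intro continuous_intros Ec continuous_on_compose2[OF Ec[of UNIV]]) auto
  next
    fix t assume t: "t \<in> {0..T}"
    have "((\<lambda>s. s + h) has_vector_derivative 1) (at t within {0..T})"
      by (auto intro!: derivative_eq_intros simp: has_real_derivative_iff_has_vector_derivative[symmetric])
    moreover have "(P has_vector_derivative E (t + h)) (at (t + h) within (\<lambda>s. s + h) ` {0..T})"
      by (rule has_vector_derivative_within_subset[OF Pd]) (use t h in auto)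
    ultimately have "((P \<circ> (\<lambda>s. s + h)) has_vector_derivative 1 *\<^sub>R E (t + h)) (at t within {0..T})"
      by (rule vector_diff_chain_within)
    then have 1: "((\<lambda>s. P (s + h)) has_vector_derivative E (t + h)) (at t within {0..T})"
      by (simp add: o_def)
    have 2: "(P has_vector_derivative E t) (at t within {0..T})"
      by (rule has_vector_derivative_within_subset[OF Pd]) (use t in auto)
    show "((\<lambda>t. (1/h) *\<^sub>R (P (t + h) - P t)) has_vector_derivative (1/h) *\<^sub>R (E (t + h) - E t)) (at t within {0..T})"
      using has_vector_derivative_scaleR[OF DERIV_const[of "1/h"] has_vector_derivative_diff[OF 1 2]] by simp
    have Pt: "P (t + h) - P t = integral {t..t+h} E"
      unfolding P_def
      using Henstock_Kurzweil_Integration.integral_combine[of 0 t "t+h" E] t h Ec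
      by (simp add: algebra_simps integrable_continuous_real)
    have "integral {t..t+h} (\<lambda>s. E s - F t) = integral {t..t+h} E - h *\<^sub>R F t"
      using h Ec by (subst integral_diff) (auto intro!: integrable_continuous_real)
    moreover have "norm (integral {t..t+h} (\<lambda>s. E s - F t)) \<le> \<delta> * (t + h - t)"
    proof (rule integral_bound)
      show "continuous_on ({t..t+h}) (\<lambda>s. E s - F t)" by (intro continuous_intros Ec)
      fix s assume s: "s \<in> {t..t+h}"
      have "dist (E s) (E t) < \<delta>" by (rule ud) (use s t h in \<open>auto simp: dist_real_def\<close>)
      then show "norm (E s - F t) \<le> \<delta>" using EF[OF t] by (simp add: dist_norm)
    qed (use h in simp)
    ultimately have "norm ((P (t + h) - P t) - h *\<^sub>R F t) \<le> \<delta> * h" using h by (simp add: Pt)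
    moreover have "(1/h) *\<^sub>R (P (t + h) - P t) - F t = (1/h) *\<^sub>R ((P (t + h) - P t) - h *\<^sub>R F t)"
      using h by (simp add: scaleR_diff_right)
    ultimately have "norm ((1/h) *\<^sub>R (P (t + h) - P t) - F t) = norm ((P (t + h) - P t) - h *\<^sub>R F t) / h"
      and "norm ((P (t + h) - P t) - h *\<^sub>R F t) / h \<le> \<delta>"
      using h by (simp_all only: norm_scaleR) (simp_all add: pos_divide_le_eq)
    then show "norm ((1/h) *\<^sub>R (P (t + h) - P t) - F t) \<le> \<delta>" by simp
  qed
qed (use that[of "\<lambda>_. 0" "\<lambda>_. 0"] in auto)

section \<open>Evolution equations with a maximal dissipative operator\<close>

text \<open>
  The operator is represented by its graph: closedness becomes a property of a set, and limits are
  taken in pairs of argument and value.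
\<close>

locale maximal_dissipative =
  fixes G :: "('a::{real_inner, banach} \<times> 'a) set"
  assumes subspace: "subspace G"
    and closed: "closed G"
    and dissipative: "(x, y) \<in> G \<Longrightarrow> inner x y \<le> 0"
    and range: "0 < l \<Longrightarrow> \<exists>x y. (x, y) \<in> G \<and> x - l *\<^sub>R y = h"
begin

text \<open>
  In operator notation \<open>yosida l h = A (1 - l A)\<^sup>-\<^sup>1 h\<close>: the point \<open>x = h + l y\<close> satisfies
  \<open>x - l y = h\<close> with \<open>(x, y) \<in> G\<close>.
\<close>

definition yosida :: "real \<Rightarrow> 'a \<Rightarrow> 'a" where
  "yosida l h = (THE y. (h + l *\<^sub>R y, y) \<in> G)"

lemma G_diff: "(x, y) \<in> G \<Longrightarrow> (x', y') \<in> G \<Longrightarrow> (x - x', y - y') \<in> G"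
  using subspace_diff[OF subspace] by fastforce

lemma yosida_unique:
  assumes "0 < l" "(h + l *\<^sub>R y, y) \<in> G" "(h + l *\<^sub>R y', y') \<in> G"
  shows "y = y'"
proof -
  have "(l *\<^sub>R (y - y'), y - y') \<in> G" using G_diff[OF assms(2,3)] by (simp add: algebra_simps)
  from dissipative[OF this] have "l * (norm (y - y'))\<^sup>2 \<le> 0" by (simp add: power2_norm_eq_inner)
  then show ?thesis using assms(1) by (simp add: mult_le_0_iff)
qed

lemma yosida_eqI: "0 < l \<Longrightarrow> (h + l *\<^sub>R y, y) \<in> G \<Longrightarrow> yosida l h = y"
  unfolding yosida_def using yosida_unique by (intro the_equality) blast+

lemma yosida_in: "0 < l \<Longrightarrow> (h + l *\<^sub>R yosida l h, yosida l h) \<in> G"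
proof -
  assume l: "0 < l"
  obtain x y where "(x, y) \<in> G" "x - l *\<^sub>R y = h" using range[OF l] by blast
  then have "(h + l *\<^sub>R y, y) \<in> G" by (metis diff_add_cancel)
  then show ?thesis using yosida_eqI[OF l] by metis
qed

lemma inner_yosida_le: "0 < l \<Longrightarrow> inner (yosida l h) h \<le> - l * (norm (yosida l h))\<^sup>2"
  using dissipative[OF yosida_in[of l h]]
  by (simp add: inner_add_right power2_norm_eq_inner inner_commute)

lemma bounded_linear_yosida:
  assumes l: "0 < l"
  shows "bounded_linear (yosida l)"
proof (rule bounded_linear_intro)
  fix x y
  show "yosida l (x + y) = yosida l x + yosida l y"
  proof (rule yosida_eqI[OF l])
    show "(x + y + l *\<^sub>R (yosida l x + yosida l y), yosida l x + yosida l y) \<in> G"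
      using subspace_add[OF subspace yosida_in[OF l, of x] yosida_in[OF l, of y]]
      by (simp add: algebra_simps)
  qed
next
  fix r x
  show "yosida l (r *\<^sub>R x) = r *\<^sub>R yosida l x"
  proof (rule yosida_eqI[OF l])
    show "(r *\<^sub>R x + l *\<^sub>R r *\<^sub>R yosida l x, r *\<^sub>R yosida l x) \<in> G"
      using subspace_scale[OF subspace yosida_in[OF l, of x], of r] by (simp add: algebra_simps)
  qed
next
  fix x
  have "l * (norm (yosida l x))\<^sup>2 \<le> \<bar>inner (yosida l x) x\<bar>" using inner_yosida_le[OF l, of x] by linarith
  also have "\<dots> \<le> norm (yosida l x) * norm x" by (rule Cauchy_Schwarz_ineq2)
  finally have "norm (yosida l x) * (l * norm (yosida l x)) \<le> norm (yosida l x) * norm x"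
    by (simp add: power2_eq_square algebra_simps)
  then have "l * norm (yosida l x) \<le> norm x"
    by (cases "norm (yosida l x) = 0") (auto simp: mult_le_cancel_left)
  then show "norm (yosida l x) \<le> norm x * (1 / l)" using l by (simp add: field_simps)
qed

text \<open>
  Dissipativity compares the points \<open>x + l A\<^sub>l x\<close> and \<open>y + m A\<^sub>m y\<close> of the domain. These
  differ from \<open>x\<close> and \<open>y\<close> by \<open>O(l)\<close> and \<open>O(m)\<close> as soon as the Yosida approximations
  \<open>A\<^sub>l x\<close> and \<open>A\<^sub>m y\<close> are bounded.
\<close>

lemma inner_yosida_diff_le:
  assumes "0 < l" "0 < m" "norm (yosida l x) \<le> M" "norm (yosida m y) \<le> M"
  shows "inner (yosida l x - yosida m y) (x - y) \<le> 2 * M\<^sup>2 * (l + m)"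
proof -
  let ?a = "yosida l x" and ?b = "yosida m y"
  have "inner ((x + l *\<^sub>R ?a) - (y + m *\<^sub>R ?b)) (?a - ?b) \<le> 0"
    using dissipative[OF G_diff[OF yosida_in yosida_in]] assms by blast
  then have "inner (?a - ?b) (x - y) \<le> inner (m *\<^sub>R ?b - l *\<^sub>R ?a) (?a - ?b)"
    by (simp add: inner_diff_left inner_diff_right inner_add_left inner_add_right inner_commute)
  also have "\<dots> \<le> norm (m *\<^sub>R ?b - l *\<^sub>R ?a) * norm (?a - ?b)" by (rule norm_cauchy_schwarz)
  also have "\<dots> \<le> (M * (l + m)) * (2 * M)"
  proof (rule mult_mono)
    have "norm (m *\<^sub>R ?b - l *\<^sub>R ?a) \<le> m * norm ?b + l * norm ?a"
      using norm_triangle_ineq4[of "m *\<^sub>R ?b" "l *\<^sub>R ?a"] assms by simp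
    also have "\<dots> \<le> m * M + l * M" using assms by (intro add_mono mult_left_mono) auto
    finally show "norm (m *\<^sub>R ?b - l *\<^sub>R ?a) \<le> M * (l + m)" by (simp add: algebra_simps)
    show "norm (?a - ?b) \<le> 2 * M" using norm_triangle_ineq4[of ?a ?b] assms by simp
    show "0 \<le> M * (l + m)" using assms norm_ge_zero order_trans by (metis add_nonneg_nonneg less_imp_le mult_nonneg_nonneg)
  qed simp
  finally show ?thesis by (simp add: power2_eq_square algebra_simps)
qed

end

locale perturbed_evolution = maximal_dissipative G
  for G :: "('a::{real_inner, banach} \<times> 'a) set" +
  fixes B :: "'a \<Rightarrow> 'a" and T :: real
  assumes B: "bounded_linear B" and T: "0 < T"
begin

sublocale B: bounded_linear B by (rule B)

definition approximate_solution :: "real \<Rightarrow> (real \<Rightarrow> 'a) \<Rightarrow> (real \<Rightarrow> 'a) \<Rightarrow> bool" where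
  "approximate_solution l F U \<longleftrightarrow> U 0 = 0 \<and> (\<forall>t\<in>{0..T}.
     (U has_vector_derivative yosida l (U t) + B (U t) + F t) (at t within {0..T}))"

lemma approximate_solution_exists:
  assumes "0 < l" "continuous_on {0..T} F"
  obtains U where "approximate_solution l F U"
proof -
  have "bounded_linear (\<lambda>x. yosida l x + B x)"
    using bounded_linear_add[OF bounded_linear_yosida[OF assms(1)] B] .
  from linear_ode_exists[OF this assms(2)] show ?thesis
    using that unfolding approximate_solution_def by metis
qed

lemma approximate_solution_diff:
  assumes "0 < l" "approximate_solution l F U" "approximate_solution l F' U'"
  shows "approximate_solution l (\<lambda>t. F t - F' t) (\<lambda>t. U t - U' t)"
  unfolding approximate_solution_def
proof (intro conjI ballI)
  interpret Y: bounded_linear "yosida l" by (rule bounded_linear_yosida[OF assms(1)])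
  show "U 0 - U' 0 = 0" using assms by (simp add: approximate_solution_def)
  fix t assume t: "t \<in> {0..T}"
  have "((\<lambda>t. U t - U' t) has_vector_derivative
     (yosida l (U t) + B (U t) + F t) - (yosida l (U' t) + B (U' t) + F' t)) (at t within {0..T})"
    using assms t unfolding approximate_solution_def by (blast intro: has_vector_derivative_diff)
  then show "((\<lambda>t. U t - U' t) has_vector_derivative
     yosida l (U t - U' t) + B (U t - U' t) + (F t - F' t)) (at t within {0..T})"
    by (simp add: Y.diff B.diff algebra_simps)
qed

definition bound_B :: real where "bound_B = (SOME b. 0 \<le> b \<and> (\<forall>x. norm (B x) \<le> norm x * b))"

lemma bound_B: "0 \<le> bound_B" "norm (B x) \<le> norm x * bound_B"
proof -
  have "\<exists>b. 0 \<le> b \<and> (\<forall>x. norm (B x) \<le> norm x * b)" using B.nonneg_bounded by blast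
  from someI_ex[OF this] show "0 \<le> bound_B" "norm (B x) \<le> norm x * bound_B"
    unfolding bound_B_def by blast+
qed

lemma inner_B_le: "inner (B x) x \<le> bound_B * (norm x)\<^sup>2"
proof -
  have "inner (B x) x \<le> norm (B x) * norm x" by (rule norm_cauchy_schwarz)
  also have "\<dots> \<le> (norm x * bound_B) * norm x" using bound_B by (intro mult_right_mono) auto
  finally show ?thesis by (simp add: power2_eq_square algebra_simps)
qed

abbreviation growth :: real where "growth \<equiv> exp ((2 * bound_B + 1) * T)"

text \<open>The estimate does not see the regularisation parameter, because the Yosida approximations
  are dissipative.\<close>

lemma stability:
  assumes l: "0 < l"
    and deriv: "\<And>t. t \<in> {0..T} \<Longrightarrow>
      (U has_vector_derivative yosida l (U t) + B (U t) + F t) (at t within {0..T})"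
    and F: "\<And>t. t \<in> {0..T} \<Longrightarrow> norm (F t) \<le> c" and t: "t \<in> {0..T}"
  shows "(norm (U t))\<^sup>2 \<le> growth * ((norm (U 0))\<^sup>2 + c\<^sup>2 * T)"
proof (rule energy_estimate[OF deriv _ bound_B(1) _ t])
  show "0 \<le> c" using F[OF t] norm_ge_zero order_trans by blast
  fix s assume s: "s \<in> {0..T}"
  have "inner (F s) (U s) \<le> norm (F s) * norm (U s)" by (rule norm_cauchy_schwarz)
  also have "\<dots> \<le> c * norm (U s)" using F[OF s] by (intro mult_right_mono) auto
  finally have "inner (F s) (U s) \<le> c * norm (U s)" .
  moreover have "inner (yosida l (U s)) (U s) \<le> 0"
    using inner_yosida_le[OF l, of "U s"] l by (smt (verit) mult_nonneg_nonneg zero_le_power2 mult_minus_left)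
  ultimately show "inner (yosida l (U s) + B (U s) + F s) (U s)
      \<le> bound_B * (norm (U s))\<^sup>2 + c * norm (U s)"
    using inner_B_le[of "U s"] by (simp add: inner_add_left)
qed

lemma approximate_solution_bound:
  assumes "0 < l" "approximate_solution l F U" "\<And>t. t \<in> {0..T} \<Longrightarrow> norm (F t) \<le> c"
    and t: "t \<in> {0..T}"
  shows "norm (U t) \<le> sqrt (growth * T) * c"
proof -
  have c: "0 \<le> c" using assms(3)[OF t] norm_ge_zero order_trans by blast
  have "(norm (U t))\<^sup>2 \<le> growth * ((norm (U 0))\<^sup>2 + c\<^sup>2 * T)"
    using assms by (intro stability[of l U F c t]) (auto simp: approximate_solution_def)
  also have "\<dots> = (sqrt (growth * T) * c)\<^sup>2"
    using assms(2) T by (simp add: approximate_solution_def power_mult_distrib)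
  finally show ?thesis by (rule power2_le_imp_le) (use c T in auto)
qed

text \<open>
  The vanishing of \<open>F\<close> at \<open>0\<close> makes the initial value of the time derivative vanish.
\<close>

lemma approximate_solution_differentiable:
  assumes l: "0 < l" and U: "approximate_solution l F U" and F0: "F 0 = 0"
    and F': "\<And>t. t \<in> {0..T} \<Longrightarrow> (F has_vector_derivative F' t) (at t within {0..T})"
  shows "approximate_solution l F' (\<lambda>t. yosida l (U t) + B (U t) + F t)"
  unfolding approximate_solution_def
proof (intro conjI ballI)
  interpret Y: bounded_linear "yosida l" by (rule bounded_linear_yosida[OF l])
  show "yosida l (U 0) + B (U 0) + F 0 = 0"
    using U F0 by (simp add: approximate_solution_def Y.zero B.zero)
  fix t assume t: "t \<in> {0..T}"
  let ?V = "yosida l (U t) + B (U t) + F t"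
  have d: "(U has_vector_derivative ?V) (at t within {0..T})"
    using U t by (auto simp: approximate_solution_def)
  show "((\<lambda>t. yosida l (U t) + B (U t) + F t) has_vector_derivative
      yosida l ?V + B ?V + F' t) (at t within {0..T})"
    by (intro has_vector_derivative_add Y.has_vector_derivative B.has_vector_derivative d F' t)
qed

text \<open>
  The time derivative of an approximate solution solves the equation with \<open>F'\<close> on the right, so it
  is bounded uniformly in \<open>l\<close>; the equation then bounds the Yosida term by terms already
  controlled.
\<close>

lemma yosida_uniformly_bounded:
  assumes F: "continuous_on {0..T} F'"
    and F': "\<And>t. t \<in> {0..T} \<Longrightarrow> (F has_vector_derivative F' t) (at t within {0..T})"
  obtains M where "\<And>l U t. 0 < l \<Longrightarrow> approximate_solution l F U \<Longrightarrow> t \<in> {0..T} \<Longrightarrow>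
    norm (yosida l (U t)) \<le> M"
proof -
  have Fc: "continuous_on {0..T} F"
    using F' by (meson continuous_on_eq_continuous_within has_vector_derivative_continuous)
  have "bounded (F ` {0..T})" "bounded (F' ` {0..T})"
    using F Fc by (auto intro!: compact_imp_bounded compact_continuous_image)
  then obtain c c' where c: "\<forall>t\<in>{0..T}. norm (F t) \<le> c" and c': "\<forall>t\<in>{0..T}. norm (F' t) \<le> c'"
    unfolding bounded_iff by blast
  define M1 where "M1 = sqrt (growth * (c\<^sup>2 + c'\<^sup>2 * T))"
  define M2 where "M2 = sqrt (growth * T) * c"
  show ?thesis
  proof (rule that)
    fix l U t assume l: "0 < l" and U: "approximate_solution l F U" and t: "t \<in> {0..T}"
    interpret Y: bounded_linear "yosida l" by (rule bounded_linear_yosida[OF l])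
    define V where "V t = yosida l (U t) + B (U t) + F t" for t
    \<comment> \<open>The initial value \<open>V 0 = F 0\<close> need not vanish here.\<close>
    have "(norm (V t))\<^sup>2 \<le> growth * ((norm (V 0))\<^sup>2 + c'\<^sup>2 * T)"
    proof (rule stability[OF l _ _ t])
      fix s assume s: "s \<in> {0..T}"
      have d: "(U has_vector_derivative V s) (at s within {0..T})"
        using U s by (auto simp: approximate_solution_def V_def)
      show "(V has_vector_derivative yosida l (V s) + B (V s) + F' s) (at s within {0..T})"
        unfolding V_def[of "_::real", abs_def]
        by (intro has_vector_derivative_add Y.has_vector_derivative B.has_vector_derivative F' s
            d[unfolded V_def])
    qed (use c' in auto)
    moreover have "(norm (V 0))\<^sup>2 \<le> c\<^sup>2"
      using c T U by (intro power_mono) (auto simp: V_def approximate_solution_def Y.zero B.zero)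
    ultimately have "(norm (V t))\<^sup>2 \<le> growth * (c\<^sup>2 + c'\<^sup>2 * T)"
      by (smt (verit) exp_gt_zero mult_left_mono)
    then have 1: "norm (V t) \<le> M1" unfolding M1_def by (rule real_le_rsqrt)
    have "norm (U t) \<le> M2" unfolding M2_def
      using approximate_solution_bound[OF l U _ t] c by blast
    then have "norm (B (U t)) \<le> M2 * bound_B"
      using bound_B(2)[of "U t"] mult_right_mono[OF _ bound_B(1)] order_trans by blast
    moreover have "yosida l (U t) = V t - B (U t) - F t" by (simp add: V_def)
    ultimately show "norm (yosida l (U t)) \<le> M1 + M2 * bound_B + c"
      using 1 c t norm_triangle_ineq4[of "V t - B (U t)" "F t"] norm_triangle_ineq4[of "V t" "B (U t)"]
      by fastforce
  qed
qed

text \<open>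
  Gronwall's inequality for the difference, with the \<open>O(l + m)\<close> term of
  \<open>inner_yosida_diff_le\<close> as the only inhomogeneity.
\<close>

lemma approximate_solutions_close:
  assumes l: "0 < l" "0 < m" and U: "approximate_solution l F U" "approximate_solution m F U'"
    and M: "\<And>t. t \<in> {0..T} \<Longrightarrow> norm (yosida l (U t)) \<le> M"
      "\<And>t. t \<in> {0..T} \<Longrightarrow> norm (yosida m (U' t)) \<le> M" and t: "t \<in> {0..T}"
  shows "(norm (U t - U' t))\<^sup>2 \<le> exp (2 * bound_B * T) * (4 * M\<^sup>2 * T) * (l + m)"
proof -
  let ?D = "\<lambda>t. U t - U' t"
  let ?D' = "\<lambda>t. (yosida l (U t) + B (U t) + F t) - (yosida m (U' t) + B (U' t) + F t)"
  have "(norm (?D t))\<^sup>2 \<le> exp (2 * bound_B * t) * ((norm (?D 0))\<^sup>2 + (4 * M\<^sup>2 * (l + m)) * t)"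
  proof (rule gronwall_affine[OF has_vector_derivative_norm_sq _ _ _ t])
    fix s assume s: "s \<in> {0..T}"
    show "(?D has_vector_derivative ?D' s) (at s within {0..T})"
      using U s unfolding approximate_solution_def by (blast intro: has_vector_derivative_diff)
    have "inner (?D' s) (?D s) = inner (yosida l (U s) - yosida m (U' s)) (?D s) + inner (B (?D s)) (?D s)"
      by (simp add: B.diff inner_diff_left inner_add_left)
    also have "\<dots> \<le> 2 * M\<^sup>2 * (l + m) + bound_B * (norm (?D s))\<^sup>2"
      using l M s by (intro add_mono inner_yosida_diff_le inner_B_le) auto
    finally show "2 * inner (?D' s) (?D s) \<le> 2 * bound_B * (norm (?D s))\<^sup>2 + 4 * M\<^sup>2 * (l + m)" by simp
  qed (use bound_B(1) l in auto)
  also have "\<dots> = exp (2 * bound_B * t) * ((4 * M\<^sup>2 * (l + m)) * t)"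
    using U by (simp add: approximate_solution_def)
  also have "\<dots> \<le> exp (2 * bound_B * T) * ((4 * M\<^sup>2 * (l + m)) * T)"
    using t l bound_B(1) by (intro mult_mono) (auto intro!: mult_left_mono)
  finally show ?thesis by (simp add: algebra_simps)
qed

abbreviation step :: "nat \<Rightarrow> real" where "step n \<equiv> 1 / (real n + 1)"

text \<open>
  For \<open>C1\<close> data this is \<open>approximate_solutions_close\<close>. Continuous data are reduced to it by density,
  because the approximate solutions depend on the data with a constant independent of the
  regularisation. The continuous case is needed for the time derivatives, whose data \<open>F'\<close> are only
  continuous.
\<close>

lemma approximate_solutions_Cauchy:
  assumes F: "continuous_on {0..T} F" and U: "\<And>n. approximate_solution (step n) F (U n)"
  shows "uniformly_Cauchy_on {0..T} U"
  unfolding uniformly_Cauchy_on_def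
proof (intro allI impI)
  fix e :: real assume e: "0 < e"
  define C where "C = sqrt (growth * T)"
  have C: "0 < C" using T by (simp add: C_def)
  obtain G G' where G': "continuous_on {0..T} G'"
    and G: "\<And>t. t \<in> {0..T} \<Longrightarrow> (G has_vector_derivative G' t) (at t within {0..T})"
    and GF: "\<And>t. t \<in> {0..T} \<Longrightarrow> norm (G t - F t) \<le> e / (4 * C)"
    using C1_uniformly_dense[OF F, of "e / (4 * C)"] e C by (metis divide_pos_pos mult_pos_pos zero_less_numeral)
  have Gc: "continuous_on {0..T} G"
    using G by (meson continuous_on_eq_continuous_within has_vector_derivative_continuous)
  have "\<exists>V. approximate_solution (step n) G V" for n
    using approximate_solution_exists[OF _ Gc, of "step n"] by auto
  then obtain V where V: "\<And>n. approximate_solution (step n) G (V n)" by metis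
  obtain M where M: "\<And>l U t. 0 < l \<Longrightarrow> approximate_solution l G U \<Longrightarrow> t \<in> {0..T} \<Longrightarrow>
      norm (yosida l (U t)) \<le> M"
    using yosida_uniformly_bounded[OF G' G] by blast
  define K where "K = exp (2 * bound_B * T) * (4 * M\<^sup>2 * T)"
  have K: "0 \<le> K" using T by (simp add: K_def)
  have VU: "norm (V n t - U n t) \<le> e / 4" if "t \<in> {0..T}" for n t
  proof -
    have "norm (V n t - U n t) \<le> sqrt (growth * T) * (e / (4 * C))"
      by (rule approximate_solution_bound[OF _ approximate_solution_diff[OF _ V U]]) (use GF that in auto)
    also have "\<dots> = e / 4" using C by (simp add: C_def[symmetric])
    finally show ?thesis .
  qed
  obtain N where N: "8 * K / e\<^sup>2 < real N" using reals_Archimedean2 by blast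
  have small: "K * (step m + step n) < (e / 2)\<^sup>2" if "N \<le> m" "N \<le> n" for m n
  proof -
    have "8 * K < (real N + 1) * e\<^sup>2"
      using N e by (simp add: divide_simps) (smt (verit) mult_right_mono zero_less_power)
    then have "K * (2 * step N) < (e / 2)\<^sup>2" by (simp add: field_simps power2_eq_square)
    moreover have "K * (step m + step n) \<le> K * (2 * step N)"
    proof (rule mult_left_mono[OF _ K])
      have "step m \<le> step N" "step n \<le> step N" using that by (auto intro!: divide_left_mono)
      then show "step m + step n \<le> 2 * step N" by linarith
    qed
    ultimately show ?thesis by linarith
  qed
  show "\<exists>N. \<forall>t\<in>{0..T}. \<forall>m\<ge>N. \<forall>n\<ge>N. dist (U m t) (U n t) < e"
  proof (intro exI[of _ N] ballI allI impI)
    fix t m n assume t: "t \<in> {0..T}" and mn: "N \<le> m" "N \<le> n"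
    have "(norm (V m t - V n t))\<^sup>2 \<le> K * (step m + step n)"
      unfolding K_def
      by (rule approximate_solutions_close[OF _ _ V V M[OF _ V] M[OF _ V] t]) simp_all
    with small[OF mn] have "(norm (V m t - V n t))\<^sup>2 < (e / 2)\<^sup>2" by linarith
    then have "norm (V m t - V n t) < e / 2" by (rule power_less_imp_less_base) (use e in simp)
    moreover have "U m t - U n t = ((V m t - V n t) - (V m t - U m t)) + (V n t - U n t)" by simp
    then have "norm (U m t - U n t) \<le> norm ((V m t - V n t) - (V m t - U m t)) + norm (V n t - U n t)"
      by (simp only:) (rule norm_triangle_ineq)
    moreover have "norm ((V m t - V n t) - (V m t - U m t)) \<le> norm (V m t - V n t) + norm (V m t - U m t)"
      by (rule norm_triangle_ineq4)
    ultimately show "dist (U m t) (U n t) < e"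
      using VU[OF t, of m] VU[OF t, of n] e unfolding dist_norm by linarith
  qed
qed

text \<open>
  Both the approximate solutions and their derivatives converge uniformly. Each pair
  \<open>(u + l A\<^sub>l u, A\<^sub>l u)\<close> lies in the closed relation \<open>G\<close>, and it converges to \<open>(U, V - B U - F)\<close>
  as \<open>l\<close> tends to \<open>0\<close>.
\<close>

theorem evolution_exists:
  assumes F': "continuous_on {0..T} F'" and F0: "F 0 = 0"
    and F: "\<And>t. t \<in> {0..T} \<Longrightarrow> (F has_vector_derivative F' t) (at t within {0..T})"
  obtains U V where "U 0 = 0" "continuous_on {0..T} V"
    "\<And>t. t \<in> {0..T} \<Longrightarrow> (U has_vector_derivative V t) (at t within {0..T})"
    "\<And>t. t \<in> {0..T} \<Longrightarrow> (U t, V t - B (U t) - F t) \<in> G"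
proof -
  have Fc: "continuous_on {0..T} F"
    using F by (meson continuous_on_eq_continuous_within has_vector_derivative_continuous)
  have "\<exists>U. approximate_solution (step n) F U" for n
    using approximate_solution_exists[OF _ Fc, of "step n"] by auto
  then obtain u where u: "\<And>n. approximate_solution (step n) F (u n)" by metis
  define v where "v n t = yosida (step n) (u n t) + B (u n t) + F t" for n t
  have v: "approximate_solution (step n) F' (v n)" for n
    unfolding v_def[abs_def] by (rule approximate_solution_differentiable[OF _ u F0 F]) auto
  have du: "(u n has_vector_derivative v n t) (at t within {0..T})" if "t \<in> {0..T}" for n t
    using u[of n] that by (auto simp: approximate_solution_def v_def)
  have vc: "continuous_on {0..T} (v n)" for n
    using v[of n] unfolding approximate_solution_def
    by (meson continuous_on_eq_continuous_within has_vector_derivative_continuous)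
  obtain U where U: "uniform_limit {0..T} u U sequentially"
    using Cauchy_uniformly_convergent[OF approximate_solutions_Cauchy[OF Fc u]]
    unfolding uniformly_convergent_on_def by blast
  obtain V where V: "uniform_limit {0..T} v V sequentially"
    using Cauchy_uniformly_convergent[OF approximate_solutions_Cauchy[OF F' v]]
    unfolding uniformly_convergent_on_def by blast
  have Vc: "continuous_on {0..T} V" using uniform_limit_theorem[OF _ V] vc by simp
  have Ut: "(\<lambda>n. u n t) \<longlonglongrightarrow> U t" "(\<lambda>n. v n t) \<longlonglongrightarrow> V t" if "t \<in> {0..T}" for t
    using tendsto_uniform_limitI[OF U that] tendsto_uniform_limitI[OF V that] by auto
  have UV: "U t = integral {0..t} V" if t: "t \<in> {0..T}" for t
  proof -
    have sub: "{0..t} \<subseteq> {0..T}" using t by auto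
    obtain I J where I: "\<And>n. (v n has_integral I n) {0..t}"
      and J: "(V has_integral J) {0..t}" and IJ: "(I \<longlongrightarrow> J) sequentially"
      using uniform_limit_integral[OF uniform_limit_on_subset[OF V sub] continuous_on_subset[OF vc sub]
          sequentially_bot] by metis
    have "I n = u n t" for n
    proof -
      have "(v n has_integral u n t - u n 0) {0..t}"
        by (rule fundamental_theorem_of_calculus)
          (use t has_vector_derivative_within_subset[OF du sub] sub in auto)
      moreover have "u n 0 = 0" using u by (simp add: approximate_solution_def)
      ultimately show ?thesis using I[of n] by (simp add: has_integral_unique)
    qed
    then have "I = (\<lambda>n. u n t)" by auto
    with IJ have "J = U t" using Ut(1)[OF t] LIMSEQ_unique by blast
    then show ?thesis using J by (simp add: integral_unique)
  qed
  show ?thesis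
  proof (rule that[of U V])
    show "U 0 = 0" using UV[of 0] T by simp
    show "continuous_on {0..T} V" by (rule Vc)
    fix t assume t: "t \<in> {0..T}"
    show "(U has_vector_derivative V t) (at t within {0..T})"
      using has_vector_derivative_transform[OF t _ integral_initial_deriv[OF Vc t]] UV by simp
    let ?y = "\<lambda>n. v n t - B (u n t) - F t"
    have y: "?y \<longlonglongrightarrow> V t - B (U t) - F t"
      by (intro tendsto_intros Ut t B.tendsto)
    have "(\<lambda>n. u n t + step n *\<^sub>R ?y n) \<longlonglongrightarrow> U t + 0 *\<^sub>R (V t - B (U t) - F t)"
      using LIMSEQ_inverse_real_of_nat
      by (intro tendsto_add tendsto_scaleR Ut t y) (simp add: inverse_eq_divide add.commute)
    then have "(\<lambda>n. (u n t + step n *\<^sub>R ?y n, ?y n)) \<longlonglongrightarrow> (U t, V t - B (U t) - F t)"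
      using y by (auto intro: tendsto_Pair)
    moreover have "(u n t + step n *\<^sub>R ?y n, ?y n) \<in> G" for n
    proof -
      have "?y n = yosida (step n) (u n t)" by (simp only: v_def) simp
      then show ?thesis using yosida_in[of "step n" "u n t"] by (simp only:) simp
    qed
    ultimately show "(U t, V t - B (U t) - F t) \<in> G"
      by (rule closed_sequentially[OF closed, rotated])
  qed
qed

text \<open>
  The hypothesis is the homogeneous equation integrated in time. The energy estimate applies to the
  primitive of \<open>U\<close>, which is differentiable even where \<open>U\<close> is not.
\<close>

theorem evolution_unique:
  assumes U: "continuous_on {0..T} U"
    and G: "\<And>t. t \<in> {0..T} \<Longrightarrow> (integral {0..t} U, U t - B (integral {0..t} U)) \<in> G"
    and t: "t \<in> {0..T}"
  shows "U t = 0"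
proof -
  let ?Y = "\<lambda>t. integral {0..t} U"
  have Y: "?Y s = 0" if s: "s \<in> {0..T}" for s
  proof -
    have "(norm (?Y s))\<^sup>2 \<le> exp ((2 * bound_B + 1) * T) * ((norm (?Y 0))\<^sup>2 + 0\<^sup>2 * T)"
    proof (rule energy_estimate[OF integral_initial_deriv[OF U] _ bound_B(1) _ s])
      fix r assume r: "r \<in> {0..T}"
      show "inner (U r) (?Y r) \<le> bound_B * (norm (?Y r))\<^sup>2 + 0 * norm (?Y r)"
        using dissipative[OF G[OF r]] inner_B_le[of "?Y r"]
        by (simp add: inner_diff_right inner_commute)
    qed auto
    then show ?thesis by simp
  qed
  have "(?Y has_vector_derivative U t) (at t within {0..T})" using integral_initial_deriv[OF U t] .
  then have "((\<lambda>_. 0) has_vector_derivative U t) (at t within {0..T})"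
    using has_vector_derivative_transform[OF t, of "\<lambda>_. 0" ?Y] Y by simp
  then show ?thesis
    using vector_derivative_unique_within_closed_interval[of 0 T t "\<lambda>_. 0" "U t" 0] T t by auto
qed

end

section \<open>The skew-adjoint relation of a closed operator\<close>

text \<open>
  If \<open>gr\<close> is the graph of an operator \<open>D\<close>, this is the graph of \<open>((u, p), m) \<mapsto> ((D\<^sup>* p, - D u), 0)\<close>,
  with the adjoint expressed by its defining identity. For the gradient, \<open>D\<^sup>* p\<close> is \<open>- div p\<close>. The
  third component collects the unknowns without spatial derivatives.
\<close>

definition skew_relation ::
  "('a::real_inner \<times> 'b::real_inner) set \<Rightarrow> ((('a \<times> 'b) \<times> 'c::real_inner) \<times> (('a \<times> 'b) \<times> 'c)) set" where
  "skew_relation gr = {(((u, p), m), ((v, w), n)). (u, - w) \<in> gr \<and> n = 0 \<and>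
     (\<forall>a b. (a, b) \<in> gr \<longrightarrow> inner v a = inner p b)}"

text \<open>
  The two off-diagonal blocks cancel in the inner product. For the range condition with right-hand
  side \<open>((f, g), m)\<close>, the equations \<open>u - l v = f\<close> and \<open>p + l b = g\<close> with \<open>(u, b) \<in> gr\<close> and \<open>v\<close>
  adjoint to \<open>p\<close> state that \<open>(f, g) - (u, l b)\<close> is orthogonal to all \<open>(a, l c)\<close> with
  \<open>(a, c) \<in> gr\<close>. So \<open>(u, l b)\<close> is an orthogonal projection.
\<close>

lemma skew_relation_maximal_dissipative:
  fixes gr :: "('a::{real_inner, banach} \<times> 'b::{real_inner, banach}) set"
  assumes sub: "subspace gr" and cl: "closed gr"
  shows "maximal_dissipative (skew_relation gr :: ((('a \<times> 'b) \<times> 'c::{real_inner, banach}) \<times> (('a \<times> 'b) \<times> 'c)) set)"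
    (is "maximal_dissipative ?G")
proof
  note subs = subspace_0[OF sub] subspace_add[OF sub] subspace_scale[OF sub]
  show "subspace ?G"
    unfolding subspace_def
  proof (intro conjI ballI allI)
    show "0 \<in> ?G" using subs(1) by (simp add: skew_relation_def zero_prod_def)
    fix x assume x: "x \<in> ?G"
    obtain u p m v w n where x': "x = (((u, p), m), ((v, w), n))" by (metis surj_pair)
    { fix y assume y: "y \<in> ?G"
      obtain u' p' m' v' w' n' where y': "y = (((u', p'), m'), ((v', w'), n'))" by (metis surj_pair)
      show "x + y \<in> ?G"
        using x y subs(2)[of "(u, - w)" "(u', - w')"]
        by (simp add: skew_relation_def x' y' inner_add_left add.commute)
    }
    fix c :: real
    show "c *\<^sub>R x \<in> ?G"
      using x subs(3)[of "(u, - w)" c] by (simp add: skew_relation_def x')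
  qed
  have "?G = (\<lambda>z. (fst (fst (fst z)), - snd (fst (snd z)))) -` gr \<inter> {z. snd (snd z) = 0} \<inter>
      (\<Inter>(a, b)\<in>gr. {z. inner (fst (fst (snd z))) a = inner (snd (fst (fst z))) b})"
    by (auto simp: skew_relation_def)
  moreover have "closed ((\<lambda>z::(('a \<times> 'b) \<times> 'c) \<times> (('a \<times> 'b) \<times> 'c). (fst (fst (fst z)), - snd (fst (snd z)))) -` gr)"
    by (rule closed_vimage[OF cl]) (intro continuous_intros)
  moreover have "closed {z::(('a \<times> 'b) \<times> 'c) \<times> (('a \<times> 'b) \<times> 'c). snd (snd z) = 0}"
    by (intro closed_Collect_eq continuous_intros)
  moreover have "closed (\<Inter>(a, b)\<in>gr. {z::(('a \<times> 'b) \<times> 'c) \<times> (('a \<times> 'b) \<times> 'c).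
      inner (fst (fst (snd z))) a = inner (snd (fst (fst z))) b})"
    by (auto intro!: closed_INT closed_Collect_eq continuous_intros)
  ultimately show "closed ?G" by (simp only: closed_Int)
  show "inner x y \<le> 0" if xy: "(x, y) \<in> ?G" for x y
  proof -
    obtain u p m v w n where "x = ((u, p), m)" "y = ((v, w), n)" by (metis surj_pair)
    then show ?thesis using xy by (auto simp: skew_relation_def inner_commute[of u v])
  qed
  show "\<exists>x y. (x, y) \<in> ?G \<and> x - l *\<^sub>R y = h" if l: "0 < l" for l h
  proof -
    obtain f g m where h: "h = ((f, g), m)" by (metis surj_pair)
    let ?M = "(\<lambda>z. (fst z, (1 / l) *\<^sub>R snd z)) -` gr"
    have M1: "subspace ?M"
      unfolding subspace_def
    proof (intro conjI ballI allI)
      show "0 \<in> ?M" using subs(1) by (simp add: zero_prod_def)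
      fix x y assume "x \<in> ?M" "y \<in> ?M"
      then show "x + y \<in> ?M" using subs(2)[of "(fst x, (1 / l) *\<^sub>R snd x)" "(fst y, (1 / l) *\<^sub>R snd y)"]
        by (simp add: scaleR_add_right)
    next
      fix c :: real and x assume "x \<in> ?M"
      then show "c *\<^sub>R x \<in> ?M" using subs(3)[of "(fst x, (1 / l) *\<^sub>R snd x)" c]
        by (simp add: mult.commute)
    qed
    have M2: "closed ?M" by (rule closed_vimage[OF cl]) (intro continuous_intros)
    obtain k where k: "k \<in> ?M" "\<And>y. y \<in> ?M \<Longrightarrow> inner ((f, g) - k) y = 0"
      by (rule closed_subspace_projection[OF M1 M2, of "(f, g)"]) blast
    define u b where "u = fst k" and "b = (1 / l) *\<^sub>R snd k"
    have kub: "k = (u, l *\<^sub>R b)" using l by (simp add: u_def b_def)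
    define p v where "p = g - l *\<^sub>R b" and "v = (1 / l) *\<^sub>R (u - f)"
    have ub: "(u, b) \<in> gr" using k(1) by (simp add: u_def b_def)
    have "inner v a = inner p c" if "(a, c) \<in> gr" for a c
    proof -
      have "inner (f - u) a + inner (g - l *\<^sub>R b) (l *\<^sub>R c) = 0"
        using k(2)[of "(a, l *\<^sub>R c)"] that l by (simp add: kub)
      then have "l * inner v a = l * inner p c"
        using l by (simp add: p_def v_def inner_diff_left algebra_simps)
      then show ?thesis using l by simp
    qed
    then have "(((u, p), m), ((v, - b), 0)) \<in> ?G" using ub by (simp add: skew_relation_def)
    moreover have "((u, p), m) - l *\<^sub>R ((v, - b), 0) = h" using l by (simp add: h p_def v_def)
    ultimately show ?thesis by blast
  qed
qed

section \<open>The Hilbert space of square-integrable functions\<close>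

definition sq_integrable :: "('a::euclidean_space \<Rightarrow> 'v::euclidean_space) \<Rightarrow> bool" where
  "sq_integrable f \<longleftrightarrow> f \<in> borel_measurable lebesgue \<and> integrable lebesgue (\<lambda>x. (norm (f x))\<^sup>2)"

lemma sq_integrable_bound:
  assumes "f \<in> borel_measurable lebesgue" "integrable lebesgue g"
    and "AE x in lebesgue. (norm (f x))\<^sup>2 \<le> g x"
  shows "sq_integrable f"
  unfolding sq_integrable_def
proof
  show "integrable lebesgue (\<lambda>x. (norm (f x))\<^sup>2)"
    by (rule Bochner_Integration.integrable_bound[OF assms(2)])
      (use assms in \<open>auto elim!: eventually_mono\<close>)
qed fact

lemma norm_add_sq_le: "(norm (a + b))\<^sup>2 \<le> 2 * (norm a)\<^sup>2 + 2 * (norm b)\<^sup>2"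
proof -
  have "(norm (a + b))\<^sup>2 \<le> (norm a + norm b)\<^sup>2" by (intro power_mono norm_triangle_ineq) simp
  also have "\<dots> \<le> 2 * (norm a)\<^sup>2 + 2 * (norm b)\<^sup>2"
    using sum_squares_bound[of "norm a" "norm b"] by (simp add: power2_sum)
  finally show ?thesis .
qed

lemma sq_integrable_0: "sq_integrable (\<lambda>_. 0)" by (simp add: sq_integrable_def)

lemma sq_integrable_add:
  assumes "sq_integrable f" "sq_integrable g"
  shows "sq_integrable (\<lambda>x. f x + g x)"
  by (rule sq_integrable_bound[where g = "\<lambda>x. 2 * (norm (f x))\<^sup>2 + 2 * (norm (g x))\<^sup>2"])
    (use assms norm_add_sq_le in \<open>auto simp: sq_integrable_def\<close>)

lemma sq_integrable_scale:
  assumes "sq_integrable f"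
  shows "sq_integrable (\<lambda>x. c *\<^sub>R f x)"
  using assms by (auto simp: sq_integrable_def power_mult_distrib)

lemma sq_integrable_uminus: "sq_integrable f \<Longrightarrow> sq_integrable (\<lambda>x. - f x)"
  using sq_integrable_scale[of f "-1"] by simp

lemma sq_integrable_diff: "sq_integrable f \<Longrightarrow> sq_integrable g \<Longrightarrow> sq_integrable (\<lambda>x. f x - g x)"
  using sq_integrable_add[OF _ sq_integrable_uminus] by fastforce

lemma sq_integrable_inner:
  assumes "sq_integrable f" "sq_integrable g"
  shows "integrable lebesgue (\<lambda>x. inner (f x) (g x))"
proof (rule Bochner_Integration.integrable_bound[where f = "\<lambda>x. (norm (f x))\<^sup>2 + (norm (g x))\<^sup>2"])
  show "AE x in lebesgue. norm (inner (f x) (g x)) \<le> norm ((norm (f x))\<^sup>2 + (norm (g x))\<^sup>2)"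
  proof (intro AE_I2)
    fix x
    have "\<bar>inner (f x) (g x)\<bar> \<le> norm (f x) * norm (g x)" by (rule Cauchy_Schwarz_ineq2)
    also have "\<dots> \<le> (norm (f x))\<^sup>2 + (norm (g x))\<^sup>2"
      using sum_squares_bound[of "norm (f x)" "norm (g x)"]
        mult_nonneg_nonneg[OF norm_ge_zero norm_ge_zero, of "f x" "g x"] by linarith
    finally show "norm (inner (f x) (g x)) \<le> norm ((norm (f x))\<^sup>2 + (norm (g x))\<^sup>2)" by simp
  qed
qed (use assms in \<open>auto simp: sq_integrable_def\<close>)

text \<open>
  One type serves all domains: a function on a subset is extended by zero.
\<close>

quotient_type (overloaded) ('a, 'v) l2 = "'a::euclidean_space \<Rightarrow> 'v::euclidean_space" / partial:
  "\<lambda>f g. sq_integrable f \<and> sq_integrable g \<and> (AE x in lebesgue. f x = g x)"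
proof (rule part_equivpI)
  show "\<exists>x::'a \<Rightarrow> 'v. sq_integrable x \<and> sq_integrable x \<and> (AE xa in lebesgue. x xa = x xa)"
    using sq_integrable_0 by auto
  show "symp (\<lambda>f g::'a \<Rightarrow> 'v. sq_integrable f \<and> sq_integrable g \<and> (AE x in lebesgue. f x = g x))"
    by (auto simp: symp_def elim: eventually_mono)
  show "transp (\<lambda>f g::'a \<Rightarrow> 'v. sq_integrable f \<and> sq_integrable g \<and> (AE x in lebesgue. f x = g x))"
    by (auto simp: transp_def elim: eventually_elim2)
qed

lemma sq_integrable_rep [simp]: "sq_integrable (rep_l2 f)"
  using Quotient3_rep_reflp[OF Quotient3_l2, of f] by blast

lemma abs_rep_l2 [simp]: "abs_l2 (rep_l2 f) = f"
  using Quotient3_abs_rep[OF Quotient3_l2] .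

lemma abs_l2_eq_iff:
  "sq_integrable f \<Longrightarrow> sq_integrable g \<Longrightarrow> abs_l2 f = abs_l2 g \<longleftrightarrow> (AE x in lebesgue. f x = g x)"
  using Quotient3_rel[OF Quotient3_l2, of f g] by auto

lemma rep_abs_l2: "sq_integrable f \<Longrightarrow> AE x in lebesgue. rep_l2 (abs_l2 f) x = f x"
  using abs_l2_eq_iff[of "rep_l2 (abs_l2 f)" f] by simp

instantiation l2 :: (euclidean_space, euclidean_space) real_vector
begin

lift_definition zero_l2 :: "('a, 'b) l2" is "\<lambda>_. 0" by (simp add: sq_integrable_0)
lift_definition plus_l2 :: "('a, 'b) l2 \<Rightarrow> ('a, 'b) l2 \<Rightarrow> ('a, 'b) l2" is "\<lambda>f g x. f x + g x"
  by (auto intro: sq_integrable_add elim: eventually_elim2)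
lift_definition uminus_l2 :: "('a, 'b) l2 \<Rightarrow> ('a, 'b) l2" is "\<lambda>f x. - f x"
  by (auto intro: sq_integrable_uminus elim: eventually_mono)
lift_definition minus_l2 :: "('a, 'b) l2 \<Rightarrow> ('a, 'b) l2 \<Rightarrow> ('a, 'b) l2" is "\<lambda>f g x. f x - g x"
  by (auto intro: sq_integrable_diff elim: eventually_elim2)
lift_definition scaleR_l2 :: "real \<Rightarrow> ('a, 'b) l2 \<Rightarrow> ('a, 'b) l2" is "\<lambda>c f x. c *\<^sub>R f x"
  by (auto intro: sq_integrable_scale elim: eventually_mono)

instance
  by (standard; transfer; simp add: sq_integrable_add sq_integrable_uminus sq_integrable_scale
      sq_integrable_diff sq_integrable_0 algebra_simps)

end

instantiation l2 :: (euclidean_space, euclidean_space) real_inner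
begin

lift_definition inner_l2 :: "('a, 'b) l2 \<Rightarrow> ('a, 'b) l2 \<Rightarrow> real" is
  "\<lambda>f g. \<integral>x. inner (f x) (g x) \<partial>lebesgue"
proof -
  fix f f' g g' :: "'a \<Rightarrow> 'b"
  assume "sq_integrable f \<and> sq_integrable f' \<and> (AE x in lebesgue. f x = f' x)"
    and "sq_integrable g \<and> sq_integrable g' \<and> (AE x in lebesgue. g x = g' x)"
  then show "(\<integral>x. inner (f x) (g x) \<partial>lebesgue) = (\<integral>x. inner (f' x) (g' x) \<partial>lebesgue)"
    by (intro integral_cong_AE borel_measurable_inner)
      (auto simp: sq_integrable_def elim: eventually_elim2)
qed

definition norm_l2 :: "('a, 'b) l2 \<Rightarrow> real" where "norm_l2 f = sqrt (inner f f)"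
definition dist_l2 :: "('a, 'b) l2 \<Rightarrow> ('a, 'b) l2 \<Rightarrow> real" where "dist_l2 f g = norm (f - g)"
definition sgn_l2 :: "('a, 'b) l2 \<Rightarrow> ('a, 'b) l2" where "sgn_l2 f = f /\<^sub>R norm f"
definition uniformity_l2 :: "(('a, 'b) l2 \<times> ('a, 'b) l2) filter" where
  "uniformity_l2 = (INF e\<in>{0 <..}. principal {(x, y). dist x y < e})"
definition open_l2 :: "('a, 'b) l2 set \<Rightarrow> bool" where
  "open_l2 S = (\<forall>x\<in>S. \<forall>\<^sub>F (x', y) in uniformity. x' = x \<longrightarrow> y \<in> S)"

instance
proof
  fix x y z :: "('a, 'b) l2" and r :: real and S :: "('a, 'b) l2 set"
  show "dist x y = norm (x - y)" by (simp add: dist_l2_def)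
  show "sgn x = x /\<^sub>R norm x" by (simp add: sgn_l2_def)
  show "uniformity = (INF e\<in>{0 <..}. principal {(x, y :: ('a, 'b) l2). dist x y < e})"
    by (rule uniformity_l2_def)
  show "open S = (\<forall>x\<in>S. \<forall>\<^sub>F (x', y) in uniformity. x' = x \<longrightarrow> y \<in> S)" by (rule open_l2_def)
  show "inner x y = inner y x" by transfer (simp add: inner_commute)
  show "inner (x + y) z = inner x z + inner y z"
    by transfer (simp add: inner_add_left sq_integrable_inner)
  show "inner (r *\<^sub>R x) y = r * inner x y" by transfer simp
  show "0 \<le> inner x x" by transfer simp
  show "(inner x x = 0) = (x = 0)"
  proof transfer
    fix f :: "'a \<Rightarrow> 'b"
    assume f: "sq_integrable f \<and> sq_integrable f \<and> (AE x in lebesgue. f x = f x)"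
    then have "(\<integral>x. inner (f x) (f x) \<partial>lebesgue) = 0 \<longleftrightarrow> (AE x in lebesgue. inner (f x) (f x) = 0)"
      by (intro integral_nonneg_eq_0_iff_AE) (auto intro: sq_integrable_inner)
    then show "((\<integral>x. inner (f x) (f x) \<partial>lebesgue) = 0) =
        (sq_integrable f \<and> sq_integrable (\<lambda>_. 0::'b) \<and> (AE x in lebesgue. f x = 0))"
      using f by (simp add: sq_integrable_0)
  qed
  show "norm x = sqrt (inner x x)" by (rule norm_l2_def)
qed

end

lemma inner_abs_l2:
  "sq_integrable f \<Longrightarrow> sq_integrable g \<Longrightarrow>
    inner (abs_l2 f) (abs_l2 g) = (\<integral>x. inner (f x) (g x) \<partial>lebesgue)"
  by (rule inner_l2.abs_eq) auto

lemma norm_abs_l2: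
  "sq_integrable f \<Longrightarrow> (norm (abs_l2 f))\<^sup>2 = (\<integral>x. (norm (f x))\<^sup>2 \<partial>lebesgue)"
  unfolding power2_norm_eq_inner by (simp add: inner_abs_l2)

lemma diff_abs_l2:
  "sq_integrable f \<Longrightarrow> sq_integrable g \<Longrightarrow> abs_l2 f - abs_l2 g = abs_l2 (\<lambda>x. f x - g x)"
  by (rule minus_l2.abs_eq) auto

lemma add_abs_l2:
  "sq_integrable f \<Longrightarrow> sq_integrable g \<Longrightarrow> abs_l2 f + abs_l2 g = abs_l2 (\<lambda>x. f x + g x)"
  by (rule plus_l2.abs_eq) auto

lemma scaleR_abs_l2: "sq_integrable f \<Longrightarrow> c *\<^sub>R abs_l2 f = abs_l2 (\<lambda>x. c *\<^sub>R f x)"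
  by (rule scaleR_l2.abs_eq) auto

lemma uminus_abs_l2: "sq_integrable f \<Longrightarrow> - abs_l2 f = abs_l2 (\<lambda>x. - f x)"
  by (rule uminus_l2.abs_eq) auto

lemma zero_abs_l2: "(0::('a::euclidean_space, 'v::euclidean_space) l2) = abs_l2 (\<lambda>_. 0)"
  by (rule zero_l2.abs_eq)

lemma nn_integral_abs_l2:
  assumes "sq_integrable f"
  shows "(\<integral>\<^sup>+x. ennreal ((norm (f x))\<^sup>2) \<partial>lebesgue) = ennreal ((norm (abs_l2 f))\<^sup>2)"
  using assms by (simp add: norm_abs_l2 nn_integral_eq_integral sq_integrable_def)

text \<open>
  The Riesz--Fischer theorem: a subsequence with consecutive distances below \<open>2\<^sup>-\<^sup>k\<close> converges almost
  everywhere, and Fatou's lemma identifies the pointwise limit as the limit in the mean.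
\<close>

instance l2 :: (euclidean_space, euclidean_space) banach
proof
  fix X :: "nat \<Rightarrow> ('a, 'b) l2" assume X: "Cauchy X"
  have "\<exists>r::nat \<Rightarrow> nat. \<forall>k. (\<forall>m\<ge>r k. \<forall>n\<ge>r k. norm (X m - X n) < (1/2) ^ k) \<and> r k < r (Suc k)"
  proof (rule dependent_nat_choice)
    show "\<exists>x. \<forall>m\<ge>x. \<forall>n\<ge>x. norm (X m - X n) < (1/2) ^ 0" using CauchyD[OF X, of 1] by simp
    fix x n
    obtain y where y: "\<forall>m\<ge>y. \<forall>k\<ge>y. norm (X m - X k) < (1/2) ^ Suc n"
      using CauchyD[OF X, of "(1/2) ^ Suc n"] by auto
    show "\<exists>y. (\<forall>m\<ge>y. \<forall>k\<ge>y. norm (X m - X k) < (1/2) ^ Suc n) \<and> x < y"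
      by (rule exI[of _ "max y (Suc x)"]) (use y in auto)
  qed
  then obtain r where r: "\<And>k m n. m \<ge> r k \<Longrightarrow> n \<ge> r k \<Longrightarrow> norm (X m - X n) < (1/2) ^ k"
    and rS: "\<And>k. r k < r (Suc k)" by metis
  have mono: "strict_mono r" using rS by (simp add: strict_mono_Suc_iff)
  define f where "f k = rep_l2 (X (r k))" for k
  have sf: "sq_integrable (f k)" for k by (simp add: f_def)
  have fm[measurable]: "f k \<in> borel_measurable lebesgue" for k using sf by (simp add: sq_integrable_def)
  have Xf: "X (r k) = abs_l2 (f k)" for k by (simp add: f_def)
  have close: "(\<integral>\<^sup>+x. ennreal ((norm (f m x - f k x))\<^sup>2) \<partial>lebesgue) \<le> ennreal (((1/2) ^ k)\<^sup>2)"
    if "k \<le> m" for k m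
  proof -
    have "r k \<le> r m" using mono that by (simp add: strict_mono_less_eq)
    then have "norm (X (r m) - X (r k)) \<le> (1/2) ^ k" using r[of k "r m" "r k"] by simp
    then have "(norm (X (r m) - X (r k)))\<^sup>2 \<le> ((1/2) ^ k)\<^sup>2" by (intro power_mono) auto
    then show ?thesis
      using nn_integral_abs_l2[OF sq_integrable_diff[OF sf sf]] diff_abs_l2[OF sf sf]
      by (simp add: Xf ennreal_leI)
  qed
  have "(\<integral>\<^sup>+x. (\<Sum>k. ennreal (2 ^ k) * ennreal ((norm (f (Suc k) x - f k x))\<^sup>2)) \<partial>lebesgue)
      = (\<Sum>k. \<integral>\<^sup>+x. ennreal (2 ^ k) * ennreal ((norm (f (Suc k) x - f k x))\<^sup>2) \<partial>lebesgue)"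
    by (rule nn_integral_suminf) measurable
  also have "\<dots> = (\<Sum>k. ennreal (2 ^ k) * (\<integral>\<^sup>+x. ennreal ((norm (f (Suc k) x - f k x))\<^sup>2) \<partial>lebesgue))"
    by (intro suminf_cong nn_integral_cmult) measurable
  also have "\<dots> \<le> (\<Sum>k. ennreal ((1/2) ^ k))"
  proof (rule suminf_le)
    fix k
    have "ennreal (2 ^ k) * (\<integral>\<^sup>+x. ennreal ((norm (f (Suc k) x - f k x))\<^sup>2) \<partial>lebesgue)
        \<le> ennreal (2 ^ k) * ennreal (((1/2) ^ k)\<^sup>2)"
      by (intro mult_left_mono close) auto
    also have "\<dots> = ennreal (2 ^ k * ((1/2) ^ k)\<^sup>2)" by (rule ennreal_mult[symmetric]) auto
    also have "2 ^ k * ((1/2) ^ k)\<^sup>2 = ((1/2)::real) ^ k"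
      by (simp add: power2_eq_square power_one_over field_simps)
    finally show "ennreal (2 ^ k) * (\<integral>\<^sup>+x. ennreal ((norm (f (Suc k) x - f k x))\<^sup>2) \<partial>lebesgue)
        \<le> ennreal ((1/2) ^ k)" .
  qed auto
  also have "\<dots> < \<infinity>"
    using suminf_ennreal_eq[OF _ power_half_series]  by (simp add: suminf_ennreal2 summable_geometric)
  finally have "AE x in lebesgue. (\<Sum>k. ennreal (2 ^ k) * ennreal ((norm (f (Suc k) x - f k x))\<^sup>2)) \<noteq> \<infinity>"
    by (intro nn_integral_PInf_AE) auto
  then have conv: "AE x in lebesgue. convergent (\<lambda>k. f k x)"
  proof eventually_elim
    case (elim x)
    let ?d = "\<lambda>k. f (Suc k) x - f k x"
    have "(\<Sum>k. ennreal (2 ^ k * (norm (?d k))\<^sup>2)) \<noteq> \<infinity>" using elim by (simp add: ennreal_mult)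
    then have s1: "summable (\<lambda>k. 2 ^ k * (norm (?d k))\<^sup>2)" by (intro summable_suminf_not_top) auto
    have "summable ?d"
    proof (rule summable_comparison_test[OF _ summable_add[OF s1 summable_geometric[of "1/2::real"]]])
      \<comment> \<open>Young's inequality with weight \<open>2 ^ n\<close>\<close>
      show "\<exists>N. \<forall>n\<ge>N. norm (?d n) \<le> 2 ^ n * (norm (?d n))\<^sup>2 + (1/2) ^ n"
      proof (intro exI allI impI)
        fix n
        define p where "p = (2::real) ^ n"
        have p: "0 < p" by (simp add: p_def)
        have "0 \<le> (p * norm (?d n) - 1 / 2)\<^sup>2" by simp
        then have "p * norm (?d n) \<le> p * (p * (norm (?d n))\<^sup>2 + 1 / p)"
          using p by (simp add: power2_diff power2_eq_square algebra_simps)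
        then have "norm (?d n) \<le> p * (norm (?d n))\<^sup>2 + 1 / p" using p by (simp only: mult_le_cancel_left_pos)
        then show "norm (?d n) \<le> 2 ^ n * (norm (?d n))\<^sup>2 + (1/2) ^ n" by (simp add: p_def power_one_over)
      qed
    qed auto
    then have "convergent (\<lambda>n. \<Sum>k<n. ?d k)" by (simp add: summable_iff_convergent)
    then have "convergent (\<lambda>n. (\<Sum>k<n. ?d k) + f 0 x)" by (intro convergent_add convergent_const)
    moreover have "(\<Sum>k<n. ?d k) + f 0 x = f n x" for n by (simp add: sum_lessThan_telescope[of "\<lambda>k. f k x"])
    ultimately show ?case by simp
  qed
  define g where "g x = lim (\<lambda>k. f k x)" for x
  have gm[measurable]: "g \<in> borel_measurable lebesgue"
    unfolding g_def by (rule borel_measurable_lim_metric) measurable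
  have fg: "AE x in lebesgue. (\<lambda>k. f k x) \<longlonglongrightarrow> g x"
    using conv by eventually_elim (simp add: g_def convergent_LIMSEQ_iff)
  have gk: "(\<integral>\<^sup>+x. ennreal ((norm (g x - f k x))\<^sup>2) \<partial>lebesgue) \<le> ennreal (((1/2) ^ k)\<^sup>2)" for k
  proof -
    have "(\<integral>\<^sup>+x. ennreal ((norm (g x - f k x))\<^sup>2) \<partial>lebesgue)
        = (\<integral>\<^sup>+x. liminf (\<lambda>m. ennreal ((norm (f m x - f k x))\<^sup>2)) \<partial>lebesgue)"
    proof (rule nn_integral_cong_AE)
      show "AE x in lebesgue. ennreal ((norm (g x - f k x))\<^sup>2) = liminf (\<lambda>m. ennreal ((norm (f m x - f k x))\<^sup>2))"
        using fg
      proof eventually_elim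
        case (elim x)
        have "(\<lambda>m. ennreal ((norm (f m x - f k x))\<^sup>2)) \<longlonglongrightarrow> ennreal ((norm (g x - f k x))\<^sup>2)"
          by (intro tendsto_ennrealI tendsto_intros elim)
        then show ?case by (rule lim_imp_Liminf[OF sequentially_bot, symmetric])
      qed
    qed
    also have "\<dots> \<le> liminf (\<lambda>m. \<integral>\<^sup>+x. ennreal ((norm (f m x - f k x))\<^sup>2) \<partial>lebesgue)"
      by (rule nn_integral_liminf) measurable
    also have "\<dots> \<le> ennreal (((1/2) ^ k)\<^sup>2)"
    proof (rule Liminf_le)
      show "\<forall>\<^sub>F m in sequentially. (\<integral>\<^sup>+x. ennreal ((norm (f m x - f k x))\<^sup>2) \<partial>lebesgue) \<le> ennreal (((1/2) ^ k)\<^sup>2)"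
        using eventually_ge_at_top[of k] by eventually_elim (rule close)
    qed auto
    finally show ?thesis .
  qed
  have sgf: "sq_integrable (\<lambda>x. g x - f k x)" for k
    unfolding sq_integrable_def
  proof
    show "integrable lebesgue (\<lambda>x. (norm (g x - f k x))\<^sup>2)"
    proof (rule integrableI_bounded)
      show "(\<integral>\<^sup>+x. ennreal (norm ((norm (g x - f k x))\<^sup>2)) \<partial>lebesgue) < \<infinity>"
        using order.strict_trans1[OF gk[of k] ennreal_less_top] by simp
    qed measurable
  qed measurable
  have sg: "sq_integrable g" using sq_integrable_add[OF sgf[of 0] sf[of 0]] by simp
  have le: "norm (X (r k) - abs_l2 g) \<le> (1/2) ^ k" for k
  proof -
    have "ennreal ((norm (abs_l2 g - X (r k)))\<^sup>2) \<le> ennreal (((1/2) ^ k)\<^sup>2)"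
      using gk[of k] nn_integral_abs_l2[OF sgf[of k]] by (simp add: Xf diff_abs_l2 sg sf)
    then have "(norm (abs_l2 g - X (r k)))\<^sup>2 \<le> ((1/2) ^ k)\<^sup>2" by (subst (asm) ennreal_le_iff) auto
    then have "norm (abs_l2 g - X (r k)) \<le> (1/2) ^ k" by (rule power2_le_imp_le) simp
    then show ?thesis by (simp add: norm_minus_commute)
  qed
  have "(\<lambda>k. X (r k) - abs_l2 g) \<longlonglongrightarrow> 0"
    by (rule Lim_null_comparison[where g = "\<lambda>k. (1/2) ^ k"])
      (use le in \<open>auto intro: LIMSEQ_realpow_zero\<close>)
  then have "(X \<circ> r) \<longlonglongrightarrow> abs_l2 g" by (simp add: LIM_zero_iff o_def)
  with X mono show "convergent X" using Cauchy_converges_subseq convergentI by blast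
qed

section \<open>Smooth test functions\<close>

text \<open>
  By uniqueness of derivatives, any known derivative serves in place of the one selected in the
  definition of \<open>Ck\<close>.
\<close>

lemma Ck_SucI:
  assumes "\<And>x. (f has_derivative f' x) (at x)" "\<And>b. b \<in> Basis \<Longrightarrow> Ck k (\<lambda>x. f' x b)"
  shows "Ck (Suc k) f"
proof -
  have "frechet_derivative f (at x) = f' x" for x
    using frechet_derivative_at[OF assms(1)[of x]] by simp
  then show ?thesis using assms by (auto simp: differentiable_def)
qed

lemma Ck_Suc_has_derivative:
  "Ck (Suc k) f \<Longrightarrow> (f has_derivative frechet_derivative f (at x)) (at x)"
  by (auto simp: frechet_derivative_works)

lemma Ck_SucD: "Ck (Suc k) f \<Longrightarrow> Ck k f"
proof (induction k arbitrary: f)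
  case 0
  then have "\<And>x. f differentiable (at x)" by simp
  then have "f differentiable_on UNIV" by (simp add: differentiable_on_def)
  then show ?case by (simp add: differentiable_imp_continuous_on)
next
  case (Suc k)
  then show ?case by (metis Ck.simps(2))
qed

lemma Ck_const: "Ck k (\<lambda>_. c)"
proof (induction k arbitrary: c)
  case (Suc k)
  show ?case by (rule Ck_SucI[where f' = "\<lambda>_ _. 0"]) (auto simp: Suc)
qed auto

lemma Ck_bounded_linear:
  assumes "bounded_linear f"
  shows "Ck k f"
proof (cases k)
  case 0
  then show ?thesis using assms by (simp add: linear_continuous_on)
next
  case (Suc k)
  show ?thesis unfolding Suc
    by (rule Ck_SucI[OF bounded_linear.has_derivative[OF assms has_derivative_ident]]) (rule Ck_const)
qed

lemma Ck_add: "Ck k f \<Longrightarrow> Ck k g \<Longrightarrow> Ck k (\<lambda>x. f x + g x)"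
proof (induction k arbitrary: f g)
  case (Suc k)
  show ?case
    by (rule Ck_SucI[OF has_derivative_add[OF Suc.prems[THEN Ck_Suc_has_derivative]]])
      (use Suc in simp)
qed (auto intro: continuous_intros)

lemma Ck_mult: "Ck k f \<Longrightarrow> Ck k g \<Longrightarrow> Ck k (\<lambda>x. f x * g x)"
proof (induction k arbitrary: f g)
  case (Suc k)
  show ?case
  proof (rule Ck_SucI[OF has_derivative_mult[OF Suc.prems[THEN Ck_Suc_has_derivative]]])
    fix b :: 'a assume "b \<in> Basis"
    then have "Ck k (\<lambda>x. frechet_derivative f (at x) b)" "Ck k (\<lambda>x. frechet_derivative g (at x) b)"
      using Suc.prems by auto
    then show "Ck k (\<lambda>x. f x * frechet_derivative g (at x) b + frechet_derivative f (at x) b * g x)"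
      using Suc.prems[THEN Ck_SucD] by (intro Ck_add Suc.IH) auto
  qed
qed (auto intro: continuous_intros)

lemma Ck_compose:
  fixes f :: "real \<Rightarrow> real" and g :: "'a::euclidean_space \<Rightarrow> real"
  shows "Ck k f \<Longrightarrow> Ck k g \<Longrightarrow> Ck k (\<lambda>x. f (g x))"
proof (induction k arbitrary: f g)
  case 0
  then show ?case by (auto intro: continuous_on_compose2)
next
  case (Suc k)
  show ?case
  proof (rule Ck_SucI[OF has_derivative_compose[OF Suc.prems(2)[THEN Ck_Suc_has_derivative]
          Suc.prems(1)[THEN Ck_Suc_has_derivative]]])
    fix b :: 'a assume b: "b \<in> Basis"
    have lin: "frechet_derivative f (at y) z = z * frechet_derivative f (at y) 1" for y z
      using linear_scale[OF has_derivative_linear[OF Suc.prems(1)[THEN Ck_Suc_has_derivative]], of y z 1]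
      by simp
    have "Ck k (\<lambda>x. frechet_derivative g (at x) b * frechet_derivative f (at (g x)) 1)"
      using Suc.prems b Suc.prems[THEN Ck_SucD]
      by (intro Ck_mult Suc.IH[where f = "\<lambda>y. frechet_derivative f (at y) 1"]) auto
    then show "Ck k (\<lambda>x. frechet_derivative f (at (g x)) (frechet_derivative g (at x) b))"
      by (subst lin)
  qed
qed

lemma Ck_cmult: "Ck k f \<Longrightarrow> Ck k (\<lambda>x. c * f x)" by (intro Ck_mult Ck_const)

lemma Ck_diff: "Ck k f \<Longrightarrow> Ck k g \<Longrightarrow> Ck k (\<lambda>x. f x - g x)"
  using Ck_add[OF _ Ck_cmult[of k g "-1"]] by simp

lemma Ck_prod: "finite I \<Longrightarrow> (\<And>i. i \<in> I \<Longrightarrow> Ck k (f i)) \<Longrightarrow> Ck k (\<lambda>x. \<Prod>i\<in>I. f i x)"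
  by (induction rule: finite_induct) (auto intro: Ck_const Ck_mult)

lemma Ck_SucI_real:
  fixes f :: "real \<Rightarrow> real"
  assumes "\<And>x. (f has_real_derivative f' x) (at x)" "Ck k f'"
  shows "Ck (Suc k) f"
  by (rule Ck_SucI[OF assms(1)[unfolded has_field_derivative_def]]) (use assms(2) in simp)

lemma Ck_Suc_real:
  fixes f :: "real \<Rightarrow> real"
  assumes "Ck (Suc k) f"
  shows "(f has_real_derivative deriv f x) (at x)" "Ck k (deriv f)"
proof -
  have d: "(f has_real_derivative deriv f x) (at x)" for x
    using assms by (simp add: DERIV_deriv_iff_real_differentiable)
  then show "(f has_real_derivative deriv f x) (at x)" .
  have "frechet_derivative f (at x) = (\<lambda>h. deriv f x * h)" for x
    using frechet_derivative_at[OF d[of x, unfolded has_field_derivative_def]] by (simp add: mult.commute)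
  then show "Ck k (deriv f)" using assms by simp
qed

lemma Ck_exp: "Ck k (exp :: real \<Rightarrow> real)"
proof (induction k)
  case (Suc k)
  then show ?case by (rule Ck_SucI_real[OF DERIV_exp])
qed (auto intro: continuous_intros)

text \<open>The standard flat function \<open>exp (- 1 / x)\<close> and its quotients by powers of \<open>x\<close>: their linear span is
  closed under differentiation, so smoothness follows by induction over all of them at once.\<close>

definition flat_exp :: "nat \<Rightarrow> real \<Rightarrow> real" where
  "flat_exp n x = (if x > 0 then exp (- inverse x) * inverse x ^ n else 0)"

lemma flat_exp_tendsto_0: "(flat_exp n \<longlongrightarrow> 0) (at 0)"
proof -
  have "((\<lambda>x::real. inverse x ^ n / exp (inverse x)) \<longlongrightarrow> 0) (at_right 0)"
    using filterlim_compose[OF tendsto_power_div_exp_0 filterlim_inverse_at_top_right] .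
  moreover have "\<forall>\<^sub>F x in at_right 0. inverse x ^ n / exp (inverse x) = flat_exp n x"
    by (auto simp: eventually_at_filter flat_exp_def exp_minus field_simps)
  ultimately have "(flat_exp n \<longlongrightarrow> 0) (at_right 0)" by (rule Lim_transform_eventually)
  moreover have "(flat_exp n \<longlongrightarrow> 0) (at_left 0)"
    by (rule tendsto_eventually) (auto simp: eventually_at_filter flat_exp_def)
  ultimately show ?thesis by (simp add: filterlim_split_at)
qed

lemma flat_exp_deriv:
  "(flat_exp n has_real_derivative flat_exp (n + 2) x - real n * flat_exp (n + 1) x) (at x)"
proof -
  consider "x > 0" | "x < 0" | "x = 0" by linarith
  then show ?thesis
  proof cases
    case 1
    have "((\<lambda>x. exp (- inverse x) * inverse x ^ n) has_real_derivative
        flat_exp (n + 2) x - real n * flat_exp (n + 1) x) (at x)"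
    proof -
      have "((\<lambda>x. exp (- inverse x) * inverse x ^ n) has_real_derivative
          (exp (- inverse x) * - (- (inverse x ^ Suc (Suc 0)))) * inverse x ^ n +
          (real n * (- (inverse x ^ Suc (Suc 0)) * inverse x ^ (n - 1))) * exp (- inverse x)) (at x)"
        using 1 by (auto intro!: derivative_eq_intros)
      then show ?thesis using 1 by (cases n) (simp_all add: flat_exp_def algebra_simps)
    qed
    then show ?thesis
      by (rule has_field_derivative_transform_within_open[of _ _ _ "{0<..}"]) (use 1 in \<open>auto simp: flat_exp_def\<close>)
  next
    case 2
    have "((\<lambda>_. 0) has_real_derivative 0) (at x)" by simp
    then have "(flat_exp n has_real_derivative 0) (at x)"
      by (rule has_field_derivative_transform_within_open[of _ _ _ "{..<0}"]) (use 2 in \<open>auto simp: flat_exp_def\<close>)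
    then show ?thesis using 2 by (simp add: flat_exp_def)
  next
    case 3
    have "((\<lambda>h. (flat_exp n (0 + h) - flat_exp n 0) / h) \<longlongrightarrow> 0) (at 0)"
    proof (rule Lim_transform_eventually[OF flat_exp_tendsto_0[of "Suc n"]])
      show "\<forall>\<^sub>F h in at 0. flat_exp (Suc n) h = (flat_exp n (0 + h) - flat_exp n 0) / h"
        by (auto simp: eventually_at_filter flat_exp_def divide_inverse)
    qed
    then show ?thesis using 3 by (simp add: DERIV_def flat_exp_def)
  qed
qed

lemma Ck_flat_exp: "Ck k (flat_exp n)"
proof (induction k arbitrary: n)
  case 0
  show ?case using flat_exp_deriv[of n] by (auto intro!: continuous_at_imp_continuous_on DERIV_isCont)
next
  case (Suc k)
  show ?case by (rule Ck_SucI_real[OF flat_exp_deriv]) (intro Ck_diff Ck_cmult Suc)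
qed

definition box_bump :: "'a::euclidean_space \<Rightarrow> 'a \<Rightarrow> 'a \<Rightarrow> real" where
  "box_bump a b x = (\<Prod>i\<in>Basis. flat_exp 0 (x \<bullet> i - a \<bullet> i) * flat_exp 0 (b \<bullet> i - x \<bullet> i))"

lemma flat_exp_pos_iff: "0 < flat_exp 0 x \<longleftrightarrow> 0 < x" "0 \<le> flat_exp 0 x" "flat_exp 0 x = 0 \<longleftrightarrow> x \<le> 0"
  by (auto simp: flat_exp_def)

lemma box_bump_pos: "x \<in> box a b \<Longrightarrow> 0 < box_bump a b x"
  unfolding box_bump_def by (intro prod_pos) (auto simp: mem_box flat_exp_pos_iff)

lemma box_bump_zero: "x \<notin> box a b \<Longrightarrow> box_bump a b x = 0"
  unfolding box_bump_def by (fastforce simp: mem_box flat_exp_pos_iff not_less)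

lemma box_bump_nonneg: "0 \<le> box_bump a b x"
  using box_bump_pos[of x a b] box_bump_zero[of x a b] by force

lemma Ck_box_bump: "Ck k (box_bump a b)"
  unfolding box_bump_def[abs_def]
  by (intro Ck_prod Ck_mult Ck_compose[OF Ck_flat_exp] Ck_diff Ck_const Ck_bounded_linear
      bounded_linear_inner_left) auto

lemma test_fun_of_box:
  assumes "\<And>k. Ck k \<phi>" "\<And>x. x \<notin> box a b \<Longrightarrow> \<phi> x = 0" "cbox a b \<subseteq> S"
  shows "test_fun S \<phi>"
proof -
  have "supp \<phi> \<subseteq> cbox a b"
    unfolding supp_def by (rule closure_minimal) (use assms(2) box_subset_cbox in auto)
  moreover have "closed (supp \<phi>)" by (simp add: supp_def)
  ultimately show ?thesis
    using assms compact_Int_closed[OF compact_cbox, of "supp \<phi>" a b]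
    by (auto simp: test_fun_def smooth_def Int_absorb1)
qed

lemma test_funD:
  assumes "test_fun S \<phi>"
  shows "Ck k \<phi>" "compact (supp \<phi>)" "supp \<phi> \<subseteq> S" "x \<notin> S \<Longrightarrow> \<phi> x = 0" "continuous_on X \<phi>" "\<phi> \<in> borel_measurable borel"
proof -
  show "Ck k \<phi>" for k using assms by (simp add: test_fun_def smooth_def)
  then have c: "continuous_on UNIV \<phi>" using Ck.simps(1) by blast
  then show "continuous_on X \<phi>" using continuous_on_subset by blast
  show "\<phi> \<in> borel_measurable borel" using c by (rule borel_measurable_continuous_onI)
  show "compact (supp \<phi>)" "supp \<phi> \<subseteq> S" using assms by (auto simp: test_fun_def)
  then show "x \<notin> S \<Longrightarrow> \<phi> x = 0" using closure_subset[of "{x. \<phi> x \<noteq> 0}"] by (auto simp: supp_def)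
qed

lemma continuous_bounded_of_supp:
  fixes \<phi> :: "'a::euclidean_space \<Rightarrow> 'b::real_normed_vector"
  assumes "continuous_on UNIV \<phi>" "compact K" "\<And>x. x \<notin> K \<Longrightarrow> \<phi> x = 0"
  obtains M where "\<And>x. norm (\<phi> x) \<le> M"
proof -
  have "bounded (\<phi> ` K)"
    using assms by (intro compact_imp_bounded compact_continuous_image) (auto intro: continuous_on_subset)
  then obtain M where M: "\<forall>x\<in>K. norm (\<phi> x) \<le> M" unfolding bounded_iff by auto
  show ?thesis by (rule that[of "max M 0"]) (use M assms(3) in \<open>metis max.coboundedI1 max.coboundedI2 norm_zero order_refl\<close>)
qed

text \<open>The functions \<open>1 - exp (- n b)\<close>, with \<open>b\<close> the bump of the box, which is positive exactly inside,
  are bounded by \<open>1\<close> and increase to the indicator of the box.\<close>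

lemma integral_box_eq_0_of_test_funs:
  fixes g :: "'a::euclidean_space \<Rightarrow> real"
  assumes g: "integrable lebesgue (\<lambda>x. indicator (cbox a b) x * g x)"
    and test: "\<And>\<phi>. test_fun S \<phi> \<Longrightarrow> (\<integral>x. \<phi> x * g x \<partial>lebesgue) = 0"
    and sub: "cbox a b \<subseteq> S"
  shows "(\<integral>x. indicator (box a b) x * g x \<partial>lebesgue) = 0"
proof -
  define \<phi> where "\<phi> n x = 1 - exp (- (real n * box_bump a b x))" for n x
  have Ckphi: "Ck k (\<phi> n)" for n k
    unfolding \<phi>_def[abs_def]
    using Ck_cmult[OF Ck_cmult[OF Ck_box_bump], of k "-1" "real n" a b]
    by (intro Ck_diff Ck_const Ck_compose[OF Ck_exp]) auto
  have z: "x \<notin> box a b \<Longrightarrow> \<phi> n x = 0" for n x by (simp add: \<phi>_def box_bump_zero)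
  have b1: "\<bar>\<phi> n x\<bar> \<le> indicator (box a b) x" for n x
    using box_bump_nonneg[of a b x] z[of x n] by (auto simp: \<phi>_def indicator_def)
  have gm: "(\<lambda>x. indicator (box a b) x * g x) \<in> borel_measurable lebesgue"
  proof -
    have "(\<lambda>x. indicator (box a b) x * (indicator (cbox a b) x * g x)) \<in> borel_measurable lebesgue"
      by (intro borel_measurable_times[OF borel_measurable_indicator borel_measurable_integrable[OF g]]) simp
    moreover have "indicator (box a b) x * (indicator (cbox a b) x * g x) = indicator (box a b) x * g x" for x
      using box_subset_cbox[of a b] by (auto simp: indicator_def)
    ultimately show ?thesis by simp
  qed
  have pm: "\<phi> n \<in> borel_measurable borel" for n
    using Ckphi[of 0 n] by (intro borel_measurable_continuous_onI) simp
  have "(\<lambda>n. \<integral>x. \<phi> n x * g x \<partial>lebesgue) \<longlonglongrightarrow> (\<integral>x. indicator (box a b) x * g x \<partial>lebesgue)"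
  proof (rule integral_dominated_convergence[where w = "\<lambda>x. norm (indicator (cbox a b) x * g x)"])
    fix n
    have "(\<lambda>x. \<phi> n x * (indicator (box a b) x * g x)) \<in> borel_measurable lebesgue"
      using pm[of n] by (intro borel_measurable_times[OF _ gm] measurable_completion) simp
    moreover have "\<phi> n x * (indicator (box a b) x * g x) = \<phi> n x * g x" for x
      using z[of x n] by (auto simp: indicator_def)
    ultimately show "(\<lambda>x. \<phi> n x * g x) \<in> borel_measurable lebesgue" by simp
    show "AE x in lebesgue. norm (\<phi> n x * g x) \<le> norm (indicator (cbox a b) x * g x)"
    proof (intro AE_I2)
      fix x
      have "\<bar>\<phi> n x\<bar> \<le> indicator (cbox a b) x"
        using b1[of n x] box_subset_cbox[of a b] by (cases "x \<in> box a b") (auto simp: z)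
      then show "norm (\<phi> n x * g x) \<le> norm (indicator (cbox a b) x * g x)"
        by (simp add: abs_mult mult_right_mono)
    qed
  next
    show "AE x in lebesgue. (\<lambda>n. \<phi> n x * g x) \<longlonglongrightarrow> indicator (box a b) x * g x"
    proof (intro AE_I2 tendsto_mult tendsto_const)
      fix x
      show "(\<lambda>n. \<phi> n x) \<longlonglongrightarrow> indicator (box a b) x"
      proof (cases "x \<in> box a b")
        case True
        have "filterlim (\<lambda>n. box_bump a b x * real n) at_top sequentially"
          by (rule filterlim_tendsto_pos_mult_at_top[OF tendsto_const box_bump_pos[OF True] filterlim_real_sequentially])
        then have "(\<lambda>n. exp (- (box_bump a b x * real n))) \<longlonglongrightarrow> 0"
          by (intro filterlim_compose[OF exp_at_bot] filterlim_compose[OF filterlim_uminus_at_bot_at_top])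
        then have "(\<lambda>n. 1 - exp (- (box_bump a b x * real n))) \<longlonglongrightarrow> 1 - 0" by (intro tendsto_intros)
        then show ?thesis using True by (simp add: \<phi>_def mult.commute)
      qed (simp add: z)
    qed
  qed (use g gm in auto)
  moreover have "(\<integral>x. \<phi> n x * g x \<partial>lebesgue) = 0" for n
    by (rule test, rule test_fun_of_box[OF Ckphi z sub])
  ultimately show ?thesis by (simp add: LIMSEQ_const_iff)
qed

text \<open>
  Boxes form an intersection-stable generator of the Borel sets, so all set integrals of \<open>g\<close> vanish.
  Set integrals are handled for a Borel function that agrees with \<open>g\<close> almost everywhere.
\<close>

lemma AE_eq_0_of_box_integrals:
  fixes g :: "'a::euclidean_space \<Rightarrow> real"
  assumes g: "integrable lebesgue g" and z: "\<And>x. x \<notin> box a b \<Longrightarrow> g x = 0"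
    and box: "\<And>c d. (\<integral>x. indicator (box c d) x * g x \<partial>lebesgue) = 0"
  shows "AE x in lebesgue. g x = 0"
proof -
  obtain h where hm: "h \<in> borel_measurable lborel" and gh: "AE x in lborel. g x = h x"
    using completion_ex_borel_measurable_real[of g lborel] g by auto
  have gh': "AE x in lebesgue. g x = h x" using gh by (rule AE_completion)
  have "integrable lebesgue h"
    by (rule integrable_cong_AE_imp[OF g measurable_completion[OF hm]]) (use gh' in auto)
  then have hi: "integrable lborel h" using integrable_completion[OF hm] by simp
  have eq: "(LINT x:A|lborel. h x) = (\<integral>x. indicator A x * g x \<partial>lebesgue)" if A: "A \<in> sets borel" for A
  proof -
    have m: "(\<lambda>x. indicator A x * h x) \<in> borel_measurable lborel" using A hm by measurable
    have "(\<integral>x. indicator A x * g x \<partial>lebesgue) = (\<integral>x. indicator A x * h x \<partial>lebesgue)"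
    proof (rule integral_cong_AE)
      show "(\<lambda>x. indicator A x * g x) \<in> borel_measurable lebesgue"
        using A by (intro borel_measurable_times borel_measurable_indicator borel_measurable_integrable[OF g])
          (simp add: sets_completionI_sets)
    qed (use gh' measurable_completion[OF m] in \<open>auto elim!: eventually_mono\<close>)
    also have "\<dots> = (\<integral>x. indicator A x * h x \<partial>lborel)" using m by (rule integral_completion)
    finally show ?thesis by (simp add: set_lebesgue_integral_def)
  qed
  have si: "set_integrable lborel A h" if "A \<in> sets borel" for A
    unfolding set_integrable_def using hi that by (intro integrable_mult_indicator) auto
  have all: "(LINT x:A|lborel. h x) = 0" if "A \<in> sigma_sets UNIV (range (\<lambda>(a, b). box a b))" for A
  proof (rule sigma_sets_induct_disjoint[OF _ _ that])
    show "Int_stable (range (\<lambda>(a, b). box a b :: 'a set))"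
      by (auto simp: Int_stable_def box_Int_box)
    show "(LINT x:{}|lborel. h x) = 0" by (simp add: set_lebesgue_integral_def)
    show "(LINT x:A|lborel. h x) = 0" if "A \<in> range (\<lambda>(a, b). box a b)" for A
      using that eq box by auto
    have U: "(LINT x:UNIV|lborel. h x) = 0"
    proof -
      have "indicator UNIV x * g x = indicator (box a b) x * g x" for x using z[of x] by (auto simp: indicator_def)
      then show ?thesis using eq[of UNIV] box[of a b] by (simp only:) simp
    qed
    fix A assume "A \<in> sigma_sets UNIV (range (\<lambda>(a, b). box a b :: 'a set))" and A0: "(LINT x:A|lborel. h x) = 0"
    then have A: "A \<in> sets borel" by (subst borel_eq_box) simp
    have "(LINT x:A \<union> (UNIV - A)|lborel. h x) = (LINT x:A|lborel. h x) + (LINT x:UNIV - A|lborel. h x)"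
      using A by (intro set_integral_Un si) auto
    then show "(LINT x:UNIV - A|lborel. h x) = 0" using U A0 by simp
  next
    fix A :: "nat \<Rightarrow> 'a set"
    assume dj: "disjoint_family A" and "range A \<subseteq> sigma_sets UNIV (range (\<lambda>(a, b). box a b :: 'a set))"
      and A0: "\<And>i. (LINT x:A i|lborel. h x) = 0"
    then have A: "A i \<in> sets borel" for i by (subst borel_eq_box) (auto simp: subset_eq)
    have "(LINT x:(\<Union>i. A i)|lborel. h x) = (\<Sum>i. (LINT x:A i|lborel. h x))"
      by (rule lebesgue_integral_countable_add) (use A dj si in \<open>auto simp: disjoint_family_on_def\<close>)
    then show "(LINT x:(\<Union>i. A i)|lborel. h x) = 0" by (simp add: A0)
  qed auto
  have "AE x in lborel. h x = 0"
  proof (rule sigma_finite_measure.density_zero[OF lborel.sigma_finite_measure_axioms hi])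
    fix A :: "'a set" assume "A \<in> sets lborel"
    then have "A \<in> sets borel" by simp
    then have "A \<in> sigma_sets UNIV (range (\<lambda>(a, b). box a b))" by (subst (asm) borel_eq_box) simp
    then show "(LINT x:A|lborel. h x) = 0" by (rule all)
  qed
  with gh have "AE x in lborel. g x = 0" by eventually_elim simp
  then show ?thesis by (rule AE_completion)
qed

text \<open>
  Local integrability suffices because an open set is a countable union of closed boxes, and on each
  of them the integrals over subboxes vanish.
\<close>

theorem fundamental_lemma_variations:
  fixes g :: "'a::euclidean_space \<Rightarrow> real"
  assumes S: "open S"
    and g: "\<And>a b. cbox a b \<subseteq> S \<Longrightarrow> integrable lebesgue (\<lambda>x. indicator (cbox a b) x * g x)"
    and test: "\<And>\<phi>. test_fun S \<phi> \<Longrightarrow> (\<integral>x. \<phi> x * g x \<partial>lebesgue) = 0"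
  shows "AE x in lebesgue_on S. g x = 0"
proof -
  obtain D where D: "countable D" "D \<subseteq> Pow S" "\<And>X. X \<in> D \<Longrightarrow> \<exists>a b. X = cbox a b" "\<Union>D = S"
    using open_countable_Union_open_cbox[OF S] by metis
  have local: "AE x in lebesgue. x \<in> X \<longrightarrow> g x = 0" if X: "X \<in> D" for X
  proof -
    obtain a b where ab: "X = cbox a b" using D(3)[OF X] by blast
    have sub: "cbox a b \<subseteq> S" using D(2) X ab by blast
    have m: "integrable lebesgue (\<lambda>x. indicator (box a b) x * (indicator (cbox a b) x * g x))"
      using integrable_mult_indicator[OF _ g[OF sub], of "box a b"] by simp
    have eq: "indicator (box c d) x * (indicator (cbox a b) x * g x) = indicator (box c d) x * g x"
      if "box c d \<subseteq> cbox a b" for x c d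
      using that by (auto simp: indicator_def)
    have "AE x in lebesgue. indicator (box a b) x * g x = 0"
    proof (rule AE_eq_0_of_box_integrals[of _ a b])
      show "integrable lebesgue (\<lambda>x. indicator (box a b) x * g x)"
        using m eq[OF box_subset_cbox] by simp
      fix c d
      obtain u v where uv: "box c d \<inter> box a b = box u v" unfolding box_Int_box by blast
      show "(\<integral>x. indicator (box c d) x * (indicator (box a b) x * g x) \<partial>lebesgue) = 0"
      proof (cases "box u v = {}")
        case True
        then have "indicator (box c d) x * (indicator (box a b) x * g x) = 0" for x
          using uv by (auto simp: indicator_def)
        then have "(\<lambda>x. indicator (box c d) x * (indicator (box a b) x * g x)) = (\<lambda>_. 0)" by (rule ext)
        then show ?thesis by (simp only: Bochner_Integration.integral_zero)
      next
        case False
        have "box u v \<subseteq> cbox a b" using uv box_subset_cbox by blast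
        then have uvc: "cbox u v \<subseteq> cbox a b"
          using False by (metis closed_cbox closure_box closure_minimal)
        have "integrable lebesgue (\<lambda>x. indicator (cbox u v) x * g x)" using g uvc sub by blast
        from integral_box_eq_0_of_test_funs[OF this test] uvc sub
        have "(\<integral>x. indicator (box u v) x * g x \<partial>lebesgue) = 0" by blast
        moreover have "indicator (box c d) x * (indicator (box a b) x * g x) = indicator (box u v) x * g x" for x
          unfolding uv[symmetric] by (auto simp: indicator_def)
        ultimately show ?thesis by (simp only:)
      qed
    qed simp
    moreover have "AE x in lebesgue. x \<notin> cbox a b - box a b"
      using negligible_frontier_interval[of a b] unfolding negligible_iff_null_sets by (rule AE_not_in)
    ultimately show ?thesis unfolding ab by eventually_elim (auto simp: indicator_def)
  qed
  have "AE x in lebesgue. \<forall>X\<in>D. x \<in> X \<longrightarrow> g x = 0"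
    by (rule AE_ball_countable[OF D(1), THEN iffD2]) (use local in blast)
  then have "AE x in lebesgue. x \<in> S \<longrightarrow> g x = 0" by eventually_elim (use D(4) in auto)
  then show ?thesis using S by (simp add: AE_restrict_space_iff borel_open sets_completionI_sets)
qed

section \<open>Integration by parts\<close>

lemma derivative_eq_0_outside_supp:
  assumes "x \<notin> supp f"
  shows "frechet_derivative f (at x) = (\<lambda>_. 0)" "f x = 0"
proof -
  have o: "open (- supp f)" by (simp add: supp_def open_Compl)
  have z: "f y = 0" if "y \<in> - supp f" for y
    using that closure_subset[of "{x. f x \<noteq> 0}"] by (auto simp: supp_def)
  then show "f x = 0" using assms by blast
  have "((\<lambda>_. 0) has_derivative (\<lambda>_. 0)) (at x)" by simp
  then have "(f has_derivative (\<lambda>_. 0)) (at x)"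
    by (rule has_derivative_transform_within_open[OF _ o]) (use assms z in auto)
  then show "frechet_derivative f (at x) = (\<lambda>_. 0)" using frechet_derivative_at by metis
qed

lemma integral_lborel_translation:
  fixes f :: "'a::euclidean_space \<Rightarrow> real"
  assumes "f \<in> borel_measurable borel"
  shows "(\<integral>x. f (c + x) \<partial>lborel) = (\<integral>x. f x \<partial>lborel)"
proof -
  have "(\<integral>x. f x \<partial>lborel) = (\<integral>x. f x \<partial>distr lborel borel ((+) c))" by (simp add: lborel_distr_plus)
  also have "\<dots> = (\<integral>x. f (c + x) \<partial>lborel)" using assms by (intro integral_distr) auto
  finally show ?thesis by simp
qed

lemma integrable_continuous_compact_support:
  fixes f :: "'a::euclidean_space \<Rightarrow> 'b::euclidean_space"
  assumes "continuous_on UNIV f" "compact K" "\<And>x. x \<notin> K \<Longrightarrow> f x = 0"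
  shows "integrable lborel f"
proof -
  have "integrable lborel (\<lambda>x. indicator K x *\<^sub>R f x)"
    using assms by (intro borel_integrable_compact) (auto intro: continuous_on_subset)
  moreover have "indicator K x *\<^sub>R f x = f x" for x using assms(3)[of x] by (auto simp: indicator_def)
  ultimately show ?thesis by simp
qed

text \<open>Translation invariance makes the difference quotients integrate to zero, and they converge
  boundedly on a fixed compact set.\<close>

lemma integral_derivative_compact_support:
  fixes f :: "'a::euclidean_space \<Rightarrow> real"
  assumes f: "Ck 1 f" and cpt: "compact (supp f)" and b: "b \<in> Basis"
  shows "(\<integral>x. frechet_derivative f (at x) b \<partial>lborel) = 0"
proof -
  define D where "D x = frechet_derivative f (at x) b" for x
  have fc: "continuous_on UNIV f" using Ck_SucD[of 0 f] f by simp
  have Dc: "continuous_on UNIV D" using f b by (simp add: D_def[abs_def])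
  have D0: "x \<notin> supp f \<Longrightarrow> D x = 0" for x by (simp add: D_def derivative_eq_0_outside_supp)
  obtain M where M: "\<And>x. norm (D x) \<le> M" using continuous_bounded_of_supp[OF Dc cpt D0] by blast
  have hd: "(f has_derivative frechet_derivative f (at x)) (at x)" for x
    using f Ck_Suc_has_derivative[of 0 f x] by simp
  have line: "((\<lambda>s. f (x + s *\<^sub>R b)) has_real_derivative D (x + s *\<^sub>R b)) (at s)" for x s
  proof -
    have "((\<lambda>s. x + s *\<^sub>R b) has_derivative (\<lambda>h. h *\<^sub>R b)) (at s)" by (auto intro!: derivative_eq_intros)
    from has_derivative_compose[OF this hd]
    show ?thesis
      unfolding has_field_derivative_def D_def
      by (rule has_derivative_eq_rhs) (simp add: fun_eq_iff linear_scale[OF has_derivative_linear[OF hd]])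
  qed
  define q where "q n x = (f (x + inverse (real (Suc n)) *\<^sub>R b) - f x) / inverse (real (Suc n))" for n x
  define K where "K = (\<lambda>z. fst z - snd z *\<^sub>R b) ` (supp f \<times> {0..1})"
  have K: "compact K"
    unfolding K_def by (intro compact_continuous_image compact_Times cpt continuous_intros) auto
  have qK: "norm (q n x) \<le> M * indicator K x" for n x
  proof -
    define h where "h = inverse (real (Suc n))"
    have h: "0 < h" "h \<le> 1" by (auto simp: h_def field_simps)
    obtain \<xi> where \<xi>: "0 < \<xi>" "\<xi> < h" "f (x + h *\<^sub>R b) - f (x + 0 *\<^sub>R b) = (h - 0) * D (x + \<xi> *\<^sub>R b)"
      using MVT2[OF h(1), of "\<lambda>s. f (x + s *\<^sub>R b)" "\<lambda>s. D (x + s *\<^sub>R b)"] line by metis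
    then have q: "q n x = D (x + \<xi> *\<^sub>R b)"
      unfolding q_def h_def[symmetric] using h by simp
    show ?thesis
    proof (cases "x + \<xi> *\<^sub>R b \<in> supp f")
      case True
      then have "x \<in> K" unfolding K_def
        by (intro image_eqI[of _ _ "(x + \<xi> *\<^sub>R b, \<xi>)"]) (use \<xi> h in auto)
      then show ?thesis using M q by simp
    next
      case False
      then show ?thesis using D0 q M[of 0] by (simp add: order_trans[OF norm_ge_zero M])
    qed
  qed
  have "(\<lambda>n. \<integral>x. q n x \<partial>lborel) \<longlonglongrightarrow> (\<integral>x. D x \<partial>lborel)"
  proof (rule integral_dominated_convergence[where w = "\<lambda>x. M * indicator K x"])
    show "D \<in> borel_measurable lborel" using Dc by (simp add: borel_measurable_continuous_onI)
    fix n
    have "continuous_on UNIV (q n)"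
      unfolding q_def[abs_def] by (intro continuous_intros continuous_on_compose2[OF fc] fc) auto
    then show "q n \<in> borel_measurable lborel" by (simp add: borel_measurable_continuous_onI)
    show "AE x in lborel. norm (q n x) \<le> M * indicator K x" using qK by simp
    show "integrable lborel (\<lambda>x. M * indicator K x)"
      using emeasure_bounded_finite[OF compact_imp_bounded[OF K]]
      by (intro integrable_mult_right integrable_real_indicator) (simp_all add: borel_compact K)
  next
    show "AE x in lborel. (\<lambda>n. q n x) \<longlonglongrightarrow> D x"
    proof (rule AE_I2)
      fix x
      have "((\<lambda>h. (f (x + h *\<^sub>R b) - f x) / h) \<longlongrightarrow> D x) (at 0)"
        using line[of x 0] by (simp add: DERIV_def)
      moreover have "filterlim (\<lambda>n. inverse (real (Suc n))) (at 0) sequentially"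
        using LIMSEQ_inverse_real_of_nat by (auto simp: filterlim_at)
      ultimately show "(\<lambda>n. q n x) \<longlonglongrightarrow> D x"
        unfolding q_def by (rule filterlim_compose)
    qed
  qed
  moreover have "(\<integral>x. q n x \<partial>lborel) = 0" for n
  proof -
    let ?h = "inverse (real (Suc n))"
    have fi: "integrable lborel f"
      using derivative_eq_0_outside_supp(2) by (intro integrable_continuous_compact_support[OF fc cpt]) blast
    have "integrable lborel (\<lambda>x. f (x + ?h *\<^sub>R b))"
    proof (rule integrable_continuous_compact_support)
      show "continuous_on UNIV (\<lambda>x. f (x + ?h *\<^sub>R b))"
        by (intro continuous_on_compose2[OF fc] continuous_intros) auto
      show "compact ((\<lambda>x. x - ?h *\<^sub>R b) ` supp f)"
        by (intro compact_continuous_image cpt continuous_intros)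
      show "f (x + ?h *\<^sub>R b) = 0" if "x \<notin> (\<lambda>x. x - ?h *\<^sub>R b) ` supp f" for x
      proof (rule derivative_eq_0_outside_supp(2)[of "x + ?h *\<^sub>R b" f])
        show "x + ?h *\<^sub>R b \<notin> supp f"
          using that image_eqI[of x "\<lambda>x. x - ?h *\<^sub>R b" "x + ?h *\<^sub>R b" "supp f"] by auto
      qed
    qed
    moreover have "(\<integral>x. f (x + ?h *\<^sub>R b) \<partial>lborel) = (\<integral>x. f x \<partial>lborel)"
      using integral_lborel_translation[of f "?h *\<^sub>R b"] fc
      by (simp add: borel_measurable_continuous_onI add.commute)
    ultimately show ?thesis using fi by (simp add: q_def)
  qed
  ultimately show ?thesis by (simp add: LIMSEQ_const_iff D_def)
qed

lemma test_fun_deriv_support: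
  assumes "test_fun S \<phi>"
  shows "x \<notin> supp \<phi> \<Longrightarrow> \<phi> x = 0" "x \<notin> supp \<phi> \<Longrightarrow> frechet_derivative \<phi> (at x) b = 0"
    "b \<in> Basis \<Longrightarrow> continuous_on UNIV (\<lambda>x. frechet_derivative \<phi> (at x) b)"
  using derivative_eq_0_outside_supp[of x \<phi>] test_funD(1)[OF assms, of 1] by auto

text \<open>
  The derivative of the product \<open>\<phi> \<psi>\<close> integrates to zero.
\<close>

lemma integral_by_parts_test_funs:
  fixes \<phi> \<psi> :: "'a::euclidean_space \<Rightarrow> real"
  assumes \<phi>: "test_fun S \<phi>" and \<psi>: "test_fun S \<psi>" and b: "b \<in> Basis"
  shows "(\<integral>x. \<phi> x * frechet_derivative \<psi> (at x) b \<partial>lborel)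
    = - (\<integral>x. \<psi> x * frechet_derivative \<phi> (at x) b \<partial>lborel)"
proof -
  define f where "f x = \<phi> x * \<psi> x" for x
  have fd: "(f has_derivative (\<lambda>h. \<phi> x * frechet_derivative \<psi> (at x) h + frechet_derivative \<phi> (at x) h * \<psi> x)) (at x)" for x
    unfolding f_def
    by (intro has_derivative_mult Ck_Suc_has_derivative[OF test_funD(1)[OF \<phi>]] Ck_Suc_has_derivative[OF test_funD(1)[OF \<psi>]])
  have D: "frechet_derivative f (at x) b = \<phi> x * frechet_derivative \<psi> (at x) b + \<psi> x * frechet_derivative \<phi> (at x) b" for x
    unfolding frechet_derivative_at[OF fd[of x], symmetric] by simp
  have "supp f \<subseteq> supp \<phi>" unfolding supp_def f_def by (intro closure_mono) auto
  moreover have "closed (supp f)" by (simp add: supp_def)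
  ultimately have cpt: "compact (supp f)"
    using test_funD(2)[OF \<phi>] by (metis compact_Int_closed inf.absorb_iff2)
  have "Ck 1 f" unfolding f_def[abs_def] by (intro Ck_mult test_funD(1)[OF \<phi>] test_funD(1)[OF \<psi>])
  from integral_derivative_compact_support[OF this cpt b]
  have "(\<integral>x. \<phi> x * frechet_derivative \<psi> (at x) b + \<psi> x * frechet_derivative \<phi> (at x) b \<partial>lborel) = 0"
    by (simp add: D)
  moreover have "integrable lborel (\<lambda>x. \<phi> x * frechet_derivative \<psi> (at x) b)"
    using test_fun_deriv_support[OF \<phi>] test_fun_deriv_support[OF \<psi>] b
    by (intro integrable_continuous_compact_support[OF _ test_funD(2)[OF \<phi>]] continuous_intros test_funD(5)[OF \<phi>]) auto
  moreover have "integrable lborel (\<lambda>x. \<psi> x * frechet_derivative \<phi> (at x) b)"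
    using test_fun_deriv_support[OF \<phi>] test_fun_deriv_support[OF \<psi>] b
    by (intro integrable_continuous_compact_support[OF _ test_funD(2)[OF \<phi>]] continuous_intros test_funD(5)[OF \<psi>]) auto
  ultimately show ?thesis by simp
qed

section \<open>Weak derivatives on an interval\<close>

lemma test_fun_interval:
  assumes \<phi>: "test_fun {0<..<T} \<phi>" and T: "0 < T"
  obtains a b where "0 < a" "a \<le> b" "b < T" "\<And>x. x \<notin> {a..b} \<Longrightarrow> \<phi> x = 0"
    "\<And>x. x \<notin> {a..b} \<Longrightarrow> deriv \<phi> x = 0" "continuous_on UNIV (deriv \<phi>)"
    "\<And>x. (\<phi> has_real_derivative deriv \<phi> x) (at x)"
proof -
  note K = test_funD(2,3)[OF \<phi>]
  have "\<exists>a b. 0 < a \<and> a \<le> b \<and> b < T \<and> supp \<phi> \<subseteq> {a..b}"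
  proof (cases "supp \<phi> = {}")
    case True
    then show ?thesis using T by (intro exI[of _ "T/2"]) auto
  next
    case False
    obtain a where a: "a \<in> supp \<phi>" "\<forall>x\<in>supp \<phi>. a \<le> x"
      using compact_attains_inf[OF K(1) False] by blast
    obtain b where b: "b \<in> supp \<phi>" "\<forall>x\<in>supp \<phi>. x \<le> b"
      using compact_attains_sup[OF K(1) False] by blast
    have "supp \<phi> \<subseteq> {a..b}" using a b by auto
    moreover have "0 < a" "b < T" "a \<le> b" using a b K(2) by auto
    ultimately show ?thesis by blast
  qed
  then obtain a b where ab: "0 < a" "a \<le> b" "b < T" "supp \<phi> \<subseteq> {a..b}" by blast
  note C = Ck_Suc_real[OF test_funD(1)[OF \<phi>]]
  have z: "\<phi> x = 0" if "x \<notin> {a..b}" for x using that ab(4) derivative_eq_0_outside_supp(2) by blast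
  have "deriv \<phi> x = 0" if "x \<notin> {a..b}" for x
  proof -
    have "frechet_derivative \<phi> (at x) = (\<lambda>_. 0)" using that ab(4) derivative_eq_0_outside_supp(1) by blast
    moreover have "frechet_derivative \<phi> (at x) = (*) (deriv \<phi> x)"
      using frechet_derivative_at[OF C(1)[of x, unfolded has_field_derivative_def]] by simp
    ultimately show ?thesis by (metis mult.right_neutral)
  qed
  then show ?thesis using that ab z C(1) C(2)[of 0] by simp
qed

text \<open>
  A primitive of a test function has compact support exactly when the integral vanishes. Such
  primitives are the admissible test functions in the lemma of du Bois-Reymond.
\<close>

lemma test_fun_primitive:
  fixes \<theta> :: "real \<Rightarrow> real"
  assumes \<theta>: "\<And>k. Ck k \<theta>" and ab: "0 < a" "a \<le> b" "b < T" and z: "\<And>x. x \<notin> {a..b} \<Longrightarrow> \<theta> x = 0"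
    and int0: "integral {0..T} \<theta> = 0"
  shows "test_fun {0<..<T} (\<lambda>t. integral {0..t} \<theta>)"
    and "((\<lambda>t. integral {0..t} \<theta>) has_real_derivative \<theta> t) (at t)"
proof -
  let ?\<phi> = "\<lambda>t. integral {0..t} \<theta>"
  have \<theta>c: "continuous_on X \<theta>" for X using \<theta>[of 0] continuous_on_subset by auto
  have D: "(?\<phi> has_real_derivative \<theta> t) (at t)" for t
  proof (cases "0 < t")
    case True
    have "(?\<phi> has_real_derivative \<theta> t) (at t within {0..t+1})"
      using True by (intro integral_has_real_derivative \<theta>c) auto
    then have "(?\<phi> has_real_derivative \<theta> t) (at t within {0<..<t+1})"
      by (rule has_field_derivative_subset) auto
    then show ?thesis using True at_within_open[of t "{0<..<t+1}"] by auto
  next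
    case False
    have zero: "?\<phi> s = 0" if "s < a" for s
    proof -
      have "?\<phi> s = integral {0..s} (\<lambda>_. 0)" by (rule integral_cong) (use that z in auto)
      then show ?thesis by simp
    qed
    have "((\<lambda>_. 0) has_real_derivative 0) (at t)" by simp
    then have "(?\<phi> has_real_derivative 0) (at t)"
      by (rule has_field_derivative_transform_within_open[of _ _ _ "{..<a}"]) (use False ab zero in auto)
    then show ?thesis using False ab z[of t] by simp
  qed
  then show "(?\<phi> has_real_derivative \<theta> t) (at t)" .
  have out: "?\<phi> t = 0" if t: "t \<notin> {a..b}" for t
  proof (cases "t < a")
    case True
    have "?\<phi> t = integral {0..t} (\<lambda>_. 0)" by (rule integral_cong) (use True z in auto)
    then show ?thesis by simp
  next
    case False
    then have bt: "b < t" using t by auto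
    have "integral {0..max t T} \<theta> = integral {0..s} \<theta>" if "b < s" "s \<le> max t T" for s
    proof -
      have "integral {0..s} \<theta> + integral {s..max t T} \<theta> = integral {0..max t T} \<theta>"
        using that ab by (intro Henstock_Kurzweil_Integration.integral_combine integrable_continuous_real \<theta>c) auto
      moreover have "integral {s..max t T} \<theta> = integral {s..max t T} (\<lambda>_. 0)"
        by (rule integral_cong) (use that z in auto)
      ultimately show ?thesis by simp
    qed
    from this[of t] this[of T] show ?thesis using bt ab int0 by simp
  qed
  have Ck: "Ck k ?\<phi>" for k
  proof (cases k)
    case 0
    then show ?thesis using Ck_SucD[of 0 ?\<phi>] Ck_SucI_real[OF D \<theta>[of 0]] by blast
  next
    case (Suc k)
    then show ?thesis using Ck_SucI_real[OF D \<theta>] by blast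
  qed
  obtain a' b' where "0 < a'" "a' < a" "b < b'" "b' < T" using dense ab by meson
  then show "test_fun {0<..<T} ?\<phi>"
    by (intro test_fun_of_box[OF Ck, of a' b'] out) auto
qed

lemma integrable_lebesgue_on_subset:
  fixes f :: "'a::euclidean_space \<Rightarrow> 'b::euclidean_space"
  assumes "integrable (lebesgue_on T) f" "S \<subseteq> T" "S \<in> sets lebesgue" "T \<in> sets lebesgue"
  shows "integrable (lebesgue_on S) f"
proof -
  have "integrable lebesgue (\<lambda>x. indicator S x *\<^sub>R (indicator T x *\<^sub>R f x))"
    by (rule integrable_mult_indicator) (use assms in \<open>simp_all add: integrable_restrict_space\<close>)
  moreover have "indicator S x *\<^sub>R (indicator T x *\<^sub>R f x) = indicator S x *\<^sub>R f x" for x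
    using assms(2) by (auto simp: indicator_def)
  ultimately have "integrable lebesgue (\<lambda>x. indicator S x *\<^sub>R f x)" by (simp only:)
  then show ?thesis using assms(3) by (simp add: integrable_restrict_space)
qed

text \<open>Integration by parts against the primitive of a merely integrable function is Fubini's
  theorem.\<close>

lemma integral_deriv_times_primitive:
  fixes k :: "real \<Rightarrow> real"
  assumes T: "0 < T" and k: "integrable (lebesgue_on {0<..<T}) k" and \<phi>: "test_fun {0<..<T} \<phi>"
  shows "(\<integral>s. deriv \<phi> s * integral {0..s} k \<partial>lebesgue_on {0<..<T}) = - (\<integral>t. \<phi> t * k t \<partial>lebesgue_on {0<..<T})"
proof -
  define M where "M = lebesgue_on {0<..<T}"
  interpret M: finite_measure M unfolding M_def by (rule finite_measure_lebesgue_on) simp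
  interpret P: pair_sigma_finite M M ..
  obtain a b where ab: "0 < a" "a \<le> b" "b < T" "\<And>x. x \<notin> {a..b} \<Longrightarrow> \<phi> x = 0"
    and d0: "\<And>x. x \<notin> {a..b} \<Longrightarrow> deriv \<phi> x = 0" and dc: "continuous_on UNIV (deriv \<phi>)"
    and D: "\<And>x. (\<phi> has_real_derivative deriv \<phi> x) (at x)"
    using test_fun_interval[OF \<phi> T] by metis
  obtain C where C: "\<And>x. norm (deriv \<phi> x) \<le> C" using continuous_bounded_of_supp[OF dc compact_Icc d0] by blast
  have C0: "0 \<le> C" using C[of 0] norm_ge_zero order_trans by blast
  have idm: "(\<lambda>x. x) \<in> borel_measurable M"
    unfolding M_def by (intro measurable_restrict_space1 measurable_completion) auto
  have km: "k \<in> borel_measurable M" using k M_def by auto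
  have dm: "deriv \<phi> \<in> borel_measurable M"
    using measurable_compose[OF idm borel_measurable_continuous_onI[OF dc]] by simp
  \<comment> \<open>Integrating in \<open>t\<close> first produces the primitive of \<open>k\<close>; integrating in \<open>s\<close> first produces
    \<open>\<phi> T - \<phi> t = - \<phi> t\<close>.\<close>
  define f where "f t s = of_bool (t < s) * (deriv \<phi> s * k t)" for t s :: real
  have [measurable]: "(\<lambda>z. fst z) \<in> borel_measurable (M \<Otimes>\<^sub>M M)" "(\<lambda>z. snd z) \<in> borel_measurable (M \<Otimes>\<^sub>M M)"
    "(\<lambda>z. k (fst z)) \<in> borel_measurable (M \<Otimes>\<^sub>M M)" "(\<lambda>z. deriv \<phi> (snd z)) \<in> borel_measurable (M \<Otimes>\<^sub>M M)"
    using measurable_compose[OF measurable_fst idm] measurable_compose[OF measurable_snd idm]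
      measurable_compose[OF measurable_fst km] measurable_compose[OF measurable_snd dm] by auto
  have fm: "case_prod f \<in> borel_measurable (M \<Otimes>\<^sub>M M)"
    unfolding f_def case_prod_beta of_bool_def by measurable
  have "integrable (M \<Otimes>\<^sub>M M) (\<lambda>z. C * k (fst z))"
  proof (rule P.Fubini_integrable)
    show "integrable M (\<lambda>x. \<integral>y. norm (C * k (fst (x, y))) \<partial>M)" using k by (simp add: M_def)
  qed auto
  then have fi: "integrable (M \<Otimes>\<^sub>M M) (case_prod f)"
  proof (rule Bochner_Integration.integrable_bound[OF _ fm])
    show "AE z in M \<Otimes>\<^sub>M M. norm (case_prod f z) \<le> norm (C * k (fst z))"
      using C C0 by (intro AE_I2) (auto simp: f_def abs_mult intro!: mult_right_mono)
  qed
  have "(\<integral>s. (\<integral>t. f t s \<partial>M) \<partial>M) = (\<integral>t. (\<integral>s. f t s \<partial>M) \<partial>M)" by (rule P.Fubini_integral[OF fi])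
  moreover have "(\<integral>t. f t s \<partial>M) = deriv \<phi> s * integral {0..s} k" if s: "s \<in> {0<..<T}" for s
  proof -
    have "(\<integral>t. f t s \<partial>M) = (\<integral>t. deriv \<phi> s * (of_bool (t < s) * k t) \<partial>M)"
      by (simp add: f_def mult.left_commute)
    also have "\<dots> = deriv \<phi> s * (\<integral>t. of_bool (t < s) * k t \<partial>M)" by simp
    also have "(\<integral>t. of_bool (t < s) * k t \<partial>M) = (\<integral>t. (if t \<in> {0<..<s} then k t else 0) \<partial>M)"
      by (rule Bochner_Integration.integral_cong) (auto simp: M_def)
    also have "\<dots> = (\<integral>t. k t \<partial>lebesgue_on {0<..<s})"
      unfolding M_def using s by (intro Lebesgue_Measure.integral_restrict) auto
    also have "\<dots> = integral {0<..<s} k"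
    proof (rule lebesgue_integral_eq_integral)
      show "integrable (lebesgue_on {0<..<s}) k"
        by (rule integrable_lebesgue_on_subset[OF k]) (use s in auto)
    qed simp
    finally show ?thesis by (simp add: integral_open_interval_real)
  qed
  moreover have "(\<integral>s. f t s \<partial>M) = - (\<phi> t * k t)" if t: "t \<in> {0<..<T}" for t
  proof -
    have "(\<integral>s. f t s \<partial>M) = (\<integral>s. k t * (of_bool (t < s) * deriv \<phi> s) \<partial>M)"
      by (simp add: f_def algebra_simps)
    also have "\<dots> = k t * (\<integral>s. of_bool (t < s) * deriv \<phi> s \<partial>M)" by simp
    also have "(\<integral>s. of_bool (t < s) * deriv \<phi> s \<partial>M) = (\<integral>s. (if s \<in> {t<..<T} then deriv \<phi> s else 0) \<partial>M)"
      by (rule Bochner_Integration.integral_cong) (use t in \<open>auto simp: M_def\<close>)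
    also have "\<dots> = (\<integral>s. deriv \<phi> s \<partial>lebesgue_on {t<..<T})"
      unfolding M_def using t by (intro Lebesgue_Measure.integral_restrict) auto
    also have "\<dots> = integral {t<..<T} (deriv \<phi>)"
    proof (rule lebesgue_integral_eq_integral)
      have "integrable (lebesgue_on {t..T}) (deriv \<phi>)"
        using integrable_continuous_real
        by (intro continuous_imp_integrable_real continuous_on_subset[OF dc]) auto
      then show "integrable (lebesgue_on {t<..<T}) (deriv \<phi>)"
        by (rule integrable_lebesgue_on_subset) auto
    qed simp
    also have "\<dots> = integral {t..T} (deriv \<phi>)" by (simp add: integral_open_interval_real)
    also have "\<dots> = \<phi> T - \<phi> t"
    proof (rule integral_unique, rule fundamental_theorem_of_calculus)
      show "(\<phi> has_vector_derivative deriv \<phi> x) (at x within {t..T})" for x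
        using D[of x] by (simp add: has_real_derivative_iff_has_vector_derivative has_vector_derivative_at_within)
    qed (use t in simp)
    finally show ?thesis using ab by simp
  qed
  ultimately have "(\<integral>s. deriv \<phi> s * integral {0..s} k \<partial>M) = (\<integral>t. - (\<phi> t * k t) \<partial>M)"
    by (metis (mono_tags, lifting) Bochner_Integration.integral_cong M_def space_lebesgue_on)
  then show ?thesis by (simp add: M_def)
qed

lemma fundamental_lemma_lebesgue_on:
  fixes g :: "'a::euclidean_space \<Rightarrow> real"
  assumes S: "open S" and g: "integrable (lebesgue_on S) g"
    and test: "\<And>\<phi>. test_fun S \<phi> \<Longrightarrow> (\<integral>x. \<phi> x * g x \<partial>lebesgue_on S) = 0"
  shows "AE x in lebesgue_on S. g x = 0"
proof -
  have Sm: "S \<in> sets lebesgue" using S by (simp add: borel_open sets_completionI_sets)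
  define h where "h x = indicator S x *\<^sub>R g x" for x
  have hi: "integrable lebesgue h" using g Sm by (simp add: h_def[abs_def] integrable_restrict_space)
  have "AE x in lebesgue_on S. h x = 0"
  proof (rule fundamental_lemma_variations[OF S])
    show "integrable lebesgue (\<lambda>x. indicator (cbox a b) x * h x)" for a b
      using integrable_mult_indicator[OF _ hi, of "cbox a b"] by simp
    fix \<phi> assume \<phi>: "test_fun S \<phi>"
    have "(\<integral>x. \<phi> x * h x \<partial>lebesgue) = (\<integral>x. indicator S x *\<^sub>R (\<phi> x * g x) \<partial>lebesgue)"
      by (rule Bochner_Integration.integral_cong) (auto simp: h_def)
    also have "\<dots> = (\<integral>x. \<phi> x * g x \<partial>lebesgue_on S)" using Sm by (simp add: integral_restrict_space)
    finally show "(\<integral>x. \<phi> x * h x \<partial>lebesgue) = 0" using test[OF \<phi>] by simp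
  qed
  then show ?thesis using Sm by (auto simp: AE_restrict_space_iff h_def elim: eventually_mono)
qed

lemma integrable_bounded_mult:
  fixes f g :: "'a \<Rightarrow> real"
  assumes "integrable M g" "f \<in> borel_measurable M" "\<And>x. \<bar>f x\<bar> \<le> C"
  shows "integrable M (\<lambda>x. f x * g x)"
proof (rule Bochner_Integration.integrable_bound[where f = "\<lambda>x. C * g x"])
  show "AE x in M. norm (f x * g x) \<le> norm (C * g x)"
  proof (rule AE_I2)
    fix x
    have "\<bar>f x\<bar> \<le> \<bar>C\<bar>" using assms(3)[of x] by linarith
    then show "norm (f x * g x) \<le> norm (C * g x)" by (simp add: abs_mult mult_right_mono)
  qed
qed (use assms in auto)

lemma borel_measurable_lebesgue_on_continuous:
  "continuous_on UNIV f \<Longrightarrow> f \<in> borel_measurable (lebesgue_on S)"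
  by (simp add: borel_measurable_continuous_onI measurable_completion measurable_restrict_space1)

text \<open>
  After subtraction of the primitive of \<open>k\<close> the weak derivative is zero, and the lemma of
  du Bois-Reymond applies: every test function \<open>\<eta>\<close> becomes, after subtraction of a multiple of a
  fixed bump \<open>\<psi>0\<close>, the derivative of a test function, so the remainder \<open>z\<close> is orthogonal to
  \<open>\<eta>\<close> minus that multiple.
\<close>

theorem weak_derivative_primitive:
  fixes g k :: "real \<Rightarrow> real"
  assumes T: "0 < T" and g: "integrable (lebesgue_on {0<..<T}) g" and k: "integrable (lebesgue_on {0<..<T}) k"
    and weak: "\<And>\<phi>. test_fun {0<..<T} \<phi> \<Longrightarrow>
      (\<integral>t. deriv \<phi> t * g t \<partial>lebesgue_on {0<..<T}) = - (\<integral>t. \<phi> t * k t \<partial>lebesgue_on {0<..<T})"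
  obtains m where "AE t in lebesgue_on {0<..<T}. g t = m + integral {0..t} k"
proof -
  define M where "M = lebesgue_on {0<..<T}"
  define z where "z t = g t - integral {0..t} k" for t
  have ki: "k integrable_on {0..T}"
    using integrable_on_lebesgue_on[OF k] by (simp add: integrable_on_open_interval_real)
  have "continuous_on {0<..<T} (\<lambda>t. integral {0..t} k)"
    using indefinite_integral_continuous_1[OF ki] by (rule continuous_on_subset) auto
  then have Km: "(\<lambda>t. integral {0..t} k) \<in> borel_measurable M"
    unfolding M_def by (intro continuous_imp_measurable_on_sets_lebesgue) auto
  have "bounded ((\<lambda>t. integral {0..t} k) ` {0..T})"
    by (intro compact_imp_bounded compact_continuous_image indefinite_integral_continuous_1[OF ki]) auto
  then obtain B where B: "\<forall>t\<in>{0..T}. \<bar>integral {0..t} k\<bar> \<le> B" unfolding bounded_iff by auto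
  interpret M: finite_measure M unfolding M_def by (rule finite_measure_lebesgue_on) simp
  have Ki: "integrable M (\<lambda>t. integral {0..t} k)"
    by (rule M.integrable_const_bound[where B = B]) (use B Km in \<open>auto simp: M_def\<close>)
  have zi: "integrable M z" unfolding z_def[abs_def] using g Ki by (simp add: M_def)
  have mi: "integrable M (\<lambda>t. c t * h t)" if "continuous_on UNIV c" "\<And>x. \<bar>c x\<bar> \<le> C" "integrable M h" for c h :: "real \<Rightarrow> real" and C :: real
    by (rule integrable_bounded_mult[where C = C])
      (use that borel_measurable_lebesgue_on_continuous in \<open>simp_all add: M_def\<close>)
  have bdd: "\<exists>C. \<forall>x. \<bar>\<eta> x\<bar> \<le> C" if "test_fun {0<..<T} \<eta>" for \<eta>
    using continuous_bounded_of_supp[OF test_funD(5,2)[OF that] test_fun_deriv_support(1)[OF that]] by (metis real_norm_def)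
  have weak0: "(\<integral>t. deriv \<phi> t * z t \<partial>M) = 0" if \<phi>: "test_fun {0<..<T} \<phi>" for \<phi>
  proof -
    obtain a b where dc: "continuous_on UNIV (deriv \<phi>)" and d0: "\<And>x. x \<notin> {a..b} \<Longrightarrow> deriv \<phi> x = 0"
      using test_fun_interval[OF \<phi> T] by metis
    obtain C where C: "\<And>x. norm (deriv \<phi> x) \<le> C" using continuous_bounded_of_supp[OF dc compact_Icc d0] by blast
    have "(\<integral>t. deriv \<phi> t * z t \<partial>M)
        = (\<integral>t. deriv \<phi> t * g t \<partial>M) - (\<integral>t. deriv \<phi> t * integral {0..t} k \<partial>M)"
      unfolding z_def right_diff_distrib
      using mi[OF dc _ Ki, of C] mi[OF dc _ g[folded M_def], of C] C by simp
    then show ?thesis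
      using weak[OF \<phi>] integral_deriv_times_primitive[OF T k \<phi>] by (simp add: M_def)
  qed
  define \<psi>0 where "\<psi>0 = box_bump (T/3) (2*T/3)"
  have \<psi>0t: "test_fun {0<..<T} \<psi>0"
    unfolding \<psi>0_def by (rule test_fun_of_box[where a = "T/3" and b = "2*T/3", OF Ck_box_bump box_bump_zero]) (use T in auto)
  have \<psi>0c: "continuous_on X \<psi>0" for X by (rule test_funD(5)[OF \<psi>0t])
  define J where "J = integral {0..T} \<psi>0"
  have J: "0 < J"
  proof -
    have "J \<noteq> 0"
    proof
      assume "J = 0"
      then have "\<forall>x\<in>{0..T}. \<psi>0 x = 0"
        unfolding J_def by (subst (asm) integral_eq_0_iff[OF \<psi>0c T]) (simp_all add: \<psi>0_def box_bump_nonneg)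
      then have "\<psi>0 (T/2) = 0" using T by simp
      moreover have "0 < \<psi>0 (T/2)" unfolding \<psi>0_def by (rule box_bump_pos) (use T in auto)
      ultimately show False by simp
    qed
    moreover have "0 \<le> J" unfolding J_def \<psi>0_def
      by (intro integral_nonneg integrable_continuous_real) (use \<psi>0c box_bump_nonneg in \<open>auto simp: \<psi>0_def\<close>)
    ultimately show ?thesis by simp
  qed
  \<comment> \<open>The only possible constant, as seen by testing with \<open>\<psi>0\<close>.\<close>
  define m where "m = (\<integral>t. \<psi>0 t * z t \<partial>M) / J"
  have "AE t in M. z t - m = 0"
    unfolding M_def
  proof (rule fundamental_lemma_lebesgue_on)
    show "integrable (lebesgue_on {0<..<T}) (\<lambda>t. z t - m)" using zi by (simp add: M_def[symmetric])
    fix \<eta> :: "real \<Rightarrow> real" assume \<eta>: "test_fun {0<..<T} \<eta>"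
    define c where "c = integral {0..T} \<eta>"
    define \<theta> where "\<theta> t = \<eta> t - (c / J) * \<psi>0 t" for t
    have C\<theta>: "Ck k \<theta>" for k
      unfolding \<theta>_def[abs_def] by (intro Ck_diff Ck_cmult test_funD(1)[OF \<eta>] test_funD(1)[OF \<psi>0t])
    obtain a b where ab: "0 < a" "a \<le> b" "b < T" "\<And>x. x \<notin> {a..b} \<Longrightarrow> \<eta> x = 0"
      using test_fun_interval[OF \<eta> T] by metis
    obtain a' b' where ab': "0 < a'" "a' \<le> b'" "b' < T" "\<And>x. x \<notin> {a'..b'} \<Longrightarrow> \<psi>0 x = 0"
      using test_fun_interval[OF \<psi>0t T] by metis
    have \<eta>c: "continuous_on X \<eta>" for X by (rule test_funD(5)[OF \<eta>])
    have "integral {0..T} \<theta> = integral {0..T} \<eta> - integral {0..T} (\<lambda>t. (c / J) * \<psi>0 t)"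
      unfolding \<theta>_def
      by (rule Henstock_Kurzweil_Integration.integral_diff)
        (intro integrable_continuous_real continuous_on_mult continuous_on_const \<eta>c \<psi>0c)+
    then have "integral {0..T} \<theta> = c - (c / J) * J" by (simp add: c_def J_def)
    then have "integral {0..T} \<theta> = 0" using J by simp
    moreover have "\<theta> x = 0" if "x \<notin> {min a a'..max b b'}" for x
    proof -
      have "x \<notin> {a..b}" "x \<notin> {a'..b'}" using that by auto
      then show ?thesis using ab(4) ab'(4) by (simp add: \<theta>_def)
    qed
    ultimately have p: "test_fun {0<..<T} (\<lambda>t. integral {0..t} \<theta>)"
      and d: "\<And>t. ((\<lambda>t. integral {0..t} \<theta>) has_real_derivative \<theta> t) (at t)"
      using test_fun_primitive[OF C\<theta>, of "min a a'" "max b b'" T] ab ab' by auto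
    have "deriv (\<lambda>t. integral {0..t} \<theta>) = \<theta>" using d DERIV_imp_deriv by blast
    with weak0[OF p] have w: "(\<integral>t. \<theta> t * z t \<partial>M) = 0" by simp
    obtain C1 C2 where C1: "\<And>x. \<bar>\<eta> x\<bar> \<le> C1" and C2: "\<And>x. \<bar>\<psi>0 x\<bar> \<le> C2" using bdd[OF \<eta>] bdd[OF \<psi>0t] by blast
    note i1 = mi[OF \<eta>c C1 zi] and i2 = mi[OF \<psi>0c C2 zi]
    have ec: "(\<integral>t. \<eta> t \<partial>M) = c"
    proof -
      have "integrable M \<eta>" using mi[OF \<eta>c C1, of "\<lambda>_. 1"] by simp
      then show ?thesis unfolding M_def c_def
        by (subst lebesgue_integral_eq_integral) (auto simp: integral_open_interval_real)
    qed
    have "(\<integral>t. \<theta> t * z t \<partial>M) = (\<integral>t. \<eta> t * z t - (c / J) * (\<psi>0 t * z t) \<partial>M)"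
      by (simp add: \<theta>_def algebra_simps)
    also have "\<dots> = (\<integral>t. \<eta> t * z t \<partial>M) - (c / J) * (\<integral>t. \<psi>0 t * z t \<partial>M)" using i1 i2 by simp
    also have "\<dots> = (\<integral>t. \<eta> t * z t \<partial>M) - m * (\<integral>t. \<eta> t \<partial>M)" by (simp add: ec m_def)
    also have "\<dots> = (\<integral>t. \<eta> t * (z t - m) \<partial>M)"
      using i1 mi[OF \<eta>c C1, of "\<lambda>_. m"] by (simp add: right_diff_distrib mult.commute)
    finally show "(\<integral>t. \<eta> t * (z t - m) \<partial>lebesgue_on {0<..<T}) = 0" using w by (simp add: M_def)
  qed simp
  then have "AE t in M. g t = m + integral {0..t} k" by eventually_elim (simp add: z_def)
  then show ?thesis unfolding M_def by (rule that)
qed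

section \<open>Square-integrable functions on a planar domain\<close>

locale open_domain =
  fixes Om :: "plane set"
  assumes open_Om: "open Om"
begin

lemma Om_lebesgue [simp]: "Om \<in> sets lebesgue"
  using open_Om by (simp add: borel_open sets_completionI_sets)

definition ext0 :: "(plane \<Rightarrow> 'v::euclidean_space) \<Rightarrow> plane \<Rightarrow> 'v" where
  "ext0 g x = (if x \<in> Om then g x else 0)"

text \<open>
  Extension by zero places the functions on every domain in one and the same Hilbert space.
\<close>

definition cls :: "(plane \<Rightarrow> 'v::euclidean_space) \<Rightarrow> (plane, 'v) l2" where
  "cls g = abs_l2 (ext0 g)"

abbreviation L2 :: "(plane \<Rightarrow> 'v::euclidean_space) set" where "L2 \<equiv> carr (L2_space Om)"

lemma borel_ext0: "ext0 g \<in> borel_measurable lebesgue \<longleftrightarrow> g \<in> borel_measurable (lebesgue_on Om)"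
  using borel_measurable_if_lebesgue_on[of Om UNIV g] unfolding ext0_def[abs_def] lebesgue_on_UNIV_eq by simp

lemma integral_ext0:
  fixes h :: "plane \<Rightarrow> 'v::euclidean_space"
  shows "integrable lebesgue (ext0 h) \<longleftrightarrow> integrable (lebesgue_on Om) h"
    and "(\<integral>x. ext0 h x \<partial>lebesgue) = (\<integral>x. h x \<partial>lebesgue_on Om)"
proof -
  have "ext0 h = (\<lambda>x. indicator Om x *\<^sub>R h x)" by (auto simp: ext0_def)
  then show "integrable lebesgue (ext0 h) \<longleftrightarrow> integrable (lebesgue_on Om) h"
    and "(\<integral>x. ext0 h x \<partial>lebesgue) = (\<integral>x. h x \<partial>lebesgue_on Om)"
    by (simp_all add: integrable_restrict_space integral_restrict_space)
qed

lemma L2_iff: "g \<in> L2 \<longleftrightarrow> sq_integrable (ext0 g)"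
proof -
  have "(\<lambda>x. (norm (ext0 g x))\<^sup>2) = ext0 (\<lambda>x. (norm (g x))\<^sup>2)" by (auto simp: ext0_def)
  then show ?thesis by (simp add: L2_space_def sq_integrable_def borel_ext0 integral_ext0)
qed

lemma nrm_L2: "g \<in> L2 \<Longrightarrow> nrm (L2_space Om) g = norm (cls g)"
proof -
  assume g: "g \<in> L2"
  have "(\<lambda>x. (norm (ext0 g x))\<^sup>2) = ext0 (\<lambda>x. (norm (g x))\<^sup>2)" by (auto simp: ext0_def)
  then have "(norm (cls g))\<^sup>2 = (\<integral>x. (norm (g x))\<^sup>2 \<partial>lebesgue_on Om)"
    using g by (simp add: cls_def norm_abs_l2 L2_iff integral_ext0)
  then show ?thesis unfolding L2_space_def by (metis norm_ge_zero real_sqrt_unique snd_conv)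
qed

lemma inner_cls:
  assumes "g \<in> L2" "h \<in> L2"
  shows "inner (cls g) (cls h) = (\<integral>x. inner (g x) (h x) \<partial>lebesgue_on Om)"
proof -
  have "(\<lambda>x. inner (ext0 g x) (ext0 h x)) = ext0 (\<lambda>x. inner (g x) (h x))" by (auto simp: ext0_def)
  then show ?thesis using assms by (simp add: cls_def L2_iff inner_abs_l2 integral_ext0)
qed

lemma integrable_inner_L2:
  assumes "g \<in> L2" "h \<in> L2"
  shows "integrable (lebesgue_on Om) (\<lambda>x. inner (g x) (h x))"
proof -
  have "(\<lambda>x. inner (ext0 g x) (ext0 h x)) = ext0 (\<lambda>x. inner (g x) (h x))" by (auto simp: ext0_def)
  then show ?thesis using sq_integrable_inner[of "ext0 g" "ext0 h"] assms by (simp add: L2_iff integral_ext0)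
qed

lemma cls_eq_iff:
  assumes "g \<in> L2" "h \<in> L2"
  shows "cls g = cls h \<longleftrightarrow> (AE x in lebesgue_on Om. g x = h x)"
proof -
  have "cls g = cls h \<longleftrightarrow> (AE x in lebesgue. ext0 g x = ext0 h x)"
    using assms by (simp add: cls_def L2_iff abs_l2_eq_iff)
  also have "\<dots> \<longleftrightarrow> (AE x in lebesgue. x \<in> Om \<longrightarrow> g x = h x)"
    by (rule AE_cong) (auto simp: ext0_def)
  finally show ?thesis by (simp add: AE_restrict_space_iff)
qed

lemma ext0_simps:
  "ext0 (\<lambda>x. g x + h x) = (\<lambda>x. ext0 g x + ext0 h x)"
  "ext0 (\<lambda>x. g x - h x) = (\<lambda>x. ext0 g x - ext0 h x)"
  "ext0 (\<lambda>x. - g x) = (\<lambda>x. - ext0 g x)"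
  "ext0 (\<lambda>x. c *\<^sub>R g x) = (\<lambda>x. c *\<^sub>R ext0 g x)"
  "ext0 (\<lambda>_. 0) = (\<lambda>_. 0)"
  by (auto simp: ext0_def)

lemma L2_add: "g \<in> L2 \<Longrightarrow> h \<in> L2 \<Longrightarrow> (\<lambda>x. g x + h x) \<in> L2"
  by (simp add: L2_iff ext0_simps sq_integrable_add)
lemma L2_diff: "g \<in> L2 \<Longrightarrow> h \<in> L2 \<Longrightarrow> (\<lambda>x. g x - h x) \<in> L2"
  by (simp add: L2_iff ext0_simps sq_integrable_diff)
lemma L2_uminus: "g \<in> L2 \<Longrightarrow> (\<lambda>x. - g x) \<in> L2"
  by (simp add: L2_iff ext0_simps sq_integrable_uminus)
lemma L2_scale: "g \<in> L2 \<Longrightarrow> (\<lambda>x. c *\<^sub>R g x) \<in> L2"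
  by (simp add: L2_iff ext0_simps sq_integrable_scale)
lemma L2_zero: "(\<lambda>_. 0) \<in> L2"
  by (simp add: L2_iff ext0_simps sq_integrable_0)
lemma L2_sum: "finite I \<Longrightarrow> (\<And>i. i \<in> I \<Longrightarrow> g i \<in> L2) \<Longrightarrow> (\<lambda>x. \<Sum>i\<in>I. g i x) \<in> L2"
  by (induction rule: finite_induct) (auto intro: L2_zero L2_add)

lemma cls_add: "g \<in> L2 \<Longrightarrow> h \<in> L2 \<Longrightarrow> cls (\<lambda>x. g x + h x) = cls g + cls h"
  by (simp add: cls_def L2_iff ext0_simps add_abs_l2)
lemma cls_diff: "g \<in> L2 \<Longrightarrow> h \<in> L2 \<Longrightarrow> cls (\<lambda>x. g x - h x) = cls g - cls h"
  by (simp add: cls_def L2_iff ext0_simps diff_abs_l2)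
lemma cls_uminus: "g \<in> L2 \<Longrightarrow> cls (\<lambda>x. - g x) = - cls g"
  by (simp add: cls_def L2_iff ext0_simps uminus_abs_l2)
lemma cls_scale: "g \<in> L2 \<Longrightarrow> cls (\<lambda>x. c *\<^sub>R g x) = c *\<^sub>R cls g"
  by (simp add: cls_def L2_iff ext0_simps scaleR_abs_l2)
lemma cls_zero: "cls (\<lambda>_. 0) = 0"
  by (simp add: cls_def ext0_simps zero_abs_l2)
lemma cls_sum: "finite I \<Longrightarrow> (\<And>i. i \<in> I \<Longrightarrow> g i \<in> L2) \<Longrightarrow> cls (\<lambda>x. \<Sum>i\<in>I. g i x) = (\<Sum>i\<in>I. cls (g i))"
  by (induction rule: finite_induct) (auto simp: cls_zero cls_add L2_sum)

lemma rep_L2: "rep_l2 U \<in> L2"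
proof -
  have "sq_integrable (rep_l2 U)" by simp
  then have "rep_l2 U \<in> borel_measurable (lebesgue_on Om)"
    and "integrable lebesgue (\<lambda>x. indicator Om x *\<^sub>R (norm (rep_l2 U x))\<^sup>2)"
    unfolding sq_integrable_def
    by (auto intro!: measurable_restrict_space1 integrable_mult_indicator[OF Om_lebesgue] simp del: real_scaleR_def)
  then show ?thesis by (simp add: L2_space_def integrable_restrict_space)
qed

text \<open>
  Measurability of the field of linear maps is expressed by its action on measurable functions, which
  treats scalar and matrix coefficients alike.
\<close>

definition multiplier :: "real \<Rightarrow> (plane \<Rightarrow> 'v::euclidean_space \<Rightarrow> 'w::euclidean_space) \<Rightarrow> bool" where
  "multiplier C a \<longleftrightarrow> (\<forall>x\<in>Om. linear (a x) \<and> (\<forall>v. norm (a x v) \<le> C * norm v)) \<and>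
     (\<forall>g. g \<in> borel_measurable (lebesgue_on Om) \<longrightarrow> (\<lambda>x. a x (g x)) \<in> borel_measurable (lebesgue_on Om))"

definition mult_op :: "(plane \<Rightarrow> 'v::euclidean_space \<Rightarrow> 'w::euclidean_space) \<Rightarrow> (plane, 'v) l2 \<Rightarrow> (plane, 'w) l2" where
  "mult_op a U = cls (\<lambda>x. a x (rep_l2 U x))"

lemma multiplier_L2:
  assumes a: "multiplier C a" and g: "g \<in> L2"
  shows "(\<lambda>x. a x (g x)) \<in> L2" "norm (cls (\<lambda>x. a x (g x))) \<le> \<bar>C\<bar> * norm (cls g)"
proof -
  have m: "(\<lambda>x. a x (g x)) \<in> borel_measurable (lebesgue_on Om)"
    using a g by (simp add: multiplier_def L2_space_def)
  have le: "(norm (a x (g x)))\<^sup>2 \<le> C\<^sup>2 * (norm (g x))\<^sup>2" if "x \<in> Om" for x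
  proof -
    have "(norm (a x (g x)))\<^sup>2 \<le> (C * norm (g x))\<^sup>2"
      using a that by (intro power_mono) (auto simp: multiplier_def)
    then show ?thesis by (simp add: power_mult_distrib)
  qed
  have gi: "integrable (lebesgue_on Om) (\<lambda>x. C\<^sup>2 * (norm (g x))\<^sup>2)" using g by (simp add: L2_space_def)
  have i: "integrable (lebesgue_on Om) (\<lambda>x. (norm (a x (g x)))\<^sup>2)"
    by (rule Bochner_Integration.integrable_bound[OF gi]) (use m le in auto)
  show L: "(\<lambda>x. a x (g x)) \<in> L2" using m i by (simp add: L2_space_def)
  have "(norm (cls (\<lambda>x. a x (g x))))\<^sup>2 = (\<integral>x. (norm (a x (g x)))\<^sup>2 \<partial>lebesgue_on Om)"
    using inner_cls[OF L L] by (simp add: power2_norm_eq_inner)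
  also have "\<dots> \<le> (\<integral>x. C\<^sup>2 * (norm (g x))\<^sup>2 \<partial>lebesgue_on Om)"
    by (rule integral_mono[OF i gi]) (use le in auto)
  also have "\<dots> = (\<bar>C\<bar> * norm (cls g))\<^sup>2"
    using inner_cls[OF g g] by (simp add: power_mult_distrib power2_norm_eq_inner)
  finally show "norm (cls (\<lambda>x. a x (g x))) \<le> \<bar>C\<bar> * norm (cls g)" by (rule power2_le_imp_le) simp
qed

lemma cls_rep_cls: "g \<in> L2 \<Longrightarrow> cls (rep_l2 (cls g)) = cls g"
proof -
  assume g: "g \<in> L2"
  have "AE x in lebesgue. rep_l2 (cls g) x = ext0 g x"
    unfolding cls_def by (rule rep_abs_l2) (use g in \<open>simp add: L2_iff\<close>)
  then have "AE x in lebesgue_on Om. rep_l2 (cls g) x = g x"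
    by (auto simp: AE_restrict_space_iff ext0_def elim: eventually_mono)
  then show ?thesis using g by (simp add: cls_eq_iff rep_L2)
qed

lemma mult_op_cls:
  assumes a: "multiplier C a" and g: "g \<in> L2"
  shows "mult_op a (cls g) = cls (\<lambda>x. a x (g x))"
proof -
  have "AE x in lebesgue_on Om. rep_l2 (cls g) x = g x"
    using cls_rep_cls[OF g] by (simp add: cls_eq_iff rep_L2 g)
  then have "AE x in lebesgue_on Om. a x (rep_l2 (cls g) x) = a x (g x)" by eventually_elim simp
  then show ?thesis unfolding mult_op_def
    by (subst cls_eq_iff) (use multiplier_L2(1)[OF a rep_L2] multiplier_L2(1)[OF a g] in simp_all)
qed

lemma norm_cls_rep_le: "norm (cls (rep_l2 U)) \<le> norm U"
proof -
  have "(norm (cls (rep_l2 U)))\<^sup>2 = (\<integral>x. (norm (rep_l2 U x))\<^sup>2 \<partial>lebesgue_on Om)"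
    using inner_cls[OF rep_L2 rep_L2, of U U] by (simp add: power2_norm_eq_inner)
  also have "\<dots> = (\<integral>x. indicator Om x *\<^sub>R (norm (rep_l2 U x))\<^sup>2 \<partial>lebesgue)"
    by (simp add: integral_restrict_space)
  also have "\<dots> \<le> (\<integral>x. (norm (rep_l2 U x))\<^sup>2 \<partial>lebesgue)"
  proof (rule integral_mono)
    have "sq_integrable (rep_l2 U)" by simp
    then show "integrable lebesgue (\<lambda>x. (norm (rep_l2 U x))\<^sup>2)" by (simp add: sq_integrable_def)
    then show "integrable lebesgue (\<lambda>x. indicator Om x *\<^sub>R (norm (rep_l2 U x))\<^sup>2)"
      by (intro integrable_mult_indicator) auto
  qed (auto simp: indicator_def)
  also have "\<dots> = (norm U)\<^sup>2" using norm_abs_l2[of "rep_l2 U"] by simp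
  finally show ?thesis by (rule power2_le_imp_le) simp
qed

lemma rep_linear:
  "AE x in lebesgue_on Om. rep_l2 (U + V) x = rep_l2 U x + rep_l2 V x"
  "AE x in lebesgue_on Om. rep_l2 (c *\<^sub>R U) x = c *\<^sub>R rep_l2 U x"
proof -
  have "abs_l2 (rep_l2 (U + V)) = abs_l2 (\<lambda>x. rep_l2 U x + rep_l2 V x)"
    using add_abs_l2[of "rep_l2 U" "rep_l2 V"] by simp
  then have "AE x in lebesgue. rep_l2 (U + V) x = rep_l2 U x + rep_l2 V x"
    by (simp add: rep_abs_l2 sq_integrable_add)
  then show "AE x in lebesgue_on Om. rep_l2 (U + V) x = rep_l2 U x + rep_l2 V x"
    unfolding AE_restrict_space_iff[of Om lebesgue, simplified] by eventually_elim simp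
  have "abs_l2 (rep_l2 (c *\<^sub>R U)) = abs_l2 (\<lambda>x. c *\<^sub>R rep_l2 U x)"
    using scaleR_abs_l2[of "rep_l2 U" c] by simp
  then have "AE x in lebesgue. rep_l2 (c *\<^sub>R U) x = c *\<^sub>R rep_l2 U x"
    by (simp add: rep_abs_l2 sq_integrable_scale)
  then show "AE x in lebesgue_on Om. rep_l2 (c *\<^sub>R U) x = c *\<^sub>R rep_l2 U x"
    unfolding AE_restrict_space_iff[of Om lebesgue, simplified] by eventually_elim simp
qed

lemma bounded_linear_mult_op:
  assumes a: "multiplier C a"
  shows "bounded_linear (mult_op a)"
proof (rule bounded_linear_intro)
  note aL = multiplier_L2(1)[OF a rep_L2]
  have lin: "x \<in> Om \<Longrightarrow> linear (a x)" for x using a by (simp add: multiplier_def)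
  fix U V :: "(plane, 'a) l2" and c :: real
  have "AE x in lebesgue_on Om. a x (rep_l2 (U + V) x) = a x (rep_l2 U x) + a x (rep_l2 V x)"
  proof -
    have "AE x in lebesgue_on Om. x \<in> Om" by (simp add: AE_restrict_space_iff)
    with rep_linear(1)[of U V] show ?thesis by eventually_elim (simp add: linear_add[OF lin])
  qed
  then show "mult_op a (U + V) = mult_op a U + mult_op a V"
    unfolding mult_op_def by (simp add: cls_add[symmetric] cls_eq_iff aL L2_add)
  have "AE x in lebesgue_on Om. a x (rep_l2 (c *\<^sub>R U) x) = c *\<^sub>R a x (rep_l2 U x)"
  proof -
    have "AE x in lebesgue_on Om. x \<in> Om" by (simp add: AE_restrict_space_iff)
    with rep_linear(2)[of c U] show ?thesis by eventually_elim (simp add: linear_scale[OF lin])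
  qed
  then show "mult_op a (c *\<^sub>R U) = c *\<^sub>R mult_op a U"
    unfolding mult_op_def by (simp add: cls_scale[symmetric] cls_eq_iff aL L2_scale)
  have "norm (mult_op a U) \<le> \<bar>C\<bar> * norm (cls (rep_l2 U))"
    unfolding mult_op_def by (rule multiplier_L2(2)[OF a rep_L2])
  also have "\<dots> \<le> \<bar>C\<bar> * norm U" by (intro mult_left_mono norm_cls_rep_le) simp
  finally show "norm (mult_op a U) \<le> norm U * \<bar>C\<bar>" by (simp add: mult.commute)
qed

text \<open>
  The orthogonal projection onto the classes of functions that vanish outside the domain. Vectors of
  the evolution equation are arbitrary classes on the plane, so they are compared with functions on
  the domain after projection.
\<close>

definition restr :: "(plane, 'v::euclidean_space) l2 \<Rightarrow> (plane, 'v) l2" where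
  "restr U = cls (rep_l2 U)"

lemma multiplier_id: "multiplier 1 (\<lambda>_ v. v)" by (simp add: multiplier_def linear_iff)

lemma bounded_linear_restr: "bounded_linear restr"
  using bounded_linear_mult_op[OF multiplier_id] unfolding mult_op_def restr_def[abs_def] .

lemma restr_cls: "g \<in> L2 \<Longrightarrow> restr (cls g) = cls g" by (simp add: restr_def cls_rep_cls)

lemma inner_cls_general:
  assumes g: "g \<in> L2"
  shows "inner U (cls g) = inner (restr U) (cls g)"
proof -
  have "inner U (cls g) = inner (abs_l2 (rep_l2 U)) (abs_l2 (ext0 g))" by (simp add: cls_def)
  also have "\<dots> = (\<integral>x. inner (rep_l2 U x) (ext0 g x) \<partial>lebesgue)"
    using g by (intro inner_abs_l2) (auto simp: L2_iff)
  also have "(\<lambda>x. inner (rep_l2 U x) (ext0 g x)) = ext0 (\<lambda>x. inner (rep_l2 U x) (g x))" by (auto simp: ext0_def)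
  also have "(\<integral>x. ext0 (\<lambda>x. inner (rep_l2 U x) (g x)) x \<partial>lebesgue) = inner (restr U) (cls g)"
    unfolding restr_def integral_ext0 by (rule inner_cls[symmetric]) (auto intro: rep_L2 g)
  finally show ?thesis .
qed

section \<open>Test functions and weak derivatives as elements of the Hilbert space\<close>

lemma L2_of_continuous_compact:
  fixes f :: "plane \<Rightarrow> 'v::euclidean_space"
  assumes "continuous_on UNIV f" "compact K" "\<And>x. x \<notin> K \<Longrightarrow> f x = 0"
  shows "f \<in> L2"
proof -
  have "integrable lborel (\<lambda>x. (norm (f x))\<^sup>2)"
    by (rule integrable_continuous_compact_support[of _ K]) (use assms in \<open>auto intro!: continuous_intros\<close>)
  then have "integrable lebesgue (\<lambda>x. (norm (f x))\<^sup>2)" by (simp add: integrable_completion)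
  then have "integrable lebesgue (\<lambda>x. indicator Om x *\<^sub>R (norm (f x))\<^sup>2)" by (intro integrable_mult_indicator) auto
  then show ?thesis
    using assms(1) by (simp add: L2_space_def integrable_restrict_space borel_measurable_lebesgue_on_continuous)
qed

abbreviation "test \<equiv> test_fun Om"

lemma axis_Basis: "axis i (1::real) \<in> (Basis :: plane set)"
  by (simp add: axis_in_Basis_iff)

lemma grad_props:
  assumes "test \<phi>"
  shows "continuous_on UNIV (grad \<phi>)" "x \<notin> supp \<phi> \<Longrightarrow> grad \<phi> x = 0" "grad \<phi> \<in> L2" "\<phi> \<in> L2"
    "(\<lambda>x. \<phi> x *\<^sub>R v) \<in> L2" "(\<lambda>x. grad \<phi> x $ i) \<in> L2"
proof -
  note z = test_fun_deriv_support[OF assms]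
  show c: "continuous_on UNIV (grad \<phi>)"
    unfolding grad_def[abs_def] by (intro continuous_on_vec_lambda z axis_Basis)
  show z': "x \<notin> supp \<phi> \<Longrightarrow> grad \<phi> x = 0" for x by (simp add: grad_def z vec_eq_iff)
  show "grad \<phi> \<in> L2" by (rule L2_of_continuous_compact[OF c test_funD(2)[OF assms] z'])
  show "\<phi> \<in> L2" by (rule L2_of_continuous_compact[OF test_funD(5,2)[OF assms] z(1)])
  show "(\<lambda>x. \<phi> x *\<^sub>R v) \<in> L2"
    by (rule L2_of_continuous_compact[OF _ test_funD(2)[OF assms]])
      (use z(1) in \<open>auto intro!: continuous_intros test_funD(5)[OF assms]\<close>)
  show "(\<lambda>x. grad \<phi> x $ i) \<in> L2"
    by (rule L2_of_continuous_compact[OF _ test_funD(2)[OF assms]])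
      (use z' in \<open>auto intro!: bounded_linear.continuous_on[OF bounded_linear_vec_nth c]\<close>)
qed

text \<open>Density of the test functions in \<open>L2\<close>, in dual form: it is the fundamental lemma of the calculus
  of variations.\<close>

lemma eq_0_if_orthogonal_to_test_funs:
  fixes U :: "(plane, real) l2"
  assumes "\<And>\<phi>. test \<phi> \<Longrightarrow> inner U (cls \<phi>) = 0"
  shows "restr U = 0"
proof -
  let ?g = "rep_l2 U"
  have "AE x in lebesgue_on Om. ?g x = 0"
  proof (rule fundamental_lemma_variations[OF open_Om])
    fix a b :: plane
    have "sq_integrable (indicator (cbox a b) :: plane \<Rightarrow> real)"
      unfolding sq_integrable_def
    proof
      have "(\<lambda>x. (norm (indicator (cbox a b) x :: real))\<^sup>2) = indicator (cbox a b)" by (auto simp: indicator_def)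
      then show "integrable lebesgue (\<lambda>x. (norm (indicator (cbox a b) x :: real))\<^sup>2)"
        using emeasure_lborel_cbox_finite[of a b] by (simp only:) (auto intro!: integrable_real_indicator)
    qed (simp add: borel_measurable_indicator)
    from sq_integrable_inner[OF this, of ?g]
    show "integrable lebesgue (\<lambda>x. indicator (cbox a b) x * ?g x)" by simp
  next
    fix \<phi> assume \<phi>: "test \<phi>"
    have "(\<lambda>x. \<phi> x * ?g x) = ext0 (\<lambda>x. inner (?g x) (\<phi> x))"
      using test_funD(4)[OF \<phi>] by (auto simp: ext0_def)
    then have "(\<integral>x. \<phi> x * ?g x \<partial>lebesgue) = inner (cls ?g) (cls \<phi>)"
      by (simp add: integral_ext0 inner_cls rep_L2 grad_props[OF \<phi>])
    also have "\<dots> = inner U (cls \<phi>)" using inner_cls_general[OF grad_props(4)[OF \<phi>], of U] by (simp add: restr_def)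
    finally show "(\<integral>x. \<phi> x * ?g x \<partial>lebesgue) = 0" using assms[OF \<phi>] by simp
  qed
  then have "cls ?g = cls (\<lambda>_. 0)" by (simp add: cls_eq_iff rep_L2 L2_zero)
  then show ?thesis by (simp add: restr_def cls_zero)
qed

end

lemma subspace_closure:
  fixes S :: "'a::real_normed_vector set"
  assumes "subspace S"
  shows "subspace (closure S)"
  unfolding subspace_def
proof (intro conjI ballI allI)
  show "0 \<in> closure S" using closure_subset subspace_0[OF assms] by blast
  fix x assume "x \<in> closure S"
  then obtain f where f: "\<And>n. f n \<in> S" "f \<longlonglongrightarrow> x" unfolding closure_sequential by blast
  { fix y assume "y \<in> closure S"
    then obtain g where g: "\<And>n. g n \<in> S" "g \<longlonglongrightarrow> y" unfolding closure_sequential by blast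
    have "(\<lambda>n. f n + g n) \<longlonglongrightarrow> x + y" by (intro tendsto_add f g)
    moreover have "f n + g n \<in> S" for n by (rule subspace_add[OF assms f(1) g(1)])
    ultimately show "x + y \<in> closure S"
      unfolding closure_sequential by (intro exI[of _ "\<lambda>n. f n + g n"]) blast
  }
  fix c :: real
  have "(\<lambda>n. c *\<^sub>R f n) \<longlonglongrightarrow> c *\<^sub>R x" by (intro tendsto_intros f)
  moreover have "c *\<^sub>R f n \<in> S" for n by (rule subspace_scale[OF assms f(1)])
  ultimately show "c *\<^sub>R x \<in> closure S"
    unfolding closure_sequential by (intro exI[of _ "\<lambda>n. c *\<^sub>R f n"]) blast
qed

lemma test_fun_add:
  assumes "test_fun S f" "test_fun S g"
  shows "test_fun S (\<lambda>x. f x + g x)"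
proof -
  have "{x. f x + g x \<noteq> 0} \<subseteq> {x. f x \<noteq> 0} \<union> {x. g x \<noteq> 0}" by auto
  then have "supp (\<lambda>x. f x + g x) \<subseteq> supp f \<union> supp g"
    unfolding supp_def by (metis closure_Un closure_mono)
  moreover have "closed (supp (\<lambda>x. f x + g x))" by (simp add: supp_def)
  moreover have "compact (supp f \<union> supp g)" using test_funD(2) assms by (intro compact_Un) auto
  ultimately have "compact (supp (\<lambda>x. f x + g x))" by (metis compact_Int_closed inf.absorb_iff2)
  then show ?thesis
    using assms test_funD(3)[OF assms(1)] test_funD(3)[OF assms(2)] \<open>supp (\<lambda>x. f x + g x) \<subseteq> supp f \<union> supp g\<close>
    by (auto simp: test_fun_def smooth_def Ck_add)
qed

lemma test_fun_scale:
  assumes "test_fun S f"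
  shows "test_fun S (\<lambda>x. c * f x)"
proof -
  have "supp (\<lambda>x. c * f x) \<subseteq> supp f" unfolding supp_def by (intro closure_mono) auto
  moreover have "closed (supp (\<lambda>x. c * f x))" by (simp add: supp_def)
  ultimately have "compact (supp (\<lambda>x. c * f x))" using test_funD(2)[OF assms] by (metis compact_Int_closed inf.absorb_iff2)
  then show ?thesis
    using assms \<open>supp (\<lambda>x. c * f x) \<subseteq> supp f\<close> by (auto simp: test_fun_def smooth_def Ck_cmult)
qed

lemma grad_linear:
  assumes "test_fun S f" "test_fun S g"
  shows "grad (\<lambda>x. f x + g x) x = grad f x + grad g x" "grad (\<lambda>x. c * f x) x = c *\<^sub>R grad f x"
proof -
  note d = Ck_Suc_has_derivative[OF test_funD(1)[OF assms(1)]] Ck_Suc_has_derivative[OF test_funD(1)[OF assms(2)]]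
  show "grad (\<lambda>x. f x + g x) x = grad f x + grad g x"
    using frechet_derivative_at[OF has_derivative_add[OF d], of x] by (simp add: grad_def vec_eq_iff fun_eq_iff)
  show "grad (\<lambda>x. c * f x) x = c *\<^sub>R grad f x"
    using frechet_derivative_at[OF has_derivative_mult_right[OF d(1)], of c x] by (simp add: grad_def vec_eq_iff fun_eq_iff)
qed

context open_domain
begin

definition test_graph :: "((plane, real) l2 \<times> (plane, plane) l2) set" where
  "test_graph = {(cls \<phi>, cls (grad \<phi>)) | \<phi>. test \<phi>}"

text \<open>
  The minimal closed gradient: by definition of \<open>H10\<close> as the closure of the test functions, this is
  the graph of the weak gradient on \<open>H10\<close>, as \<open>H10_iff\<close> and \<open>grad_graph_rep\<close> make precise.
\<close>

definition grad_graph :: "((plane, real) l2 \<times> (plane, plane) l2) set" where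
  "grad_graph = closure test_graph"

lemma closed_grad_graph: "closed grad_graph" by (simp add: grad_graph_def)

lemma subspace_grad_graph: "subspace grad_graph"
  unfolding grad_graph_def
proof (rule subspace_closure)
  show "subspace test_graph"
    unfolding subspace_def
  proof (intro conjI ballI allI)
    have "test (\<lambda>_. 0)" by (simp add: test_fun_def smooth_def Ck_const supp_def)
    moreover have "grad (\<lambda>_. 0) = (\<lambda>_. 0)"
      using frechet_derivative_at[OF has_derivative_const[of "0::real"]] by (auto simp: grad_def vec_eq_iff fun_eq_iff)
    ultimately show "0 \<in> test_graph"
      unfolding test_graph_def zero_prod_def by (intro CollectI exI[of _ "\<lambda>_. 0"]) (simp add: cls_zero)
    fix x assume "x \<in> test_graph"
    then obtain f where f: "x = (cls f, cls (grad f))" "test f" by (auto simp: test_graph_def)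
    { fix y assume "y \<in> test_graph"
      then obtain g where g: "y = (cls g, cls (grad g))" "test g" by (auto simp: test_graph_def)
      have "grad (\<lambda>x. f x + g x) = (\<lambda>x. grad f x + grad g x)" using grad_linear f g by blast
      then show "x + y \<in> test_graph"
        unfolding test_graph_def using f g test_fun_add[OF f(2) g(2)]
        by (intro CollectI exI[of _ "\<lambda>x. f x + g x"]) (simp add: cls_add grad_props)
    }
    fix c :: real
    have "grad (\<lambda>x. c * f x) = (\<lambda>x. c *\<^sub>R grad f x)" using grad_linear f by blast
    moreover have "cls (\<lambda>x. c * f x) = c *\<^sub>R cls f" using cls_scale[OF grad_props(4)[OF f(2)], of c] by simp
    ultimately show "c *\<^sub>R x \<in> test_graph"
      unfolding test_graph_def using f test_fun_scale[OF f(2)]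
      by (intro CollectI exI[of _ "\<lambda>x. c * f x"]) (simp add: cls_scale grad_props)
  qed
qed

lemma grad_graph_closed_induct:
  assumes "z \<in> grad_graph" "closed {z. P z}" "\<And>\<phi>. test \<phi> \<Longrightarrow> P (cls \<phi>, cls (grad \<phi>))"
  shows "P z"
proof -
  have "test_graph \<subseteq> {z. P z}" using assms(3) by (auto simp: test_graph_def)
  then have "grad_graph \<subseteq> {z. P z}" unfolding grad_graph_def using assms(2) by (rule closure_minimal)
  then show ?thesis using assms(1) by blast
qed

lemma continuous_restr: "continuous_on X f \<Longrightarrow> continuous_on X (\<lambda>x. restr (f x))"
  by (rule bounded_linear.continuous_on[OF bounded_linear_restr])

lemma grad_graph_restr:
  assumes "(u, b) \<in> grad_graph"
  shows "restr u = u" "restr b = b"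
proof -
  have "restr (fst (u, b)) = fst (u, b) \<and> restr (snd (u, b)) = snd (u, b)"
    by (rule grad_graph_closed_induct[OF assms])
      (auto intro!: closed_Collect_conj closed_Collect_eq continuous_restr continuous_intros simp: restr_cls grad_props)
  then show "restr u = u" "restr b = b" by auto
qed

lemma integrable_scaleR_L2:
  fixes G :: "plane \<Rightarrow> 'v::euclidean_space"
  assumes "w \<in> L2" "G \<in> L2"
  shows "integrable (lebesgue_on Om) (\<lambda>x. w x *\<^sub>R G x)"
proof (rule Bochner_Integration.integrable_bound)
  have "(\<lambda>x. norm (G x)) \<in> L2" "(\<lambda>x. norm (w x)) \<in> L2" using assms by (auto simp: L2_space_def)
  then show "integrable (lebesgue_on Om) (\<lambda>x. inner (norm (w x)) (norm (G x)))" by (intro integrable_inner_L2)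
qed (use assms in \<open>auto simp: L2_space_def\<close>)

lemma vec_eq_iff_axis: "(a :: plane) = b \<longleftrightarrow> (\<forall>i. inner a (axis i 1) = inner b (axis i 1))"
  by (simp add: vec_eq_iff inner_axis)

lemma is_weak_grad_iff:
  assumes w: "w \<in> L2"
  shows "is_weak_grad Om w G \<longleftrightarrow> G \<in> L2 \<and> (\<forall>\<phi> i. test \<phi> \<longrightarrow>
    inner (cls w) (cls (\<lambda>x. grad \<phi> x $ i)) = - inner (cls G) (cls (\<lambda>x. \<phi> x *\<^sub>R axis i 1)))"
proof -
  have "((\<integral>x. w x *\<^sub>R grad \<phi> x \<partial>lebesgue_on Om) = - (\<integral>x. \<phi> x *\<^sub>R G x \<partial>lebesgue_on Om)) \<longleftrightarrow>
     (\<forall>i. inner (cls w) (cls (\<lambda>x. grad \<phi> x $ i)) = - inner (cls G) (cls (\<lambda>x. \<phi> x *\<^sub>R axis i 1)))"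
    if G: "G \<in> L2" and \<phi>: "test \<phi>" for \<phi>
  proof -
    note L = grad_props[OF \<phi>]
    have 1: "inner (\<integral>x. w x *\<^sub>R grad \<phi> x \<partial>lebesgue_on Om) (axis i 1) = inner (cls w) (cls (\<lambda>x. grad \<phi> x $ i))" for i
    proof -
      have "inner (\<integral>x. w x *\<^sub>R grad \<phi> x \<partial>lebesgue_on Om) (axis i 1)
          = (\<integral>x. inner (w x *\<^sub>R grad \<phi> x) (axis i 1) \<partial>lebesgue_on Om)"
        using integrable_scaleR_L2[OF w L(3)] by (intro integral_inner_left[symmetric])
      also have "\<dots> = inner (cls w) (cls (\<lambda>x. grad \<phi> x $ i))"
        by (simp add: inner_cls w L inner_axis)
      finally show ?thesis .
    qed
    have 2: "inner (\<integral>x. \<phi> x *\<^sub>R G x \<partial>lebesgue_on Om) (axis i 1) = inner (cls G) (cls (\<lambda>x. \<phi> x *\<^sub>R axis i 1))" for i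
    proof -
      have "inner (\<integral>x. \<phi> x *\<^sub>R G x \<partial>lebesgue_on Om) (axis i 1)
          = (\<integral>x. inner (\<phi> x *\<^sub>R G x) (axis i 1) \<partial>lebesgue_on Om)"
        using integrable_scaleR_L2[OF L(4) G] by (intro integral_inner_left[symmetric])
      also have "\<dots> = inner (cls G) (cls (\<lambda>x. \<phi> x *\<^sub>R axis i 1))"
        by (simp add: inner_cls G L)
      finally show ?thesis .
    qed
    show ?thesis unfolding vec_eq_iff_axis using 1 2 by simp
  qed
  then show ?thesis unfolding is_weak_grad_def by blast
qed

lemma eq_0_if_orthogonal_to_vector_test_funs:
  fixes V :: "(plane, plane) l2"
  assumes "\<And>\<phi> i. test \<phi> \<Longrightarrow> inner V (cls (\<lambda>x. \<phi> x *\<^sub>R axis i 1)) = 0"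
  shows "restr V = 0"
proof -
  have m: "multiplier 1 (\<lambda>_ v::plane. v $ i)" for i :: 2
  proof -
    have "(\<lambda>x. g x $ i) \<in> borel_measurable (lebesgue_on Om)" if "g \<in> borel_measurable (lebesgue_on Om)" for g :: "plane \<Rightarrow> plane"
    proof -
      have "(\<lambda>x. inner (g x) (axis i 1)) \<in> borel_measurable (lebesgue_on Om)"
        by (intro borel_measurable_inner that) simp
      then show ?thesis by (simp add: inner_axis)
    qed
    then show ?thesis
      by (simp add: multiplier_def component_le_norm_cart linear_iff)
  qed
  have L: "(\<lambda>x. rep_l2 V x $ i) \<in> L2" for i by (rule multiplier_L2(1)[OF m rep_L2])
  have "AE x in lebesgue_on Om. rep_l2 V x $ i = 0" for i
  proof -
    have "inner (cls (\<lambda>x. rep_l2 V x $ i)) (cls \<phi>) = 0" if \<phi>: "test \<phi>" for \<phi>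
    proof -
      have "inner (cls (\<lambda>x. rep_l2 V x $ i)) (cls \<phi>) = inner (restr V) (cls (\<lambda>x. \<phi> x *\<^sub>R axis i 1))"
        unfolding restr_def by (simp add: inner_cls L rep_L2 grad_props[OF \<phi>] inner_axis mult.commute)
      then show ?thesis using assms[OF \<phi>, of i] inner_cls_general[OF grad_props(5)[OF \<phi>]] by metis
    qed
    then have "restr (cls (\<lambda>x. rep_l2 V x $ i)) = 0" by (rule eq_0_if_orthogonal_to_test_funs)
    then have "cls (\<lambda>x. rep_l2 V x $ i) = cls (\<lambda>_. 0)" by (simp add: restr_cls L cls_zero)
    then show ?thesis by (simp add: cls_eq_iff L L2_zero)
  qed
  then have "AE x in lebesgue_on Om. \<forall>i. rep_l2 V x $ i = 0" by (simp add: AE_all_countable)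
  then have "AE x in lebesgue_on Om. rep_l2 V x = 0" by eventually_elim (simp add: vec_eq_iff)
  then have "cls (rep_l2 V) = cls (\<lambda>_. 0)" by (simp add: cls_eq_iff rep_L2 L2_zero)
  then show ?thesis by (simp add: restr_def cls_zero)
qed

text \<open>
  The weak gradient is a chosen representative; uniqueness up to null sets makes its choice
  immaterial, also for the norms of \<open>H1\<close> and \<open>H10\<close>.
\<close>

lemma weak_grad_unique:
  assumes w: "w \<in> L2" "is_weak_grad Om w G" and w': "w' \<in> L2" "is_weak_grad Om w' G'" and eq: "cls w = cls w'"
  shows "cls G = cls G'"
proof -
  have G: "G \<in> L2" "G' \<in> L2" using w w' by (auto simp: is_weak_grad_def)
  have "restr (cls G - cls G') = 0"
  proof (rule eq_0_if_orthogonal_to_vector_test_funs)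
    fix \<phi> i assume "test \<phi>"
    then show "inner (cls G - cls G') (cls (\<lambda>x. \<phi> x *\<^sub>R axis i 1)) = 0"
      using w w' eq is_weak_grad_iff by (simp add: inner_diff_left)
  qed
  then show ?thesis using G by (simp add: cls_diff[symmetric] restr_cls L2_diff) (simp add: cls_diff)
qed

lemma integral_on_Om_borel:
  fixes h :: "plane \<Rightarrow> real"
  assumes "h \<in> borel_measurable borel" "\<And>x. x \<notin> Om \<Longrightarrow> h x = 0"
  shows "(\<integral>x. h x \<partial>lebesgue_on Om) = (\<integral>x. h x \<partial>lborel)"
proof -
  have "ext0 h = h" using assms(2) by (auto simp: ext0_def)
  then have "(\<integral>x. h x \<partial>lebesgue_on Om) = (\<integral>x. h x \<partial>lebesgue)" using integral_ext0(2)[of h] by simp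
  then show ?thesis using assms(1) by (simp add: integral_completion)
qed

lemma is_weak_grad_test:
  assumes \<phi>: "test \<phi>"
  shows "is_weak_grad Om \<phi> (grad \<phi>)"
  unfolding is_weak_grad_iff[OF grad_props(4)[OF \<phi>]]
proof (intro conjI allI impI)
  show "grad \<phi> \<in> L2" by (rule grad_props(3)[OF \<phi>])
  fix \<psi> i assume \<psi>: "test \<psi>"
  note P = grad_props[OF \<phi>] grad_props[OF \<psi>]
  have m: "(\<lambda>x. frechet_derivative f (at x) (axis i 1)) \<in> borel_measurable borel" if "test f" for f
    using test_fun_deriv_support(3)[OF that axis_Basis] by (rule borel_measurable_continuous_onI)
  have "inner (cls \<phi>) (cls (\<lambda>x. grad \<psi> x $ i)) = (\<integral>x. \<phi> x * frechet_derivative \<psi> (at x) (axis i 1) \<partial>lebesgue_on Om)"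
    by (simp add: inner_cls P) (simp add: grad_def)
  also have "\<dots> = (\<integral>x. \<phi> x * frechet_derivative \<psi> (at x) (axis i 1) \<partial>lborel)"
    by (rule integral_on_Om_borel) (use m[OF \<psi>] test_funD(4,6)[OF \<phi>] in \<open>auto intro: borel_measurable_times\<close>)
  also have "\<dots> = - (\<integral>x. \<psi> x * frechet_derivative \<phi> (at x) (axis i 1) \<partial>lborel)"
    by (rule integral_by_parts_test_funs[OF \<phi> \<psi> axis_Basis])
  also have "(\<integral>x. \<psi> x * frechet_derivative \<phi> (at x) (axis i 1) \<partial>lborel)
      = (\<integral>x. \<psi> x * frechet_derivative \<phi> (at x) (axis i 1) \<partial>lebesgue_on Om)"
    by (rule integral_on_Om_borel[symmetric]) (use m[OF \<phi>] test_funD(4,6)[OF \<psi>] in \<open>auto intro: borel_measurable_times\<close>)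
  also have "\<dots> = inner (cls (grad \<phi>)) (cls (\<lambda>x. \<psi> x *\<^sub>R axis i 1))"
    by (simp add: inner_cls P inner_axis) (simp add: grad_def mult.commute)
  finally show "inner (cls \<phi>) (cls (\<lambda>x. grad \<psi> x $ i)) = - inner (cls (grad \<phi>)) (cls (\<lambda>x. \<psi> x *\<^sub>R axis i 1))" .
qed

lemma is_weak_grad_diff:
  assumes "w \<in> L2" "is_weak_grad Om w G" "w' \<in> L2" "is_weak_grad Om w' G'"
  shows "is_weak_grad Om (\<lambda>x. w x - w' x) (\<lambda>x. G x - G' x)"
proof -
  have G: "G \<in> L2" "G' \<in> L2" using assms by (auto simp: is_weak_grad_def)
  then show ?thesis
    using assms by (simp add: is_weak_grad_iff L2_diff cls_diff inner_diff_left)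
qed

lemma H1_carr: "w \<in> carr (H1_space Om) \<longleftrightarrow> w \<in> L2 \<and> (\<exists>G. is_weak_grad Om w G)"
  by (auto simp: H1_space_def)

lemma weak_grad_is: "is_weak_grad Om w G \<Longrightarrow> is_weak_grad Om w (weak_grad Om w)"
  unfolding weak_grad_def using someI_ex[of "is_weak_grad Om w"] by blast

text \<open>
  Via this identity convergence in \<open>H1\<close> becomes convergence of graph points in the product Hilbert
  space.
\<close>

lemma nrm_H1:
  assumes w: "w \<in> L2" "is_weak_grad Om w G"
  shows "nrm (H1_space Om) w = norm (cls w, cls G)"
proof -
  have g: "is_weak_grad Om w (weak_grad Om w)" by (rule weak_grad_is[OF w(2)])
  then have "weak_grad Om w \<in> L2" by (simp add: is_weak_grad_def)
  moreover have "cls (weak_grad Om w) = cls G" by (rule weak_grad_unique[OF w(1) g w refl])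
  ultimately show ?thesis using w(1) by (simp add: H1_space_def nrm_L2 norm_prod_def)
qed

lemma H10_iff:
  "w \<in> carr (H10_space Om) \<longleftrightarrow> w \<in> L2 \<and> (\<exists>G. is_weak_grad Om w G \<and> (cls w, cls G) \<in> grad_graph)"
proof -
  have eq: "nrm (H1_space Om) (\<lambda>x. w x - \<phi> x) = norm ((cls \<phi>, cls (grad \<phi>)) - (cls w, cls G))"
    if w: "w \<in> L2" "is_weak_grad Om w G" and \<phi>: "test \<phi>" for G \<phi>
  proof -
    note P = grad_props[OF \<phi>]
    have "G \<in> L2" using w by (simp add: is_weak_grad_def)
    then show ?thesis
      using nrm_H1[OF L2_diff[OF w(1) P(4)] is_weak_grad_diff[OF w P(4) is_weak_grad_test[OF \<phi>]]]
      by (simp add: cls_diff w P norm_prod_def norm_minus_commute)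
  qed
  show ?thesis
  proof
    assume "w \<in> carr (H10_space Om)"
    then obtain G \<phi> where w: "w \<in> L2" "is_weak_grad Om w G" and \<phi>: "\<And>n::nat. test (\<phi> n)"
      and lim: "(\<lambda>n. nrm (H1_space Om) (\<lambda>x. w x - \<phi> n x)) \<longlonglongrightarrow> 0"
      by (auto simp: H10_space_def H1_carr)
    have "(\<lambda>n. norm ((cls (\<phi> n), cls (grad (\<phi> n))) - (cls w, cls G))) \<longlonglongrightarrow> 0"
      using lim eq[OF w \<phi>] by simp
    then have "(\<lambda>n. (cls (\<phi> n), cls (grad (\<phi> n)))) \<longlonglongrightarrow> (cls w, cls G)"
      unfolding tendsto_norm_zero_iff by (rule LIM_zero_cancel)
    moreover have "(cls (\<phi> n), cls (grad (\<phi> n))) \<in> test_graph" for n using \<phi> by (auto simp: test_graph_def)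
    ultimately have "(cls w, cls G) \<in> grad_graph"
      unfolding grad_graph_def closure_sequential by (intro exI[of _ "\<lambda>n. (cls (\<phi> n), cls (grad (\<phi> n)))"] conjI allI)
    then show "w \<in> L2 \<and> (\<exists>G. is_weak_grad Om w G \<and> (cls w, cls G) \<in> grad_graph)" using w by blast
  next
    assume "w \<in> L2 \<and> (\<exists>G. is_weak_grad Om w G \<and> (cls w, cls G) \<in> grad_graph)"
    then obtain G where w: "w \<in> L2" "is_weak_grad Om w G" and gr: "(cls w, cls G) \<in> grad_graph" by blast
    then obtain f where f: "\<And>n. f n \<in> test_graph" and lim: "f \<longlonglongrightarrow> (cls w, cls G)"
      unfolding grad_graph_def closure_sequential by blast
    have "\<exists>\<phi>. test \<phi> \<and> f n = (cls \<phi>, cls (grad \<phi>))" for n using f[of n] by (auto simp: test_graph_def)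
    then obtain \<phi> where \<phi>: "\<And>n. test (\<phi> n)" "\<And>n. f n = (cls (\<phi> n), cls (grad (\<phi> n)))" by metis
    have "(\<lambda>n. nrm (H1_space Om) (\<lambda>x. w x - \<phi> n x)) \<longlonglongrightarrow> 0"
      unfolding eq[OF w \<phi>(1)] \<phi>(2)[symmetric] using lim by (simp add: LIM_zero tendsto_norm_zero)
    then show "w \<in> carr (H10_space Om)" using w \<phi> by (auto simp: H10_space_def H1_carr)
  qed
qed

lemma nrm_H10: "nrm (H10_space Om) = nrm (H1_space Om)" by (simp add: H10_space_def)

lemma H10_graph:
  assumes "w \<in> carr (H10_space Om)"
  shows "w \<in> L2" "weak_grad Om w \<in> L2" "(cls w, cls (weak_grad Om w)) \<in> grad_graph"
proof -
  obtain G where w: "w \<in> L2" "is_weak_grad Om w G" "(cls w, cls G) \<in> grad_graph" using assms H10_iff by blast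
  note g = weak_grad_is[OF w(2)]
  show "w \<in> L2" "weak_grad Om w \<in> L2" using w g by (auto simp: is_weak_grad_def)
  show "(cls w, cls (weak_grad Om w)) \<in> grad_graph" using weak_grad_unique[OF w(1) g w(1,2) refl] w(3) by simp
qed

text \<open>
  The integration by parts identity is linear and continuous in the graph point, so it passes from
  test functions to the closure.
\<close>

lemma grad_graph_rep:
  assumes "(u, b) \<in> grad_graph" "w \<in> L2" "G \<in> L2" "cls w = u" "cls G = b"
  shows "is_weak_grad Om w G" "w \<in> carr (H10_space Om)"
proof -
  have "inner u (cls (\<lambda>x. grad \<phi> x $ i)) = - inner b (cls (\<lambda>x. \<phi> x *\<^sub>R axis i 1))" if \<phi>: "test \<phi>" for \<phi> i
  proof -
    have "inner (fst (u, b)) (cls (\<lambda>x. grad \<phi> x $ i)) = - inner (snd (u, b)) (cls (\<lambda>x. \<phi> x *\<^sub>R axis i 1))"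
    proof (rule grad_graph_closed_induct[OF assms(1)])
      fix \<psi> assume \<psi>: "test \<psi>"
      show "inner (fst (cls \<psi>, cls (grad \<psi>))) (cls (\<lambda>x. grad \<phi> x $ i)) =
         - inner (snd (cls \<psi>, cls (grad \<psi>))) (cls (\<lambda>x. \<phi> x *\<^sub>R axis i 1))"
        using is_weak_grad_test[OF \<psi>] \<phi> by (simp add: is_weak_grad_iff grad_props[OF \<psi>])
    qed (intro closed_Collect_eq continuous_intros)
    then show ?thesis by simp
  qed
  then show "is_weak_grad Om w G" using assms by (simp add: is_weak_grad_iff)
  then show "w \<in> carr (H10_space Om)" using assms H10_iff by blast
qed

lemma is_weak_div_iff:
  assumes p: "p \<in> L2"
  shows "is_weak_div Om p d \<longleftrightarrow> d \<in> L2 \<and> (\<forall>\<phi>. test \<phi> \<longrightarrow>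
    inner (cls p) (cls (grad \<phi>)) = - inner (cls d) (cls \<phi>))"
  unfolding is_weak_div_def using p by (auto simp: inner_cls grad_props)

lemma weak_div_unique:
  assumes p: "p \<in> L2" "is_weak_div Om p d" and p': "p' \<in> L2" "is_weak_div Om p' d'" and eq: "cls p = cls p'"
  shows "cls d = cls d'"
proof -
  have d: "d \<in> L2" "d' \<in> L2" using p p' by (auto simp: is_weak_div_def)
  have "restr (cls d - cls d') = 0"
    by (rule eq_0_if_orthogonal_to_test_funs) (use p p' eq is_weak_div_iff in \<open>simp add: inner_diff_left\<close>)
  then show ?thesis using d by (simp add: cls_diff[symmetric] restr_cls L2_diff) (simp add: cls_diff)
qed

lemma weak_div_is: "is_weak_div Om p d \<Longrightarrow> is_weak_div Om p (weak_div Om p)"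
  unfolding weak_div_def using someI_ex[of "is_weak_div Om p"] by blast

lemma Hdiv_carr: "p \<in> carr (Hdiv_space Om) \<longleftrightarrow> p \<in> L2 \<and> (\<exists>d. is_weak_div Om p d)"
  by (auto simp: Hdiv_space_def)

lemma nrm_Hdiv:
  assumes p: "p \<in> L2" "is_weak_div Om p d"
  shows "nrm (Hdiv_space Om) p = norm (cls p, cls d)"
proof -
  note g = weak_div_is[OF p(2)]
  then have "weak_div Om p \<in> L2" by (simp add: is_weak_div_def)
  moreover have "cls (weak_div Om p) = cls d" by (rule weak_div_unique[OF p(1) g p refl])
  ultimately show ?thesis using p(1) by (simp add: Hdiv_space_def nrm_L2 norm_prod_def)
qed

lemma is_weak_div_diff:
  assumes "p \<in> L2" "is_weak_div Om p d" "p' \<in> L2" "is_weak_div Om p' d'"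
  shows "is_weak_div Om (\<lambda>x. p x - p' x) (\<lambda>x. d x - d' x)"
  using assms by (simp add: is_weak_div_iff L2_diff cls_diff inner_diff_left)

text \<open>
  The weak divergence is minus the adjoint of the closed gradient: the defining identity extends from
  test functions to \<open>H10\<close>.
\<close>

lemma weak_div_grad_graph:
  assumes "p \<in> L2" "is_weak_div Om p d" "(a, b) \<in> grad_graph"
  shows "inner (cls p) b = - inner (cls d) a"
proof -
  have "inner (cls p) (snd (a, b)) = - inner (cls d) (fst (a, b))"
    by (rule grad_graph_closed_induct[OF assms(3)])
      (use assms in \<open>auto intro!: closed_Collect_eq continuous_intros simp: is_weak_div_iff\<close>)
  then show ?thesis by simp
qed

text \<open>
  The approximating test functions have their support inside the open domain, hence away from every
  part \<open>S\<close> of the boundary.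
\<close>

lemma vanishes_on_of_H10:
  assumes "w \<in> carr (H10_space Om)" "S \<inter> Om = {}"
  shows "vanishes_on Om S w"
proof -
  obtain \<phi> where w: "w \<in> carr (H1_space Om)" and \<phi>: "\<And>n::nat. test (\<phi> n)"
    and lim: "(\<lambda>n. nrm (H1_space Om) (\<lambda>x. w x - \<phi> n x)) \<longlonglongrightarrow> 0"
    using assms(1) by (auto simp: H10_space_def)
  have "smooth (\<phi> n) \<and> supp (\<phi> n) \<inter> S = {} \<and> \<phi> n \<in> carr (H1_space Om)" for n
    using \<phi>[of n] test_funD(3)[OF \<phi>[of n]] assms(2) is_weak_grad_test[OF \<phi>[of n]] grad_props(4)[OF \<phi>[of n]]
    by (auto simp: test_fun_def H1_carr)
  then show ?thesis using w lim by (auto simp: vanishes_on_def)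
qed

end

section \<open>Vector-valued functions of time\<close>

lemma borel_measurable_lebesgue_on_AE:
  fixes f g :: "'a::euclidean_space \<Rightarrow> real"
  assumes f: "f \<in> borel_measurable (lebesgue_on S)" and S: "S \<in> sets lebesgue"
    and eq: "AE x in lebesgue_on S. f x = g x"
  shows "g \<in> borel_measurable (lebesgue_on S)"
proof -
  let ?f = "\<lambda>x. if x \<in> S then f x else 0" and ?g = "\<lambda>x. if x \<in> S then g x else 0"
  have fm: "?f \<in> borel_measurable lebesgue"
    using borel_measurable_if_lebesgue_on[of S UNIV f] f S by (simp add: lebesgue_on_UNIV_eq)
  have e: "AE x in lebesgue. ?f x = ?g x"
    using eq S by (auto simp: AE_restrict_space_iff elim: eventually_mono)
  have "?g \<in> borel_measurable lebesgue"
  proof (rule measurableI)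
    fix A :: "real set" assume A: "A \<in> sets borel"
    have "?f -` A \<inter> space lebesgue \<in> sets lebesgue" using fm A by (rule measurable_sets)
    moreover have "AE x in lebesgue. x \<in> ?f -` A \<inter> space lebesgue \<longleftrightarrow> x \<in> ?g -` A \<inter> space lebesgue"
      using e by eventually_elim auto
    ultimately show "?g -` A \<inter> space lebesgue \<in> sets lebesgue"
      using completion.in_sets_AE by blast
  qed simp
  then show ?thesis
    using borel_measurable_if_lebesgue_on[of S UNIV g] S by (simp add: lebesgue_on_UNIV_eq)
qed

definition step_function :: "real set \<Rightarrow> (real \<Rightarrow> 'h) \<Rightarrow> bool" where
  "step_function I s \<longleftrightarrow> finite (s ` I) \<and> (\<forall>g. {t\<in>I. s t = g} \<in> sets lebesgue)"

definition step_limit :: "real set \<Rightarrow> (real \<Rightarrow> 'h::real_inner) \<Rightarrow> bool" where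
  "step_limit I f \<longleftrightarrow> (\<exists>s. (\<forall>n::nat. step_function I (s n)) \<and>
     (AE t in lebesgue_on I. (\<lambda>n. s n t) \<longlonglongrightarrow> f t))"

text \<open>
  What is kept of strong measurability: together with scalar information against every fixed vector,
  a countable set of values allows the exceptional null sets to be collected into one.
\<close>

definition separably_valued :: "real set \<Rightarrow> (real \<Rightarrow> 'h::real_inner) \<Rightarrow> bool" where
  "separably_valued I f \<longleftrightarrow> (\<exists>D. countable D \<and> (AE t in lebesgue_on I. f t \<in> closure D))"

lemma step_function_compose_sum:
  assumes "step_function I s" "t \<in> I"
  shows "F (s t) = (\<Sum>g\<in>s ` I. indicator {t\<in>I. s t = g} t * (F g :: real))"
proof -
  have "(\<Sum>g\<in>s ` I. indicator {t\<in>I. s t = g} t * F g) = (\<Sum>g\<in>s ` I. if s t = g then F g else 0)"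
    using assms(2) by (intro sum.cong) (auto simp: indicator_def)
  then show ?thesis using assms by (simp add: step_function_def)
qed

lemma step_function_measurable:
  assumes s: "step_function I s" and I: "I \<in> sets lebesgue"
  shows "(\<lambda>t. F (s t) :: real) \<in> borel_measurable (lebesgue_on I)"
proof -
  have "(\<lambda>t. \<Sum>g\<in>s ` I. indicator {t\<in>I. s t = g} t * F g) \<in> borel_measurable (lebesgue_on I)"
    using s I by (intro borel_measurable_sum borel_measurable_times borel_measurable_const borel_measurable_indicator)
      (auto simp: step_function_def sets_restrict_space_iff)
  then show ?thesis
    using step_function_compose_sum[OF s, of _ F] by (subst measurable_cong) auto
qed

lemma step_limit_measurable:
  fixes F :: "'h::real_inner \<Rightarrow> real"
  assumes f: "step_limit I f" and I: "I \<in> sets lebesgue" and F: "continuous_on UNIV F"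
  shows "(\<lambda>t. F (f t)) \<in> borel_measurable (lebesgue_on I)"
proof -
  obtain s where s: "\<And>n::nat. step_function I (s n)" and lim: "AE t in lebesgue_on I. (\<lambda>n. s n t) \<longlonglongrightarrow> f t"
    using f unfolding step_limit_def by blast
  have 1: "AE t in lebesgue_on I. lim (\<lambda>n. F (s n t)) = F (f t)"
    using lim
  proof eventually_elim
    case (elim t)
    have "(\<lambda>n. F (s n t)) \<longlonglongrightarrow> F (f t)"
      by (rule continuous_on_tendsto_compose[OF F elim]) auto
    then show ?case by (rule limI)
  qed
  have 2: "(\<lambda>t. lim (\<lambda>n. F (s n t))) \<in> borel_measurable (lebesgue_on I)"
    by (rule borel_measurable_lim_metric) (rule step_function_measurable[OF s I])
  show ?thesis by (rule borel_measurable_lebesgue_on_AE[OF 2 I 1])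
qed

lemma step_limit_separably_valued:
  assumes "step_limit I f"
  shows "separably_valued I f"
proof -
  obtain s where s: "\<And>n::nat. step_function I (s n)" and lim: "AE t in lebesgue_on I. (\<lambda>n. s n t) \<longlonglongrightarrow> f t"
    using assms unfolding step_limit_def by blast
  let ?D = "\<Union>n. s n ` I"
  have "countable ?D" by (rule countable_UN[OF countableI_type countable_finite]) (use s in \<open>simp add: step_function_def\<close>)
  moreover have "AE t in lebesgue_on I. f t \<in> closure ?D"
    using lim AE_space
  proof eventually_elim
    case (elim t)
    have "s n t \<in> ?D" for n using elim(2) by auto
    then show ?case unfolding closure_sequential using elim(1) by (intro exI[of _ "\<lambda>n. s n t"] conjI allI)
  qed
  ultimately show ?thesis unfolding separably_valued_def by blast
qed

lemma separably_valued_diff: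
  assumes "separably_valued I f" "separably_valued I g"
  shows "separably_valued I (\<lambda>t. f t - g t)"
proof -
  obtain D E where D: "countable D" "AE t in lebesgue_on I. f t \<in> closure D"
    and E: "countable E" "AE t in lebesgue_on I. g t \<in> closure E"
    using assms unfolding separably_valued_def by blast
  let ?C = "(\<lambda>z. fst z - snd z) ` (D \<times> E)"
  have "AE t in lebesgue_on I. f t - g t \<in> closure ?C"
    using D(2) E(2)
  proof eventually_elim
    case (elim t)
    obtain u v where u: "\<And>n. u n \<in> D" "u \<longlonglongrightarrow> f t" and v: "\<And>n. v n \<in> E" "v \<longlonglongrightarrow> g t"
      using elim unfolding closure_sequential by blast
    have "(\<lambda>n. u n - v n) \<longlonglongrightarrow> f t - g t" by (intro tendsto_diff u v)
    moreover have "u n - v n \<in> ?C" for n using u v by force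
    ultimately show ?case unfolding closure_sequential by (intro exI[of _ "\<lambda>n. u n - v n"] conjI allI)
  qed
  then show ?thesis using D(1) E(1) unfolding separably_valued_def by (intro exI[of _ ?C]) simp
qed

lemma separably_valued_continuous:
  fixes J :: "real \<Rightarrow> 'h::real_inner"
  assumes J: "continuous_on {0<..<T} J"
  shows "separably_valued {0<..<T} J"
  unfolding separably_valued_def
proof (intro exI conjI)
  let ?D = "J ` (\<rat> \<inter> {0<..<T})"
  show "countable ?D" using countable_rat by (intro countable_image countable_Int1)
  show "AE t in lebesgue_on {0<..<T}. J t \<in> closure ?D"
  proof (rule AE_I2)
    fix t assume "t \<in> space (lebesgue_on {0<..<T})"
    then have t: "0 < t" "t < T" by auto
    show "J t \<in> closure ?D"
      unfolding closure_approachable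
    proof (intro allI impI)
      fix e :: real assume "0 < e"
      then obtain d where d: "0 < d" "\<And>s. s \<in> {0<..<T} \<Longrightarrow> dist s t < d \<Longrightarrow> dist (J s) (J t) < e"
        using J t unfolding continuous_on_iff by (metis greaterThanLessThan_iff)
      obtain q where q: "q \<in> \<rat>" "t < q" "q < min T (t + d)"
        using Rats_dense_in_real[of t "min T (t + d)"] t d by auto
      then have "dist (J q) (J t) < e" using t by (intro d) (auto simp: dist_real_def)
      then show "\<exists>y\<in>?D. dist y (J t) < e" using q t by (intro bexI[of _ "J q"]) auto
    qed
  qed
qed

lemma orthogonal_to_closure:
  assumes "\<And>d. d \<in> D \<Longrightarrow> inner x d = (0::real)" "y \<in> closure D"
  shows "inner x y = 0"
proof -
  have "closure D \<subseteq> {y. inner x y = 0}"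
    by (rule closure_minimal) (use assms(1) in \<open>auto intro!: closed_Collect_eq continuous_intros\<close>)
  then show ?thesis using assms(2) by blast
qed

lemma separably_valued_eq_0:
  assumes "separably_valued I f" "\<And>h. AE t in lebesgue_on I. inner (f t) h = 0"
  shows "AE t in lebesgue_on I. f t = 0"
proof -
  obtain D where D: "countable D" "AE t in lebesgue_on I. f t \<in> closure D"
    using assms(1) unfolding separably_valued_def by blast
  have "AE t in lebesgue_on I. \<forall>d\<in>D. inner (f t) d = 0" using D(1) assms(2) by (simp add: AE_ball_countable)
  with D(2) show ?thesis
  proof eventually_elim
    case (elim t)
    have "inner (f t) (f t) = 0" by (rule orthogonal_to_closure[of D]) (use elim in auto)
    then show ?case by simp
  qed
qed

lemma separably_valued_const:
  assumes f: "separably_valued I f" and h: "\<And>h. \<exists>m. AE t in lebesgue_on I. inner (f t) h = m"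
    and nonnull: "\<not> (AE t in lebesgue_on I. False)"
  obtains k where "AE t in lebesgue_on I. f t = k"
proof -
  obtain D where D: "countable D" "AE t in lebesgue_on I. f t \<in> closure D"
    using f unfolding separably_valued_def by blast
  obtain m where m: "\<And>h. AE t in lebesgue_on I. inner (f t) h = m h" using h by metis
  have "AE t in lebesgue_on I. \<forall>d\<in>D. inner (f t) d = m d" using D(1) m by (simp add: AE_ball_countable)
  with D(2) have good: "AE t in lebesgue_on I. f t \<in> closure D \<and> (\<forall>d\<in>D. inner (f t) d = m d)"
    by eventually_elim simp
  have "\<exists>t. f t \<in> closure D \<and> (\<forall>d\<in>D. inner (f t) d = m d)"
  proof (rule ccontr)
    assume none: "\<nexists>t. f t \<in> closure D \<and> (\<forall>d\<in>D. inner (f t) d = m d)"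
    have "AE t in lebesgue_on I. False" using good by eventually_elim (use none in blast)
    with nonnull show False by blast
  qed
  then obtain t0 where t0: "f t0 \<in> closure D" "\<And>d. d \<in> D \<Longrightarrow> inner (f t0) d = m d" by blast
  have "AE t in lebesgue_on I. f t = f t0"
    using good
  proof eventually_elim
    case (elim t)
    have o: "inner (f t - f t0) d = 0" if "d \<in> D" for d using that elim t0 by (simp add: inner_diff_left)
    have "inner (f t - f t0) (f t) = 0" "inner (f t - f t0) (f t0) = 0"
      using orthogonal_to_closure[OF o] elim t0 by auto
    then have "inner (f t - f t0) (f t - f t0) = 0" by (simp add: inner_diff_right)
    then show ?case by simp
  qed
  then show ?thesis using that by blast
qed

locale time_interval =
  fixes T :: real
  assumes T_pos: "0 < T"
begin

abbreviation "I \<equiv> {0<..<T}"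
abbreviation "MI \<equiv> lebesgue_on {0<..<T}"

sublocale MI: finite_measure MI by (rule finite_measure_lebesgue_on) simp

lemma interval_not_null: "\<not> (AE t in MI. False)"
proof
  assume "AE t in MI. False"
  then have "AE t in lebesgue. t \<notin> I" by (simp add: AE_restrict_space_iff)
  then have "I \<in> null_sets lebesgue" by (subst AE_iff_null_sets) auto
  then have "emeasure lebesgue I = 0" by (simp add: null_sets_def)
  then show False using T_pos by simp
qed

lemma AE_I_space: "AE t in MI. 0 < t \<and> t < T" using AE_space[of MI] by eventually_elim auto

lemma continuous_AE_eq:
  fixes f g :: "real \<Rightarrow> 'b::real_normed_vector"
  assumes f: "continuous_on {0..T} f" "continuous_on {0..T} g" and eq: "AE t in MI. f t = g t" and t: "t \<in> {0..T}"
  shows "f t = g t"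
proof -
  define N where "N = {t\<in>I. f t - g t \<noteq> 0}"
  have fg: "continuous_on {0..T} (\<lambda>t. f t - g t)" by (intro continuous_intros f)
  then have "continuous_on I (\<lambda>t. f t - g t)" by (rule continuous_on_subset) auto
  then have "open (I \<inter> (\<lambda>t. f t - g t) -` (- {0}))" by (rule continuous_open_preimage) auto
  moreover have "I \<inter> (\<lambda>t. f t - g t) -` (- {0}) = N" by (auto simp: N_def)
  ultimately have N: "open N" by simp
  have "AE t in lebesgue. t \<notin> N"
    using eq unfolding AE_restrict_space_iff[of I lebesgue, simplified] N_def by eventually_elim auto
  moreover have "N \<in> sets lebesgue" using N by (simp add: borel_open sets_completionI_sets)
  ultimately have "negligible N" by (simp add: negligible_iff_null_sets AE_iff_null_sets)
  then have "N = {}" using N open_not_negligible by blast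
  then have "I \<subseteq> {t\<in>{0..T}. f t - g t = 0}" by (auto simp: N_def)
  moreover have "closed {t\<in>{0..T}. f t - g t = 0}"
    by (rule continuous_closed_preimage_constant[OF fg closed_atLeastAtMost])
  ultimately have "closure I \<subseteq> {t\<in>{0..T}. f t - g t = 0}" by (rule closure_minimal)
  then show ?thesis using t T_pos by auto
qed

lemma integrable_on_of_MI:
  assumes "integrable MI (k :: real \<Rightarrow> real)"
  shows "k integrable_on {0..T}" "integral {0..T} k = (\<integral>t. k t \<partial>MI)"
  using integrable_on_lebesgue_on[OF assms] lebesgue_integral_eq_integral[OF assms]
  by (simp_all add: integrable_on_open_interval_real integral_open_interval_real)

lemma integrable_MI_continuous:
  fixes k :: "real \<Rightarrow> real"
  assumes "continuous_on {0..T} k"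
  shows "integrable MI k"
  by (rule integrable_lebesgue_on_subset[OF continuous_imp_integrable_real[OF assms]]) auto

text \<open>
  The scalar function \<open>inner (z t) h\<close> agrees almost everywhere with a primitive of \<open>inner (V t) h\<close>, and
  continuous functions that agree almost everywhere agree at every time, in particular at \<open>0\<close>.
\<close>

lemma weak_primitive_continuous:
  fixes c V z :: "real \<Rightarrow> 'h::real_inner"
  assumes c: "continuous_on {0..T} c" and z: "AE t in MI. z t = c t"
    and i: "integrable MI (\<lambda>t. inner (z t) h)" "integrable MI (\<lambda>t. inner (V t) h)"
    and weak: "\<And>\<phi>. test_fun I \<phi> \<Longrightarrow>
      (\<integral>t. deriv \<phi> t * inner (z t) h \<partial>MI) = - (\<integral>t. \<phi> t * inner (V t) h \<partial>MI)"
    and t: "t \<in> {0..T}"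
  shows "inner (c t) h = inner (c 0) h + integral {0..t} (\<lambda>t. inner (V t) h)"
proof -
  obtain m where m: "AE t in MI. inner (z t) h = m + integral {0..t} (\<lambda>t. inner (V t) h)"
    using weak_derivative_primitive[OF T_pos i weak] by blast
  let ?K = "\<lambda>t. m + integral {0..t} (\<lambda>t. inner (V t) h)"
  have K: "continuous_on {0..T} ?K"
    by (intro continuous_intros indefinite_integral_continuous_1 integrable_on_of_MI(1) i)
  have "AE t in MI. inner (c t) h = ?K t" using m z by eventually_elim simp
  then have eq: "inner (c t) h = ?K t" if "t \<in> {0..T}" for t
    using continuous_AE_eq[OF continuous_on_inner[OF c continuous_on_const] K] that by blast
  from eq[of 0] have "inner (c 0) h = m" using T_pos by simp
  then show ?thesis using eq[OF t] by simp
qed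

text \<open>
  The primitive \<open>J\<close> of \<open>V\<close> is defined weakly, by the Riesz theorem, and is continuous because
  \<open>\<parallel>J b - J a\<parallel>\<close> is at most the integral of \<open>\<parallel>V\<parallel>\<close>. The difference \<open>z - J\<close> is constant against each
  vector, with an exceptional null set depending on the vector; separability makes it constant.
\<close>

lemma continuous_representative:
  fixes z V :: "real \<Rightarrow> 'h::{real_inner, banach}"
  assumes z: "separably_valued I z"
    and iz: "\<And>h. integrable MI (\<lambda>t. inner (z t) h)" and iV: "\<And>h. integrable MI (\<lambda>t. inner (V t) h)"
    and nV: "integrable MI (\<lambda>t. norm (V t))"
    and weak: "\<And>\<phi> h. test_fun I \<phi> \<Longrightarrow>
      (\<integral>t. deriv \<phi> t * inner (z t) h \<partial>MI) = - (\<integral>t. \<phi> t * inner (V t) h \<partial>MI)"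
  obtains c where "continuous_on {0..T} c" "AE t in MI. z t = c t"
proof -
  let ?K = "\<lambda>h t. integral {0..t} (\<lambda>s. inner (V s) h)" and ?N = "\<lambda>t. integral {0..t} (\<lambda>s. norm (V s))"
  have Vi: "(\<lambda>s. inner (V s) h) integrable_on {a..b}" if "{a..b} \<subseteq> {0..T}" for h a b
    using integrable_on_of_MI(1)[OF iV] that integrable_on_subinterval by blast
  have Ni: "(\<lambda>s. norm (V s)) integrable_on {a..b}" if "{a..b} \<subseteq> {0..T}" for a b
    using integrable_on_of_MI(1)[OF nV] that integrable_on_subinterval by blast
  have diff: "\<bar>?K h b - ?K h a\<bar> \<le> (?N b - ?N a) * norm h" if ab: "0 \<le> a" "a \<le> b" "b \<le> T" for h a b
  proof -
    have K: "?K h b - ?K h a = integral {a..b} (\<lambda>s. inner (V s) h)"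
      using Henstock_Kurzweil_Integration.integral_combine[OF ab(1,2) Vi[of 0 b h]] ab by auto
    have N: "?N b - ?N a = integral {a..b} (\<lambda>s. norm (V s))"
      using Henstock_Kurzweil_Integration.integral_combine[OF ab(1,2) Ni[of 0 b]] ab by auto
    have "norm (integral {a..b} (\<lambda>s. inner (V s) h)) \<le> integral {a..b} (\<lambda>s. norm (V s) * norm h)"
      by (rule integral_norm_bound_integral)
        (use ab in \<open>auto intro!: Vi integrable_on_mult_left Ni Cauchy_Schwarz_ineq2\<close>)
    then show ?thesis by (simp add: K N)
  qed
  have "\<exists>J. \<forall>h. inner J h = ?K h t" if t: "t \<in> {0..T}" for t
  proof -
    have bl: "bounded_linear (\<lambda>h. ?K h t)"
    proof (rule bounded_linear_intro)
      fix x y r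
      show "?K (x + y) t = ?K x t + ?K y t"
        unfolding inner_add_right by (rule Henstock_Kurzweil_Integration.integral_add) (use t in \<open>auto intro!: Vi\<close>)
      show "?K (r *\<^sub>R x) t = r *\<^sub>R ?K x t" by simp
      show "norm (?K x t) \<le> norm x * ?N t" using diff[of 0 t x] t by (simp add: mult.commute)
    qed
    show ?thesis using riesz_representation[OF bl] by metis
  qed
  then obtain J where J: "\<And>t h. t \<in> {0..T} \<Longrightarrow> inner (J t) h = ?K h t" by metis
  have Jle: "norm (J b - J a) \<le> ?N b - ?N a" if ab: "0 \<le> a" "a \<le> b" "b \<le> T" for a b
  proof -
    let ?d = "J b - J a"
    have "(norm ?d)\<^sup>2 = inner (J b) ?d - inner (J a) ?d" by (simp add: power2_norm_eq_inner inner_diff_left)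
    also have "\<dots> = ?K ?d b - ?K ?d a" using ab by (simp add: J del: inner_diff_right)
    also have "\<dots> \<le> (?N b - ?N a) * norm ?d" using diff[OF ab, of ?d] by linarith
    finally have "norm ?d * norm ?d \<le> (?N b - ?N a) * norm ?d" by (simp add: power2_eq_square)
    moreover have "0 \<le> ?N b - ?N a"
    proof -
      have "?N b - ?N a = integral {a..b} (\<lambda>s. norm (V s))"
        using Henstock_Kurzweil_Integration.integral_combine[OF ab(1,2) Ni[of 0 b]] ab by auto
      then show ?thesis using Ni[of a b] ab by (simp add: Henstock_Kurzweil_Integration.integral_nonneg)
    qed
    ultimately show ?thesis by (cases "norm ?d = 0") (auto simp: mult_le_cancel_right)
  qed
  have Jc: "continuous_on {0..T} J"
  proof -
    have Nc: "continuous_on {0..T} ?N" by (intro indefinite_integral_continuous_1 Ni) simp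
    show ?thesis
      unfolding continuous_on_iff
    proof (intro ballI allI impI)
      fix x e :: real assume x: "x \<in> {0..T}" and e: "0 < e"
      then obtain d where d: "0 < d" "\<And>y. y \<in> {0..T} \<Longrightarrow> dist y x < d \<Longrightarrow> dist (?N y) (?N x) < e"
        using Nc unfolding continuous_on_iff by meson
      show "\<exists>d>0. \<forall>y\<in>{0..T}. dist y x < d \<longrightarrow> dist (J y) (J x) < e"
      proof (intro exI[of _ d] conjI ballI impI d(1))
        fix y assume y: "y \<in> {0..T}" "dist y x < d"
        have "dist (J y) (J x) \<le> dist (?N y) (?N x)"
        proof (cases "x \<le> y")
          case True
          then show ?thesis using Jle[of x y] x y by (simp add: dist_norm)
        next
          case False
          then show ?thesis using Jle[of y x] x y by (simp add: dist_norm norm_minus_commute)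
        qed
        then show "dist (J y) (J x) < e" using d(2)[OF y] by linarith
      qed
    qed
  qed
  have "separably_valued I (\<lambda>t. z t - J t)"
    by (intro separably_valued_diff z separably_valued_continuous continuous_on_subset[OF Jc]) auto
  moreover have "\<exists>m. AE t in MI. inner (z t - J t) h = m" for h
  proof -
    obtain m where m: "AE t in MI. inner (z t) h = m + ?K h t"
      using weak_derivative_primitive[OF T_pos iz iV weak] by blast
    have "AE t in MI. inner (z t - J t) h = m"
      using m AE_I_space by eventually_elim (simp add: inner_diff_left J)
    then show ?thesis by blast
  qed
  ultimately obtain k where k: "AE t in MI. z t - J t = k"
    using separably_valued_const[OF _ _ interval_not_null] by blast
  show ?thesis
  proof (rule that)
    show "continuous_on {0..T} (\<lambda>t. k + J t)" by (intro continuous_intros Jc)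
    show "AE t in MI. z t = k + J t" using k by eventually_elim (simp add: algebra_simps)
  qed
qed

end

section \<open>Bochner integrals and weak time derivatives\<close>

context time_interval
begin

text \<open>Rounding down to an equidistant grid; a continuous curve sampled at the rounded time is a simple
  map close to the curve.\<close>

definition grid :: "nat \<Rightarrow> real \<Rightarrow> real" where
  "grid n t = T / (real n + 1) * real_of_int \<lfloor>t * (real n + 1) / T\<rfloor>"

lemma grid_le:
  shows "grid n t \<le> t" "t \<le> grid n t + T / (real n + 1)"
proof -
  define y where "y = t * (real n + 1) / T"
  have h: "0 < T / (real n + 1)" using T_pos by simp
  have t: "t = T / (real n + 1) * y" using T_pos by (simp add: y_def)
  have "T / (real n + 1) * real_of_int \<lfloor>y\<rfloor> \<le> T / (real n + 1) * y" using h by (intro mult_left_mono) auto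
  then show "grid n t \<le> t" unfolding grid_def y_def[symmetric] using t by simp
  have "T / (real n + 1) * y \<le> T / (real n + 1) * (real_of_int \<lfloor>y\<rfloor> + 1)"
    using h by (intro mult_left_mono) linarith+
  then show "t \<le> grid n t + T / (real n + 1)"
    unfolding grid_def y_def[symmetric] using t by (simp add: distrib_left)
qed

lemma grid_mem: "t \<in> I \<Longrightarrow> grid n t \<in> {0..T}"
proof -
  assume t: "t \<in> I"
  then have "0 \<le> grid n t" unfolding grid_def by (intro mult_nonneg_nonneg) auto
  then show ?thesis using grid_le(1)[of n t] t by auto
qed

lemma grid_finite: "finite (grid n ` I)"
proof -
  have "grid n ` I \<subseteq> (\<lambda>k. T / (real n + 1) * real_of_int k) ` {0..int n + 1}"
  proof
    fix x assume "x \<in> grid n ` I"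
    then obtain t where t: "t \<in> I" "x = grid n t" by blast
    have "t * (real n + 1) \<le> T * (real n + 1)" using t(1) by (intro mult_right_mono) auto
    then have "t * (real n + 1) / T \<le> real n + 1" using T_pos by (simp add: pos_divide_le_eq mult.commute)
    then have "\<lfloor>t * (real n + 1) / T\<rfloor> \<le> int n + 1" by linarith
    moreover have "0 \<le> \<lfloor>t * (real n + 1) / T\<rfloor>" using t by auto
    ultimately show "x \<in> (\<lambda>k. T / (real n + 1) * real_of_int k) ` {0..int n + 1}"
      using t(2) unfolding grid_def by auto
  qed
  then show ?thesis using finite_surj[of "{0..int n + 1}"] by blast
qed

lemma step_function_grid: "step_function I (\<lambda>t. c (grid n t))"
  unfolding step_function_def
proof (intro conjI allI)
  have "(\<lambda>t. c (grid n t)) ` I = c ` (grid n ` I)" by auto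
  then show "finite ((\<lambda>t. c (grid n t)) ` I)" using grid_finite by simp
  fix g
  let ?S = "{x \<in> grid n ` I. c x = g}"
  have m: "grid n \<in> borel_measurable borel" unfolding grid_def[abs_def] by measurable
  have "finite ?S" using grid_finite by simp
  then have "?S \<in> sets borel" by (intro borel_closed finite_imp_closed)
  then have "grid n -` ?S \<inter> space borel \<in> sets borel" using m by (intro measurable_sets)
  then have "I \<inter> (grid n -` ?S) \<in> sets borel" by auto
  moreover have "I \<inter> (grid n -` ?S) = {t\<in>I. c (grid n t) = g}" by auto
  ultimately show "{t\<in>I. c (grid n t) = g} \<in> sets lebesgue" by (metis sets_completionI_sets sets_lborel)
qed

lemma grid_approximates:
  assumes unif: "\<And>e. 0 < e \<Longrightarrow> \<exists>d>0. \<forall>s\<in>{0..T}. \<forall>t\<in>{0..T}. \<bar>s - t\<bar> < d \<longrightarrow> N s t < e" and e: "0 < (e::real)"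
  shows "\<exists>n0. \<forall>n\<ge>n0. \<forall>t\<in>I. N t (grid n t) < e"
proof -
  obtain d where d: "0 < d" "\<And>s t. s \<in> {0..T} \<Longrightarrow> t \<in> {0..T} \<Longrightarrow> \<bar>s - t\<bar> < d \<Longrightarrow> N s t < e"
    using unif[OF e] by blast
  obtain n0 where n0: "T / d < real n0" using reals_Archimedean2 by blast
  show ?thesis
  proof (intro exI[of _ n0] allI impI ballI)
    fix n t assume n: "n0 \<le> n" and t: "t \<in> I"
    have "T < real n0 * d" using n0 d(1) by (simp add: divide_less_eq)
    also have "\<dots> \<le> (real n + 1) * d" using n d(1) by (intro mult_right_mono) auto
    finally have "T / (real n + 1) < d" by (simp add: divide_less_eq mult.commute)
    then have "\<bar>t - grid n t\<bar> < d" using grid_le(1)[of n t] grid_le(2)[of t n] by linarith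
    then show "N t (grid n t) < e" using d(2) grid_mem[OF t] t by auto
  qed
qed

lemma strongly_measurable_of_continuous:
  assumes c: "\<And>t. t \<in> {0..T} \<Longrightarrow> c t \<in> carr X"
    and unif: "\<And>e. 0 < e \<Longrightarrow> \<exists>d>0. \<forall>s\<in>{0..T}. \<forall>t\<in>{0..T}. \<bar>s - t\<bar> < d \<longrightarrow> nrm X (\<lambda>x. c s x - c t x) < e"
    and nonneg: "\<And>s t. s \<in> {0..T} \<Longrightarrow> t \<in> {0..T} \<Longrightarrow> 0 \<le> nrm X (\<lambda>x. c s x - c t x)"
  shows "strongly_measurable I X c"
  unfolding strongly_measurable_def
proof (intro conjI exI)
  show "AE t in MI. c t \<in> carr X" using AE_I_space by eventually_elim (use c in auto)
  show "\<forall>n. simple_map I X (\<lambda>t. c (grid n t))"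
  proof
    fix n show "simple_map I X (\<lambda>t. c (grid n t))"
      using step_function_grid[of c n] c grid_mem[of _ n] by (auto simp: simple_map_def step_function_def)
  qed
  show "AE t in MI. (\<lambda>n. nrm X (\<lambda>x. c t x - c (grid n t) x)) \<longlonglongrightarrow> 0"
    using AE_I_space
  proof eventually_elim
    case (elim t)
    then have t: "t \<in> I" by auto
    show ?case
    proof (rule LIMSEQ_I)
      fix e :: real assume "0 < e"
      from grid_approximates[of "\<lambda>s t. nrm X (\<lambda>x. c s x - c t x)", OF unif this]
      obtain n0 where n0: "\<forall>n\<ge>n0. \<forall>t\<in>I. nrm X (\<lambda>x. c t x - c (grid n t) x) < e" by blast
      have "0 \<le> nrm X (\<lambda>x. c t x - c (grid n t) x)" for n using nonneg grid_mem[OF t] t by auto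
      then show "\<exists>no. \<forall>n\<ge>no. norm (nrm X (\<lambda>x. c t x - c (grid n t) x) - 0) < e"
        using n0 t by (intro exI[of _ n0]) auto
    qed
  qed
qed

lemma L2_time_of_continuous:
  assumes sm: "strongly_measurable I X c" and M: "\<And>t. t \<in> {0..T} \<Longrightarrow> \<bar>nrm X (c t)\<bar> \<le> M"
  shows "c \<in> L2_time I X"
proof -
  have "(\<integral>\<^sup>+t. ennreal ((nrm X (c t))\<^sup>2) \<partial>MI) \<le> (\<integral>\<^sup>+t. ennreal (M\<^sup>2) \<partial>MI)"
  proof (rule nn_integral_mono_AE)
    show "AE t in MI. ennreal ((nrm X (c t))\<^sup>2) \<le> ennreal (M\<^sup>2)"
      using AE_I_space
    proof eventually_elim
      case (elim t)
      then have "\<bar>nrm X (c t)\<bar> \<le> M" using M by auto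
      then show ?case by (intro ennreal_leI) (metis abs_ge_zero power2_abs power_mono)
    qed
  qed
  also have "\<dots> < \<infinity>" using MI.emeasure_finite[of I] by (simp add: ennreal_mult_eq_top_iff less_top[symmetric])
  finally show ?thesis using sm by (simp add: L2_time_def)
qed

end

locale evolution_domain = open_domain Om + time_interval T for Om T
begin

lemma simple_map_step_function:
  assumes s: "simple_map I (L2_space Om) s"
  shows "step_function I (\<lambda>t. cls (s t))" "t \<in> I \<Longrightarrow> s t \<in> L2"
proof -
  have f: "finite (s ` I)" and m: "\<And>g. {t\<in>I. s t = g} \<in> sets lebesgue" and L: "s ` I \<subseteq> L2"
    using s by (auto simp: simple_map_def)
  show "t \<in> I \<Longrightarrow> s t \<in> L2" using L by auto
  have "{t\<in>I. cls (s t) = g} = (\<Union>h\<in>{h\<in>s ` I. cls h = g}. {t\<in>I. s t = h})" for g by auto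
  moreover have "(\<lambda>t. cls (s t)) ` I = cls ` (s ` I)" by auto
  ultimately show "step_function I (\<lambda>t. cls (s t))"
    using f m unfolding step_function_def by (auto intro!: sets.finite_UN)
qed

lemma nrm_cls_diff: "g \<in> L2 \<Longrightarrow> h \<in> L2 \<Longrightarrow> nrm (L2_space Om) (\<lambda>x. g x - h x) = norm (cls g - cls h)"
  by (simp add: nrm_L2 L2_diff cls_diff)

lemma strongly_measurable_step_limit:
  assumes "strongly_measurable I (L2_space Om) F"
  shows "step_limit I (\<lambda>t. cls (F t))" "AE t in MI. F t \<in> L2"
proof -
  obtain s where s: "\<And>n::nat. simple_map I (L2_space Om) (s n)"
    and lim: "AE t in MI. (\<lambda>n. nrm (L2_space Om) (\<lambda>x. F t x - s n t x)) \<longlonglongrightarrow> 0"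
    and F: "AE t in MI. F t \<in> L2"
    using assms unfolding strongly_measurable_def by blast
  show "AE t in MI. F t \<in> L2" by (rule F)
  have "AE t in MI. (\<lambda>n. cls (s n t)) \<longlonglongrightarrow> cls (F t)"
    using lim F AE_I_space
  proof eventually_elim
    case (elim t)
    have "s n t \<in> L2" for n using simple_map_step_function(2)[OF s] elim(3) by auto
    then have "(\<lambda>n. norm (cls (F t) - cls (s n t))) \<longlonglongrightarrow> 0" using elim by (simp add: nrm_cls_diff)
    then have "(\<lambda>n. norm (cls (s n t) - cls (F t))) \<longlonglongrightarrow> 0" by (simp add: norm_minus_commute)
    then show ?case unfolding tendsto_norm_zero_iff by (rule LIM_zero_cancel)
  qed
  then show "step_limit I (\<lambda>t. cls (F t))"
    unfolding step_limit_def using simple_map_step_function(1)[OF s] by (intro exI[of _ "\<lambda>n t. cls (s n t)"]) blast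
qed

lemma integral_simple_map:
  assumes s: "simple_map I (L2_space Om) s"
  shows "integrable MI (\<lambda>t. inner (cls (s t)) h)"
    and "(\<integral>t. inner (cls (s t)) h \<partial>MI) = inner (cls (simple_int I s)) h"
    and "simple_int I s \<in> L2"
proof -
  have f: "finite (s ` I)" and m: "\<And>g. {t\<in>I. s t = g} \<in> sets lebesgue" and L: "\<And>g. g \<in> s ` I \<Longrightarrow> g \<in> L2"
    using s by (auto simp: simple_map_def)
  have st: "step_function I s" using f m by (simp add: step_function_def)
  let ?A = "\<lambda>g. {t\<in>I. s t = g}"
  have eq: "inner (cls (s t)) h = (\<Sum>g\<in>s ` I. indicator (?A g) t * inner (cls g) h)" if "t \<in> space MI" for t
    using step_function_compose_sum[OF st, of t "\<lambda>g. inner (cls g) h"] that by simp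
  have mA: "?A g \<in> sets MI" for g using m[of g] by (auto simp: sets_restrict_space_iff)
  have ii: "integrable MI (\<lambda>t. indicator (?A g) t * inner (cls g) h)" for g
  proof (rule integrable_mult_left)
    show "integrable MI (indicator (?A g) :: real \<Rightarrow> real)"
      by (rule integrable_real_indicator[OF mA]) (use MI.emeasure_finite in \<open>simp add: less_top[symmetric]\<close>)
  qed
  show "integrable MI (\<lambda>t. inner (cls (s t)) h)"
    by (subst Bochner_Integration.integrable_cong[OF refl eq]) (assumption, intro Bochner_Integration.integrable_sum ii)
  have meas: "measure MI (?A g) = measure lebesgue (?A g)" for g
    by (rule measure_restrict_space) auto
  have "(\<integral>t. inner (cls (s t)) h \<partial>MI) = (\<integral>t. (\<Sum>g\<in>s ` I. indicator (?A g) t * inner (cls g) h) \<partial>MI)"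
    by (rule Bochner_Integration.integral_cong[OF refl eq])
  also have "\<dots> = (\<Sum>g\<in>s ` I. \<integral>t. indicator (?A g) t * inner (cls g) h \<partial>MI)"
    by (rule Bochner_Integration.integral_sum[OF ii])
  also have "\<dots> = (\<Sum>g\<in>s ` I. measure lebesgue (?A g) * inner (cls g) h)"
  proof (intro sum.cong refl)
    fix g
    have "?A g \<inter> space MI = ?A g" by auto
    then have "(\<integral>t. indicator (?A g) t \<partial>MI) = measure lebesgue (?A g)"
      by (simp only: Bochner_Integration.integral_indicator meas)
    then show "(\<integral>t. indicator (?A g) t * inner (cls g) h \<partial>MI) = measure lebesgue (?A g) * inner (cls g) h"
      by (simp only: integral_mult_left_zero)
  qed
  also have "\<dots> = inner (\<Sum>g\<in>s ` I. measure lebesgue (?A g) *\<^sub>R cls g) h"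
    by (simp add: inner_sum_left)
  also have "(\<Sum>g\<in>s ` I. measure lebesgue (?A g) *\<^sub>R cls g) = cls (simple_int I s)"
    unfolding simple_int_def using L f by (subst cls_sum) (auto simp: L2_scale cls_scale)
  finally show "(\<integral>t. inner (cls (s t)) h \<partial>MI) = inner (cls (simple_int I s)) h" .
  show "simple_int I s \<in> L2" unfolding simple_int_def using L f by (intro L2_sum L2_scale) auto
qed

text \<open>
  The Bochner integral commutes with the functional \<open>inner _ h\<close>: this holds for simple maps, and both
  sides are continuous under the two limits in the definition.
\<close>

lemma has_bochner_int_weak:
  assumes B: "has_bochner_int I (L2_space Om) F w"
  shows "(\<integral>t. inner (cls (F t)) h \<partial>MI) = inner (cls w) h" "w \<in> L2"
proof -
  obtain s where sm: "strongly_measurable I (L2_space Om) F" and s: "\<And>n::nat. simple_map I (L2_space Om) (s n)"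
    and l1: "(\<lambda>n. \<integral>\<^sup>+t. ennreal (nrm (L2_space Om) (\<lambda>x. F t x - s n t x)) \<partial>MI) \<longlonglongrightarrow> 0"
    and l2: "(\<lambda>n. nrm (L2_space Om) (\<lambda>x. simple_int I (s n) x - w x)) \<longlonglongrightarrow> 0"
    and w: "w \<in> L2"
    using B unfolding has_bochner_int_def by blast
  show "w \<in> L2" by (rule w)
  note SL = strongly_measurable_step_limit[OF sm]
  let ?f = "\<lambda>t. inner (cls (F t)) h"
  have fm: "?f \<in> borel_measurable MI"
    by (rule step_limit_measurable[OF SL(1)]) (auto intro!: continuous_intros)
  have Fn: "AE t in MI. nrm (L2_space Om) (\<lambda>x. F t x - s n t x) = norm (cls (F t) - cls (s n t))" for n
    using SL(2) AE_I_space
  proof eventually_elim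
    case (elim t)
    then have "s n t \<in> L2" using simple_map_step_function(2)[OF s] by auto
    then show ?case using elim by (simp add: nrm_cls_diff)
  qed
  define \<delta> where "\<delta> n = (\<integral>\<^sup>+t. ennreal (nrm (L2_space Om) (\<lambda>x. F t x - s n t x)) \<partial>MI)" for n
  have bd: "(\<integral>\<^sup>+t. ennreal \<bar>?f t - inner (cls (s n t)) h\<bar> \<partial>MI) \<le> ennreal (norm h) * \<delta> n" for n
  proof -
    have "(\<integral>\<^sup>+t. ennreal \<bar>?f t - inner (cls (s n t)) h\<bar> \<partial>MI)
        \<le> (\<integral>\<^sup>+t. ennreal (norm h) * ennreal (norm (cls (F t) - cls (s n t))) \<partial>MI)"
    proof (rule nn_integral_mono)
      fix t
      have "\<bar>?f t - inner (cls (s n t)) h\<bar> \<le> norm h * norm (cls (F t) - cls (s n t))"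
        using Cauchy_Schwarz_ineq2[of "cls (F t) - cls (s n t)" h] by (simp add: inner_diff_left mult.commute)
      then show "ennreal \<bar>?f t - inner (cls (s n t)) h\<bar> \<le> ennreal (norm h) * ennreal (norm (cls (F t) - cls (s n t)))"
        by (simp add: ennreal_mult[symmetric] ennreal_leI)
    qed
    also have "\<dots> = ennreal (norm h) * (\<integral>\<^sup>+t. ennreal (norm (cls (F t) - cls (s n t))) \<partial>MI)"
    proof (rule nn_integral_cmult)
      obtain r where r: "\<And>k::nat. step_function I (r k)" and rl: "AE t in MI. (\<lambda>k. r k t) \<longlonglongrightarrow> cls (F t)"
        using SL(1) unfolding step_limit_def by blast
      have fin: "finite ((\<lambda>t. cls (s n t)) ` I)"
        using simple_map_step_function(1)[OF s] by (simp add: step_function_def)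
      have "step_function I (\<lambda>t. r k t - cls (s n t))" for k
      proof -
        have "(\<lambda>t. r k t - cls (s n t)) ` I \<subseteq> (\<lambda>z. fst z - snd z) ` (r k ` I \<times> (\<lambda>t. cls (s n t)) ` I)" by force
        then have f1: "finite ((\<lambda>t. r k t - cls (s n t)) ` I)"
          using r[of k] fin by (meson finite_SigmaI finite_imageI finite_subset step_function_def)
        have eqS: "{t\<in>I. r k t - cls (s n t) = g} = (\<Union>a\<in>(\<lambda>t. cls (s n t)) ` I. {t\<in>I. r k t = g + a} \<inter> {t\<in>I. cls (s n t) = a})" for g
          by (auto simp: algebra_simps)
        have inS: "{t\<in>I. r k t = g + a} \<inter> {t\<in>I. cls (s n t) = a} \<in> sets lebesgue" for a g
          using r[of k] simple_map_step_function(1)[OF s, of n]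
          unfolding step_function_def by (intro sets.Int) blast+
        have "{t\<in>I. r k t - cls (s n t) = g} \<in> sets lebesgue" for g
          unfolding eqS by (rule sets.finite_UN[OF fin inS])
        then show ?thesis using f1 by (simp add: step_function_def)
      qed
      moreover have "AE t in MI. (\<lambda>k. r k t - cls (s n t)) \<longlonglongrightarrow> cls (F t) - cls (s n t)"
        using rl by eventually_elim (intro tendsto_intros)
      ultimately have "step_limit I (\<lambda>t. cls (F t) - cls (s n t))"
        unfolding step_limit_def by (intro exI[of _ "\<lambda>k t. r k t - cls (s n t)"]) blast
      then have "(\<lambda>t. norm (cls (F t) - cls (s n t))) \<in> borel_measurable MI"
        by (rule step_limit_measurable) (auto intro!: continuous_intros)
      then show "(\<lambda>t. ennreal (norm (cls (F t) - cls (s n t)))) \<in> borel_measurable MI" by measurable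
    qed
    also have "(\<integral>\<^sup>+t. ennreal (norm (cls (F t) - cls (s n t))) \<partial>MI) = \<delta> n"
      unfolding \<delta>_def by (rule nn_integral_cong_AE) (use Fn[of n] in \<open>auto elim: eventually_mono\<close>)
    finally show ?thesis .
  qed
  have lim0: "(\<lambda>n. ennreal (norm h) * \<delta> n) \<longlonglongrightarrow> 0"
    using ennreal_tendsto_cmult[OF _ l1[folded \<delta>_def], of "ennreal (norm h)"] by simp
  have fi: "integrable MI ?f"
  proof -
    obtain n where n: "ennreal (norm h) * \<delta> n < 1"
      using order_tendstoD(2)[OF lim0, of 1] by (auto simp: eventually_sequentially)
    have "integrable MI (\<lambda>t. ?f t - inner (cls (s n t)) h)"
    proof (rule integrableI_bounded)
      show "(\<lambda>t. ?f t - inner (cls (s n t)) h) \<in> borel_measurable MI"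
        using fm integral_simple_map(1)[OF s, of n h] by auto
      show "(\<integral>\<^sup>+t. ennreal (norm (?f t - inner (cls (s n t)) h)) \<partial>MI) < \<infinity>"
        using order.strict_trans[OF order.strict_trans1[OF bd n] ennreal_one_less_top] by simp
    qed
    from Bochner_Integration.integrable_add[OF this integral_simple_map(1)[OF s, of n h]]
    show ?thesis by simp
  qed
  have d: "ennreal \<bar>(\<integral>t. ?f t \<partial>MI) - inner (cls (simple_int I (s n))) h\<bar> \<le> ennreal (norm h) * \<delta> n" for n
  proof -
    have "(\<integral>t. ?f t \<partial>MI) - inner (cls (simple_int I (s n))) h = (\<integral>t. ?f t - inner (cls (s n t)) h \<partial>MI)"
      using fi integral_simple_map(1)[OF s, of n h] integral_simple_map(2)[OF s, of n h] by simp
    also have "ennreal \<bar>\<dots>\<bar> \<le> (\<integral>\<^sup>+t. ennreal (norm (?f t - inner (cls (s n t)) h)) \<partial>MI)"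
      using integral_norm_bound_ennreal[of MI "\<lambda>t. ?f t - inner (cls (s n t)) h"] fi integral_simple_map(1)[OF s, of n h]
      by simp
    also have "\<dots> \<le> ennreal (norm h) * \<delta> n" using bd[of n] by simp
    finally show ?thesis .
  qed
  have "(\<lambda>n. ennreal \<bar>(\<integral>t. ?f t \<partial>MI) - inner (cls (simple_int I (s n))) h\<bar>) \<longlonglongrightarrow> 0"
    by (rule tendsto_sandwich[OF _ _ tendsto_const lim0]) (use d in auto)
  then have "(\<lambda>n. \<bar>(\<integral>t. ?f t \<partial>MI) - inner (cls (simple_int I (s n))) h\<bar>) \<longlonglongrightarrow> 0"
    by (simp add: tendsto_ennreal_iff[of _ _ 0, simplified])
  then have "(\<lambda>n. \<bar>inner (cls (simple_int I (s n))) h - (\<integral>t. ?f t \<partial>MI)\<bar>) \<longlonglongrightarrow> 0"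
    by (subst abs_minus_commute)
  then have "(\<lambda>n. inner (cls (simple_int I (s n))) h - (\<integral>t. ?f t \<partial>MI)) \<longlonglongrightarrow> 0"
    by (rule tendsto_rabs_zero_cancel)
  then have A: "(\<lambda>n. inner (cls (simple_int I (s n))) h) \<longlonglongrightarrow> (\<integral>t. ?f t \<partial>MI)"
    by (rule LIM_zero_cancel)
  have "(\<lambda>n. norm (cls (simple_int I (s n)) - cls w)) \<longlonglongrightarrow> 0"
    using l2 integral_simple_map(3)[OF s] w by (simp add: nrm_cls_diff)
  then have "(\<lambda>n. cls (simple_int I (s n))) \<longlonglongrightarrow> cls w"
    unfolding tendsto_norm_zero_iff by (rule LIM_zero_cancel)
  then have "(\<lambda>n. inner (cls (simple_int I (s n))) h) \<longlonglongrightarrow> inner (cls w) h" by (intro tendsto_intros)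
  with A show "(\<integral>t. ?f t \<partial>MI) = inner (cls w) h" by (rule LIMSEQ_unique)
qed

lemma L2_time_props:
  assumes u: "u \<in> L2_time I (L2_space Om)"
  shows "AE t in MI. u t \<in> L2" "step_limit I (\<lambda>t. cls (u t))"
    "integrable MI (\<lambda>t. norm (cls (u t)))" "integrable MI (\<lambda>t. inner (cls (u t)) h)"
proof -
  have sm: "strongly_measurable I (L2_space Om) u" and fin: "(\<integral>\<^sup>+t. ennreal ((nrm (L2_space Om) (u t))\<^sup>2) \<partial>MI) < \<infinity>"
    using u by (auto simp: L2_time_def)
  show L: "AE t in MI. u t \<in> L2" and SL: "step_limit I (\<lambda>t. cls (u t))"
    using strongly_measurable_step_limit[OF sm] by auto
  have nm: "(\<lambda>t. norm (cls (u t))) \<in> borel_measurable MI"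
    by (rule step_limit_measurable[OF SL]) (auto intro!: continuous_intros)
  have hm: "(\<lambda>t. inner (cls (u t)) h) \<in> borel_measurable MI"
    by (rule step_limit_measurable[OF SL]) (auto intro!: continuous_intros)
  have "(\<integral>\<^sup>+t. ennreal ((norm (cls (u t)))\<^sup>2) \<partial>MI) = (\<integral>\<^sup>+t. ennreal ((nrm (L2_space Om) (u t))\<^sup>2) \<partial>MI)"
    by (rule nn_integral_cong_AE) (use L in \<open>auto simp: nrm_L2 elim: eventually_mono\<close>)
  then have "integrable MI (\<lambda>t. (norm (cls (u t)))\<^sup>2)"
    using fin nm by (intro integrableI_bounded) auto
  then show ni: "integrable MI (\<lambda>t. norm (cls (u t)))"
    using nm MI.square_integrable_imp_integrable by blast
  show "integrable MI (\<lambda>t. inner (cls (u t)) h)"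
  proof (rule Bochner_Integration.integrable_bound[OF _ hm])
    show "integrable MI (\<lambda>t. norm (cls (u t)) * norm h)" using ni by simp
  qed (auto simp: Cauchy_Schwarz_ineq2)
qed

text \<open>
  Reduces the vector-valued weak derivative to scalar ones.
\<close>

lemma is_time_deriv_weak:
  assumes u: "u \<in> L2_time I (L2_space Om)" and d: "is_time_deriv I (L2_space Om) u v" and \<phi>: "test_fun I \<phi>"
  shows "(\<integral>t. deriv \<phi> t * inner (cls (u t)) h \<partial>MI) = - (\<integral>t. \<phi> t * inner (cls (v t)) h \<partial>MI)"
proof -
  have v: "v \<in> L2_time I (L2_space Om)" using d by (simp add: is_time_deriv_def)
  obtain w where w: "has_bochner_int I (L2_space Om) (\<lambda>t x. deriv \<phi> t *\<^sub>R u t x) w"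
    and w': "has_bochner_int I (L2_space Om) (\<lambda>t x. \<phi> t *\<^sub>R v t x) (\<lambda>x. - w x)"
    using d \<phi> unfolding is_time_deriv_def by blast
  have m: "(\<lambda>t. k t * inner (cls (g t)) h) \<in> borel_measurable MI"
    if "k \<in> borel_measurable MI" "g \<in> L2_time I (L2_space Om)" for k and g :: "real \<Rightarrow> plane \<Rightarrow> 'a"
    by (rule borel_measurable_times[OF that(1) borel_measurable_integrable[OF L2_time_props(4)[OF that(2)]]])
  have eq: "(\<integral>t. inner (cls (\<lambda>x. k t *\<^sub>R g t x)) h \<partial>MI) = (\<integral>t. k t * inner (cls (g t)) h \<partial>MI)"
    if g: "g \<in> L2_time I (L2_space Om)" and k: "k \<in> borel_measurable MI" for k and g :: "real \<Rightarrow> plane \<Rightarrow> 'a"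
  proof (rule integral_cong_AE)
    show e: "AE t in MI. inner (cls (\<lambda>x. k t *\<^sub>R g t x)) h = k t * inner (cls (g t)) h"
      using L2_time_props(1)[OF g] by eventually_elim (simp add: cls_scale)
    show mm: "(\<lambda>t. k t * inner (cls (g t)) h) \<in> borel_measurable MI" by (rule m[OF k g])
    show "(\<lambda>t. inner (cls (\<lambda>x. k t *\<^sub>R g t x)) h) \<in> borel_measurable MI"
      by (rule borel_measurable_lebesgue_on_AE[OF mm]) (use e in \<open>auto elim: eventually_mono\<close>)
  qed
  obtain a b where "continuous_on UNIV (deriv \<phi>)" using test_fun_interval[OF \<phi> T_pos] by metis
  then have dm: "deriv \<phi> \<in> borel_measurable MI" by (rule borel_measurable_lebesgue_on_continuous)
  have pm: "\<phi> \<in> borel_measurable MI" by (rule borel_measurable_lebesgue_on_continuous[OF test_funD(5)[OF \<phi>]])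
  have wL: "w \<in> L2" by (rule has_bochner_int_weak(2)[OF w])
  show ?thesis
    using has_bochner_int_weak(1)[OF w, of h] has_bochner_int_weak(1)[OF w', of h]
    by (simp add: eq[OF u dm] eq[OF v pm] cls_uminus wL)
qed

text \<open>
  Two weak derivatives agree against each vector by the fundamental lemma, hence almost everywhere by
  separability of their values.
\<close>

lemma time_deriv_unique:
  assumes u: "u \<in> L2_time I (L2_space Om)" and d: "is_time_deriv I (L2_space Om) u v" "is_time_deriv I (L2_space Om) u v'"
  shows "AE t in MI. cls (v t) = cls (v' t)"
proof -
  have v: "v \<in> L2_time I (L2_space Om)" "v' \<in> L2_time I (L2_space Om)" using d by (auto simp: is_time_deriv_def)
  have "AE t in MI. cls (v t) - cls (v' t) = 0"
  proof (rule separably_valued_eq_0)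
    show "separably_valued I (\<lambda>t. cls (v t) - cls (v' t))"
      by (intro separably_valued_diff step_limit_separably_valued L2_time_props v)
    fix h
    note i = L2_time_props(4)[OF v(1), of h] L2_time_props(4)[OF v(2), of h]
    show "AE t in MI. inner (cls (v t) - cls (v' t)) h = 0"
    proof (rule fundamental_lemma_lebesgue_on)
      show "integrable MI (\<lambda>t. inner (cls (v t) - cls (v' t)) h)" using i by (simp add: inner_diff_left)
      fix \<phi> :: "real \<Rightarrow> real" assume \<phi>: "test_fun I \<phi>"
      obtain C where C: "\<And>x. norm (\<phi> x) \<le> C"
        using continuous_bounded_of_supp[OF test_funD(5,2)[OF \<phi>] test_fun_deriv_support(1)[OF \<phi>]] by blast
      have j: "integrable MI (\<lambda>t. \<phi> t * inner (cls (v t)) h)" "integrable MI (\<lambda>t. \<phi> t * inner (cls (v' t)) h)"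
        using i C by (auto intro!: integrable_bounded_mult[where C = C] borel_measurable_lebesgue_on_continuous test_funD(5)[OF \<phi>])
      show "(\<integral>t. \<phi> t * inner (cls (v t) - cls (v' t)) h \<partial>MI) = 0"
        using is_time_deriv_weak[OF u d(1) \<phi>, of h] is_time_deriv_weak[OF u d(2) \<phi>, of h] j
        by (simp add: inner_diff_left right_diff_distrib)
    qed simp
  qed
  then show ?thesis by eventually_elim simp
qed

lemma time_deriv_is:
  assumes "is_time_deriv I (L2_space Om) u v"
  shows "is_time_deriv I (L2_space Om) u (time_deriv I (L2_space Om) u)"
  unfolding time_deriv_def using assms someI_ex[of "is_time_deriv I (L2_space Om) u"] by blast

end

section \<open>Regularity in time\<close>

context time_interval
begin

lemma uniform_of_continuous:
  fixes C :: "real \<Rightarrow> 'b::real_normed_vector"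
  assumes "continuous_on {0..T} C" "0 < e"
  shows "\<exists>d>0. \<forall>s\<in>{0..T}. \<forall>t\<in>{0..T}. \<bar>s - t\<bar> < d \<longrightarrow> norm (C s - C t) < e"
proof -
  have "uniformly_continuous_on {0..T} C" using assms(1) compact_uniformly_continuous by blast
  then obtain d where "0 < d" "\<forall>x\<in>{0..T}. \<forall>x'\<in>{0..T}. dist x' x < d \<longrightarrow> dist (C x') (C x) < e"
    using assms(2) unfolding uniformly_continuous_on_def by meson
  then show ?thesis by (intro exI[of _ d]) (auto simp: dist_norm)
qed

lemma bounded_of_continuous:
  fixes C :: "real \<Rightarrow> 'b::real_normed_vector"
  assumes "continuous_on {0..T} C"
  obtains M where "\<And>t. t \<in> {0..T} \<Longrightarrow> norm (C t) \<le> M"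
proof -
  have "bounded (C ` {0..T})" using assms by (intro compact_imp_bounded compact_continuous_image) auto
  then show ?thesis using that unfolding bounded_iff by blast
qed

text \<open>Serves the spaces \<open>L2\<close>, \<open>H10\<close> and \<open>H(div)\<close> at once. Their seminorms are norms of Hilbert space
  vectors: of \<open>w\<close> itself, of the pair of \<open>w\<close> and its gradient, of the pair of \<open>p\<close> and its divergence.\<close>

lemma L2_time_of_continuous_curve:
  fixes C :: "real \<Rightarrow> 'b::real_normed_vector"
  assumes C: "continuous_on {0..T} C"
    and c: "\<And>t. t \<in> {0..T} \<Longrightarrow> c t \<in> carr X"
    and n: "\<And>t. t \<in> {0..T} \<Longrightarrow> nrm X (c t) = norm (C t)"
    and nd: "\<And>s t. s \<in> {0..T} \<Longrightarrow> t \<in> {0..T} \<Longrightarrow> nrm X (\<lambda>x. c s x - c t x) = norm (C s - C t)"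
  shows "c \<in> L2_time I X" "strongly_measurable I X c"
proof -
  show sm: "strongly_measurable I X c"
  proof (rule strongly_measurable_of_continuous[OF c])
    fix e :: real assume "0 < e"
    then show "\<exists>d>0. \<forall>s\<in>{0..T}. \<forall>t\<in>{0..T}. \<bar>s - t\<bar> < d \<longrightarrow> nrm X (\<lambda>x. c s x - c t x) < e"
      using uniform_of_continuous[OF C] nd by metis
  next
    fix s t assume "s \<in> {0..T}" "t \<in> {0..T}"
    then show "0 \<le> nrm X (\<lambda>x. c s x - c t x)" using nd by simp
  qed
  obtain M where "\<And>t. t \<in> {0..T} \<Longrightarrow> norm (C t) \<le> M" using bounded_of_continuous[OF C] by blast
  then show "c \<in> L2_time I X" by (intro L2_time_of_continuous[OF sm, of M]) (simp add: n)
qed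

lemma inner_integral:
  fixes C :: "real \<Rightarrow> 'h::{real_inner, banach}"
  assumes "C integrable_on S"
  shows "inner (integral S C) h = integral S (\<lambda>t. inner (C t) h)"
  using integral_linear[OF assms bounded_linear_inner_left[of h]] by (simp add: o_def)

end

context evolution_domain
begin

text \<open>
  Uniform continuity makes the grid approximations converge uniformly, so their integrals converge
  to the Riemann integral of the curve of classes.
\<close>

lemma has_bochner_int_continuous:
  assumes c: "\<And>t. t \<in> {0..T} \<Longrightarrow> c t \<in> L2" and C: "continuous_on {0..T} (\<lambda>t. cls (c t))"
    and w: "w \<in> L2" "cls w = integral {0..T} (\<lambda>t. cls (c t))"
  shows "has_bochner_int I (L2_space Om) c w"
  unfolding has_bochner_int_def
proof (intro conjI exI allI)
  let ?X = "L2_space Om :: (plane, 'a) fspace"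
  let ?s = "\<lambda>n t. c (grid n t)"
  have nd: "nrm ?X (\<lambda>x. c s x - c t x) = norm (cls (c s) - cls (c t))" if "s \<in> {0..T}" "t \<in> {0..T}" for s t
    using nrm_cls_diff c that by blast
  show "strongly_measurable I ?X c"
    by (rule L2_time_of_continuous_curve(2)[OF C c]) (auto simp: nrm_L2 c nd)
  show "w \<in> L2" by (rule w)
  show s: "simple_map I ?X (?s n)" for n
    using step_function_grid[of c n] c grid_mem[of _ n] by (auto simp: simple_map_def step_function_def)
  show "emeasure lebesgue {t \<in> I. ?s n t \<noteq> (\<lambda>_. 0)} < \<infinity>" for n
  proof -
    have "emeasure lebesgue {t \<in> I. ?s n t \<noteq> (\<lambda>_. 0)} \<le> emeasure lebesgue I" by (rule emeasure_mono) auto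
    also have "\<dots> < \<infinity>" using T_pos by simp
    finally show ?thesis .
  qed
  have close: "\<exists>n0. \<forall>n\<ge>n0. \<forall>t\<in>I. norm (cls (c t) - cls (?s n t)) < e" if "0 < e" for e
    by (rule grid_approximates[OF uniform_of_continuous[OF C] that])
  have em: "emeasure MI I = ennreal T" using T_pos by (simp add: emeasure_restrict_space)
  show "(\<lambda>n. \<integral>\<^sup>+t. ennreal (nrm ?X (\<lambda>x. c t x - ?s n t x)) \<partial>MI) \<longlonglongrightarrow> 0"
  proof (rule order_tendstoI)
    fix a :: ennreal assume a: "0 < a"
    obtain e where e: "0 < e" "ennreal (e * T) < a"
    proof (cases a)
      case (real r)
      then have "0 < r" using a by (cases "r = 0") auto
      then show ?thesis using real T_pos that[of "r / (2 * T)"] by (simp add: ennreal_less_iff)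
    next
      case top
      then show ?thesis using that[of 1] by simp
    qed
    obtain n0 where n0: "\<forall>n\<ge>n0. \<forall>t\<in>I. norm (cls (c t) - cls (?s n t)) < e" using close[OF e(1)] by blast
    have "(\<integral>\<^sup>+t. ennreal (nrm ?X (\<lambda>x. c t x - ?s n t x)) \<partial>MI) < a" if n: "n0 \<le> n" for n
    proof -
      have "(\<integral>\<^sup>+t. ennreal (nrm ?X (\<lambda>x. c t x - ?s n t x)) \<partial>MI) \<le> (\<integral>\<^sup>+t. ennreal e \<partial>MI)"
      proof (rule nn_integral_mono)
        fix t assume "t \<in> space MI"
        then have t: "t \<in> I" by simp
        then have "nrm ?X (\<lambda>x. c t x - ?s n t x) = norm (cls (c t) - cls (?s n t))" using nd grid_mem[OF t] by auto
        then show "ennreal (nrm ?X (\<lambda>x. c t x - ?s n t x)) \<le> ennreal e"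
          using n0 n t by (intro ennreal_leI) (metis less_imp_le)
      qed
      also have "\<dots> = ennreal (e * T)" using e(1) T_pos em by (simp add: ennreal_mult)
      finally show ?thesis using e(2) by simp
    qed
    then show "\<forall>\<^sub>F n in sequentially. (\<integral>\<^sup>+t. ennreal (nrm ?X (\<lambda>x. c t x - ?s n t x)) \<partial>MI) < a"
      unfolding eventually_sequentially by blast
  qed simp
  show "(\<lambda>n. nrm ?X (\<lambda>x. simple_int I (?s n) x - w x)) \<longlonglongrightarrow> 0"
  proof (rule LIMSEQ_I)
    fix r :: real assume r: "0 < r"
    define e where "e = r / (2 * T)"
    have e: "0 < e" using r T_pos by (simp add: e_def)
    obtain n0 where n0: "\<forall>n\<ge>n0. \<forall>t\<in>I. norm (cls (c t) - cls (?s n t)) < e" using close[OF e] by blast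
    show "\<exists>no. \<forall>n\<ge>no. norm (nrm ?X (\<lambda>x. simple_int I (?s n) x - w x) - 0) < r"
    proof (intro exI[of _ n0] allI impI)
      fix n assume n: "n0 \<le> n"
      let ?d = "cls (simple_int I (?s n)) - cls w"
      have Ci: "integrable MI (\<lambda>t. inner (cls (c t)) ?d)"
        by (intro integrable_MI_continuous continuous_intros C)
      have wi: "inner (cls w) ?d = (\<integral>t. inner (cls (c t)) ?d \<partial>MI)"
        unfolding w(2) using inner_integral[OF integrable_continuous_real[OF C]] integrable_on_of_MI(2)[OF Ci] w(2) by simp
      have "(norm ?d)\<^sup>2 = inner (cls (simple_int I (?s n))) ?d - inner (cls w) ?d"
        by (simp add: power2_norm_eq_inner inner_diff_left)
      also have "\<dots> = (\<integral>t. inner (cls (?s n t)) ?d - inner (cls (c t)) ?d \<partial>MI)"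
        using integral_simple_map(1)[OF s, of n ?d] integral_simple_map(2)[OF s, of n ?d] wi Ci by simp
      also have "\<dots> \<le> (\<integral>t. e * norm ?d \<partial>MI)"
      proof (rule integral_mono)
        show "integrable MI (\<lambda>t. inner (cls (?s n t)) ?d - inner (cls (c t)) ?d)"
          using integral_simple_map(1)[OF s, of n ?d] Ci by simp
        fix t assume "t \<in> space MI"
        then have t: "t \<in> I" by simp
        have "inner (cls (?s n t)) ?d - inner (cls (c t)) ?d \<le> norm (cls (?s n t) - cls (c t)) * norm ?d"
          using norm_cauchy_schwarz[of "cls (?s n t) - cls (c t)" ?d] by (simp only: inner_diff_left)
        also have "\<dots> \<le> e * norm ?d"
          using n0 n t by (intro mult_right_mono) (auto simp: norm_minus_commute less_imp_le)
        finally show "inner (cls (?s n t)) ?d - inner (cls (c t)) ?d \<le> e * norm ?d" .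
      qed simp
      also have "\<dots> = T * e * norm ?d" using em T_pos by (simp add: measure_def)
      finally have "norm ?d * norm ?d \<le> (T * e) * norm ?d" by (simp add: power2_eq_square)
      then have "norm ?d \<le> T * e" using T_pos e by (cases "norm ?d = 0") (auto simp: mult_le_cancel_right)
      also have "T * e < r" using r T_pos by (simp add: e_def)
      finally show "norm (nrm ?X (\<lambda>x. simple_int I (?s n) x - w x) - 0) < r"
        using integral_simple_map(3)[OF s] w(1) by (simp add: nrm_cls_diff)
    qed
  qed
qed

lemma restr_integral:
  assumes "C integrable_on S" "\<And>t. t \<in> S \<Longrightarrow> restr (C t) = C t"
  shows "restr (integral S C) = integral S C"
proof -
  have "integral S (restr \<circ> C) = restr (integral S C)" by (rule integral_linear[OF assms(1) bounded_linear_restr])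
  moreover have "integral S (restr \<circ> C) = integral S C" by (rule integral_cong) (simp add: assms(2))
  ultimately show ?thesis by simp
qed

lemma L2_time_L2:
  assumes c: "\<And>t. t \<in> {0..T} \<Longrightarrow> c t \<in> L2" and C: "continuous_on {0..T} (\<lambda>t. cls (c t))"
  shows "c \<in> L2_time I (L2_space Om)"
  by (rule L2_time_of_continuous_curve(1)[OF C c]) (auto simp: nrm_L2 nrm_cls_diff c)

text \<open>
  For a test function \<open>\<phi>\<close> the curve \<open>\<phi> c\<close> vanishes at both ends, so the integral of its classical
  derivative is zero.
\<close>

lemma is_time_deriv_C1:
  assumes c: "\<And>t. t \<in> {0..T} \<Longrightarrow> c t \<in> L2" and v: "\<And>t. t \<in> {0..T} \<Longrightarrow> v t \<in> L2"
    and V: "continuous_on {0..T} (\<lambda>t. cls (v t))"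
    and D: "\<And>t. t \<in> {0..T} \<Longrightarrow> ((\<lambda>t. cls (c t)) has_vector_derivative cls (v t)) (at t within {0..T})"
  shows "is_time_deriv I (L2_space Om) c v" "c \<in> H1_time I (L2_space Om)"
proof -
  have C: "continuous_on {0..T} (\<lambda>t. cls (c t))"
    using D by (meson continuous_on_eq_continuous_within has_vector_derivative_continuous)
  show td: "is_time_deriv I (L2_space Om) c v"
    unfolding is_time_deriv_def
  proof (intro conjI allI impI)
    show "v \<in> L2_time I (L2_space Om)" by (rule L2_time_L2[OF v V])
    fix \<phi> :: "real \<Rightarrow> real" assume \<phi>: "test_fun I \<phi>"
    obtain a b where ab: "0 < a" "a \<le> b" "b < T" "\<And>x. x \<notin> {a..b} \<Longrightarrow> \<phi> x = 0"
      and dc: "continuous_on UNIV (deriv \<phi>)" and d: "\<And>x. (\<phi> has_real_derivative deriv \<phi> x) (at x)"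
      using test_fun_interval[OF \<phi> T_pos] by metis
    have \<phi>c: "continuous_on {0..T} \<phi>" by (rule test_funD(5)[OF \<phi>])
    have dc': "continuous_on {0..T} (deriv \<phi>)" using dc continuous_on_subset by blast
    have E1: "continuous_on {0..T} (\<lambda>t. deriv \<phi> t *\<^sub>R cls (c t))" by (intro continuous_intros dc' C)
    have E2: "continuous_on {0..T} (\<lambda>t. \<phi> t *\<^sub>R cls (v t))" by (intro continuous_intros \<phi>c V)
    define W where "W = integral {0..T} (\<lambda>t. deriv \<phi> t *\<^sub>R cls (c t))"
    have rW: "restr W = W"
      unfolding W_def
      by (rule restr_integral[OF integrable_continuous_real[OF E1]])
        (simp add: c restr_cls linear_simps(5)[OF bounded_linear_restr])
    have "((\<lambda>t. \<phi> t *\<^sub>R cls (v t) + deriv \<phi> t *\<^sub>R cls (c t)) has_integral \<phi> T *\<^sub>R cls (c T) - \<phi> 0 *\<^sub>R cls (c 0)) {0..T}"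
    proof (rule fundamental_theorem_of_calculus)
      fix t assume t: "t \<in> {0..T}"
      show "((\<lambda>t. \<phi> t *\<^sub>R cls (c t)) has_vector_derivative \<phi> t *\<^sub>R cls (v t) + deriv \<phi> t *\<^sub>R cls (c t)) (at t within {0..T})"
        by (rule has_vector_derivative_scaleR[OF has_field_derivative_at_within[OF d] D[OF t]])
    qed (use T_pos in simp)
    then have "integral {0..T} (\<lambda>t. \<phi> t *\<^sub>R cls (v t) + deriv \<phi> t *\<^sub>R cls (c t)) = 0"
      using ab by (simp add: integral_unique)
    then have W2: "integral {0..T} (\<lambda>t. \<phi> t *\<^sub>R cls (v t)) = - W"
      using integral_add[OF integrable_continuous_real[OF E2] integrable_continuous_real[OF E1]]
      by (simp add: W_def eq_neg_iff_add_eq_0)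
    show "\<exists>w. has_bochner_int I (L2_space Om) (\<lambda>t x. deriv \<phi> t *\<^sub>R c t x) w \<and>
        has_bochner_int I (L2_space Om) (\<lambda>t x. \<phi> t *\<^sub>R v t x) (\<lambda>x. - w x)"
    proof (intro exI[of _ "rep_l2 W"] conjI)
      have cw: "cls (rep_l2 W) = W" using rW by (simp add: restr_def)
      show "has_bochner_int I (L2_space Om) (\<lambda>t x. deriv \<phi> t *\<^sub>R c t x) (rep_l2 W)"
      proof (rule has_bochner_int_continuous)
        show "continuous_on {0..T} (\<lambda>t. cls (\<lambda>x. deriv \<phi> t *\<^sub>R c t x))"
          using E1 by (rule continuous_on_eq) (simp add: cls_scale c)
        have "integral {0..T} (\<lambda>t. cls (\<lambda>x. deriv \<phi> t *\<^sub>R c t x)) = W"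
          unfolding W_def by (rule integral_cong) (simp add: cls_scale c)
        then show "cls (rep_l2 W) = integral {0..T} (\<lambda>t. cls (\<lambda>x. deriv \<phi> t *\<^sub>R c t x))" using cw by simp
      next
        show "(\<lambda>x. deriv \<phi> t *\<^sub>R c t x) \<in> L2" if "t \<in> {0..T}" for t by (rule L2_scale[OF c[OF that]])
      qed (rule rep_L2)
      show "has_bochner_int I (L2_space Om) (\<lambda>t x. \<phi> t *\<^sub>R v t x) (\<lambda>x. - rep_l2 W x)"
      proof (rule has_bochner_int_continuous)
        show "continuous_on {0..T} (\<lambda>t. cls (\<lambda>x. \<phi> t *\<^sub>R v t x))"
          using E2 by (rule continuous_on_eq) (simp add: cls_scale v)
        have "integral {0..T} (\<lambda>t. cls (\<lambda>x. \<phi> t *\<^sub>R v t x)) = - W"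
          unfolding W2[symmetric] by (rule integral_cong) (simp add: cls_scale v)
        then show "cls (\<lambda>x. - rep_l2 W x) = integral {0..T} (\<lambda>t. cls (\<lambda>x. \<phi> t *\<^sub>R v t x))"
          using cw by (simp add: cls_uminus rep_L2)
      next
        show "(\<lambda>x. \<phi> t *\<^sub>R v t x) \<in> L2" if "t \<in> {0..T}" for t by (rule L2_scale[OF v[OF that]])
      qed (rule L2_uminus[OF rep_L2])
    qed
  qed
  then show "c \<in> H1_time I (L2_space Om)" using L2_time_L2[OF c C] by (auto simp: H1_time_def)
qed

lemma time_deriv_C1:
  assumes c: "\<And>t. t \<in> {0..T} \<Longrightarrow> c t \<in> L2" and v: "\<And>t. t \<in> {0..T} \<Longrightarrow> v t \<in> L2"
    and V: "continuous_on {0..T} (\<lambda>t. cls (v t))"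
    and D: "\<And>t. t \<in> {0..T} \<Longrightarrow> ((\<lambda>t. cls (c t)) has_vector_derivative cls (v t)) (at t within {0..T})"
  shows "AE t in MI. AE x in lebesgue_on Om. time_deriv I (L2_space Om) c t x = v t x"
proof -
  have td: "is_time_deriv I (L2_space Om) c v" by (rule is_time_deriv_C1(1)[OF c v V D])
  have "c \<in> H1_time I (L2_space Om)" by (rule is_time_deriv_C1(2)[OF c v V D])
  then have cL: "c \<in> L2_time I (L2_space Om)" by (simp add: H1_time_def)
  note td' = time_deriv_is[OF td]
  have "time_deriv I (L2_space Om) c \<in> L2_time I (L2_space Om)" using td' by (simp add: is_time_deriv_def)
  from L2_time_props(1)[OF this] time_deriv_unique[OF cL td' td] AE_I_space
  show ?thesis
  proof eventually_elim
    case (elim t)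
    then show ?case using v[of t] by (simp add: cls_eq_iff)
  qed
qed

lemma L2_time_H10:
  assumes w: "\<And>t. t \<in> {0..T} \<Longrightarrow> w t \<in> L2" and g: "\<And>t. t \<in> {0..T} \<Longrightarrow> g t \<in> L2"
    and gr: "\<And>t. t \<in> {0..T} \<Longrightarrow> (cls (w t), cls (g t)) \<in> grad_graph"
    and W: "continuous_on {0..T} (\<lambda>t. cls (w t))" and G: "continuous_on {0..T} (\<lambda>t. cls (g t))"
  shows "w \<in> L2_time I (H10_space Om)"
proof (rule L2_time_of_continuous_curve(1))
  show "continuous_on {0..T} (\<lambda>t. (cls (w t), cls (g t)))" by (intro continuous_on_Pair W G)
  fix t assume t: "t \<in> {0..T}"
  note P = grad_graph_rep[OF gr[OF t] w[OF t] g[OF t] refl refl]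
  show "w t \<in> carr (H10_space Om)" by (rule P)
  show "nrm (H10_space Om) (w t) = norm (cls (w t), cls (g t))"
    unfolding nrm_H10 by (rule nrm_H1[OF w[OF t] P(1)])
  fix s assume s: "s \<in> {0..T}"
  note Q = grad_graph_rep[OF gr[OF s] w[OF s] g[OF s] refl refl]
  show "nrm (H10_space Om) (\<lambda>x. w s x - w t x) = norm ((cls (w s), cls (g s)) - (cls (w t), cls (g t)))"
    unfolding nrm_H10
    using nrm_H1[OF L2_diff[OF w[OF s] w[OF t]] is_weak_grad_diff[OF w[OF s] Q(1) w[OF t] P(1)]]
    by (simp add: cls_diff w[OF s] w[OF t] g[OF s] g[OF t])
qed

lemma L2_time_Hdiv:
  assumes p: "\<And>t. t \<in> {0..T} \<Longrightarrow> p t \<in> L2" and d: "\<And>t. t \<in> {0..T} \<Longrightarrow> is_weak_div Om (p t) (d t)"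
    and P: "continuous_on {0..T} (\<lambda>t. cls (p t))" and Dv: "continuous_on {0..T} (\<lambda>t. cls (d t))"
  shows "p \<in> L2_time I (Hdiv_space Om)"
proof (rule L2_time_of_continuous_curve(1))
  show "continuous_on {0..T} (\<lambda>t. (cls (p t), cls (d t)))" by (intro continuous_on_Pair P Dv)
  have dL: "d t \<in> L2" if "t \<in> {0..T}" for t using d[OF that] by (simp add: is_weak_div_def)
  fix t assume t: "t \<in> {0..T}"
  show "p t \<in> carr (Hdiv_space Om)" using p[OF t] d[OF t] by (auto simp: Hdiv_carr)
  show "nrm (Hdiv_space Om) (p t) = norm (cls (p t), cls (d t))" by (rule nrm_Hdiv[OF p[OF t] d[OF t]])
  fix s assume s: "s \<in> {0..T}"
  show "nrm (Hdiv_space Om) (\<lambda>x. p s x - p t x) = norm ((cls (p s), cls (d s)) - (cls (p t), cls (d t)))"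
    using nrm_Hdiv[OF L2_diff[OF p[OF s] p[OF t]] is_weak_div_diff[OF p[OF s] d[OF s] p[OF t] d[OF t]]]
    by (simp add: cls_diff p[OF s] p[OF t] dL[OF s] dL[OF t])
qed

lemma has_initial_value_continuous:
  assumes c: "\<And>t. t \<in> {0..T} \<Longrightarrow> c t \<in> L2" and C: "continuous_on {0..T} (\<lambda>t. cls (c t))"
    and "cls (c 0) = 0"
  shows "has_initial_value T (L2_space Om) c (\<lambda>_. 0)"
  unfolding has_initial_value_def
proof (intro exI[of _ c] conjI ballI)
  fix t0 assume t0: "t0 \<in> {0..T}"
  have "((\<lambda>t. cls (c t)) \<longlongrightarrow> cls (c t0)) (at t0 within {0..T})" using C t0 by (simp add: continuous_on)
  then have "((\<lambda>t. norm (cls (c t) - cls (c t0))) \<longlongrightarrow> 0) (at t0 within {0..T})"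
    by (intro tendsto_norm_zero LIM_zero)
  moreover have "\<forall>\<^sub>F t in at t0 within {0..T}. norm (cls (c t) - cls (c t0)) = nrm (L2_space Om) (\<lambda>x. c t x - c t0 x)"
    unfolding eventually_at_filter
    by (rule always_eventually) (use nrm_cls_diff[OF c c[OF t0]] in metis)
  ultimately show "((\<lambda>t. nrm (L2_space Om) (\<lambda>x. c t x - c t0 x)) \<longlongrightarrow> 0) (at t0 within {0..T})"
    by (rule Lim_transform_eventually)
next
  show "AE t in MI. nrm (L2_space Om) (\<lambda>x. c t x - c t x) = 0"
    by (rule AE_I2) (simp add: nrm_L2 L2_zero cls_zero)
  show "nrm (L2_space Om) (\<lambda>x. c 0 x - 0) = 0" using assms T_pos by (simp add: nrm_L2)
qed (rule c)

lemma has_initial_value_curve: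
  assumes u: "u \<in> L2_time I (L2_space Om)" and i: "has_initial_value T (L2_space Om) u (\<lambda>_. 0)"
  obtains C where "continuous_on {0..T} C" "C 0 = 0" "AE t in MI. cls (u t) = C t"
proof -
  obtain c where c: "\<And>t. t \<in> {0..T} \<Longrightarrow> c t \<in> L2"
    and l: "\<And>t0. t0 \<in> {0..T} \<Longrightarrow> ((\<lambda>t. nrm (L2_space Om) (\<lambda>x. c t x - c t0 x)) \<longlongrightarrow> 0) (at t0 within {0..T})"
    and ae: "AE t in MI. nrm (L2_space Om) (\<lambda>x. u t x - c t x) = 0"
    and z: "nrm (L2_space Om) (\<lambda>x. c 0 x - 0) = 0"
    using i unfolding has_initial_value_def by blast
  show ?thesis
  proof (rule that[of "\<lambda>t. cls (c t)"])
    show "continuous_on {0..T} (\<lambda>t. cls (c t))"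
      unfolding continuous_on
    proof
      fix t0 assume t0: "t0 \<in> {0..T}"
      have "\<forall>\<^sub>F t in at t0 within {0..T}. nrm (L2_space Om) (\<lambda>x. c t x - c t0 x) = norm (cls (c t) - cls (c t0))"
        unfolding eventually_at_filter
        by (rule always_eventually) (use nrm_cls_diff[OF c c[OF t0]] in metis)
      from Lim_transform_eventually[OF l[OF t0] this]
      show "((\<lambda>t. cls (c t)) \<longlongrightarrow> cls (c t0)) (at t0 within {0..T})"
        unfolding tendsto_norm_zero_iff by (rule LIM_zero_cancel)
    qed
    show "cls (c 0) = 0" using z c[of 0] T_pos by (simp add: nrm_L2)
    show "AE t in MI. cls (u t) = cls (c t)"
      using ae L2_time_props(1)[OF u] AE_I_space
      by eventually_elim (simp add: nrm_cls_diff c)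
  qed
qed

lemma H1_time_primitive:
  assumes u: "u \<in> L2_time I (L2_space Om)" and d: "is_time_deriv I (L2_space Om) u v"
    and C: "continuous_on {0..T} C" "AE t in MI. cls (u t) = C t" and t: "t \<in> {0..T}"
  shows "inner (C t) h = inner (C 0) h + integral {0..t} (\<lambda>s. inner (cls (v s)) h)"
proof -
  have v: "v \<in> L2_time I (L2_space Om)" using d by (simp add: is_time_deriv_def)
  show ?thesis
    by (rule weak_primitive_continuous[OF C L2_time_props(4)[OF u] L2_time_props(4)[OF v] is_time_deriv_weak[OF u d] t])
qed

text \<open>
  The weak derivative of \<open>f\<close> has itself an integrable weak derivative and therefore a continuous
  representative; \<open>f\<close> vanishes initially, so it is the primitive of that representative.
\<close>

lemma H2_time_C1:
  assumes f: "f \<in> H2_time I (L2_space Om)" and i: "has_initial_value T (L2_space Om) f (\<lambda>_. 0)"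
  obtains F F' where "continuous_on {0..T} F'" "F 0 = 0"
    "\<And>t. t \<in> {0..T} \<Longrightarrow> (F has_vector_derivative F' t) (at t within {0..T})"
    "AE t in MI. f t \<in> L2 \<and> cls (f t) = F t"
proof -
  let ?X = "L2_space Om :: (plane, 'a) fspace"
  define f1 where "f1 = time_deriv I ?X f"
  define f2 where "f2 = time_deriv I ?X f1"
  have fL: "f \<in> L2_time I ?X" using f by (simp add: H2_time_def H1_time_def)
  obtain v where "is_time_deriv I ?X f v" using f by (auto simp: H2_time_def H1_time_def)
  then have d1: "is_time_deriv I ?X f f1" unfolding f1_def by (rule time_deriv_is)
  have f1L: "f1 \<in> L2_time I ?X" using d1 by (simp add: is_time_deriv_def)
  obtain v where "is_time_deriv I ?X f1 v" using f by (auto simp: H2_time_def H1_time_def f1_def)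
  then have d2: "is_time_deriv I ?X f1 f2" unfolding f2_def by (rule time_deriv_is)
  have f2L: "f2 \<in> L2_time I ?X" using d2 by (simp add: is_time_deriv_def)
  obtain C1 where C1: "continuous_on {0..T} C1" "AE t in MI. cls (f1 t) = C1 t"
    by (rule continuous_representative[OF step_limit_separably_valued[OF L2_time_props(2)[OF f1L]]
          L2_time_props(4)[OF f1L] L2_time_props(4)[OF f2L] L2_time_props(3)[OF f2L] is_time_deriv_weak[OF f1L d2]])
  obtain C where C: "continuous_on {0..T} C" "C 0 = 0" "AE t in MI. cls (f t) = C t"
    using has_initial_value_curve[OF fL i] by blast
  let ?F = "\<lambda>t. integral {0..t} C1"
  have CF: "C t = ?F t" if t: "t \<in> {0..T}" for t
  proof -
    have ci: "C1 integrable_on {0..t}"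
      by (rule integrable_continuous_real[OF continuous_on_subset[OF C1(1)]]) (use t in auto)
    have "inner (C t) h = inner (?F t) h" for h
    proof -
      have "inner (C t) h = integral {0..t} (\<lambda>s. inner (cls (f1 s)) h)"
        using H1_time_primitive[OF fL d1 C(1,3) t, of h] C(2) by simp
      also have "\<dots> = integral {0..t} (\<lambda>s. inner (C1 s) h)"
      proof -
        have "AE s in lebesgue. s \<in> I \<longrightarrow> cls (f1 s) = C1 s"
          using C1(2) unfolding AE_restrict_space_iff[of I lebesgue, simplified] by simp
        then obtain N where N: "{s. \<not> (s \<in> I \<longrightarrow> cls (f1 s) = C1 s)} \<subseteq> N" "N \<in> null_sets lebesgue"
          unfolding eventually_ae_filter by auto
        have "negligible (insert 0 (insert T N))" using N(2) by (simp add: negligible_iff_null_sets[symmetric])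
        then show ?thesis
        proof (rule integral_spike)
          fix s assume s: "s \<in> {0..t} - insert 0 (insert T N)"
          then have "s \<in> I" using t by auto
          then have "cls (f1 s) = C1 s" using N(1) s by blast
          then show "inner (C1 s) h = inner (cls (f1 s)) h" by simp
        qed
      qed
      also have "\<dots> = inner (?F t) h" using inner_integral[OF ci] by simp
      finally show ?thesis .
    qed
    then have "inner (C t - ?F t) (C t - ?F t) = 0" by (simp only: inner_diff_left)
    then show ?thesis by simp
  qed
  show ?thesis
  proof (rule that[of C1 ?F])
    show "(?F has_vector_derivative C1 t) (at t within {0..T})" if "t \<in> {0..T}" for t
      by (rule integral_initial_deriv[OF C1(1) that])
    show "AE t in MI. f t \<in> L2 \<and> cls (f t) = ?F t"
      using C(3) L2_time_props(1)[OF fL] AE_I_space by eventually_elim (simp add: CF)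
  qed (use C1 in auto)
qed

end

section \<open>The perfectly matched layer as an evolution equation\<close>

context evolution_domain
begin

text \<open>
  Regularity of the source is available on balls inside the domain, which are bounded and connected,
  while the domain itself may fail to be connected. Finitely many balls cover the
  support; the weights \<open>w x\<close>, the indicator of each ball divided by the number of balls that contain
  the point, are bounded multipliers which add up to one on the support, and they patch the local
  \<open>C1\<close> curves together.
\<close>

lemma compactly_supported_source_C1:
  assumes K: "compact K" "K \<subseteq> Om"
    and supp: "AE t in MI. AE x in lebesgue_on Om. x \<notin> K \<longrightarrow> f t x = 0"
    and f: "\<And>x r. 0 < r \<Longrightarrow> ball x r \<subseteq> Om \<Longrightarrow>
      f \<in> H2_time I (L2_space (ball x r)) \<and> has_initial_value T (L2_space (ball x r)) f (\<lambda>_. 0)"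
  obtains F F' :: "real \<Rightarrow> (plane, real) l2" where "continuous_on {0..T} F'" "F 0 = 0"
    "\<forall>t\<in>{0..T}. (F has_vector_derivative F' t) (at t within {0..T})"
    "AE t in MI. AE x in lebesgue_on Om. rep_l2 (F t) x = f t x"
proof -
  have "\<exists>r>0. ball x r \<subseteq> Om" if "x \<in> K" for x using K(2) that open_Om open_contains_ball by blast
  then obtain r where r: "\<And>x. x \<in> K \<Longrightarrow> 0 < r x" "\<And>x. x \<in> K \<Longrightarrow> ball x (r x) \<subseteq> Om" by metis
  obtain C where C: "C \<subseteq> K" "finite C" and cov: "K \<subseteq> (\<Union>x\<in>C. ball x (r x))"
    by (rule compactE_image[OF K(1), of K "\<lambda>x. ball x (r x)"]) (use r in force)+
  let ?B = "\<lambda>x. ball x (r x)"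
  define P where "P x F F' \<longleftrightarrow> continuous_on {0..T} F' \<and> F 0 = 0 \<and>
      (\<forall>t\<in>{0..T}. (F has_vector_derivative F' t) (at t within {0..T})) \<and>
      (AE t in MI. AE y in lebesgue. y \<in> ?B x \<longrightarrow> rep_l2 (F t) y = f t y)"
    for x and F F' :: "real \<Rightarrow> (plane, real) l2"
  have "\<exists>F F'. P x F F'" if x: "x \<in> C" for x
  proof -
    interpret B: evolution_domain "?B x" T by unfold_locales auto
    have fB: "f \<in> H2_time I (L2_space (?B x))" "has_initial_value T (L2_space (?B x)) f (\<lambda>_. 0)"
      using f[of "r x" x] r x C(1) by auto
    show ?thesis
    proof (rule B.H2_time_C1[OF fB])
    fix F F' :: "real \<Rightarrow> (plane, real) l2"
    assume F: "continuous_on {0..T} F'" "F 0 = 0"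
      "\<And>t. t \<in> {0..T} \<Longrightarrow> (F has_vector_derivative F' t) (at t within {0..T})"
      and eq: "AE t in MI. f t \<in> B.L2 \<and> B.cls (f t) = F t"
    have "AE t in MI. AE y in lebesgue. y \<in> ?B x \<longrightarrow> rep_l2 (F t) y = f t y"
      using eq
    proof eventually_elim
      case (elim t)
      then have "AE y in lebesgue. rep_l2 (F t) y = B.ext0 (f t) y"
        using rep_abs_l2[of "B.ext0 (f t)"] by (simp add: B.cls_def B.L2_iff)
      then show ?case by eventually_elim (simp add: B.ext0_def)
    qed
    then have "P x F F'" unfolding P_def using F by blast
    then show ?thesis by blast
    qed
  qed
  then obtain F F' where P: "\<And>x. x \<in> C \<Longrightarrow> P x (F x) (F' x)" by metis
  have F': "\<And>x. x \<in> C \<Longrightarrow> continuous_on {0..T} (F' x)" and F0: "\<And>x. x \<in> C \<Longrightarrow> F x 0 = 0"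
    and D: "\<And>x t. x \<in> C \<Longrightarrow> t \<in> {0..T} \<Longrightarrow> (F x has_vector_derivative F' x t) (at t within {0..T})"
    and rep: "\<And>x. x \<in> C \<Longrightarrow> AE t in MI. AE y in lebesgue. y \<in> ?B x \<longrightarrow> rep_l2 (F x t) y = f t y"
    using P unfolding P_def by simp_all
  define w where "w x y = indicator (?B x) y / (\<Sum>z\<in>C. indicator (?B z) y :: real)" for x y
  have wle: "\<bar>w x y\<bar> \<le> 1" if "x \<in> C" for x y
  proof -
    have "indicator (?B x) y \<le> (\<Sum>z\<in>C. indicator (?B z) y :: real)"
      using that C(2) by (intro member_le_sum) auto
    then show ?thesis unfolding w_def by (auto simp: divide_le_eq indicator_def split: if_splits)
  qed
  have wm: "w x \<in> borel_measurable (lebesgue_on Om)" for x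
    unfolding w_def[abs_def]
    by (intro measurable_restrict_space1 borel_measurable_divide borel_measurable_sum borel_measurable_indicator) auto
  have mult: "multiplier 1 (\<lambda>y v. w x y * v)" if x: "x \<in> C" for x
    unfolding multiplier_def
    using wle[OF x] wm by (auto simp: linear_iff algebra_simps abs_mult intro!: borel_measurable_times mult_left_le)
  let ?M = "\<lambda>x. mult_op (\<lambda>y v. w x y * v)"
  have bl: "bounded_linear (?M x)" if "x \<in> C" for x by (rule bounded_linear_mult_op[OF mult[OF that]])
  show ?thesis
  proof (rule that[of "\<lambda>t. \<Sum>x\<in>C. ?M x (F' x t)" "\<lambda>t. \<Sum>x\<in>C. ?M x (F x t)"])
    show "continuous_on {0..T} (\<lambda>t. \<Sum>x\<in>C. ?M x (F' x t))"
      by (intro continuous_on_sum bounded_linear.continuous_on[OF bl] F')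
    show "(\<Sum>x\<in>C. ?M x (F x 0)) = 0"
      by (intro sum.neutral ballI) (simp add: F0 linear_simps(3)[OF bl])
    show "\<forall>t\<in>{0..T}. ((\<lambda>t. \<Sum>x\<in>C. ?M x (F x t)) has_vector_derivative (\<Sum>x\<in>C. ?M x (F' x t))) (at t within {0..T})"
      by (intro ballI has_vector_derivative_sum bounded_linear.has_vector_derivative[OF bl] D)
    have "AE t in MI. \<forall>x\<in>C. AE y in lebesgue. y \<in> ?B x \<longrightarrow> rep_l2 (F x t) y = f t y"
      using C(2) rep by (simp add: AE_ball_countable countable_finite)
    with supp show "AE t in MI. AE x in lebesgue_on Om. rep_l2 (\<Sum>x\<in>C. ?M x (F x t)) x = f t x"
    proof eventually_elim
      case (elim t)
      let ?g = "\<lambda>y. \<Sum>x\<in>C. w x y * rep_l2 (F x t) y"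
      have gL: "?g \<in> L2" by (intro L2_sum C(2) multiplier_L2(1)[OF mult rep_L2])
      have "(\<Sum>x\<in>C. ?M x (F x t)) = cls ?g"
        unfolding mult_op_def by (rule cls_sum[symmetric, OF C(2)]) (rule multiplier_L2(1)[OF mult rep_L2])
      then have "AE y in lebesgue_on Om. rep_l2 (\<Sum>x\<in>C. ?M x (F x t)) y = ?g y"
        using cls_rep_cls[OF gL] by (simp add: cls_eq_iff rep_L2 gL)
      moreover have "AE y in lebesgue. \<forall>x\<in>C. y \<in> ?B x \<longrightarrow> rep_l2 (F x t) y = f t y"
        using C(2) elim(2) by (simp add: AE_ball_countable countable_finite)
      then have "AE y in lebesgue_on Om. \<forall>x\<in>C. y \<in> ?B x \<longrightarrow> rep_l2 (F x t) y = f t y"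
        unfolding AE_restrict_space_iff[of Om lebesgue, simplified] by eventually_elim simp
      ultimately show ?case using elim(1)
      proof eventually_elim
        case (elim y)
        have "?g y = (\<Sum>x\<in>C. w x y * f t y)"
          by (intro sum.cong refl) (use elim(2) in \<open>auto simp: w_def indicator_def\<close>)
        also have "\<dots> = (\<Sum>x\<in>C. w x y) * f t y" by (simp add: sum_distrib_right)
        also have "\<dots> = f t y"
        proof (cases "y \<in> K")
          case True
          then obtain x where x: "x \<in> C" "y \<in> ?B x" using cov by blast
          have "indicator (?B x) y \<le> (\<Sum>z\<in>C. indicator (?B z) y :: real)"
            using x C(2) by (intro member_le_sum) auto
          then have "(\<Sum>z\<in>C. indicator (?B z) y :: real) \<noteq> 0" using x by auto
          then have "(\<Sum>x\<in>C. w x y) = 1" unfolding w_def by (simp add: sum_divide_distrib[symmetric])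
          then show ?thesis by simp
        next
          case False
          then show ?thesis using elim(3) by simp
        qed
        finally show ?case using elim(1) by simp
      qed
    qed
  qed
qed

end

text \<open>
  The coefficients \<open>\<alpha>\<close>, \<open>\<beta>\<close>, \<open>\<gamma>\<close>, \<open>A1\<close>, \<open>A2\<close> stand for \<open>\<sigma> + \<sigma>\<^sub>h\<close>, \<open>\<sigma>\<^sub>h\<close>, \<open>\<sigma>\<close>, \<open>\<Lambda>\<^sub>1\<close>, \<open>\<Lambda>\<^sub>2\<close>, with \<open>\<sigma>\<^sub>h\<close>
  the radial mean of \<open>\<sigma>\<close>.
\<close>

locale pml_system = evolution_domain Om T for Om T +
  fixes \<alpha> \<beta> \<gamma> :: "plane \<Rightarrow> real" and A1 A2 :: "plane \<Rightarrow> real^2^2" and bd :: real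
  assumes \<alpha>: "multiplier bd (\<lambda>x v. \<alpha> x * v)" and \<beta>: "multiplier bd (\<lambda>x v. \<beta> x * v)"
    and \<gamma>: "multiplier bd (\<lambda>x v. \<gamma> x * v)"
    and A1: "multiplier bd (\<lambda>x v. A1 x *v v)" and A2: "multiplier bd (\<lambda>x v. A2 x *v v)"
begin

abbreviation "M\<alpha> \<equiv> mult_op (\<lambda>x v. \<alpha> x * v)"
abbreviation "M\<beta> \<equiv> mult_op (\<lambda>x v. \<beta> x * v)"
abbreviation "M\<gamma> \<equiv> mult_op (\<lambda>x v. \<gamma> x * v)"
abbreviation "MA1 \<equiv> mult_op (\<lambda>x v. A1 x *v v)"
abbreviation "MA2 \<equiv> mult_op (\<lambda>x v. A2 x *v v)"

lemmas bl = bounded_linear_mult_op[OF \<alpha>] bounded_linear_mult_op[OF \<beta>] bounded_linear_mult_op[OF \<gamma>]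
  bounded_linear_mult_op[OF A1] bounded_linear_mult_op[OF A2]

type_synonym state = "((plane, real) l2 \<times> (plane, plane) l2) \<times> ((plane, real) l2 \<times> (plane, plane) l2)"

text \<open>
  The zeroth-order terms in the unknowns \<open>((u, p), (u\<^sup>*, q))\<close> with \<open>q = p - p\<^sup>*\<close>. Subtracting the
  equation for \<open>p\<^sup>*\<close> from the last one gives \<open>\<partial>q = A2 (p - q) - A1 p\<close>, free of spatial derivatives.
  The equation for \<open>p\<close> then is \<open>\<partial>p = - grad u + A2 (p - q) - A1 p\<close>.
\<close>

definition coupling :: "state \<Rightarrow> state" where
  "coupling U = (case U of ((u, p), (us, q)) \<Rightarrow>
     ((- (M\<alpha> u + M\<beta> us), MA2 (p - q) - MA1 p), (M\<gamma> u, MA2 (p - q) - MA1 p)))"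

lemma bounded_linear_coupling: "bounded_linear coupling"
proof -
  have eq: "coupling = (\<lambda>U. ((- (M\<alpha> (fst (fst U)) + M\<beta> (fst (snd U))),
      MA2 (snd (fst U) - snd (snd U)) - MA1 (snd (fst U))),
      (M\<gamma> (fst (fst U)), MA2 (snd (fst U) - snd (snd U)) - MA1 (snd (fst U)))))"
    by (auto simp: coupling_def fun_eq_iff)
  have 1: "bounded_linear (\<lambda>U::state. fst (fst U))" "bounded_linear (\<lambda>U::state. snd (fst U))"
    "bounded_linear (\<lambda>U::state. fst (snd U))" "bounded_linear (\<lambda>U::state. snd (snd U))"
    by (intro bounded_linear_fst_comp bounded_linear_snd_comp bounded_linear_fst bounded_linear_snd)+
  note c = bl[THEN bounded_linear_compose]
  show ?thesis
    unfolding eq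
    by (intro bounded_linear_Pair bounded_linear_minus bounded_linear_add bounded_linear_sub c 1)
qed

sublocale evolution: perturbed_evolution "skew_relation grad_graph :: (state \<times> state) set" coupling T
proof -
  interpret maximal_dissipative "skew_relation grad_graph :: (state \<times> state) set"
    by (rule skew_relation_maximal_dissipative[OF subspace_grad_graph closed_grad_graph])
  show "perturbed_evolution (skew_relation grad_graph :: (state \<times> state) set) coupling T"
    by (intro perturbed_evolution.intro perturbed_evolution_axioms.intro maximal_dissipative_axioms
        bounded_linear_coupling T_pos)
qed

definition weak_solution ::
  "(real \<Rightarrow> plane \<Rightarrow> real) \<Rightarrow> (real \<Rightarrow> plane \<Rightarrow> real) \<Rightarrow> (real \<Rightarrow> plane \<Rightarrow> plane) \<Rightarrow>
   (real \<Rightarrow> plane \<Rightarrow> real) \<Rightarrow> (real \<Rightarrow> plane \<Rightarrow> plane) \<Rightarrow> bool" where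
  "weak_solution f u p us ps \<longleftrightarrow> solution_class Om T u p us ps \<and>
     (AE t in MI. AE x in lebesgue_on Om.
        time_deriv I (L2_space Om) u t x + \<alpha> x * u t x + \<beta> x * us t x + weak_div Om (p t) x = f t x \<and>
        time_deriv I (L2_space Om) ps t x = - weak_grad Om (u t) x \<and>
        time_deriv I (L2_space Om) us t x = \<gamma> x * u t x \<and>
        time_deriv I (L2_space Om) p t x + A1 x *v p t x
          = time_deriv I (L2_space Om) ps t x + A2 x *v ps t x) \<and>
     has_initial_value T (L2_space Om) u (\<lambda>_. 0) \<and> has_initial_value T (L2_space Om) p (\<lambda>_. 0) \<and>
     has_initial_value T (L2_space Om) us (\<lambda>_. 0) \<and> has_initial_value T (L2_space Om) ps (\<lambda>_. 0)"

text \<open>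
  Translates a \<open>C1\<close> curve of classes starting at zero into the language of representatives.
\<close>

lemma restr_curve:
  fixes W V :: "real \<Rightarrow> (plane, 'v::euclidean_space) l2"
  assumes W: "\<forall>t\<in>{0..T}. (W has_vector_derivative V t) (at t within {0..T})"
    and V: "continuous_on {0..T} V" and "W 0 = 0"
  shows "(\<lambda>t. rep_l2 (W t)) \<in> H1_time I (L2_space Om)"
    "has_initial_value T (L2_space Om) (\<lambda>t. rep_l2 (W t)) (\<lambda>_. 0)"
    "AE t in MI. AE x in lebesgue_on Om. time_deriv I (L2_space Om) (\<lambda>t. rep_l2 (W t)) t x = rep_l2 (V t) x"
    "continuous_on {0..T} (\<lambda>t. cls (rep_l2 (W t)))"
proof -
  have D: "((\<lambda>t. cls (rep_l2 (W t))) has_vector_derivative cls (rep_l2 (V t))) (at t within {0..T})"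
    if "t \<in> {0..T}" for t
    using bounded_linear.has_vector_derivative[OF bounded_linear_restr W[rule_format, OF that]] by (simp add: restr_def)
  have Vc: "continuous_on {0..T} (\<lambda>t. cls (rep_l2 (V t)))"
    using continuous_restr[OF V] by (simp add: restr_def)
  show Wc: "continuous_on {0..T} (\<lambda>t. cls (rep_l2 (W t)))"
    using D by (meson continuous_on_eq_continuous_within has_vector_derivative_continuous)
  show "(\<lambda>t. rep_l2 (W t)) \<in> H1_time I (L2_space Om)"
    by (rule is_time_deriv_C1(2)[where v = "\<lambda>t. rep_l2 (V t)", OF rep_L2 rep_L2 Vc D])
  show "AE t in MI. AE x in lebesgue_on Om. time_deriv I (L2_space Om) (\<lambda>t. rep_l2 (W t)) t x = rep_l2 (V t) x"
    by (rule time_deriv_C1[where v = "\<lambda>t. rep_l2 (V t)", OF rep_L2 rep_L2 Vc D])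
  show "has_initial_value T (L2_space Om) (\<lambda>t. rep_l2 (W t)) (\<lambda>_. 0)"
    by (rule has_initial_value_continuous[OF rep_L2 Wc])
      (use assms(3) linear_simps(3)[OF bounded_linear_restr] in \<open>simp add: restr_def\<close>)
qed

text \<open>
  The abstract solution \<open>U\<close> is \<open>C1\<close> in time. Its membership in the relation says that \<open>u\<close> lies in
  \<open>H10\<close> with gradient \<open>q' - p'\<close> and that \<open>p\<close> has a weak divergence determined by the first equation;
  both are continuous in time, which gives integrability in \<open>H10\<close> and \<open>H(div)\<close>.
\<close>

theorem weak_solution_exists:
  fixes F F' :: "real \<Rightarrow> (plane, real) l2"
  assumes F': "continuous_on {0..T} F'" and F0: "F 0 = 0"
    and F: "\<And>t. t \<in> {0..T} \<Longrightarrow> (F has_vector_derivative F' t) (at t within {0..T})"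
    and f: "AE t in MI. AE x in lebesgue_on Om. rep_l2 (F t) x = f t x"
  obtains u p us ps where "weak_solution f u p us ps" "\<forall>t\<in>{0..T}. u t \<in> carr (H10_space Om)"
proof -
  define FF FF' :: "real \<Rightarrow> state" where "FF t = ((F t, 0), (0, 0))" and "FF' t = ((F' t, 0), (0, 0))" for t
  have FF'c: "continuous_on {0..T} FF'" unfolding FF'_def[abs_def] by (intro continuous_on_Pair F' continuous_on_const)
  have FFd: "(FF has_vector_derivative FF' t) (at t within {0..T})" if "t \<in> {0..T}" for t
    unfolding FF_def[abs_def] FF'_def by (intro has_vector_derivative_Pair F that has_vector_derivative_const)
  obtain U V :: "real \<Rightarrow> state" where U0: "U 0 = 0" and Vc: "continuous_on {0..T} V"
    and UV: "\<And>t. t \<in> {0..T} \<Longrightarrow> (U has_vector_derivative V t) (at t within {0..T})"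
    and G: "\<And>t. t \<in> {0..T} \<Longrightarrow> (U t, V t - coupling (U t) - FF t) \<in> skew_relation grad_graph"
    using evolution.evolution_exists[OF FF'c _ FFd] F0 by (auto simp: FF_def zero_prod_def)
  define u p us q where "u t = fst (fst (U t))" and "p t = snd (fst (U t))"
    and "us t = fst (snd (U t))" and "q t = snd (snd (U t))" for t
  define u' p' us' q' where "u' t = fst (fst (V t))" and "p' t = snd (fst (V t))"
    and "us' t = fst (snd (V t))" and "q' t = snd (snd (V t))" for t
  note defs = u_def p_def us_def q_def u'_def p'_def us'_def q'_def
  have d: "(u has_vector_derivative u' t) (at t within {0..T})" "(p has_vector_derivative p' t) (at t within {0..T})"
    "(us has_vector_derivative us' t) (at t within {0..T})" "(q has_vector_derivative q' t) (at t within {0..T})"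
    if "t \<in> {0..T}" for t
    using bounded_linear.has_vector_derivative[OF bounded_linear_fst, OF bounded_linear.has_vector_derivative[OF bounded_linear_fst, OF UV[OF that]]]
      bounded_linear.has_vector_derivative[OF bounded_linear_snd, OF bounded_linear.has_vector_derivative[OF bounded_linear_fst, OF UV[OF that]]]
      bounded_linear.has_vector_derivative[OF bounded_linear_fst, OF bounded_linear.has_vector_derivative[OF bounded_linear_snd, OF UV[OF that]]]
      bounded_linear.has_vector_derivative[OF bounded_linear_snd, OF bounded_linear.has_vector_derivative[OF bounded_linear_snd, OF UV[OF that]]]
    unfolding defs[abs_def] by auto
  have c': "continuous_on {0..T} u'" "continuous_on {0..T} p'" "continuous_on {0..T} us'" "continuous_on {0..T} q'"
    unfolding defs[abs_def] by (intro continuous_on_fst continuous_on_snd Vc)+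
  have z: "u 0 = 0" "p 0 = 0" "us 0 = 0" "q 0 = 0" using U0 by (auto simp: defs)
  \<comment> \<open>The gradient of \<open>u t\<close> and the divergence of \<open>p t\<close>, read off from the equations.\<close>
  define b where "b t = q' t - p' t" for t
  define dv where "dv t = - (u' t + M\<alpha> (u t) + M\<beta> (us t) - F t)" for t
  have rel: "(u t, b t) \<in> grad_graph" "us' t = M\<gamma> (u t)" "q' t = MA2 (p t - q t) - MA1 (p t)"
    "\<And>a c. (a, c) \<in> grad_graph \<Longrightarrow> inner (dv t) a = - inner (p t) c" if t: "t \<in> {0..T}" for t
  proof -
    have Ut: "U t = ((u t, p t), (us t, q t))" "V t = ((u' t, p' t), (us' t, q' t))" by (simp_all add: defs)
    have g: "(((u t, p t), (us t, q t)),
      ((u' t + (M\<alpha> (u t) + M\<beta> (us t)) - F t, p' t - (MA2 (p t - q t) - MA1 (p t))),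
       (us' t - M\<gamma> (u t), q' t - (MA2 (p t - q t) - MA1 (p t))))) \<in> skew_relation grad_graph"
      using G[OF t] by (simp add: Ut coupling_def FF_def algebra_simps)
    show 3: "q' t = MA2 (p t - q t) - MA1 (p t)" and "us' t = M\<gamma> (u t)"
      using g by (auto simp: skew_relation_def zero_prod_def)
    show "(u t, b t) \<in> grad_graph" using g by (simp add: skew_relation_def b_def 3)
    show "inner (dv t) a = - inner (p t) c" if "(a, c) \<in> grad_graph" for a c
    proof -
      have "inner (u' t + (M\<alpha> (u t) + M\<beta> (us t)) - F t) a = inner (p t) c"
        using g that by (simp add: skew_relation_def)
      then show ?thesis by (simp add: dv_def inner_diff_left inner_add_left)
    qed
  qed
  have ps: "((\<lambda>t. p t - q t) has_vector_derivative - b t) (at t within {0..T})" if "t \<in> {0..T}" for t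
    using has_vector_derivative_diff[OF d(2)[OF that] d(4)[OF that]] by (simp add: b_def)
  have bc: "continuous_on {0..T} b" unfolding b_def[abs_def] by (intro continuous_intros c')
  have cc: "continuous_on {0..T} u" "continuous_on {0..T} us" "continuous_on {0..T} F"
    using d F by (meson continuous_on_eq_continuous_within has_vector_derivative_continuous)+
  have dvc: "continuous_on {0..T} dv"
    unfolding dv_def[abs_def]
    by (intro continuous_intros c' cc bounded_linear.continuous_on[OF bl(1)] bounded_linear.continuous_on[OF bl(2)])
  have dB: "\<forall>t\<in>{0..T}. (u has_vector_derivative u' t) (at t within {0..T})"
    "\<forall>t\<in>{0..T}. (p has_vector_derivative p' t) (at t within {0..T})"
    "\<forall>t\<in>{0..T}. (us has_vector_derivative us' t) (at t within {0..T})"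
    "\<forall>t\<in>{0..T}. ((\<lambda>t. p t - q t) has_vector_derivative - b t) (at t within {0..T})"
    using d ps by blast+
  note Ru = restr_curve[where W = u and V = u', OF dB(1) c'(1) z(1)]
  note Rp = restr_curve[where W = p and V = p', OF dB(2) c'(2) z(2)]
  note Rus = restr_curve[where W = us and V = us', OF dB(3) c'(3) z(3)]
  have mbc: "continuous_on {0..T} (\<lambda>t. - b t)" by (intro continuous_intros bc)
  have psz: "p 0 - q 0 = 0" by (simp add: z)
  note Rps = restr_curve[where W = "\<lambda>t. p t - q t" and V = "\<lambda>t. - b t", OF dB(4) mbc psz]
  have cu: "cls (rep_l2 (u t)) = u t" "cls (rep_l2 (b t)) = b t" if "t \<in> {0..T}" for t
    using grad_graph_restr[OF rel(1)[OF that]] by (auto simp: restr_def)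
  have gr: "(cls (rep_l2 (u t)), cls (rep_l2 (b t))) \<in> grad_graph" if "t \<in> {0..T}" for t
    using rel(1)[OF that] cu[OF that] by simp
  have brc: "continuous_on {0..T} (\<lambda>t. cls (rep_l2 (b t)))" using continuous_restr[OF bc] by (simp add: restr_def)
  have dvrc: "continuous_on {0..T} (\<lambda>t. cls (rep_l2 (dv t)))" using continuous_restr[OF dvc] by (simp add: restr_def)
  have div: "is_weak_div Om (rep_l2 (p t)) (rep_l2 (dv t))" if t: "t \<in> {0..T}" for t
    unfolding is_weak_div_iff[OF rep_L2]
  proof (intro conjI allI impI rep_L2)
    fix \<phi> assume \<phi>: "test \<phi>"
    have "(cls \<phi>, cls (grad \<phi>)) \<in> grad_graph"
      unfolding grad_graph_def test_graph_def using \<phi> by (intro subsetD[OF closure_subset]) auto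
    from rel(4)[OF t this] inner_cls_general[OF grad_props(3)[OF \<phi>], of "p t"]
      inner_cls_general[OF grad_props(4)[OF \<phi>], of "dv t"]
    show "inner (cls (rep_l2 (p t))) (cls (grad \<phi>)) = - inner (cls (rep_l2 (dv t))) (cls \<phi>)"
      by (simp add: restr_def)
  qed
  let ?u = "\<lambda>t. rep_l2 (u t)" and ?p = "\<lambda>t. rep_l2 (p t)" and ?us = "\<lambda>t. rep_l2 (us t)" and ?ps = "\<lambda>t. rep_l2 (p t - q t)"
  have H10: "?u t \<in> carr (H10_space Om)" if "t \<in> {0..T}" for t
    by (rule grad_graph_rep(2)[OF gr[OF that] rep_L2 rep_L2 refl refl])
  have sc: "solution_class Om T ?u ?p ?us ?ps"
    unfolding solution_class_def
  proof (intro conjI IntI)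
    show "?u \<in> L2_time I (H10_space Om)" by (rule L2_time_H10[OF rep_L2 rep_L2 gr Ru(4) brc])
    show "?p \<in> L2_time I (Hdiv_space Om)" by (rule L2_time_Hdiv[OF rep_L2 div Rp(4) dvrc])
  qed (fact Ru(1) Rp(1) Rus(1) Rps(1))+
  have eqs: "AE x in lebesgue_on Om. u1 x + \<alpha> x * ?u t x + \<beta> x * ?us t x + weak_div Om (?p t) x = f t x \<and>
        ps1 x = - weak_grad Om (?u t) x \<and> us1 x = \<gamma> x * ?u t x \<and>
        p1 x + A1 x *v ?p t x = ps1 x + A2 x *v ?ps t x"
    if t: "t \<in> {0..T}" and e: "AE x in lebesgue_on Om. u1 x = rep_l2 (u' t) x" "AE x in lebesgue_on Om. p1 x = rep_l2 (p' t) x"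
      "AE x in lebesgue_on Om. us1 x = rep_l2 (us' t) x" "AE x in lebesgue_on Om. ps1 x = rep_l2 (- b t) x"
      "AE x in lebesgue_on Om. rep_l2 (F t) x = f t x" for t u1 p1 us1 ps1
  proof -
    have dw: "is_weak_div Om (?p t) (weak_div Om (?p t))" by (rule weak_div_is[OF div[OF t]])
    have dwL: "weak_div Om (?p t) \<in> L2" using dw by (simp add: is_weak_div_def)
    have dwc: "cls (weak_div Om (?p t)) = restr (dv t)"
      using weak_div_unique[OF rep_L2 dw rep_L2 div[OF t] refl] by (simp add: restr_def)
    note gw = grad_graph_rep(1)[OF gr[OF t] rep_L2 rep_L2 refl refl]
    have gw': "is_weak_grad Om (?u t) (weak_grad Om (?u t))" by (rule weak_grad_is[OF gw])
    have gwL: "weak_grad Om (?u t) \<in> L2" using gw' by (simp add: is_weak_grad_def)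
    have gwc: "cls (weak_grad Om (?u t)) = cls (rep_l2 (b t))" by (rule weak_grad_unique[OF rep_L2 gw' rep_L2 gw refl])
    note L = multiplier_L2(1)[OF \<alpha> rep_L2] multiplier_L2(1)[OF \<beta> rep_L2] multiplier_L2(1)[OF \<gamma> rep_L2]
      multiplier_L2(1)[OF A1 rep_L2] multiplier_L2(1)[OF A2 rep_L2]
    note rl = linear_simps[OF bounded_linear_restr]
    have rM: "restr (mult_op a W) = mult_op a W" if "multiplier bd a" for a W
      unfolding mult_op_def by (rule restr_cls[OF multiplier_L2(1)[OF that rep_L2]])
    have "cls (\<lambda>x. rep_l2 (u' t) x + \<alpha> x * ?u t x + \<beta> x * ?us t x + weak_div Om (?p t) x)
        = restr (u' t) + M\<alpha> (u t) + M\<beta> (us t) + restr (dv t)"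
      by (simp add: cls_add L L2_add rep_L2 dwL dwc restr_def[symmetric] mult_op_def)
    also have "\<dots> = cls (rep_l2 (F t))"
      by (simp add: dv_def rl rM \<alpha> \<beta> restr_def[symmetric])
    finally have 1: "AE x in lebesgue_on Om. rep_l2 (u' t) x + \<alpha> x * ?u t x + \<beta> x * ?us t x + weak_div Om (?p t) x = rep_l2 (F t) x"
      by (subst (asm) cls_eq_iff) (auto intro!: L2_add L rep_L2 dwL)
    have "cls (rep_l2 (- b t)) = - cls (rep_l2 (b t))" using rl(4)[of "b t"] by (simp add: restr_def)
    also have "\<dots> = cls (\<lambda>x. - weak_grad Om (?u t) x)" by (simp add: cls_uminus gwL gwc)
    finally have 2: "AE x in lebesgue_on Om. rep_l2 (- b t) x = - weak_grad Om (?u t) x"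
      by (subst (asm) cls_eq_iff) (auto intro!: L2_uminus rep_L2 gwL)
    have "cls (rep_l2 (us' t)) = cls (\<lambda>x. \<gamma> x * ?u t x)"
      using rM[OF \<gamma>, of "u t"] rel(2)[OF t] by (simp add: restr_def mult_op_def)
    then have 3: "AE x in lebesgue_on Om. rep_l2 (us' t) x = \<gamma> x * ?u t x"
      by (subst (asm) cls_eq_iff) (auto intro!: L rep_L2)
    have "cls (\<lambda>x. rep_l2 (p' t) x + A1 x *v ?p t x) = restr (p' t) + MA1 (p t)"
      by (simp add: cls_add L rep_L2 restr_def[symmetric] mult_op_def)
    also have "restr (p' t) + MA1 (p t) = restr (- b t) + MA2 (p t - q t)"
    proof -
      have p': "p' t = - b t + (MA2 (p t - q t) - MA1 (p t))" using rel(3)[OF t] by (simp add: b_def)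
      show ?thesis unfolding p' by (simp only: rl(1,2) rM[OF A1] rM[OF A2]) simp
    qed
    also have "\<dots> = cls (\<lambda>x. rep_l2 (- b t) x + A2 x *v ?ps t x)"
      by (simp add: cls_add L rep_L2 restr_def[symmetric] mult_op_def)
    finally have 4: "AE x in lebesgue_on Om. rep_l2 (p' t) x + A1 x *v ?p t x = rep_l2 (- b t) x + A2 x *v ?ps t x"
      by (subst (asm) cls_eq_iff) (auto intro!: L2_add L rep_L2)
    show ?thesis using e 1 2 3 4 by eventually_elim simp
  qed
  have "AE t in MI. AE x in lebesgue_on Om.
        time_deriv I (L2_space Om) ?u t x + \<alpha> x * ?u t x + \<beta> x * ?us t x + weak_div Om (?p t) x = f t x \<and>
        time_deriv I (L2_space Om) ?ps t x = - weak_grad Om (?u t) x \<and>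
        time_deriv I (L2_space Om) ?us t x = \<gamma> x * ?u t x \<and>
        time_deriv I (L2_space Om) ?p t x + A1 x *v ?p t x
          = time_deriv I (L2_space Om) ?ps t x + A2 x *v ?ps t x"
    using Ru(3) Rp(3) Rus(3) Rps(3) f AE_I_space
  proof eventually_elim
    case (elim t)
    show ?case by (rule eqs) (use elim in auto)
  qed
  then have "weak_solution f ?u ?p ?us ?ps"
    unfolding weak_solution_def using sc Ru(2) Rp(2) Rus(2) Rps(2) by blast
  then show ?thesis using H10 that by blast
qed

end

lemma (in time_interval) integral_AE_zero:
  fixes k :: "real \<Rightarrow> real"
  assumes "AE s in MI. k s = 0" and t: "t \<in> {0..T}"
  shows "integral {0..t} k = 0"
proof -
  have "AE s in lebesgue. s \<in> I \<longrightarrow> k s = 0"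
    using assms(1) unfolding AE_restrict_space_iff[of I lebesgue, simplified] by simp
  then obtain N where N: "{s. \<not> (s \<in> I \<longrightarrow> k s = 0)} \<subseteq> N" "N \<in> null_sets lebesgue"
    unfolding eventually_ae_filter by auto
  have neg: "negligible (insert 0 (insert T N))" using N(2) by (simp add: negligible_iff_null_sets[symmetric])
  have "integral {0..t} k = integral {0..t} (\<lambda>_. 0)"
  proof (rule integral_spike[OF neg])
    fix s assume s: "s \<in> {0..t} - insert 0 (insert T N)"
    then have sI: "s \<in> I" using t by auto
    have "s \<notin> N" using s by simp
    then have "s \<notin> {s. \<not> (s \<in> I \<longrightarrow> k s = 0)}" using N(1) by (meson subsetD)
    then show "0 = k s" using sI by simp
  qed
  then show ?thesis by simp
qed

context pml_system
begin

lemma H1_time_curve: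
  assumes u: "u \<in> H1_time I (L2_space Om)" and i: "has_initial_value T (L2_space Om) u (\<lambda>_. 0)"
  obtains C where "continuous_on {0..T} C" "AE t in MI. cls (u t) = C t"
    "AE t in MI. u t \<in> L2" "AE t in MI. time_deriv I (L2_space Om) u t \<in> L2"
    "\<forall>h. integrable MI (\<lambda>s. inner (cls (time_deriv I (L2_space Om) u s)) h)"
    "\<forall>t\<in>{0..T}. \<forall>h. inner (C t) h = integral {0..t} (\<lambda>s. inner (cls (time_deriv I (L2_space Om) u s)) h)"
proof -
  have uL: "u \<in> L2_time I (L2_space Om)" using u by (simp add: H1_time_def)
  obtain v where "is_time_deriv I (L2_space Om) u v" using u by (auto simp: H1_time_def)
  then have d: "is_time_deriv I (L2_space Om) u (time_deriv I (L2_space Om) u)" by (rule time_deriv_is)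
  then have dL: "time_deriv I (L2_space Om) u \<in> L2_time I (L2_space Om)" by (simp add: is_time_deriv_def)
  obtain C where C: "continuous_on {0..T} C" "C 0 = 0" "AE t in MI. cls (u t) = C t"
    by (rule has_initial_value_curve[OF uL i])
  show ?thesis
  proof (rule that[OF C(1,3) L2_time_props(1)[OF uL] L2_time_props(1)[OF dL]])
    show "\<forall>h. integrable MI (\<lambda>s. inner (cls (time_deriv I (L2_space Om) u s)) h)"
      using L2_time_props(4)[OF dL] by blast
    show "\<forall>t\<in>{0..T}. \<forall>h. inner (C t) h = integral {0..t} (\<lambda>s. inner (cls (time_deriv I (L2_space Om) u s)) h)"
      using H1_time_primitive[OF uL d C(1,3)] C(2) by simp
  qed
qed

text \<open>
  Conversely to the existence proof, every solution of the given class traces a continuous curve \<open>C\<close>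
  in the state space, the weak primitive of its time derivative \<open>V\<close>, and satisfies the abstract
  equation at almost every time. The function \<open>g\<close> replaces \<open>f t\<close>, which is known only up to null
  sets, by a measurable representative.
\<close>

lemma weak_solution_trajectory:
  assumes sol: "weak_solution f u p us ps"
  obtains C V :: "real \<Rightarrow> state" where "continuous_on {0..T} C"
    "AE t in MI. C t = ((cls (u t), cls (p t)), (cls (us t), cls (p t) - cls (ps t)))"
    "AE t in MI. u t \<in> L2 \<and> p t \<in> L2 \<and> us t \<in> L2 \<and> ps t \<in> L2"
    "\<forall>h. integrable MI (\<lambda>s. inner (V s) h)"
    "\<forall>t\<in>{0..T}. \<forall>h. inner (C t) h = integral {0..t} (\<lambda>s. inner (V s) h)"
    "AE t in MI. \<exists>g\<in>L2. (AE x in lebesgue_on Om. g x = f t x) \<and>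
       (C t, V t - coupling (C t) - ((cls g, 0), (0, 0))) \<in> skew_relation grad_graph"
proof -
  have sc: "u \<in> L2_time I (H10_space Om)" "u \<in> H1_time I (L2_space Om)" "us \<in> H1_time I (L2_space Om)"
    "p \<in> L2_time I (Hdiv_space Om)" "p \<in> H1_time I (L2_space Om)" "ps \<in> H1_time I (L2_space Om)"
    and iv: "has_initial_value T (L2_space Om) u (\<lambda>_. 0)" "has_initial_value T (L2_space Om) p (\<lambda>_. 0)"
     "has_initial_value T (L2_space Om) us (\<lambda>_. 0)" "has_initial_value T (L2_space Om) ps (\<lambda>_. 0)"
    using sol by (auto simp: weak_solution_def solution_class_def)
  let ?d = "\<lambda>u. time_deriv I (L2_space Om) u"
  have eqs: "AE t in MI. AE x in lebesgue_on Om.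
        ?d u t x + \<alpha> x * u t x + \<beta> x * us t x + weak_div Om (p t) x = f t x \<and>
        time_deriv I (L2_space Om) ps t x = - weak_grad Om (u t) x \<and>
        ?d us t x = \<gamma> x * u t x \<and>
        time_deriv I (L2_space Om) p t x + A1 x *v p t x
          = time_deriv I (L2_space Om) ps t x + A2 x *v ps t x"
    using sol by (simp add: weak_solution_def)
  obtain Cu where Cu: "continuous_on {0..T} Cu" "AE t in MI. cls (u t) = Cu t"
    "AE t in MI. u t \<in> L2" "AE t in MI. ?d u t \<in> L2" "\<forall>h. integrable MI (\<lambda>s. inner (cls (?d u s)) h)"
    "\<forall>t\<in>{0..T}. \<forall>h. inner (Cu t) h = integral {0..t} (\<lambda>s. inner (cls (?d u s)) h)"
    by (rule H1_time_curve[OF sc(2) iv(1)])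
  obtain Cp where Cp: "continuous_on {0..T} Cp" "AE t in MI. cls (p t) = Cp t"
    "AE t in MI. p t \<in> L2" "AE t in MI. time_deriv I (L2_space Om) p t \<in> L2"
    "\<forall>h. integrable MI (\<lambda>s. inner (cls (time_deriv I (L2_space Om) p s)) h)"
    "\<forall>t\<in>{0..T}. \<forall>h. inner (Cp t) h = integral {0..t} (\<lambda>s. inner (cls (time_deriv I (L2_space Om) p s)) h)"
    by (rule H1_time_curve[OF sc(5) iv(2)])
  obtain Cus where Cus: "continuous_on {0..T} Cus" "AE t in MI. cls (us t) = Cus t"
    "AE t in MI. us t \<in> L2" "AE t in MI. ?d us t \<in> L2" "\<forall>h. integrable MI (\<lambda>s. inner (cls (?d us s)) h)"
    "\<forall>t\<in>{0..T}. \<forall>h. inner (Cus t) h = integral {0..t} (\<lambda>s. inner (cls (?d us s)) h)"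
    by (rule H1_time_curve[OF sc(3) iv(3)])
  obtain Cps where Cps: "continuous_on {0..T} Cps" "AE t in MI. cls (ps t) = Cps t"
    "AE t in MI. ps t \<in> L2" "AE t in MI. time_deriv I (L2_space Om) ps t \<in> L2"
    "\<forall>h. integrable MI (\<lambda>s. inner (cls (time_deriv I (L2_space Om) ps s)) h)"
    "\<forall>t\<in>{0..T}. \<forall>h. inner (Cps t) h = integral {0..t} (\<lambda>s. inner (cls (time_deriv I (L2_space Om) ps s)) h)"
    by (rule H1_time_curve[OF sc(6) iv(4)])
  define C :: "real \<Rightarrow> state" where "C t = ((Cu t, Cp t), (Cus t, Cp t - Cps t))" for t
  define V :: "real \<Rightarrow> state" where
    "V t = ((cls (?d u t), cls (time_deriv I (L2_space Om) p t)),
      (cls (?d us t), cls (time_deriv I (L2_space Om) p t) - cls (time_deriv I (L2_space Om) ps t)))" for t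
  show ?thesis
  proof (rule that[of C V])
    show "continuous_on {0..T} C" unfolding C_def[abs_def] by (intro continuous_on_Pair continuous_on_diff Cu Cp Cus Cps)
    show CA: "AE t in MI. C t = ((cls (u t), cls (p t)), (cls (us t), cls (p t) - cls (ps t)))"
      using Cu(2) Cp(2) Cus(2) Cps(2) by eventually_elim (simp add: C_def)
    show "AE t in MI. u t \<in> L2 \<and> p t \<in> L2 \<and> us t \<in> L2 \<and> ps t \<in> L2"
      using Cu(3) Cp(3) Cus(3) Cps(3) by eventually_elim simp
    have Vh: "inner (V s) ((h1, h2), (h3, h4)) = inner (cls (?d u s)) h1 + inner (cls (time_deriv I (L2_space Om) p s)) h2
      + (inner (cls (?d us s)) h3 + (inner (cls (time_deriv I (L2_space Om) p s)) h4 - inner (cls (time_deriv I (L2_space Om) ps s)) h4))" for s h1 h2 h3 h4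
      by (simp add: V_def inner_diff_left)
    show "\<forall>h. integrable MI (\<lambda>s. inner (V s) h)"
    proof
      fix h :: state
      obtain h1 h2 h3 h4 where "h = ((h1, h2), (h3, h4))" by (metis surj_pair)
      then show "integrable MI (\<lambda>s. inner (V s) h)"
        by (simp only: Vh) (intro Bochner_Integration.integrable_add Bochner_Integration.integrable_diff
            Cu(5)[rule_format] Cp(5)[rule_format] Cus(5)[rule_format] Cps(5)[rule_format])
    qed
    show "\<forall>t\<in>{0..T}. \<forall>h. inner (C t) h = integral {0..t} (\<lambda>s. inner (V s) h)"
    proof (intro ballI allI)
      fix t and h :: state assume t: "t \<in> {0..T}"
      obtain h1 h2 h3 h4 where h: "h = ((h1, h2), (h3, h4))" by (metis surj_pair)
      have sub: "k integrable_on {0..t}" if "integrable MI k" for k :: "real \<Rightarrow> real"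
        using integrable_on_subinterval[OF integrable_on_of_MI(1)[OF that]] t by auto
      note S = sub[OF Cu(5)[rule_format]] sub[OF Cp(5)[rule_format]] sub[OF Cus(5)[rule_format]] sub[OF Cps(5)[rule_format]]
      note E = Cu(6)[rule_format, OF t] Cp(6)[rule_format, OF t] Cus(6)[rule_format, OF t] Cps(6)[rule_format, OF t]
      show "inner (C t) h = integral {0..t} (\<lambda>s. inner (V s) h)"
        unfolding h Vh
        by (simp add: C_def inner_diff_left E Henstock_Kurzweil_Integration.integral_add
            Henstock_Kurzweil_Integration.integral_diff integrable_add integrable_diff S)
    qed
    have H10: "AE t in MI. u t \<in> carr (H10_space Om)" and Hdiv: "AE t in MI. p t \<in> carr (Hdiv_space Om)"
      using sc(1,4) by (auto simp: L2_time_def strongly_measurable_def)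
    show "AE t in MI. \<exists>g\<in>L2. (AE x in lebesgue_on Om. g x = f t x) \<and>
       (C t, V t - coupling (C t) - ((cls g, 0), (0, 0))) \<in> skew_relation grad_graph"
      using H10 Hdiv CA Cu(3,4) Cp(3,4) Cus(3,4) Cps(3,4) eqs
    proof eventually_elim
      case (elim t)
      let ?g = "\<lambda>x. ?d u t x + \<alpha> x * u t x + \<beta> x * us t x + weak_div Om (p t) x"
      obtain dv where "is_weak_div Om (p t) dv" using elim(2) by (auto simp: Hdiv_carr)
      then have dv: "is_weak_div Om (p t) (weak_div Om (p t))" by (rule weak_div_is)
      then have dvL: "weak_div Om (p t) \<in> L2" by (simp add: is_weak_div_def)
      note gr = H10_graph[OF elim(1)]
      note L = multiplier_L2(1)[OF \<alpha> elim(4)] multiplier_L2(1)[OF \<beta> elim(8)] multiplier_L2(1)[OF \<gamma> elim(4)]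
        multiplier_L2(1)[OF A1 elim(6)] multiplier_L2(1)[OF A2 elim(10)]
      note M = mult_op_cls[OF \<alpha> elim(4)] mult_op_cls[OF \<beta> elim(8)] mult_op_cls[OF \<gamma> elim(4)]
        mult_op_cls[OF A1 elim(6)] mult_op_cls[OF A2 elim(10)]
      have gL: "?g \<in> L2" by (intro L2_add elim L dvL)
      have cg: "cls ?g = cls (?d u t) + M\<alpha> (cls (u t)) + M\<beta> (cls (us t)) + cls (weak_div Om (p t))"
        by (simp add: cls_add L2_add elim L dvL M)
      have "AE x in lebesgue_on Om. time_deriv I (L2_space Om) ps t x = - weak_grad Om (u t) x"
        using elim(12) by eventually_elim simp
      then have e2: "cls (time_deriv I (L2_space Om) ps t) = - cls (weak_grad Om (u t))"
        by (simp add: cls_uminus[symmetric] cls_eq_iff elim L2_uminus gr(2))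
      have "AE x in lebesgue_on Om. ?d us t x = \<gamma> x * u t x" using elim(12) by eventually_elim simp
      then have e3: "cls (?d us t) = M\<gamma> (cls (u t))" by (simp add: M cls_eq_iff elim L)
      have "AE x in lebesgue_on Om. time_deriv I (L2_space Om) p t x + A1 x *v p t x
          = time_deriv I (L2_space Om) ps t x + A2 x *v ps t x"
        using elim(12) by eventually_elim simp
      then have e4: "cls (time_deriv I (L2_space Om) p t) + MA1 (cls (p t)) = cls (time_deriv I (L2_space Om) ps t) + MA2 (cls (ps t))"
        by (simp add: M cls_add[symmetric] cls_eq_iff L2_add elim L)
      have g: "- (cls (time_deriv I (L2_space Om) p t) - (MA2 (cls (ps t)) - MA1 (cls (p t)))) = cls (weak_grad Om (u t))"
        using e4 e2 by (simp add: algebra_simps)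
      have n: "cls (time_deriv I (L2_space Om) p t) - cls (time_deriv I (L2_space Om) ps t) - (MA2 (cls (ps t)) - MA1 (cls (p t))) = 0"
        using e4 by (simp add: algebra_simps)
      have v: "cls (?d u t) + (M\<alpha> (cls (u t)) + M\<beta> (cls (us t))) - cls ?g = - cls (weak_div Om (p t))"
        by (simp add: cg)
      let ?y = "((cls (?d u t) + (M\<alpha> (cls (u t)) + M\<beta> (cls (us t))) - cls ?g, cls (time_deriv I (L2_space Om) p t) - (MA2 (cls (ps t)) - MA1 (cls (p t)))),
         (cls (?d us t) - M\<gamma> (cls (u t)), cls (time_deriv I (L2_space Om) p t) - cls (time_deriv I (L2_space Om) ps t) - (MA2 (cls (ps t)) - MA1 (cls (p t)))))"
      have eqy: "V t - coupling (C t) - ((cls ?g, 0), (0, 0)) = ?y"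
        unfolding elim(3) by (simp add: V_def coupling_def)
      have "(C t, ?y) \<in> skew_relation grad_graph"
        unfolding elim(3) v n e3 skew_relation_def
        using gr(3) g weak_div_grad_graph[OF elim(6) dv] by (auto simp: zero_prod_def)
      then have "(C t, V t - coupling (C t) - ((cls ?g, 0), (0, 0))) \<in> skew_relation grad_graph"
        by (simp only: eqy)
      moreover have "AE x in lebesgue_on Om. ?g x = f t x" using elim(12) by eventually_elim simp
      ultimately show ?case by (intro bexI[OF _ gL] conjI)
    qed
  qed
qed

text \<open>
  The difference \<open>C\<close> of two trajectories satisfies \<open>(C, V - B C) \<in> G\<close> almost everywhere, with \<open>V\<close>
  known only weakly. Since \<open>G\<close> is a closed subspace, membership of the time-integrated pair can be
  tested on the vectors orthogonal to \<open>G\<close>, where it is a statement about scalar integrals.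
\<close>

theorem weak_solution_unique:
  assumes "weak_solution f u p us ps" "weak_solution f v q vs qs"
  shows "AE t in MI. AE x in lebesgue_on Om. u t x = v t x \<and> p t x = q t x \<and> us t x = vs t x \<and> ps t x = qs t x"
proof -
  obtain C1 V1 :: "real \<Rightarrow> state" where C1: "continuous_on {0..T} C1"
    "AE t in MI. C1 t = ((cls (u t), cls (p t)), (cls (us t), cls (p t) - cls (ps t)))"
    "AE t in MI. u t \<in> L2 \<and> p t \<in> L2 \<and> us t \<in> L2 \<and> ps t \<in> L2"
    "\<forall>h. integrable MI (\<lambda>s. inner (V1 s) h)"
    "\<forall>t\<in>{0..T}. \<forall>h. inner (C1 t) h = integral {0..t} (\<lambda>s. inner (V1 s) h)"
    "AE t in MI. \<exists>g\<in>L2. (AE x in lebesgue_on Om. g x = f t x) \<and>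
       (C1 t, V1 t - coupling (C1 t) - ((cls g, 0), (0, 0))) \<in> skew_relation grad_graph"
    by (rule weak_solution_trajectory[OF assms(1)])
  obtain C2 V2 :: "real \<Rightarrow> state" where C2: "continuous_on {0..T} C2"
    "AE t in MI. C2 t = ((cls (v t), cls (q t)), (cls (vs t), cls (q t) - cls (qs t)))"
    "AE t in MI. v t \<in> L2 \<and> q t \<in> L2 \<and> vs t \<in> L2 \<and> qs t \<in> L2"
    "\<forall>h. integrable MI (\<lambda>s. inner (V2 s) h)"
    "\<forall>t\<in>{0..T}. \<forall>h. inner (C2 t) h = integral {0..t} (\<lambda>s. inner (V2 s) h)"
    "AE t in MI. \<exists>g\<in>L2. (AE x in lebesgue_on Om. g x = f t x) \<and>
       (C2 t, V2 t - coupling (C2 t) - ((cls g, 0), (0, 0))) \<in> skew_relation grad_graph"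
    by (rule weak_solution_trajectory[OF assms(2)])
  let ?G = "skew_relation grad_graph :: (state \<times> state) set"
  define C V where "C t = C1 t - C2 t" and "V t = V1 t - V2 t" for t
  have Cc: "continuous_on {0..T} C" unfolding C_def[abs_def] by (intro continuous_on_diff C1 C2)
  have rel: "AE t in MI. (C t, V t - coupling (C t)) \<in> ?G"
    using C1(6) C2(6)
  proof eventually_elim
    case (elim t)
    obtain g1 where g1: "g1 \<in> L2" "AE x in lebesgue_on Om. g1 x = f t x"
      "(C1 t, V1 t - coupling (C1 t) - ((cls g1, 0), (0, 0))) \<in> ?G" using elim(1) by blast
    obtain g2 where g2: "g2 \<in> L2" "AE x in lebesgue_on Om. g2 x = f t x"
      "(C2 t, V2 t - coupling (C2 t) - ((cls g2, 0), (0, 0))) \<in> ?G" using elim(2) by blast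
    have "AE x in lebesgue_on Om. g1 x = g2 x" using g1(2) g2(2) by eventually_elim simp
    then have "cls g1 = cls g2" using g1 g2 by (simp add: cls_eq_iff)
    moreover note evolution.G_diff[OF g1(3) g2(3)]
    ultimately show ?case by (simp add: C_def V_def linear_simps(2)[OF bounded_linear_coupling] algebra_simps)
  qed
  have zero: "C t = 0" if t: "t \<in> {0..T}" for t
  proof (rule evolution.evolution_unique[OF Cc _ t])
    fix t assume t: "t \<in> {0..T}"
    have Ci: "C integrable_on {0..t}"
      by (rule integrable_continuous_real[OF continuous_on_subset[OF Cc]]) (use t in auto)
    have sub: "k integrable_on {0..t}" if "integrable MI k" for k :: "real \<Rightarrow> real"
      using integrable_on_subinterval[OF integrable_on_of_MI(1)[OF that]] t by auto
    show "(integral {0..t} C, C t - coupling (integral {0..t} C)) \<in> ?G"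
    proof (rule mem_closed_subspace_if_orthogonal[OF evolution.subspace evolution.closed])
      fix h assume h: "\<And>y. y \<in> ?G \<Longrightarrow> inner y h = 0"
      obtain h1 h2 where hh: "h = (h1, h2)" by (cases h)
      have Vi: "(\<lambda>s. inner (V s) h2) integrable_on {0..t}"
        unfolding V_def inner_diff_left by (intro integrable_diff sub C1(4)[rule_format] C2(4)[rule_format])
      have C1i: "(\<lambda>s. inner (C s) h1) integrable_on {0..t}"
        by (rule integrable_continuous_real) (use t in \<open>intro continuous_intros continuous_on_subset[OF Cc], auto\<close>)
      have BCi: "(\<lambda>s. coupling (C s)) integrable_on {0..t}"
        by (rule integrable_continuous_real) (use t in \<open>intro bounded_linear.continuous_on[OF bounded_linear_coupling] continuous_on_subset[OF Cc], auto\<close>)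
      have BCh: "(\<lambda>s. inner (coupling (C s)) h2) integrable_on {0..t}"
        by (rule integrable_continuous_real)
          (use t in \<open>intro continuous_on_inner continuous_on_const bounded_linear.continuous_on[OF bounded_linear_coupling] continuous_on_subset[OF Cc], auto\<close>)
      have 1: "inner (integral {0..t} C) h1 = integral {0..t} (\<lambda>s. inner (C s) h1)" by (rule inner_integral[OF Ci])
      have 2: "inner (C t) h2 = integral {0..t} (\<lambda>s. inner (V s) h2)"
        unfolding C_def V_def inner_diff_left C1(5)[rule_format, OF t] C2(5)[rule_format, OF t]
        by (rule Henstock_Kurzweil_Integration.integral_diff[symmetric]) (intro sub C1(4)[rule_format] C2(4)[rule_format])+
      have "coupling (integral {0..t} C) = integral {0..t} (\<lambda>s. coupling (C s))"
        using integral_linear[OF Ci bounded_linear_coupling] by (simp add: o_def)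
      then have 3: "inner (coupling (integral {0..t} C)) h2 = integral {0..t} (\<lambda>s. inner (coupling (C s)) h2)"
        using inner_integral[OF BCi] by simp
      have "AE s in MI. inner (C s) h1 + (inner (V s) h2 - inner (coupling (C s)) h2) = 0"
        using rel
      proof eventually_elim
        case (elim s)
        from h[OF elim] show ?case by (simp add: hh inner_diff_left)
      qed
      then have "integral {0..t} (\<lambda>s. inner (C s) h1 + (inner (V s) h2 - inner (coupling (C s)) h2)) = 0"
        by (rule integral_AE_zero[OF _ t])
      then have "integral {0..t} (\<lambda>s. inner (C s) h1) + (integral {0..t} (\<lambda>s. inner (V s) h2)
          - integral {0..t} (\<lambda>s. inner (coupling (C s)) h2)) = 0"
        by (simp add: Henstock_Kurzweil_Integration.integral_add Henstock_Kurzweil_Integration.integral_diff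
            integrable_diff C1i Vi BCh)
      then show "inner (integral {0..t} C, C t - coupling (integral {0..t} C)) h = 0"
        by (simp add: hh inner_diff_left 1 2 3)
    qed
  qed
  show ?thesis
    using C1(2,3) C2(2,3) AE_I_space
  proof eventually_elim
    case (elim t)
    have "C1 t = C2 t" using zero[of t] elim(5) by (simp add: C_def)
    then have "cls (u t) = cls (v t)" "cls (p t) = cls (q t)" "cls (us t) = cls (vs t)" "cls (ps t) = cls (qs t)"
      using elim(1,3) by auto
    then have "AE x in lebesgue_on Om. u t x = v t x" "AE x in lebesgue_on Om. p t x = q t x"
      "AE x in lebesgue_on Om. us t x = vs t x" "AE x in lebesgue_on Om. ps t x = qs t x"
      using elim(2,4) by (auto simp: cls_eq_iff)
    then show ?case by eventually_elim simp
  qed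
qed

end

section \<open>Geometry of the truncated domain\<close>

text \<open>
  Applied to the parameter sets of the two ends of the curve: what remains between them is a
  bounded set of parameters.
\<close>

lemma unbounded_intervals_cover_ends:
  fixes A B :: "real set"
  assumes A: "connected A" "\<not> bounded A" and B: "connected B" "\<not> bounded B" and disj: "A \<inter> B = {}"
    and ab: "a \<in> A" "b \<in> B" "a < b"
  shows "{..a} \<subseteq> A" "{b..} \<subseteq> B"
proof -
  have iv: "x \<in> S" if "connected S" "y \<in> S" "z \<in> S" "y \<le> x" "x \<le> z" for S :: "real set" and x y z
    using that connectedD_interval by blast
  show "{..a} \<subseteq> A"
  proof
    fix x assume x: "x \<in> {..a}"
    show "x \<in> A"
    proof (rule ccontr)
      assume n: "x \<notin> A"
      have "A \<subseteq> {x..b}"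
      proof
        fix y assume y: "y \<in> A"
        have "x \<le> y" using iv[OF A(1) y ab(1), of x] x n by force
        moreover have "y \<le> b" using iv[OF A(1) ab(1) y, of b] ab disj by force
        ultimately show "y \<in> {x..b}" by simp
      qed
      then show False using A(2) bounded_subset bounded_closed_interval by blast
    qed
  qed
  show "{b..} \<subseteq> B"
  proof
    fix x assume x: "x \<in> {b..}"
    show "x \<in> B"
    proof (rule ccontr)
      assume n: "x \<notin> B"
      have "B \<subseteq> {a..x}"
      proof
        fix y assume y: "y \<in> B"
        have "y \<le> x" using iv[OF B(1) ab(2) y, of x] x n by force
        moreover have "a \<le> y" using iv[OF B(1) y ab(2), of a] ab disj by force
        ultimately show "y \<in> {a..x}" by simp
      qed
      then show False using B(2) bounded_subset bounded_closed_interval by blast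
    qed
  qed
qed

text \<open>One end of the curve, for \<open>e = 1\<close> or \<open>e = - 1\<close>. There the first coordinate is an injective
  continuous function of the parameter, hence a homeomorphism onto the half-line by invariance of
  domain, so the parameters form an interval; it is unbounded because its image is. At a finite end of
  this interval the curve passes through the end point of the half-line.\<close>

lemma curve_end:
  fixes \<gamma> :: "real \<Rightarrow> plane" and e :: real
  assumes inj: "inj \<gamma>" and c: "continuous_on UNIV \<gamma>" and e: "e = 1 \<or> e = - 1"
    and line: "\<And>x. e * x$1 > R \<Longrightarrow> x \<in> range \<gamma> \<longleftrightarrow> x$2 = 0"
  defines "A \<equiv> {s. e * \<gamma> s $ 1 > R}"
  shows "open A" "connected A" "\<not> bounded A" "A \<noteq> {}"
    and "A \<noteq> UNIV \<Longrightarrow> \<exists>s. e * \<gamma> s $ 1 = R \<and> \<gamma> s $ 2 = 0"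
proof -
  let ?f = "\<lambda>s. e * \<gamma> s $ 1"
  have fc: "continuous_on X ?f" and f2c: "continuous_on X (\<lambda>s. \<gamma> s $ 2)" for X
    by (intro continuous_intros bounded_linear.continuous_on[OF bounded_linear_vec_nth] continuous_on_subset[OF c], simp)+
  have A: "A = ?f -` {R<..}" by (auto simp: A_def)
  show oA: "open A" unfolding A by (rule open_vimage[OF open_greaterThan fc])
  have z: "\<gamma> s $ 2 = 0" if "s \<in> A" for s using line[of "\<gamma> s"] that by (simp add: A_def)
  have "inj_on ?f A"
  proof (rule inj_onI)
    fix s t assume st: "s \<in> A" "t \<in> A" "?f s = ?f t"
    then have "\<gamma> s $ 1 = \<gamma> t $ 1" using e by auto
    then have "\<gamma> s = \<gamma> t" using z st by (simp add: vec_eq_iff forall_2)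
    then show "s = t" using inj by (simp add: inj_eq)
  qed
  then obtain g where g: "homeomorphism A (?f ` A) ?f g"
    using invariance_of_domain_homeomorphism[OF oA fc] by auto
  have img: "?f ` A = {R<..}"
  proof
    show "?f ` A \<subseteq> {R<..}" by (auto simp: A_def)
    show "{R<..} \<subseteq> ?f ` A"
    proof
      fix y assume y: "y \<in> {R<..}"
      define x where "x = (vector [e * y, 0] :: plane)"
      have ee: "e * (e * y) = y" using e by auto
      have x12: "x $ 1 = e * y" "x $ 2 = 0" by (simp_all add: x_def)
      then have "x \<in> range \<gamma>" using line[of x] y ee by simp
      then obtain s where "x = \<gamma> s" by blast
      then have "?f s = y" using x12 ee by simp
      then show "y \<in> ?f ` A" using y by (intro image_eqI[of _ _ s]) (auto simp: A_def)
    qed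
  qed
  have "A = g ` {R<..}" using g unfolding img homeomorphism_def by simp
  moreover have "continuous_on {R<..} g" using g unfolding img homeomorphism_def by simp
  ultimately show "connected A" using connected_continuous_image[of "{R<..}" g] by simp
  show "\<not> bounded A"
  proof
    assume "bounded A"
    then have "compact (closure A)" by simp
    then have "bounded (?f ` closure A)" by (intro compact_imp_bounded compact_continuous_image fc)
    then have "bounded (?f ` A)" by (rule bounded_subset) (use closure_subset in blast)
    then obtain M where M: "\<And>y. y \<in> {R<..} \<Longrightarrow> \<bar>y\<bar> \<le> M" unfolding img bounded_iff by auto
    have "max (R + 1) (M + 1) \<in> {R<..}" by auto
    from M[OF this] show False by linarith
  qed
  then show ne: "A \<noteq> {}" by auto
  show "\<exists>s. ?f s = R \<and> \<gamma> s $ 2 = 0" if "A \<noteq> UNIV"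
  proof -
    have "frontier A \<noteq> {}" using ne that frontier_eq_empty by blast
    then obtain s where s: "s \<in> closure A" "s \<notin> A" using oA by (auto simp: frontier_def interior_open)
    have "closed {s. R \<le> ?f s \<and> \<gamma> s $ 2 = 0}"
      by (intro closed_Collect_conj closed_Collect_le closed_Collect_eq continuous_on_const fc f2c)
    then have "closure A \<subseteq> {s. R \<le> ?f s \<and> \<gamma> s $ 2 = 0}"
      by (intro closure_minimal) (use z in \<open>auto simp: A_def\<close>)
    then show ?thesis using s by (intro exI[of _ s]) (auto simp: A_def)
  qed
qed

text \<open>
  Outside the two ends the parameters form a compact set, so the curve is the union of a compact set
  and two closed half-lines. The end points of the half-lines, where the defining condition of the
  perturbed line is silent, belong to the curve by the last part of \<open>curve_end\<close>.
\<close>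

lemma closed_perturbed_line:
  assumes "perturbed_line R \<Gamma>" "0 < R"
  shows "closed \<Gamma>"
proof -
  obtain \<gamma> \<gamma>' where \<Gamma>: "\<Gamma> = range \<gamma>" and inj: "inj \<gamma>"
    and d: "\<And>s. (\<gamma> has_vector_derivative \<gamma>' s) (at s)"
    and line: "\<And>x. \<bar>x$1\<bar> > R \<Longrightarrow> (x \<in> \<Gamma> \<longleftrightarrow> x$2 = 0)"
    using assms(1) unfolding perturbed_line_def by metis
  have c: "continuous_on UNIV \<gamma>"
    using d by (intro continuous_at_imp_continuous_on ballI has_vector_derivative_continuous) blast
  define A where "A = {s. 1 * \<gamma> s $ 1 > R}"
  define B where "B = {s. - 1 * \<gamma> s $ 1 > R}"
  have lineA: "x \<in> range \<gamma> \<longleftrightarrow> x$2 = 0" if "1 * x$1 > R" for x :: plane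
    using line[of x] that \<Gamma> by auto
  have lineB: "x \<in> range \<gamma> \<longleftrightarrow> x$2 = 0" if "- 1 * x$1 > R" for x :: plane
    using line[of x] that \<Gamma> by auto
  have A: "open A" "connected A" "\<not> bounded A" "A \<noteq> {}"
    unfolding A_def by (rule curve_end(1-4)[OF inj c disjI1[OF refl]], erule lineA)+
  have A_end: "\<exists>s. 1 * \<gamma> s $ 1 = R \<and> \<gamma> s $ 2 = 0" if "A \<noteq> UNIV"
    by (rule curve_end(5)[OF inj c disjI1[OF refl]]) (use that lineA in \<open>auto simp: A_def\<close>)
  have B: "open B" "connected B" "\<not> bounded B" "B \<noteq> {}"
    unfolding B_def by (rule curve_end(1-4)[OF inj c disjI2[OF refl]], erule lineB)+
  have B_end: "\<exists>s. - 1 * \<gamma> s $ 1 = R \<and> \<gamma> s $ 2 = 0" if "B \<noteq> UNIV"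
    by (rule curve_end(5)[OF inj c disjI2[OF refl]]) (use that lineB in \<open>auto simp: B_def\<close>)
  have disj: "A \<inter> B = {}" using assms(2) by (auto simp: A_def B_def)
  obtain a b where ab: "a \<in> A" "b \<in> B" using A(4) B(4) by blast
  have M: "bounded (- (A \<union> B))"
  proof (cases "a < b")
    case True
    note ends = unbounded_intervals_cover_ends[OF A(2,3) B(2,3) disj ab True]
    have "- (A \<union> B) \<subseteq> {a..b}"
    proof
      fix x assume "x \<in> - (A \<union> B)"
      then have "x \<notin> {..a}" "x \<notin> {b..}" using ends by blast+
      then show "x \<in> {a..b}" by simp
    qed
    then show ?thesis using bounded_subset bounded_closed_interval by blast
  next
    case False
    then have "b < a" using ab disj by (metis IntI empty_iff linorder_neqE_linordered_idom)
    have disj': "B \<inter> A = {}" using disj by blast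
    note ends = unbounded_intervals_cover_ends[OF B(2,3) A(2,3) disj' ab(2,1) \<open>b < a\<close>]
    have "- (A \<union> B) \<subseteq> {b..a}"
    proof
      fix x assume "x \<in> - (A \<union> B)"
      then have "x \<notin> {..b}" "x \<notin> {a..}" using ends by blast+
      then show "x \<in> {b..a}" by simp
    qed
    then show ?thesis using bounded_subset bounded_closed_interval by blast
  qed
  have "compact (- (A \<union> B))" using M open_Un[OF A(1) B(1)] by (simp only: compact_eq_bounded_closed closed_Compl simp_thms)
  then have cl1: "closed (\<gamma> ` (- (A \<union> B)))"
    by (intro compact_imp_closed compact_continuous_image continuous_on_subset[OF c]) auto
  let ?L = "{x::plane. x$2 = 0 \<and> R \<le> \<bar>x$1\<bar>}"
  have cl2: "closed ?L"
    by (intro closed_Collect_conj closed_Collect_eq closed_Collect_le continuous_intros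
        bounded_linear.continuous_on[OF bounded_linear_vec_nth])
  have "\<Gamma> = \<gamma> ` (- (A \<union> B)) \<union> ?L"
  proof
    show "\<Gamma> \<subseteq> \<gamma> ` (- (A \<union> B)) \<union> ?L"
    proof
      fix x assume x: "x \<in> \<Gamma>"
      then obtain s where s: "x = \<gamma> s" using \<Gamma> by blast
      show "x \<in> \<gamma> ` (- (A \<union> B)) \<union> ?L"
      proof (cases "s \<in> A \<union> B")
        case True
        then have "\<bar>x$1\<bar> > R" unfolding s A_def B_def by auto
        then show ?thesis using line x by auto
      qed (use s in auto)
    qed
    show "\<gamma> ` (- (A \<union> B)) \<union> ?L \<subseteq> \<Gamma>"
    proof
      fix x assume "x \<in> \<gamma> ` (- (A \<union> B)) \<union> ?L"
      then consider "x \<in> range \<gamma>" | "x$2 = 0" "R < \<bar>x$1\<bar>" | "x$2 = 0" "x$1 = R" | "x$2 = 0" "x$1 = - R"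
        by force
      then show "x \<in> \<Gamma>"
      proof cases
        case 3
        obtain s where "1 * \<gamma> s $ 1 = R" "\<gamma> s $ 2 = 0" using A_end ab disj by blast
        then have "x = \<gamma> s" using 3 by (simp add: vec_eq_iff forall_2)
        then show ?thesis using \<Gamma> by blast
      next
        case 4
        obtain s where "- 1 * \<gamma> s $ 1 = R" "\<gamma> s $ 2 = 0" using B_end ab disj by blast
        then have "x = \<gamma> s" using 4 by (simp add: vec_eq_iff forall_2)
        then show ?thesis using \<Gamma> by blast
      qed (use \<Gamma> line in auto)
    qed
  qed
  then show ?thesis using closed_Un[OF cl1 cl2] by (simp only:)
qed

text \<open>
  The upper domain is a union of components of the open complement of \<open>\<Gamma>\<close>.
\<close>

lemma upper_domain_props:
  assumes "closed \<Gamma>"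
  shows "open (upper_domain \<Gamma>)" "upper_domain \<Gamma> \<inter> \<Gamma> = {}"
proof -
  have sub: "x \<in> - \<Gamma>" if "x \<in> upper_domain \<Gamma>" for x
  proof -
    from that have "\<forall>\<^sub>F h::real in at_top. x \<in> - \<Gamma>"
      unfolding upper_domain_def mem_Collect_eq
      by eventually_elim (metis connected_component_in)
    then show ?thesis by simp
  qed
  then show "upper_domain \<Gamma> \<inter> \<Gamma> = {}" by blast
  show "open (upper_domain \<Gamma>)"
    unfolding open_contains_ball
  proof
    fix x assume x: "x \<in> upper_domain \<Gamma>"
    obtain e where e: "0 < e" "ball x e \<subseteq> - \<Gamma>"
      using assms sub[OF x] open_contains_ball[of "- \<Gamma>"] by (auto simp: open_Compl)
    have "y \<in> upper_domain \<Gamma>" if y: "y \<in> ball x e" for y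
    proof -
      have xy: "connected_component (- \<Gamma>) x y"
        unfolding connected_component_def by (intro exI[of _ "ball x e"]) (use e y in auto)
      have "\<forall>\<^sub>F h in at_top. connected_component (- \<Gamma>) (vector [0, h]) x"
        using x by (simp add: upper_domain_def)
      then have "\<forall>\<^sub>F h in at_top. connected_component (- \<Gamma>) (vector [0, h]) y"
        by eventually_elim (rule connected_component_trans[OF _ xy])
      then show ?thesis by (simp add: upper_domain_def)
    qed
    then show "\<exists>e>0. ball x e \<subseteq> upper_domain \<Gamma>" using e by blast
  qed
qed

lemma open_truncated_domain:
  assumes "closed \<Gamma>"
  shows "open (truncated_domain \<Gamma> D \<rho>)"
proof -
  have "half_disc \<Gamma> \<rho> = upper_domain \<Gamma> \<inter> ball 0 \<rho>" by (auto simp: half_disc_def)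
  then show ?thesis
    using upper_domain_props(1)[OF assms] by (simp add: truncated_domain_def open_Diff open_Int)
qed

section \<open>The coefficients of the perfectly matched layer\<close>

lemma polar_coordinates:
  fixes x :: plane
  assumes "x \<noteq> 0"
  shows "cos (polar_angle x) = x$1 / norm x" "sin (polar_angle x) = x$2 / norm x"
proof -
  have "norm (Complex (x$1) (x$2)) = norm x"
    by (simp add: norm_vec_def L2_set_def sum_2 cmod_def)
  moreover have "Complex (x$1) (x$2) \<noteq> 0" using assms by (auto simp: vec_eq_iff forall_2 complex_eq_iff)
  ultimately show "cos (polar_angle x) = x$1 / norm x" "sin (polar_angle x) = x$2 / norm x"
    by (simp_all add: polar_angle_def cos_Arg sin_Arg)
qed

text \<open>
  The matrix \<open>M\<^sup>T diag(a, b) M\<close> written with the direction \<open>x / norm x\<close> instead of the polar angle,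
  which displays it as a Borel function of \<open>x\<close>. At the origin the direction is zero in this formula
  while the rotation matrix is not, so the two expressions agree there only for \<open>a = b = 0\<close>.
\<close>

definition rotated_diag :: "real \<Rightarrow> real \<Rightarrow> plane \<Rightarrow> plane \<Rightarrow> plane" where
  "rotated_diag a b x v =
     (a * (x$1 / norm x * v$1 + x$2 / norm x * v$2)) *\<^sub>R vector [x$1 / norm x, x$2 / norm x] +
     (b * (x$1 / norm x * v$2 - x$2 / norm x * v$1)) *\<^sub>R vector [- (x$2 / norm x), x$1 / norm x]"

lemma rotated_diag_matrix:
  assumes "x \<noteq> 0 \<or> a = 0 \<and> b = 0"
  shows "(transpose (rot_mat (polar_angle x)) ** diag2 a b ** rot_mat (polar_angle x)) *v v = rotated_diag a b x v"
proof (cases "x = 0")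
  case True
  then have "diag2 a b = 0" using assms by (simp add: diag2_def vec_eq_iff forall_2)
  then show ?thesis using True assms by (simp add: rotated_diag_def)
next
  case False
  show ?thesis
    by (simp add: vec_eq_iff forall_2 matrix_vector_mult_def matrix_matrix_mult_def transpose_def
        sum_2 rot_mat_def diag2_def rotated_diag_def polar_coordinates[OF False] vector_2 algebra_simps)
qed

text \<open>
  Rotations preserve the norm.
\<close>

lemma norm_rotated_diag_le:
  assumes "\<bar>a\<bar> \<le> m" "\<bar>b\<bar> \<le> m"
  shows "norm (rotated_diag a b x v) \<le> m * norm v"
proof (cases "x = 0")
  case True
  then show ?thesis using assms by (simp add: rotated_diag_def)
next
  case False
  define c s where "c = x$1 / norm x" and "s = x$2 / norm x"
  have "(norm x)\<^sup>2 = (x$1)\<^sup>2 + (x$2)\<^sup>2" by (simp add: norm_vec_def L2_set_def sum_2)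
  moreover have "c\<^sup>2 + s\<^sup>2 = ((x$1)\<^sup>2 + (x$2)\<^sup>2) / (norm x)\<^sup>2"
    by (simp only: c_def s_def power_divide add_divide_distrib)
  ultimately have "c\<^sup>2 + s\<^sup>2 = (norm x)\<^sup>2 / (norm x)\<^sup>2" by (simp only:)
  then have cs: "c\<^sup>2 + s\<^sup>2 = 1" using False by simp
  define w1 w2 where "w1 = c * v$1 + s * v$2" and "w2 = c * v$2 - s * v$1"
  have sq: "(norm y)\<^sup>2 = (y$1)\<^sup>2 + (y$2)\<^sup>2" for y :: plane by (simp add: norm_vec_def L2_set_def sum_2)
  have comp: "rotated_diag a b x v $ 1 = a * w1 * c - b * w2 * s" "rotated_diag a b x v $ 2 = a * w1 * s + b * w2 * c"
    by (simp_all add: rotated_diag_def c_def s_def w1_def w2_def vector_2)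
  have "(norm (rotated_diag a b x v))\<^sup>2 = (a * w1 * c - b * w2 * s)\<^sup>2 + (a * w1 * s + b * w2 * c)\<^sup>2"
    by (simp only: sq comp)
  also have "\<dots> = (c\<^sup>2 + s\<^sup>2) * ((a * w1)\<^sup>2 + (b * w2)\<^sup>2)" by (simp add: power2_eq_square algebra_simps)
  also have "\<dots> = a\<^sup>2 * w1\<^sup>2 + b\<^sup>2 * w2\<^sup>2" by (simp add: cs power_mult_distrib)
  also have "\<dots> \<le> m\<^sup>2 * w1\<^sup>2 + m\<^sup>2 * w2\<^sup>2"
    using assms by (intro add_mono mult_right_mono) (auto intro!: abs_le_square_iff[THEN iffD1])
  also have "\<dots> = m\<^sup>2 * ((c\<^sup>2 + s\<^sup>2) * ((v$1)\<^sup>2 + (v$2)\<^sup>2))"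
    by (simp add: w1_def w2_def power2_eq_square algebra_simps)
  also have "\<dots> = (m * norm v)\<^sup>2" by (simp only: cs power_mult_distrib sq mult_1_left)
  finally show ?thesis by (rule power2_le_imp_le) (use assms in auto)
qed

lemma borel_measurable_component:
  "g \<in> borel_measurable M \<Longrightarrow> (\<lambda>x. (g x :: plane) $ i) \<in> borel_measurable M"
  using borel_measurable_inner[OF _ borel_measurable_const[of "axis i 1 :: plane" M], of g]
  by (simp add: inner_axis)

lemma (in open_domain) multiplier_rotated_diag:
  assumes a: "a \<in> borel_measurable borel" "b \<in> borel_measurable borel"
    and m: "\<And>x. x \<in> Om \<Longrightarrow> \<bar>a x\<bar> \<le> m" "\<And>x. x \<in> Om \<Longrightarrow> \<bar>b x\<bar> \<le> m"
    and L: "\<And>x v. x \<in> Om \<Longrightarrow> L x v = rotated_diag (a x) (b x) x v"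
  shows "multiplier m L"
  unfolding multiplier_def
proof (intro conjI ballI allI impI)
  fix x assume x: "x \<in> Om"
  have "linear (\<lambda>v::plane. (k * (c * v$1 + s * v$2)) *\<^sub>R w + (l * (c * v$2 - s * v$1)) *\<^sub>R (z::plane))" for k l c s w z
    by (simp add: linear_iff algebra_simps)
  then have "linear (rotated_diag (a x) (b x) x)" unfolding rotated_diag_def .
  moreover have "L x = rotated_diag (a x) (b x) x" using L[OF x] by blast
  ultimately show "linear (L x)" by simp
  show "norm (L x v) \<le> m * norm v" for v
    unfolding L[OF x] by (rule norm_rotated_diag_le[OF m(1)[OF x] m(2)[OF x]])
next
  fix g :: "plane \<Rightarrow> plane" assume g: "g \<in> borel_measurable (lebesgue_on Om)"
  have idm: "(\<lambda>x::plane. x) \<in> borel_measurable (lebesgue_on Om)"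
    by (intro measurable_restrict_space1 measurable_completion) simp
  have am: "a \<in> borel_measurable (lebesgue_on Om)" "b \<in> borel_measurable (lebesgue_on Om)"
    using measurable_compose[OF idm a(1)] measurable_compose[OF idm a(2)] by auto
  have nm: "(\<lambda>x::plane. norm x) \<in> borel_measurable (lebesgue_on Om)"
    by (intro measurable_restrict_space1 measurable_completion) simp
  note G = borel_measurable_component[OF g] borel_measurable_component[OF idm] nm
  have "(\<lambda>x. rotated_diag (a x) (b x) x (g x)) \<in> borel_measurable (lebesgue_on Om)"
  proof -
    have "rotated_diag (a x) (b x) x (g x) =
       (a x * (x$1 / norm x * g x$1 + x$2 / norm x * g x$2) * (x$1 / norm x)
         - b x * (x$1 / norm x * g x$2 - x$2 / norm x * g x$1) * (x$2 / norm x)) *\<^sub>R axis 1 1 +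
       (a x * (x$1 / norm x * g x$1 + x$2 / norm x * g x$2) * (x$2 / norm x)
         + b x * (x$1 / norm x * g x$2 - x$2 / norm x * g x$1) * (x$1 / norm x)) *\<^sub>R axis 2 1" for x
      by (simp add: rotated_diag_def vec_eq_iff forall_2 axis_def vector_2)
    then show ?thesis
      by (simp only:) (intro borel_measurable_add borel_measurable_diff borel_measurable_scaleR borel_measurable_times
          borel_measurable_divide borel_measurable_const am G)
  qed
  then show "(\<lambda>x. L x (g x)) \<in> borel_measurable (lebesgue_on Om)"
    by (rule measurable_cong[THEN iffD1, rotated]) (simp add: L)
qed

lemma (in open_domain) multiplier_real:
  fixes a :: "plane \<Rightarrow> real"
  assumes a: "a \<in> borel_measurable borel" and m: "\<And>x. x \<in> Om \<Longrightarrow> \<bar>a x\<bar> \<le> m"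
    and k: "\<And>x. x \<in> Om \<Longrightarrow> k x = a x"
  shows "multiplier m (\<lambda>x v. k x * v)"
  unfolding multiplier_def
proof (intro conjI ballI allI impI)
  fix x assume x: "x \<in> Om"
  show "linear ((*) (k x))" by (simp add: linear_iff algebra_simps)
  show "norm (k x * v) \<le> m * norm v" for v
    using m[OF x] k[OF x] by (simp add: abs_mult mult_right_mono)
next
  fix g :: "plane \<Rightarrow> real" assume g: "g \<in> borel_measurable (lebesgue_on Om)"
  have "a \<in> borel_measurable (lebesgue_on Om)"
    using a by (intro measurable_restrict_space1 measurable_completion) simp
  then have "(\<lambda>x. a x * g x) \<in> borel_measurable (lebesgue_on Om)" using g by (rule borel_measurable_times)
  then show "(\<lambda>x. k x * g x) \<in> borel_measurable (lebesgue_on Om)"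
    by (rule measurable_cong[THEN iffD1, rotated]) (simp add: k)
qed

text \<open>
  Replaces \<open>\<sigma>\<close> and its radial mean by globally defined Borel functions with the same values on the
  disc.
\<close>

lemma pml_coefficient_props:
  assumes \<sigma>: "pml_coefficient R \<rho> \<sigma>\<^sub>R \<sigma>\<^sub>\<rho> \<sigma>" and R: "0 < R" "R < \<rho>"
  obtains a b where "a \<in> borel_measurable borel" "b \<in> borel_measurable borel"
    "\<forall>x::plane. norm x < \<rho> \<longrightarrow> a x = \<sigma> (norm x) \<and> b x = sigma_hat \<sigma> (norm x) \<and>
       0 \<le> a x \<and> a x \<le> \<sigma>\<^sub>\<rho> \<and> 0 \<le> b x \<and> b x \<le> \<sigma>\<^sub>\<rho>"
    "a 0 = 0" "b 0 = 0" "0 \<le> \<sigma>\<^sub>\<rho>"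
proof -
  note \<sigma>' = \<sigma>[unfolded pml_coefficient_def]
  have mono: "mono_on {R..\<rho>} \<sigma>" using \<sigma>' by blast
  have z: "\<sigma> r = 0" if "r \<le> R" for r using \<sigma>' that by blast
  have pos: "0 < \<sigma> r" if "R < r" for r using \<sigma>' that by blast
  have bd: "\<sigma> r \<le> \<sigma>\<^sub>\<rho>" if "r \<in> {R..\<rho>}" for r using \<sigma>' that by blast
  have s0: "0 \<le> \<sigma>\<^sub>\<rho>" using bd[of R] z[of R] R by simp
  have nonneg: "0 \<le> \<sigma> r" for r using z[of r] pos[of r] by (cases "r \<le> R") auto
  have le: "\<sigma> r \<le> \<sigma>\<^sub>\<rho>" if "r \<le> \<rho>" for r using bd[of r] z[of r] s0 that by (cases "r \<le> R") auto
  have mono': "\<sigma> r \<le> \<sigma> s" if "r \<le> s" "s \<le> \<rho>" for r s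
  proof (cases "r \<le> R")
    case True
    then show ?thesis using z[of r] nonneg[of s] by simp
  next
    case False
    show ?thesis by (rule mono_onD[OF mono]) (use False that in auto)
  qed
  \<comment> \<open>Constant continuation beyond \<open>\<rho>\<close> makes \<open>\<sigma>\<close> monotone on the whole line, hence Borel measurable.\<close>
  define S where "S r = \<sigma> (min r \<rho>)" for r
  have "mono S" by (rule monoI) (auto simp: S_def intro!: mono')
  then have Sm: "S \<in> borel_measurable borel" by (rule borel_measurable_mono)
  have Si: "S integrable_on {0..\<rho>}"
    by (rule integrable_on_mono_on) (use \<open>mono S\<close> in \<open>auto simp: mono_on_def mono_def\<close>)
  \<comment> \<open>Clamping the upper limit makes the primitive continuous on the whole line.\<close>
  define K where "K r = integral {0..max 0 (min r \<rho>)} S" for r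
  have Kc: "continuous_on UNIV K"
    unfolding K_def[abs_def]
    by (rule continuous_on_compose2[OF indefinite_integral_continuous_1[OF Si]])
      (use R in \<open>auto intro!: continuous_intros\<close>)
  have KS: "K r = integral {0..r} \<sigma>" if "0 \<le> r" "r \<le> \<rho>" for r
    unfolding K_def using that by (auto intro!: integral_cong simp: S_def)
  have Kb: "0 \<le> K r \<and> K r \<le> \<sigma>\<^sub>\<rho> * r" if r: "0 \<le> r" "r \<le> \<rho>" for r
  proof -
    have i: "S integrable_on {0..r}" using integrable_on_subinterval[OF Si] r by auto
    have Kr: "K r = integral {0..r} S" using r by (simp add: K_def)
    have "0 \<le> integral {0..r} S"
      by (rule Henstock_Kurzweil_Integration.integral_nonneg[OF i]) (simp add: S_def nonneg)
    moreover have "integral {0..r} S \<le> integral {0..r} (\<lambda>_. \<sigma>\<^sub>\<rho>)"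
      by (rule integral_le[OF i]) (auto simp: S_def intro!: le)
    ultimately show ?thesis using r by (simp add: Kr mult.commute)
  qed
  have nm: "(\<lambda>x::plane. norm x) \<in> borel_measurable borel" by simp
  show ?thesis
  proof (rule that[of "\<lambda>x. S (norm x)" "\<lambda>x. inverse (norm x) * K (norm x)"])
    show "(\<lambda>x::plane. S (norm x)) \<in> borel_measurable borel" using measurable_compose[OF nm Sm] by simp
    have "(\<lambda>x::plane. K (norm x)) \<in> borel_measurable borel"
      using measurable_compose[OF nm borel_measurable_continuous_onI[OF Kc]] by simp
    then show "(\<lambda>x::plane. inverse (norm x) * K (norm x)) \<in> borel_measurable borel" by measurable
    show "\<forall>x::plane. norm x < \<rho> \<longrightarrow> S (norm x) = \<sigma> (norm x) \<and> inverse (norm x) * K (norm x) = sigma_hat \<sigma> (norm x) \<and>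
       0 \<le> S (norm x) \<and> S (norm x) \<le> \<sigma>\<^sub>\<rho> \<and>
       0 \<le> inverse (norm x) * K (norm x) \<and> inverse (norm x) * K (norm x) \<le> \<sigma>\<^sub>\<rho>"
    proof (intro allI impI)
      fix x :: plane assume x: "norm x < \<rho>"
      have 1: "S (norm x) = \<sigma> (norm x)" using x by (simp add: S_def)
      have 2: "inverse (norm x) * K (norm x) = sigma_hat \<sigma> (norm x)"
        using x KS[of "norm x"] by (simp add: sigma_hat_def inverse_eq_divide)
      have 3: "0 \<le> S (norm x) \<and> S (norm x) \<le> \<sigma>\<^sub>\<rho>" using x le nonneg by (simp add: S_def)
      have 4: "0 \<le> inverse (norm x) * K (norm x) \<and> inverse (norm x) * K (norm x) \<le> \<sigma>\<^sub>\<rho>"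
      proof (cases "x = 0")
        case True
        then show ?thesis using s0 by simp
      next
        case False
        have "inverse (norm x) * K (norm x) \<le> inverse (norm x) * (\<sigma>\<^sub>\<rho> * norm x)"
          using Kb[of "norm x"] x by (intro mult_left_mono) auto
        also have "\<dots> = \<sigma>\<^sub>\<rho>" using False by (simp add: field_simps)
        finally show ?thesis using Kb[of "norm x"] x by simp
      qed
      show "S (norm x) = \<sigma> (norm x) \<and> inverse (norm x) * K (norm x) = sigma_hat \<sigma> (norm x) \<and>
        0 \<le> S (norm x) \<and> S (norm x) \<le> \<sigma>\<^sub>\<rho> \<and>
        0 \<le> inverse (norm x) * K (norm x) \<and> inverse (norm x) * K (norm x) \<le> \<sigma>\<^sub>\<rho>"
        using 1 2 3 4 by blast
    qed
  next
    show "S (norm (0::plane)) = 0" using z[of 0] R by (simp add: S_def)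
  qed (use s0 in auto)
qed

theorem theorem3p1:
  fixes R \<rho> T \<sigma>\<^sub>R \<sigma>\<^sub>\<rho> :: real and \<Gamma>\<^sub>0 D :: "plane set"
    and \<sigma> :: "real \<Rightarrow> real" and f :: "real \<Rightarrow> plane \<Rightarrow> real"
  assumes "0 < R" and "R < \<rho>" and "0 < T"
    and "perturbed_line R \<Gamma>\<^sub>0"
    and "is_obstacle \<Gamma>\<^sub>0 R D"
    and "pml_coefficient R \<rho> \<sigma>\<^sub>R \<sigma>\<^sub>\<rho> \<sigma>"
    and "admissible_source \<Gamma>\<^sub>0 D R T f"
  shows "(\<exists>u p us ps. solution_class (truncated_domain \<Gamma>\<^sub>0 D \<rho>) T u p us ps \<and>
            pml_solution \<Gamma>\<^sub>0 D \<rho> T \<sigma> f u p us ps) \<and>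
         (\<forall>u p us ps v q vs qs.
            solution_class (truncated_domain \<Gamma>\<^sub>0 D \<rho>) T u p us ps \<and>
            pml_solution \<Gamma>\<^sub>0 D \<rho> T \<sigma> f u p us ps \<and>
            solution_class (truncated_domain \<Gamma>\<^sub>0 D \<rho>) T v q vs qs \<and>
            pml_solution \<Gamma>\<^sub>0 D \<rho> T \<sigma> f v q vs qs \<longrightarrow>
            (AE t in lebesgue_on {0<..<T}. AE x in lebesgue_on (truncated_domain \<Gamma>\<^sub>0 D \<rho>).
               u t x = v t x \<and> p t x = q t x \<and> us t x = vs t x \<and> ps t x = qs t x))"
proof -
  define Om where "Om = truncated_domain \<Gamma>\<^sub>0 D \<rho>"
  have cl: "closed \<Gamma>\<^sub>0" using closed_perturbed_line assms by blast
  have oU: "open (upper_domain \<Gamma>\<^sub>0)" by (rule upper_domain_props(1)[OF cl])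
  interpret E: evolution_domain Om T
    by unfold_locales (simp_all add: Om_def open_truncated_domain[OF cl] assms)
  obtain a b where ab: "a \<in> borel_measurable borel" "b \<in> borel_measurable borel"
    and abx: "\<forall>x::plane. norm x < \<rho> \<longrightarrow> a x = \<sigma> (norm x) \<and> b x = sigma_hat \<sigma> (norm x) \<and>
       0 \<le> a x \<and> a x \<le> \<sigma>\<^sub>\<rho> \<and> 0 \<le> b x \<and> b x \<le> \<sigma>\<^sub>\<rho>"
    and zero: "a 0 = 0" "b 0 = 0" and \<sigma>0: "0 \<le> \<sigma>\<^sub>\<rho>"
    by (rule pml_coefficient_props[OF assms(6,1,2)])
  have eq: "a x = \<sigma> (norm x)" "b x = sigma_hat \<sigma> (norm x)"
    and bd: "0 \<le> a x \<and> a x \<le> \<sigma>\<^sub>\<rho>" "0 \<le> b x \<and> b x \<le> \<sigma>\<^sub>\<rho>" if "norm x < \<rho>" for x :: plane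
    using abx[rule_format, OF that] by blast+
  have Om\<rho>: "norm x < \<rho>" if "x \<in> Om" for x using that by (simp add: Om_def truncated_domain_def half_disc_def)
  have nz: "x \<noteq> 0 \<or> a x = 0 \<and> b x = 0" for x :: plane using zero by (cases "x = 0") auto
  have nz': "x \<noteq> 0 \<or> b x = 0 \<and> a x = 0" for x :: plane using zero by (cases "x = 0") auto
  interpret P: pml_system Om T "\<lambda>x. \<sigma> (norm x) + sigma_hat \<sigma> (norm x)" "\<lambda>x. sigma_hat \<sigma> (norm x)" "\<lambda>x. \<sigma> (norm x)"
    "Lambda1 \<sigma>" "Lambda2 \<sigma>" "2 * \<sigma>\<^sub>\<rho>"
  proof
    show "E.multiplier (2 * \<sigma>\<^sub>\<rho>) (\<lambda>x v. (\<sigma> (norm x) + sigma_hat \<sigma> (norm x)) * v)"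
      by (rule E.multiplier_real[of "\<lambda>x. a x + b x"])
        (use ab bd Om\<rho> eq in \<open>force intro: borel_measurable_add\<close>)+
    show "E.multiplier (2 * \<sigma>\<^sub>\<rho>) (\<lambda>x v. sigma_hat \<sigma> (norm x) * v)"
      by (rule E.multiplier_real[OF ab(2)]) (use bd Om\<rho> eq \<sigma>0 in force)+
    show "E.multiplier (2 * \<sigma>\<^sub>\<rho>) (\<lambda>x v. \<sigma> (norm x) * v)"
      by (rule E.multiplier_real[OF ab(1)]) (use bd Om\<rho> eq \<sigma>0 in force)+
    have m: "\<bar>a x\<bar> \<le> 2 * \<sigma>\<^sub>\<rho>" "\<bar>b x\<bar> \<le> 2 * \<sigma>\<^sub>\<rho>" if "x \<in> Om" for x
      using bd[OF Om\<rho>[OF that]] \<sigma>0 by auto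
    show "E.multiplier (2 * \<sigma>\<^sub>\<rho>) (\<lambda>x v. Lambda1 \<sigma> x *v v)"
      by (rule E.multiplier_rotated_diag[OF ab m])
        (simp_all add: Lambda1_def eq[OF Om\<rho>, symmetric] rotated_diag_matrix[OF nz])
    show "E.multiplier (2 * \<sigma>\<^sub>\<rho>) (\<lambda>x v. Lambda2 \<sigma> x *v v)"
      by (rule E.multiplier_rotated_diag[OF ab(2,1) m(2,1)])
        (simp_all add: Lambda2_def eq[OF Om\<rho>, symmetric] rotated_diag_matrix[OF nz'])
  qed
  have iff: "P.weak_solution f u p us ps \<longleftrightarrow> solution_class Om T u p us ps \<and> pml_equations Om T \<sigma> f u p us ps \<and>
      has_initial_value T (L2_space Om) u (\<lambda>_. 0) \<and> has_initial_value T (L2_space Om) p (\<lambda>_. 0) \<and>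
      has_initial_value T (L2_space Om) us (\<lambda>_. 0) \<and> has_initial_value T (L2_space Om) ps (\<lambda>_. 0)" for u p us ps
    by (simp add: P.weak_solution_def pml_equations_def)
  have "\<exists>u p us ps. solution_class Om T u p us ps \<and> pml_solution \<Gamma>\<^sub>0 D \<rho> T \<sigma> f u p us ps"
  proof -
    let ?U = "upper_domain \<Gamma>\<^sub>0 - closure D"
    have U: "?U \<in> sets lebesgue" using oU by (simp add: open_Diff borel_open sets_completionI_sets)
    have OmU: "Om \<subseteq> ?U" by (auto simp: Om_def truncated_domain_def half_disc_def)
    obtain K where K: "compact K" "K \<subseteq> half_disc \<Gamma>\<^sub>0 R - closure D"
      and supp: "AE t in lebesgue_on {0<..<T}. AE x in lebesgue_on ?U. x \<notin> K \<longrightarrow> f t x = 0"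
      and f: "\<And>\<Omega>0. open \<Omega>0 \<Longrightarrow> connected \<Omega>0 \<Longrightarrow> \<Omega>0 \<noteq> {} \<Longrightarrow> bounded \<Omega>0 \<Longrightarrow> \<Omega>0 \<subseteq> ?U \<Longrightarrow>
        f \<in> H2_time {0<..<T} (L2_space \<Omega>0) \<and> has_initial_value T (L2_space \<Omega>0) f (\<lambda>_. 0)"
      using assms(7) unfolding admissible_source_def by blast
    have KOm: "K \<subseteq> Om" using K(2) assms(2) by (force simp: Om_def truncated_domain_def half_disc_def)
    have supp': "AE t in lebesgue_on {0<..<T}. AE x in lebesgue_on Om. x \<notin> K \<longrightarrow> f t x = 0"
      using supp
    proof eventually_elim
      case (elim t)
      then have "AE x in lebesgue. x \<in> ?U \<longrightarrow> x \<notin> K \<longrightarrow> f t x = 0" using U by (simp add: AE_restrict_space_iff)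
      then show ?case unfolding AE_restrict_space_iff[of Om lebesgue, simplified]
        by eventually_elim (use OmU in blast)
    qed
    obtain F F' :: "real \<Rightarrow> (plane, real) l2" where F: "continuous_on {0..T} F'" "F 0 = 0"
      "\<forall>t\<in>{0..T}. (F has_vector_derivative F' t) (at t within {0..T})"
      "AE t in lebesgue_on {0<..<T}. AE x in lebesgue_on Om. rep_l2 (F t) x = f t x"
    proof (rule E.compactly_supported_source_C1[OF K(1) KOm supp'])
      fix x r assume "(0::real) < r" "ball x r \<subseteq> Om"
      then show "f \<in> H2_time {0<..<T} (L2_space (ball x r)) \<and> has_initial_value T (L2_space (ball x r)) f (\<lambda>_. 0)"
        using OmU by (intro f) auto
    qed
    obtain u p us ps where sol: "P.weak_solution f u p us ps" and H: "\<forall>t\<in>{0..T}. u t \<in> carr (H10_space Om)"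
      by (rule P.weak_solution_exists[OF F(1,2) bspec[OF F(3)] F(4)])
    \<comment> \<open>Both boundary conditions hold since the solution lies in \<open>H10\<close> and the boundary parts miss the
      open domain.\<close>
    have S1: "(frontier D \<union> (\<Gamma>\<^sub>0 \<inter> cball 0 \<rho>)) \<inter> Om = {}"
      using upper_domain_props(2)[OF cl] by (auto simp: Om_def truncated_domain_def half_disc_def frontier_def)
    have S2: "outer_arc \<Gamma>\<^sub>0 \<rho> \<inter> Om = {}"
      by (auto simp: Om_def truncated_domain_def half_disc_def outer_arc_def)
    have V: "AE t in lebesgue_on {0<..<T}. vanishes_on Om S (u t)" if "S \<inter> Om = {}" for S
      using E.AE_I_space by eventually_elim (use H E.vanishes_on_of_H10[OF _ that] in auto)
    have "pml_solution \<Gamma>\<^sub>0 D \<rho> T \<sigma> f u p us ps"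
      using sol V[OF S1] V[OF S2] unfolding iff pml_solution_def Om_def[symmetric] Let_def by blast
    then show ?thesis using sol iff by blast
  qed
  moreover have "AE t in lebesgue_on {0<..<T}. AE x in lebesgue_on Om.
      u t x = v t x \<and> p t x = q t x \<and> us t x = vs t x \<and> ps t x = qs t x"
    if "solution_class Om T u p us ps" "pml_solution \<Gamma>\<^sub>0 D \<rho> T \<sigma> f u p us ps"
      "solution_class Om T v q vs qs" "pml_solution \<Gamma>\<^sub>0 D \<rho> T \<sigma> f v q vs qs" for u p us ps v q vs qs
    by (rule P.weak_solution_unique[where f = f]) (use that in \<open>auto simp: iff pml_solution_def Om_def[symmetric] Let_def\<close>)
  ultimately show ?thesis unfolding Om_def by blast
qed

end
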